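(* Let $M$ be a matroid without large uniform minors. (1) If $M$ is representable over $\mathbb S$ (orientable), then $M$ is representable over every field of characteristic different from $2$. (2) If $M$ is representable over $\mathbb P$, then for every characteristic $c\neq 2$ (including $c=0$) there is a field of characteristic $c$ over which $M$ is representable. (3) If $M$ is representable over $\mathbb W$ (weakly orientable), then $M$ is representable over $\mathbb F_3$ (ternary).
   Context: A pasture is a commutative monoid $P$ with absorbing $0$ such that $P^\times=P\setminus\{0\}$ is a group, with a null set $N_P$ of formal sums $a+b+c$ satisfying: $a+0+0\in N_P$ iff $a=0$; closure under multiplying all terms by any $d\in P$; a unique $\epsilon$ with $1+\epsilon+0\in N_P$ (write $-a=\epsilon a$). A field $k$ is a pasture with null set $\{a+b+c: a+b+c=0\text{ in }k\}$. $\mathbb S=\{0,1,-1\}$ (sign hyperfield): $a+b+c$ is null iff all terms are $0$ or the multiset $\{a,b,c\}$ contains both $1$ and $-1$. $\mathbb W=\{0,1,-1\}$ (weak sign hyperfield): $a+b+c$ is null iff it is $0+0+0$, or of the form $a+(-a)+0$ with $a\neq0$, or all of $a,b,c$ are nonzero. $\mathbb P$ (phase hyperfield): $\mathbb P^\times$ is the unit circle in $\mathbb C$, and $a+b+c$ is null iff the smallest convex cone in $\mathbb C$ containing $a,b,c$ is an $\mathbb R$-linear subspace of $\mathbb C$. For a matroid $M$ of rank $r$ on finite $E$ and a pasture $P$, a $P$-representation is $\Delta:E^r\to P$ with $\Delta(e_1,\dots,e_r)\neq0$ iff $\{e_1,\dots,e_r\}$ is a basis, $\Delta$ alternating ($\Delta\circ\sigma=\mathrm{sign}(\sigma)\Delta$),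 and $\Delta(\mathbf Je_1e_2)\Delta(\mathbf Je_3e_4)-\Delta(\mathbf Je_1e_3)\Delta(\mathbf Je_2e_4)+\Delta(\mathbf Je_1e_4)\Delta(\mathbf Je_2e_3)\in N_P$ for all $\mathbf J\in E^{r-2}$, $e_i\in E$. $M$ is representable over $P$ if such $\Delta$ exists; for fields this agrees with linear representability. A matroid is without large uniform minors if it has no minor isomorphic to $U^2_5$ or $U^3_5$. *)

theory Defs
  imports "HOL-Analysis.Analysis" "HOL-Number_Theory.Residues" "HOL-Library.Multiset"
begin

definition matroid :: "'a set \<Rightarrow> 'a set set \<Rightarrow> bool" where
  "matroid E \<B> \<longleftrightarrow> finite E \<and> \<B> \<noteq> {} \<and> (\<forall>X\<in>\<B>. X \<subseteq> E) \<and>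
     (\<forall>B1\<in>\<B>. \<forall>B2\<in>\<B>. \<forall>x\<in>B1 - B2. \<exists>y\<in>B2 - B1. insert y (B1 - {x}) \<in> \<B>)"

definition indep :: "'a set set \<Rightarrow> 'a set \<Rightarrow> bool" where
  "indep \<B> X \<longleftrightarrow> (\<exists>B\<in>\<B>. X \<subseteq> B)"

definition basis_of :: "'a set set \<Rightarrow> 'a set \<Rightarrow> 'a set \<Rightarrow> bool" where
  "basis_of \<B> S X \<longleftrightarrow> X \<subseteq> S \<and> indep \<B> X \<and> (\<forall>Y. X \<subset> Y \<and> Y \<subseteq> S \<longrightarrow> \<not> indep \<B> Y)"

text \<open>Bases of the minor M/C\D = (M restricted to E-D) contracted by C,
  for disjoint C, D subsets of E; its ground set is E - C - D.\<close>
definition minor_bases :: "'a set \<Rightarrow> 'a set set \<Rightarrow> 'a set \<Rightarrow> 'a set \<Rightarrow> 'a set set" where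
  "minor_bases E \<B> C D = {X - C | X. basis_of \<B> (E - D) X \<and> basis_of \<B> C (X \<inter> C)}"

definition is_uniform :: "nat \<Rightarrow> nat \<Rightarrow> 'a set \<Rightarrow> 'a set set \<Rightarrow> bool" where
  "is_uniform r n E' \<B>' \<longleftrightarrow> finite E' \<and> card E' = n \<and> \<B>' = {X. X \<subseteq> E' \<and> card X = r}"

definition without_large_uniform_minors :: "'a set \<Rightarrow> 'a set set \<Rightarrow> bool" where
  "without_large_uniform_minors E \<B> \<longleftrightarrow>
     (\<forall>C D. C \<subseteq> E \<and> D \<subseteq> E \<and> C \<inter> D = {} \<longrightarrow>
        \<not> is_uniform 2 5 (E - C - D) (minor_bases E \<B> C D) \<and>
        \<not> is_uniform 3 5 (E - C - D) (minor_bases E \<B> C D))"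

text \<open>A pasture is given by carrier K, zero z, multiplication mul, the element eps (= -1),
  and its null set as a predicate on formal sums a+b+c.
  Delta is defined on E^r, encoded as lists of length r with entries in E.\<close>
definition pasture_rep ::
  "'p set \<Rightarrow> 'p \<Rightarrow> ('p \<Rightarrow> 'p \<Rightarrow> 'p) \<Rightarrow> 'p \<Rightarrow> ('p \<Rightarrow> 'p \<Rightarrow> 'p \<Rightarrow> bool)
   \<Rightarrow> 'a set \<Rightarrow> 'a set set \<Rightarrow> nat \<Rightarrow> ('a list \<Rightarrow> 'p) \<Rightarrow> bool" where
  "pasture_rep K z mul eps nul E \<B> r \<Delta> \<longleftrightarrow>
     (\<forall>xs. set xs \<subseteq> E \<and> length xs = r \<longrightarrow> \<Delta> xs \<in> K \<and> (\<Delta> xs \<noteq> z \<longleftrightarrow> set xs \<in> \<B>)) \<and>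
     (\<forall>xs \<sigma>. set xs \<subseteq> E \<and> length xs = r \<and> \<sigma> permutes {..<r} \<longrightarrow>
        \<Delta> (map (\<lambda>i. xs ! \<sigma> i) [0..<r]) = (if evenperm \<sigma> then \<Delta> xs else mul eps (\<Delta> xs))) \<and>
     (\<forall>J e1 e2 e3 e4. set J \<subseteq> E \<and> length J + 2 = r \<and> {e1, e2, e3, e4} \<subseteq> E \<longrightarrow>
        nul (mul (\<Delta> (J @ [e1, e2])) (\<Delta> (J @ [e3, e4])))
            (mul eps (mul (\<Delta> (J @ [e1, e3])) (\<Delta> (J @ [e2, e4]))))
            (mul (\<Delta> (J @ [e1, e4])) (\<Delta> (J @ [e2, e3]))))"

definition representable_over ::
  "'p set \<Rightarrow> 'p \<Rightarrow> ('p \<Rightarrow> 'p \<Rightarrow> 'p) \<Rightarrow> 'p \<Rightarrow> ('p \<Rightarrow> 'p \<Rightarrow> 'p \<Rightarrow> bool)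
   \<Rightarrow> 'a set \<Rightarrow> 'a set set \<Rightarrow> bool" where
  "representable_over K z mul eps nul E \<B> \<longleftrightarrow>
     (\<exists>r \<Delta>. (\<forall>X\<in>\<B>. card X = r) \<and> pasture_rep K z mul eps nul E \<B> r \<Delta>)"

definition field_null :: "('k, 'b) ring_scheme \<Rightarrow> 'k \<Rightarrow> 'k \<Rightarrow> 'k \<Rightarrow> bool" where
  "field_null R a b c \<longleftrightarrow> a \<oplus>\<^bsub>R\<^esub> b \<oplus>\<^bsub>R\<^esub> c = \<zero>\<^bsub>R\<^esub>"

definition representable_over_field :: "('k, 'b) ring_scheme \<Rightarrow> 'a set \<Rightarrow> 'a set set \<Rightarrow> bool" where
  "representable_over_field R E \<B> \<longleftrightarrow>
     representable_over (carrier R) \<zero>\<^bsub>R\<^esub> (\<otimes>\<^bsub>R\<^esub>) (\<ominus>\<^bsub>R\<^esub> \<one>\<^bsub>R\<^esub>) (field_null R) E \<B>"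

definition ring_char :: "('k, 'b) ring_scheme \<Rightarrow> nat" where
  "ring_char R = Gcd {n::nat. add_pow R n \<one>\<^bsub>R\<^esub> = \<zero>\<^bsub>R\<^esub>}"

datatype sgn = SZero | SPos | SNeg

fun sgn_mul :: "sgn \<Rightarrow> sgn \<Rightarrow> sgn" where
  "sgn_mul SZero _ = SZero"
| "sgn_mul _ SZero = SZero"
| "sgn_mul SPos y = y"
| "sgn_mul SNeg SPos = SNeg"
| "sgn_mul SNeg SNeg = SPos"

definition S_null :: "sgn \<Rightarrow> sgn \<Rightarrow> sgn \<Rightarrow> bool" where
  "S_null a b c \<longleftrightarrow> (a = SZero \<and> b = SZero \<and> c = SZero) \<or>
     (SPos \<in> {a, b, c} \<and> SNeg \<in> {a, b, c})"

definition W_null :: "sgn \<Rightarrow> sgn \<Rightarrow> sgn \<Rightarrow> bool" where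
  "W_null a b c \<longleftrightarrow> (a = SZero \<and> b = SZero \<and> c = SZero) \<or>
     (\<exists>x. x \<noteq> SZero \<and> {#a, b, c#} = {#x, sgn_mul SNeg x, SZero#}) \<or>
     (a \<noteq> SZero \<and> b \<noteq> SZero \<and> c \<noteq> SZero)"

definition representable_over_S :: "'a set \<Rightarrow> 'a set set \<Rightarrow> bool" where
  "representable_over_S E \<B> \<longleftrightarrow> representable_over UNIV SZero sgn_mul SNeg S_null E \<B>"

definition representable_over_W :: "'a set \<Rightarrow> 'a set set \<Rightarrow> bool" where
  "representable_over_W E \<B> \<longleftrightarrow> representable_over UNIV SZero sgn_mul SNeg W_null E \<B>"

definition P_null :: "complex \<Rightarrow> complex \<Rightarrow> complex \<Rightarrow> bool" where
  "P_null a b c \<longleftrightarrow> subspace (convex_cone hull {a, b, c})"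

definition representable_over_P :: "'a set \<Rightarrow> 'a set set \<Rightarrow> bool" where
  "representable_over_P E \<B> \<longleftrightarrow>
     representable_over ({0} \<union> sphere 0 1) 0 (*) (-1) P_null E \<B>"

end

theory Submission
  imports Defs "HOL-Combinatorics.Permutations" "HOL-Algebra.Multiplicative_Group" "HOL-Algebra.QuotRing"
begin

text \<open>
  A null triple of nonzero elements of the source pasture determines, up to scaling, a triple with
  sum zero in a field: \<open>(1, 1, -2)\<close> up to order for two equal signs and their opposite,
  \<open>(1, \<omega>, \<omega>\<^sup>2)\<close> for three phases that positively span the plane, and \<open>(1, 1, 1)\<close> in the field with
  three elements. The ratios that occur generate a group \<open>\<Gamma>\<close> of units, which maps to every field of
  the required kind, and the null triples survive this map. So it suffices to lift
  a Grassmann-Pluecker function triple by triple; in a matroid without minors \<open>U\<^sup>2\<^sub>5\<close> and \<open>U\<^sup>3\<^sub>5\<close> this is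
  possible, by induction on the ground set.

  A simple and cosimple connected matroid of rank and corank at least 3 has, up to duality, a pair
  \<open>a, b\<close> such that deleting both leaves it connected. Functions on the bases of a connected matroid
  that are trivial on all quadrangles come from rescaling elements; hence the lifts on the deletions of
  \<open>a\<close> and of \<open>b\<close> can be made to agree, and they determine the values on the bases containing
  \<open>a\<close> and \<open>b\<close>. That the remaining quadrangles are lifted correctly is a
  statement about configurations of points in the plane without \<open>U\<^sup>2\<^sub>5\<close> and \<open>U\<^sup>3\<^sub>5\<close>, where the only
  exceptional configuration is the quadrangle with its diagonal points.
\<close>

section \<open>Matroids by bases\<close>

text \<open>The engine is that a null triple has only one lift up to a common factor. Hence two
  lifts of the same function differ by a factor that is trivial on quadrangles, equal source entries
  receive equal lifts, and parallelism or collinearity of the source passes to the target. The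
  obstacle is consistency: in a rank two minor with n pairwise independent elements there are n
  choose 4 nondegenerate relations, tied by multiplicative identities that lifts of single triples
  need not respect. With n at most 4 there is only one, and the other excluded minor is the dual
  condition. In the gluing, the value on a basis through \<open>a\<close> and \<open>b\<close> is
  forced by one relation, and all other relations have to be checked for it. A fifth element
  \<open>z\<close> that is independent of \<open>c\<close> and \<open>d\<close> settles the relation
  of \<open>a, b, c, d\<close>, because five pairwise independent elements are excluded. When no
  such \<open>z\<close> exists, paths in the fundamental graph replace it, and paths of length two
  lead to plane configurations. The Fano plane does not occur because 1 and -1 differ in the source;
  the remaining exceptional quadrangle gives a triple with two equal entries, whose lift is
  forced.\<close>

lemma matroid_finite: "matroid E \<B> ==> finite E"
 by (simp add: matroid_def)

lemma matroid_basis_subset: "matroid E \<B> ==> B \<in> \<B> ==> B \<subseteq> E"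
 by (simp add: matroid_def)

lemma matroid_basis_finite: "matroid E \<B> ==> B \<in> \<B> ==> finite B"
 using matroid_finite matroid_basis_subset finite_subset by metis

lemma matroid_nonempty: "matroid E \<B> ==> \<exists>B. B \<in> \<B>"
 by (auto simp add: matroid_def)

lemma matroid_exchange:
 "matroid E \<B> ==> B1 \<in> \<B> ==> B2 \<in> \<B> ==> x \<in> B1 - B2 ==>
  \<exists>y\<in>B2 - B1. insert y (B1 - {x}) \<in> \<B>"
 by (simp add: matroid_def)

text \<open>Exchanging towards \<open>B2\<close> keeps the cardinality and shrinks
  \<open>B1 - B2\<close>, until \<open>B1\<close> lies inside \<open>B2\<close>.\<close>

lemma matroid_basis_card_le:
 assumes "matroid E \<B>" "B1 \<in> \<B>" "B2 \<in> \<B>"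
 shows "card B1 \<le> card B2"
 using assms(2)
proof (induction "card (B1 - B2)" arbitrary: B1)
 case 0
 then have "B1 \<subseteq> B2"
  using matroid_basis_finite[OF assms(1)] by auto
 then show ?case
  using matroid_basis_finite[OF assms(1,3)] by (simp add: card_mono)
next
 case (Suc n)
 have fin: "finite B1" using matroid_basis_finite[OF assms(1) Suc.prems] .
 obtain x where x: "x \<in> B1 - B2"
  using Suc.hyps(2) by (metis card.empty ex_in_conv nat.distinct(1))
 obtain y where y: "y \<in> B2 - B1" "insert y (B1 - {x}) \<in> \<B>"
  using matroid_exchange[OF assms(1) Suc.prems assms(3) x] by blast
 have "insert y (B1 - {x}) - B2 = (B1 - B2) - {x}" using y by blast
 then have "card (insert y (B1 - {x}) - B2) = n" using Suc.hyps(2) x fin by simp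
 then have "card (insert y (B1 - {x})) \<le> card B2"
  using Suc.hyps(1) y(2) by blast
 moreover have "card (insert y (B1 - {x})) = card B1"
  using x y fin by (metis DiffD1 DiffD2 card.remove card_insert_disjoint finite_Diff insertE insert_Diff)
 ultimately show ?case by simp
qed

lemma matroid_basis_card:
 "matroid E \<B> ==> B1 \<in> \<B> ==> B2 \<in> \<B> ==> card B1 = card B2"
 by (simp add: le_antisym matroid_basis_card_le)

text \<open>Among the bases containing \<open>I\<close> take one that meets \<open>B\<close> in as
  many elements as possible; an element of it outside \<open>I \<union> B\<close> could still be
  exchanged for one of \<open>B\<close>.\<close>

lemma matroid_extend:
 assumes M: "matroid E \<B>" and "C \<in> \<B>" "I \<subseteq> C" "B \<in> \<B>"
 shows "\<exists>B'\<in>\<B>. I \<subseteq> B' & B' \<subseteq> I \<union> B"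
proof -
 obtain B' where B': "B' \<in> \<B>" "I \<subseteq> B'"
  and max: "\<And>B''. B'' \<in> \<B> ==> I \<subseteq> B'' ==> card (B'' \<inter> B) \<le> card (B' \<inter> B)"
 proof -
  have "\<exists>y. (y \<in> \<B> & I \<subseteq> y) & (\<forall>z. (z \<in> \<B> & I \<subseteq> z) \<longrightarrow> card (z \<inter> B) \<le> card (y \<inter> B))"
   using assms(2,3) matroid_basis_finite[OF M assms(4)]
   by (intro ex_has_greatest_nat[where k = C and b = "Suc (card B)"]) (auto intro: card_mono simp: less_Suc_eq_le)
  then show ?thesis using that by blast
 qed
 have "B' \<subseteq> I \<union> B"
 proof (rule ccontr)
  assume "\<not> B' \<subseteq> I \<union> B"
  then obtain x where x: "x \<in> B'" "x ~: I" "x ~: B" by blast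
  obtain y where y: "y \<in> B - B'" "insert y (B' - {x}) \<in> \<B>"
   using matroid_exchange[OF M B'(1) assms(4), of x] x by blast
  have "insert y (B' - {x}) \<inter> B = insert y (B' \<inter> B)" using x y by blast
  then have "card (insert y (B' - {x}) \<inter> B) = Suc (card (B' \<inter> B))"
   using y matroid_basis_finite[OF M B'(1)] by simp
  moreover have "I \<subseteq> insert y (B' - {x})" using B'(2) x by blast
  ultimately show False using max[OF y(2)] by simp
 qed
 then show ?thesis using B' by blast
qed

text \<open>Equal cardinality leaves room for dropping exactly one element of \<open>B\<close>. This
  turns the output of \<open>matroid_extend\<close> into a single exchange.\<close>

lemma basis_swapI:
 assumes M: "matroid E \<B>" and "B \<in> \<B>" "B' \<in> \<B>" "y ~: B" "y \<in> B'" "B' \<subseteq> insert y B"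
 shows "\<exists>x\<in>B - B'. B' = insert y (B - {x})"
proof -
 have fin: "finite B" "finite B'" using matroid_basis_finite[OF M] assms by auto
 have c: "card B = card B'" using matroid_basis_card[OF M] assms by blast
 have "B - B' ~= {}"
 proof
  assume "B - B' = {}"
  then have "insert y B \<subseteq> B'" using assms by blast
  then have "card (insert y B) \<le> card B'" using fin card_mono by blast
  then show False using c assms fin by simp
 qed
 then obtain x where x: "x \<in> B - B'" by blast
 have "B' \<subseteq> insert y (B - {x})" using assms x by blast
 moreover have "card (insert y (B - {x})) = card B'"
 proof -
  have "card B = Suc (card (B - {x}))" using x fin by (meson DiffD1 card.remove)
  then show ?thesis using c fin assms(4) by simp
 qed
 ultimately have "B' = insert y (B - {x})" using fin by (simp add: card_subset_eq)
 then show ?thesis using x by blast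
qed

text \<open>Here the incoming element is prescribed instead of the outgoing one. Extending
  \<open>insert y (B1 \<inter> B2)\<close> by elements of \<open>B1\<close> forces the dropped
  element to lie outside \<open>B2\<close>.\<close>

lemma matroid_exchange_dual:
 assumes M: "matroid E \<B>" and "B1 \<in> \<B>" "B2 \<in> \<B>" "y \<in> B2 - B1"
 shows "\<exists>x\<in>B1 - B2. insert y (B1 - {x}) \<in> \<B>"
proof -
 obtain B' where B': "B' \<in> \<B>" "insert y (B1 \<inter> B2) \<subseteq> B'" "B' \<subseteq> insert y (B1 \<inter> B2) \<union> B1"
  using matroid_extend[OF M assms(3) _ assms(2), of "insert y (B1 \<inter> B2)"] assms(4) by blast
 have "B' \<subseteq> insert y B1" "y ~: B1" "y \<in> B'" using B' assms(4) by blast+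
 then obtain x where x: "x \<in> B1 - B'" "B' = insert y (B1 - {x})"
  using basis_swapI[OF M assms(2) B'(1)] by blast
 then have "x ~: B2" using B'(2) by blast
 then show ?thesis using x B'(1) by blast
qed

text \<open>Extend \<open>I\<close> inside \<open>I \<union> C2\<close>. If nothing of
  \<open>I2 - I\<close> could be added, \<open>C2\<close> would have more elements outside the
  extension than the extension has outside \<open>C2\<close>, although both are bases.\<close>

lemma matroid_augment:
 assumes M: "matroid E \<B>" and "C1 \<in> \<B>" "I \<subseteq> C1" "C2 \<in> \<B>" "I2 \<subseteq> C2" "card I < card I2"
 shows "\<exists>y\<in>I2 - I. \<exists>B\<in>\<B>. insert y I \<subseteq> B"
proof (rule ccontr)
 assume neg: "\<not> ?thesis"
 obtain B where B: "B \<in> \<B>" "I \<subseteq> B" "B \<subseteq> I \<union> C2"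
  using matroid_extend[OF M assms(2,3,4)] by blast
 have fin: "finite B" "finite C2" using matroid_basis_finite[OF M] B assms by auto
 have finI: "finite I" "finite I2" using fin B(2) assms(5) by (auto intro: finite_subset)
 have disj: "(I2 - I) \<inter> B = {}" using neg B by blast
 have "card (B - C2) = card (C2 - B)"
 proof -
  have "card B = card (B \<inter> C2) + card (B - C2)" "card C2 = card (C2 \<inter> B) + card (C2 - B)"
   using fin by (metis card_Int_Diff)+
  then show ?thesis using matroid_basis_card[OF M B(1) assms(4)] by (simp add: Int_commute)
 qed
 moreover have "card (I2 - I) \<le> card (C2 - B)"
  using disj assms fin by (intro card_mono) auto
 moreover have "card (B - C2) \<le> card (I - I2)"
  using B assms finI by (intro card_mono) auto
 moreover have "card I = card (I \<inter> I2) + card (I - I2)" "card I2 = card (I2 \<inter> I) + card (I2 - I)"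
  using finI by (metis card_Int_Diff)+
 ultimately show False using assms(6) by (simp add: Int_commute)
qed

lemma matroid_delete:
 assumes "matroid E \<B>" "\<exists>B\<in>\<B>. a ~: B"
 shows "matroid (E - {a}) {B \<in> \<B>. a ~: B}"
 unfolding matroid_def
proof (intro conjI ballI)
 show "finite (E - {a})" "{B \<in> \<B>. a ~: B} ~= {}" using assms by (auto simp: matroid_def)
 show "X \<subseteq> E - {a}" if "X \<in> {B \<in> \<B>. a ~: B}" for X
  using that matroid_basis_subset[OF assms(1)] by blast
 show "\<exists>y\<in>B2 - B1. insert y (B1 - {x}) \<in> {B \<in> \<B>. a ~: B}"
  if "B1 \<in> {B \<in> \<B>. a ~: B}" "B2 \<in> {B \<in> \<B>. a ~: B}" "x \<in> B1 - B2" for B1 B2 x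
  using matroid_exchange[OF assms(1), of B1 B2 x] that by blast
qed

lemma matroid_dual:
 assumes M: "matroid E \<B>"
 shows "matroid E ((-) E ` \<B>)"
 unfolding matroid_def
proof (intro conjI ballI)
 show "finite E" "(-) E ` \<B> ~= {}" using M by (auto simp: matroid_def)
 show "X \<subseteq> E" if "X \<in> (-) E ` \<B>" for X using that by blast
next
 fix C1 C2 x assume C: "C1 \<in> (-) E ` \<B>" "C2 \<in> (-) E ` \<B>" "x \<in> C1 - C2"
 then obtain B1 B2 where B: "B1 \<in> \<B>" "C1 = E - B1" "B2 \<in> \<B>" "C2 = E - B2" by blast
 have "x \<in> B2 - B1" using C B by blast
 then obtain y where y: "y \<in> B1 - B2" "insert x (B1 - {y}) \<in> \<B>"
  using matroid_exchange_dual[OF M B(1,3)] by blast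
 have "y \<in> E" "x \<in> E" using y(1) C(3) B(2) matroid_basis_subset[OF M B(1)] by auto
 then have "insert y (C1 - {x}) = E - insert x (B1 - {y})" using B y C by blast
 moreover have "y \<in> C2 - C1" using y B \<open>y \<in> E\<close> by blast
 ultimately show "\<exists>y\<in>C2 - C1. insert y (C1 - {x}) \<in> (-) E ` \<B>" using y by blast
qed

subsection \<open>Separators and connectivity\<close>

text \<open>Constancy of \<open>card (B \<inter> S)\<close> says that the ranks of \<open>S\<close>
  and of its complement add up to the rank, so separators are the unions of connected components.
  Stated through bases, the notion applies verbatim to minors whose deleted or contracted elements
  stay in the ground set.\<close>

definition separator :: "'a set set => 'a set => bool" where
 "separator \<B> S \<longleftrightarrow> (\<forall>B\<in>\<B>. \<forall>B'\<in>\<B>. card (B \<inter> S) = card (B' \<inter> S))"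

definition connected_matroid :: "'a set => 'a set set => bool" where
 "connected_matroid E \<B> \<longleftrightarrow> (\<forall>S\<subseteq>E. separator \<B> S \<longrightarrow> S = {} \<or> S = E)"

definition rk :: "'a set set => 'a set => nat" where
 "rk \<B> S = Max ((\<lambda>B. card (B \<inter> S)) ` \<B>)"

lemma matroid_finite_bases: "matroid E \<B> ==> finite \<B>"
 by (meson Pow_iff finite_Pow_iff finite_subset matroid_basis_subset matroid_finite subsetI)

lemma rk_ge: "matroid E \<B> ==> B \<in> \<B> ==> card (B \<inter> S) \<le> rk \<B> S"
 unfolding rk_def by (rule Max_ge) (auto simp: matroid_finite_bases)

lemma rk_attained: "matroid E \<B> ==> \<exists>B\<in>\<B>. card (B \<inter> S) = rk \<B> S"
proof -
 assume M: "matroid E \<B>"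
 have "rk \<B> S \<in> (\<lambda>B. card (B \<inter> S)) ` \<B>"
  unfolding rk_def using matroid_nonempty[OF M] matroid_finite_bases[OF M] by (intro Max_in) auto
 then show ?thesis by auto
qed

text \<open>Among the bases that are optimal for \<open>Y\<close>, take the best one for
  \<open>X\<close>. Augmenting inside \<open>X\<close> expels one element but adds one of
  \<open>X \<subseteq> Y\<close>, so nothing is lost in \<open>Y\<close>. Applied to an intersection
  and a union this gives submodularity.\<close>

lemma rk_attained_nested:
 assumes M: "matroid E \<B>" and XY: "X \<subseteq> Y"
 shows "\<exists>B\<in>\<B>. card (B \<inter> X) = rk \<B> X & card (B \<inter> Y) = rk \<B> Y"
proof -
 obtain BX where BX: "BX \<in> \<B>" "card (BX \<inter> X) = rk \<B> X" using rk_attained[OF M] by blast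
 obtain BY where BY: "BY \<in> \<B>" "card (BY \<inter> Y) = rk \<B> Y" using rk_attained[OF M] by blast
 obtain B where B: "B \<in> \<B>" "card (B \<inter> Y) = rk \<B> Y"
  and max: "\<And>C. C \<in> \<B> ==> card (C \<inter> Y) = rk \<B> Y ==> card (C \<inter> X) \<le> card (B \<inter> X)"
 proof -
  have "\<exists>y. (y \<in> \<B> & card (y \<inter> Y) = rk \<B> Y) &
   (\<forall>z. (z \<in> \<B> & card (z \<inter> Y) = rk \<B> Y) \<longrightarrow> card (z \<inter> X) \<le> card (y \<inter> X))"
   using BY rk_ge[OF M] by (intro ex_has_greatest_nat[where k = BY and b = "Suc (rk \<B> X)"]) (auto simp: less_Suc_eq_le)
  then show ?thesis using that by blast
 qed
 have "card (B \<inter> X) = rk \<B> X"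
 proof (rule ccontr)
  assume "card (B \<inter> X) ~= rk \<B> X"
  then have "card (B \<inter> X) < card (BX \<inter> X)" using rk_ge[OF M B(1), of X] BX by simp
  then obtain y C where y: "y \<in> BX \<inter> X - B \<inter> X" "C \<in> \<B>" "insert y (B \<inter> X) \<subseteq> C"
   using matroid_augment[OF M B(1) _ BX(1), of "B \<inter> X" "BX \<inter> X"] by blast
  obtain B' where B': "B' \<in> \<B>" "insert y (B \<inter> X) \<subseteq> B'" "B' \<subseteq> insert y (B \<inter> X) \<union> B"
   using matroid_extend[OF M y(2,3) B(1)] by blast
  have "y ~: B" "y \<in> B'" "B' \<subseteq> insert y B" using y B' by blast+
  then obtain x where x: "x \<in> B - B'" "B' = insert y (B - {x})"
   using basis_swapI[OF M B(1) B'(1)] by blast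
  have fin: "finite B" "finite B'" using matroid_basis_finite[OF M] B B' by auto
  have xX: "x ~: X" using x B' by blast
  have "B' \<inter> X = insert y (B \<inter> X)" using x xX y by blast
  then have c1: "card (B' \<inter> X) = Suc (card (B \<inter> X))" using \<open>y ~: B\<close> fin by simp
  have "card (B \<inter> Y) \<le> card (B' \<inter> Y)"
  proof -
   have "B' \<inter> Y = insert y (B \<inter> Y - {x})" using x y XY by blast
   moreover have "y ~: B \<inter> Y - {x}" using \<open>y ~: B\<close> by blast
   ultimately have "card (B' \<inter> Y) = Suc (card (B \<inter> Y - {x}))" using fin by simp
   then show ?thesis using fin card_Suc_Diff1[of "B \<inter> Y" x] by (cases "x \<in> B \<inter> Y") auto
  qed
  then have "card (B' \<inter> Y) = rk \<B> Y" using B rk_ge[OF M B'(1), of Y] by simp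
  then show False using max[OF B'(1)] c1 by simp
 qed
 then show ?thesis using B by blast
qed

lemma rk_submodular:
 assumes M: "matroid E \<B>"
 shows "rk \<B> (X \<union> Y) + rk \<B> (X \<inter> Y) \<le> rk \<B> X + rk \<B> Y"
proof -
 obtain B where B: "B \<in> \<B>" "card (B \<inter> (X \<inter> Y)) = rk \<B> (X \<inter> Y)" "card (B \<inter> (X \<union> Y)) = rk \<B> (X \<union> Y)"
  using rk_attained_nested[OF M, of "X \<inter> Y" "X \<union> Y"] by blast
 have fin: "finite B" using matroid_basis_finite[OF M B(1)] .
 have "card (B \<inter> X) + card (B \<inter> Y) = card ((B \<inter> X) \<union> (B \<inter> Y)) + card ((B \<inter> X) \<inter> (B \<inter> Y))"
  using fin by (intro card_Un_Int) auto
 moreover have "(B \<inter> X) \<union> (B \<inter> Y) = B \<inter> (X \<union> Y)" "(B \<inter> X) \<inter> (B \<inter> Y) = B \<inter> (X \<inter> Y)" by blast+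
 ultimately show ?thesis using B rk_ge[OF M B(1), of X] rk_ge[OF M B(1), of Y] by simp
qed

lemma card_basis_split:
 assumes "matroid E \<B>" "B \<in> \<B>"
 shows "card (B \<inter> S) + card (B \<inter> (E - S)) = card B"
proof -
 have "B \<inter> (E - S) = B - S" using matroid_basis_subset[OF assms] by blast
 then show ?thesis using card_Int_Diff[OF matroid_basis_finite[OF assms], of S] by simp
qed

lemma separator_if_rk:
 assumes M: "matroid E \<B>" and "B0 \<in> \<B>" "rk \<B> S + rk \<B> (E - S) \<le> card B0"
 shows "separator \<B> S"
proof -
 have "card (B \<inter> S) = rk \<B> S" if "B \<in> \<B>" for B
  using rk_ge[OF M that, of S] rk_ge[OF M that, of "E - S"] card_basis_split[OF M that, of S]
   matroid_basis_card[OF M that assms(2)] assms(3) by linarith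
 then show ?thesis by (simp add: separator_def)
qed

lemma separator_compl:
 assumes M: "matroid E \<B>" and "separator \<B> S" shows "separator \<B> (E - S)"
 unfolding separator_def
proof (intro ballI)
 fix B B' assume B: "B \<in> \<B>" "B' \<in> \<B>"
 have "card (B \<inter> S) = card (B' \<inter> S)" using assms(2) B unfolding separator_def by blast
 then show "card (B \<inter> (E - S)) = card (B' \<inter> (E - S))"
  using card_basis_split[OF M B(1), of S] card_basis_split[OF M B(2), of S] matroid_basis_card[OF M B]
  by linarith
qed

text \<open>Contracting \<open>e\<close> amounts to keeping the bases that contain \<open>e\<close>; as separators only count
 elements of \<open>E - {e}\<close>, there is no need to remove \<open>e\<close> from them.\<close>

lemma connected_delete_or_contract:
 assumes M: "matroid E \<B>" and C: "connected_matroid E \<B>"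
  and e: "e \<in> E" "\<exists>B\<in>\<B>. e ~: B" "\<exists>B\<in>\<B>. e \<in> B"
 shows "connected_matroid (E - {e}) {B \<in> \<B>. e ~: B} \<or> connected_matroid (E - {e}) {B \<in> \<B>. e \<in> B}"
proof (rule ccontr)
 assume "\<not> ?thesis"
 then obtain S S' where S: "S \<subseteq> E - {e}" "separator {B \<in> \<B>. e ~: B} S" "S ~= {}" "S ~= E - {e}"
  and S': "S' \<subseteq> E - {e}" "separator {B \<in> \<B>. e \<in> B} S'" "S' ~= {}" "S' ~= E - {e}"
  unfolding connected_matroid_def by blast
 obtain B0 where B0: "B0 \<in> \<B>" "e ~: B0" using e by blast
 obtain B1 where B1: "B1 \<in> \<B>" "e \<in> B1" using e by blast
 define r where "r = card B0"
 have cr: "card B = r" if "B \<in> \<B>" for B using matroid_basis_card[OF M that B0(1)] r_def by simp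
 \<comment> \<open>Every \<open>B \<inter> X\<close> extends by elements of \<open>B0\<close> to a
   basis avoiding \<open>e\<close>, so deleting \<open>e\<close> does not change the rank of
   \<open>X\<close>.\<close>
 have rkS: "rk \<B> X = card (B0 \<inter> X)" if X: "X \<subseteq> E - {e}" "separator {B \<in> \<B>. e ~: B} X" for X
 proof -
  obtain B where B: "B \<in> \<B>" "card (B \<inter> X) = rk \<B> X" using rk_attained[OF M] by blast
  obtain B' where B': "B' \<in> \<B>" "B \<inter> X \<subseteq> B'" "B' \<subseteq> (B \<inter> X) \<union> B0"
   using matroid_extend[OF M B(1) _ B0(1), of "B \<inter> X"] by blast
  have "e ~: B'" using B' B0 X by blast
  then have "card (B' \<inter> X) = card (B0 \<inter> X)" using X(2) B' B0 unfolding separator_def by blast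
  moreover have "rk \<B> X \<le> card (B' \<inter> X)"
   using B B' matroid_basis_finite[OF M B'(1)] by (metis Int_lower2 Int_greatest card_mono finite_Int)
  ultimately show ?thesis using rk_ge[OF M B0(1), of X] by simp
 qed
 have sepD: "separator {B \<in> \<B>. e ~: B} (E - {e} - S)"
  using separator_compl[OF matroid_delete[OF M e(2)] S(2)] .
 have 1: "rk \<B> S + rk \<B> (E - {e} - S) \<le> r"
 proof -
  have "card (B0 \<inter> S) + card (B0 \<inter> (E - {e} - S)) = r"
   using card_basis_split[OF matroid_delete[OF M e(2)], of B0 S] B0 cr by auto
  then show ?thesis using rkS[OF S(1,2)] rkS[OF _ sepD] by auto
 qed
 have cS': "card (B \<inter> S') + card (B \<inter> (E - {e} - S')) + 1 = r" if "B \<in> \<B>" "e \<in> B" for B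
 proof -
  have fin: "finite B" using matroid_basis_finite[OF M that(1)] .
  have sub: "B \<subseteq> E" using matroid_basis_subset[OF M that(1)] .
  have "card (B - {e}) + 1 = r" using card_Suc_Diff1[OF fin that(2)] cr[OF that(1)] by simp
  moreover have "card (B - {e}) = card ((B - {e}) \<inter> S') + card ((B - {e}) - S')"
   using fin by (intro card_Int_Diff) simp
  moreover have "(B - {e}) \<inter> S' = B \<inter> S'" "(B - {e}) - S' = B \<inter> (E - {e} - S')"
   using S'(1) sub by blast+
  ultimately show ?thesis by simp
 qed
 have sepC: "separator {B \<in> \<B>. e \<in> B} (E - {e} - S')"
  unfolding separator_def
 proof (intro ballI)
  fix B B' assume h: "B \<in> {B \<in> \<B>. e \<in> B}" "B' \<in> {B \<in> \<B>. e \<in> B}"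
  then have "card (B \<inter> S') = card (B' \<inter> S')" using S'(2) unfolding separator_def by blast
  moreover have "card (B \<inter> S') + card (B \<inter> (E - {e} - S')) + 1 = r"
   "card (B' \<inter> S') + card (B' \<inter> (E - {e} - S')) + 1 = r" using cS' h by blast+
  ultimately show "card (B \<inter> (E - {e} - S')) = card (B' \<inter> (E - {e} - S'))" by linarith
 qed
 \<comment> \<open>A basis can be made to contain \<open>e\<close> without losing elements of
   \<open>insert e X\<close>; the summand 1 counts \<open>e\<close> itself.\<close>
 have rkS': "rk \<B> (insert e X) \<le> card (B1 \<inter> X) + 1"
  if X: "X \<subseteq> E - {e}" "separator {B \<in> \<B>. e \<in> B} X" for X
 proof -
  obtain B where B: "B \<in> \<B>" "card (B \<inter> insert e X) = rk \<B> (insert e X)" using rk_attained[OF M] by blast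
  have finB: "finite B" using matroid_basis_finite[OF M B(1)] .
  have *: "\<exists>B'\<in>\<B>. e \<in> B' & card (B \<inter> insert e X) \<le> card (B' \<inter> insert e X)"
  proof (cases "e \<in> B")
   case True then show ?thesis using B by blast
  next
   case False
   then obtain x where x: "x \<in> B" "insert e (B - {x}) \<in> \<B>"
    using matroid_exchange_dual[OF M B(1) B1(1), of e] B1 by blast
   have "insert e (B - {x}) \<inter> insert e X = insert e ((B \<inter> insert e X) - {x})" by blast
   then have "card (insert e (B - {x}) \<inter> insert e X) = Suc (card ((B \<inter> insert e X) - {x}))"
    using finB False by simp
   then have "card (B \<inter> insert e X) \<le> card (insert e (B - {x}) \<inter> insert e X)"
    using finB card_Suc_Diff1[of "B \<inter> insert e X" x] by (cases "x \<in> B \<inter> insert e X") auto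
   then show ?thesis using x by blast
  qed
  then obtain B' where B': "B' \<in> \<B>" "e \<in> B'" "card (B \<inter> insert e X) \<le> card (B' \<inter> insert e X)" by blast
  have "B' \<inter> insert e X = insert e (B' \<inter> X)" "e ~: B' \<inter> X" using B' X by blast+
  then have "card (B' \<inter> insert e X) = card (B' \<inter> X) + 1"
   using matroid_basis_finite[OF M B'(1)] by simp
  moreover have "card (B' \<inter> X) = card (B1 \<inter> X)"
   using X(2) B' B1 unfolding separator_def by blast
  ultimately show ?thesis using B B' by simp
 qed
 have 2: "rk \<B> (insert e S') + rk \<B> (insert e (E - {e} - S')) \<le> r + 1"
 proof -
  have "E - {e} - S' \<subseteq> E - {e}" by blast
  then show ?thesis using rkS'[OF S'(1,2)] rkS'[OF _ sepC] cS'[OF B1] by simp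
 qed
 define T T' where "T = E - {e} - S" and "T' = E - {e} - S'"
 \<comment> \<open>Uncrossing: by the two submodular inequalities the sums of ranks for
   \<open>A \<inter> A'\<close> and for \<open>D \<inter> D'\<close>, each taken with its
   complement, total at most \<open>2 * r + 1\<close>. So one of them is at most \<open>r\<close>
   and belongs to a separator of the whole matroid, which must be empty.\<close>
 have key: "A \<inter> A' = {} \<or> D \<inter> D' = {}"
  if "A \<union> D = E - {e}" "A \<inter> D = {}" "A' \<union> D' = E - {e}" "A' \<inter> D' = {}"
   "rk \<B> A + rk \<B> D \<le> r" "rk \<B> (insert e A') + rk \<B> (insert e D') \<le> r + 1" for A D A' D'
 proof -
  have i: "A \<inter> insert e A' = A \<inter> A'" "D \<inter> insert e D' = D \<inter> D'" using that by blast+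
  have c: "A \<union> insert e A' = E - D \<inter> D'" "D \<union> insert e D' = E - A \<inter> A'"
   using that e(1) by blast+
  have "rk \<B> (A \<union> insert e A') + rk \<B> (A \<inter> insert e A') \<le> rk \<B> A + rk \<B> (insert e A')"
   "rk \<B> (D \<union> insert e D') + rk \<B> (D \<inter> insert e D') \<le> rk \<B> D + rk \<B> (insert e D')"
   using rk_submodular[OF M] by blast+
  then have "rk \<B> (A \<inter> A') + rk \<B> (E - A \<inter> A') \<le> r \<or> rk \<B> (D \<inter> D') + rk \<B> (E - D \<inter> D') \<le> r"
   using that(5,6) unfolding i c by linarith
  then have "separator \<B> (A \<inter> A') \<or> separator \<B> (D \<inter> D')"
   using separator_if_rk[OF M B0(1)] r_def by blast
  moreover have "A \<inter> A' \<subseteq> E" "D \<inter> D' \<subseteq> E" "A \<inter> A' ~= E" "D \<inter> D' ~= E" using that e(1) by blast+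
  ultimately show ?thesis using C unfolding connected_matroid_def by metis
 qed
 \<comment> \<open>Each alternative here, combined with each alternative of the next step, empties
   one of \<open>S\<close>, \<open>T\<close>, \<open>S'\<close>, \<open>T'\<close>.\<close>
 have "S \<inter> S' = {} \<or> T \<inter> T' = {}"
  using S S' 1 2 unfolding T_def T'_def by (intro key) auto
 moreover have "S \<inter> T' = {} \<or> T \<inter> S' = {}"
  using S S' 1 2 unfolding T_def T'_def by (intro key) auto
 ultimately show False using S S' unfolding T_def T'_def by blast
qed

lemma connected_not_coloop:
 assumes "matroid E \<B>" "connected_matroid E \<B>" "e \<in> E" "E ~= {e}"
 shows "\<exists>B\<in>\<B>. e ~: B" "\<exists>B\<in>\<B>. e \<in> B"
proof -
 have "\<not> separator \<B> {e}" using assms unfolding connected_matroid_def by blast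
 then obtain B B' where "B \<in> \<B>" "B' \<in> \<B>" "card (B \<inter> {e}) ~= card (B' \<inter> {e})"
  unfolding separator_def by blast
 then have "(e \<in> B & e ~: B') \<or> (e \<in> B' & e ~: B)" by (auto split: if_splits)
 then show "\<exists>B\<in>\<B>. e ~: B" "\<exists>B\<in>\<B>. e \<in> B" using \<open>B \<in> \<B>\<close> \<open>B' \<in> \<B>\<close> by blast+
qed

subsection \<open>Paths in the fundamental graph of a basis\<close>

text \<open>Elements of the basis \<open>X\<close> with a common neighbour in the fundamental graph,
  the bipartite graph in which \<open>x\<close> in \<open>X\<close> and \<open>z\<close> outside
  \<open>X\<close> are adjacent if exchanging \<open>x\<close> for \<open>z\<close> gives a
  basis.\<close>

definition share :: "'a set set => 'a set => ('a \<times> 'a) set" where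
 "share \<B> X = {(c, d). c \<in> X & d \<in> X & (\<exists>z. z ~: X & insert z (X - {c}) \<in> \<B> & insert z (X - {d}) \<in> \<B>)}"

text \<open>The elements of \<open>X\<close> reachable from \<open>c\<close>, together with their
  neighbours outside \<open>X\<close>, form a separator.\<close>

lemma connected_share:
 assumes M: "matroid E \<B>" and C: "connected_matroid E \<B>" and X: "X \<in> \<B>" "c \<in> X" "d \<in> X"
 shows "(c, d) \<in> (share \<B> X)\<^sup>*"
proof (rule ccontr)
 assume neg: "(c, d) ~: (share \<B> X)\<^sup>*"
 define R where "R = {x \<in> X. (c, x) \<in> (share \<B> X)\<^sup>*}"
 define S where "S = R \<union> {z \<in> E - X. \<exists>x\<in>R. insert z (X - {x}) \<in> \<B>}"
 have XE: "X \<subseteq> E" using matroid_basis_subset[OF M X(1)] .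
 have SE: "S \<subseteq> E" unfolding S_def R_def using XE by blast
 have edge: "x \<in> S \<longleftrightarrow> z \<in> S" if xz: "x \<in> X" "z \<in> E - X" "insert z (X - {x}) \<in> \<B>" for x z
 proof
  assume "x \<in> S" then have "x \<in> R" using that unfolding S_def by blast
  then show "z \<in> S" using that unfolding S_def by blast
 next
  assume "z \<in> S"
  then obtain x' where x': "x' \<in> R" "insert z (X - {x'}) \<in> \<B>"
   using xz(2) unfolding S_def R_def by auto
  then have "(x', x) \<in> share \<B> X" using that unfolding share_def R_def by blast
  then have "x \<in> R" using x' that unfolding R_def by (auto intro: rtrancl_into_rtrancl)
  then show "x \<in> S" unfolding S_def by blast
 qed
 have fX: "finite X" using matroid_basis_finite[OF M X(1)] .
 \<comment> \<open>If \<open>A\<close> is closed under adjacency, no basis has more elements in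
   \<open>A\<close> than \<open>X\<close> has: otherwise some \<open>y\<close> in \<open>A\<close>
   could be exchanged for an \<open>x\<close> outside \<open>A\<close>, an edge leaving
   \<open>A\<close>. This is applied to \<open>S\<close> and to its complement.\<close>
 have le: "card (B \<inter> A) \<le> card (X \<inter> A)"
  if B: "B \<in> \<B>" and A: "\<And>x z. x \<in> X ==> z \<in> E - X ==> insert z (X - {x}) \<in> \<B> ==> x \<in> A \<longleftrightarrow> z \<in> A" for A B
 proof (rule ccontr)
  assume "\<not> ?thesis"
  then have "card (X \<inter> A) < card (B \<inter> A)" by simp
  then obtain y C' where y: "y \<in> B \<inter> A - X \<inter> A" "C' \<in> \<B>" "insert y (X \<inter> A) \<subseteq> C'"
   using matroid_augment[OF M X(1) _ B, of "X \<inter> A" "B \<inter> A"] by blast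
  obtain B' where B': "B' \<in> \<B>" "insert y (X \<inter> A) \<subseteq> B'" "B' \<subseteq> insert y (X \<inter> A) \<union> X"
   using matroid_extend[OF M y(2,3) X(1)] by blast
  then have "y ~: X" "y \<in> B'" "B' \<subseteq> insert y X" using y by blast+
  then obtain x where x: "x \<in> X - B'" "B' = insert y (X - {x})"
   using basis_swapI[OF M X(1) B'(1)] by blast
  have "x ~: A" using x B' by blast
  moreover have "y \<in> E" using B' matroid_basis_subset[OF M B'(1)] by blast
  ultimately show False using A[of x y] x y B' by blast
 qed
 have "separator \<B> S"
  unfolding separator_def
 proof (intro ballI)
  have "card (B \<inter> S) = card (X \<inter> S)" if B: "B \<in> \<B>" for B
  proof -
   have "card (B \<inter> S) \<le> card (X \<inter> S)" using le[OF B] edge by blast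
   moreover have "card (B \<inter> (E - S)) \<le> card (X \<inter> (E - S))" using le[OF B, of "E - S"] edge XE by blast
   ultimately show ?thesis
    using card_basis_split[OF M B, of S] card_basis_split[OF M X(1), of S] matroid_basis_card[OF M B X(1)]
    by linarith
  qed
  then show "card (B \<inter> S) = card (B' \<inter> S)" if "B \<in> \<B>" "B' \<in> \<B>" for B B' using that by simp
 qed
 moreover have "c \<in> S" "d ~: S" using X neg unfolding S_def R_def by auto
 moreover have "d \<in> E" using X XE by blast
 ultimately show False using C SE unfolding connected_matroid_def by blast
qed

text \<open>In the fundamental matrix with rows \<open>X\<close>, the minor on rows
  \<open>x, y\<close> and columns \<open>z, w\<close> has a nonzero diagonal and a zero off the
  diagonal, so it behaves like a nonzero determinant.\<close>

lemma basis_double_exchange: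
 assumes M: "matroid E \<B>" and X: "x \<in> X" "y \<in> X" "x ~= y" "z ~: X" "w ~: X" "z ~= w"
  and B: "insert z (X - {x}) \<in> \<B>" "insert w (X - {y}) \<in> \<B>"
  and N: "insert z (X - {y}) ~: \<B> \<or> insert w (X - {x}) ~: \<B>"
 shows "insert z (insert w (X - {x} - {y})) \<in> \<B>"
 using N
proof
 assume n: "insert z (X - {y}) ~: \<B>"
 have "y \<in> insert z (X - {x}) - insert w (X - {y})" using X by blast
 then obtain u where u: "u \<in> insert w (X - {y}) - insert z (X - {x})"
  "insert u (insert z (X - {x}) - {y}) \<in> \<B>"
  using matroid_exchange[OF M B] by blast
 have "u = w \<or> u = x" using u X by blast
 moreover have "insert x (insert z (X - {x}) - {y}) = insert z (X - {y})" using X by blast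
 moreover have "insert w (insert z (X - {x}) - {y}) = insert z (insert w (X - {x} - {y}))" using X by blast
 ultimately show ?thesis using u n by metis
next
 assume n: "insert w (X - {x}) ~: \<B>"
 have "x \<in> insert w (X - {y}) - insert z (X - {x})" using X by blast
 then obtain u where u: "u \<in> insert z (X - {x}) - insert w (X - {y})"
  "insert u (insert w (X - {y}) - {x}) \<in> \<B>"
  using matroid_exchange[OF M B(2,1)] by blast
 have "u = z \<or> u = y" using u X by blast
 moreover have "insert y (insert w (X - {y}) - {x}) = insert w (X - {x})" using X by blast
 moreover have "insert z (insert w (X - {y}) - {x}) = insert z (insert w (X - {x} - {y}))" using X by blast
 ultimately show ?thesis using u n by metis
qed

lemma pivot_swap:
 assumes "x \<in> X" "y \<in> X" "x ~= y" "z ~: X" "w ~: X" "z ~= w"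
 shows "insert w (insert z (X - {x}) - {y}) = insert z (insert w (X - {x} - {y}))"
 using assms by blast

text \<open>A pivot on \<open>(x, z)\<close> leaves alone every entry \<open>(y, w)\<close> whose row or column vanishes on the pivot.\<close>

lemma pivot_basis:
 assumes M: "matroid E \<B>" and X: "x \<in> X" "y \<in> X" "x ~= y" "z ~: X" "w ~: X" "z ~= w"
  and B: "insert z (X - {x}) \<in> \<B>" "insert w (X - {y}) \<in> \<B>"
  and N: "insert z (X - {y}) ~: \<B> \<or> insert w (X - {x}) ~: \<B>"
 shows "insert w (insert z (X - {x}) - {y}) \<in> \<B>"
 using basis_double_exchange[OF assms] pivot_swap[OF X] by simp

text \<open>The case complementary to \<open>pivot_basis\<close>: the entry \<open>(y, w)\<close> is
  zero, the three other entries of the two by two minor are not, and the pivot fills in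
  \<open>(y, w)\<close>.\<close>

lemma pivot_basis_new:
 assumes M: "matroid E \<B>" and X: "x \<in> X" "y \<in> X" "x ~= y" "z ~: X" "w ~: X" "z ~= w"
  and B: "insert z (X - {x}) \<in> \<B>" "insert z (X - {y}) \<in> \<B>" "insert w (X - {x}) \<in> \<B>"
  and N: "insert w (X - {y}) ~: \<B>"
 shows "insert w (insert z (X - {x}) - {y}) \<in> \<B>"
proof -
 have "insert w (insert z (X - {x} - {y})) \<in> \<B>"
  using basis_double_exchange[OF M X(1,2,3,5,4) _ B(3,2)] X(6) N by blast
 then show ?thesis using pivot_swap[OF X] by (simp add: insert_commute)
qed

text \<open>Induction on the distance of \<open>c\<close> and \<open>d\<close> in
  \<open>share\<close>. On a shortest path of length at least three, a pivot in the interior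
  shortens the path, and by minimality the pivot column vanishes on \<open>c\<close> and
  \<open>d\<close>. Lengths one and two are the base cases, the second with the vanishing entries
  that exclude a shortcut.\<close>

lemma connected_path_induct:
 assumes M: "matroid E \<B>" and C: "connected_matroid E \<B>"
  and near: "\<And>X c d z. X \<in> \<B> ==> c \<in> X ==> d \<in> X ==> c ~= d ==> z ~: X ==>
    insert z (X - {c}) \<in> \<B> ==> insert z (X - {d}) \<in> \<B> ==> Q X c d"
  and pivot: "\<And>X c d x z. X \<in> \<B> ==> c \<in> X ==> d \<in> X ==> x \<in> X ==> c ~= d ==> x ~= c ==> x ~= d ==>
    z ~: X ==> insert z (X - {x}) \<in> \<B> ==> insert z (X - {c}) ~: \<B> ==> insert z (X - {d}) ~: \<B> ==>
    Q (insert z (X - {x})) c d ==> Q X c d"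
  and two: "\<And>X c d x z z'. X \<in> \<B> ==> c \<in> X ==> d \<in> X ==> x \<in> X ==> c ~= d ==> x ~= c ==> x ~= d ==>
    z ~: X ==> z' ~: X ==> z ~= z' ==>
    insert z (X - {c}) \<in> \<B> ==> insert z (X - {x}) \<in> \<B> ==> insert z (X - {d}) ~: \<B> ==>
    insert z' (X - {x}) \<in> \<B> ==> insert z' (X - {d}) \<in> \<B> ==> insert z' (X - {c}) ~: \<B> ==> Q X c d"
  and X: "X \<in> \<B>" "c \<in> X" "d \<in> X" "c ~= d"
 shows "Q X c d"
proof -
 have "Q X c d" if "(c, d) \<in> share \<B> X ^^ m" "X \<in> \<B>" for m X
  using that
 proof (induction m arbitrary: X rule: less_induct)
  case (less m)
  show ?case
  proof (cases "\<exists>k<m. (c, d) \<in> share \<B> X ^^ k")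
   case True then show ?thesis using less by blast
  next
   case False
   obtain f where f: "f 0 = c" "f m = d" "\<And>i. i < m ==> (f i, f (Suc i)) \<in> share \<B> X"
    using less.prems(1) unfolding relpow_fun_conv by blast
   have seg: "(f i, f (i + k)) \<in> share \<B> X ^^ k" if "i + k \<le> m" for i k
    unfolding relpow_fun_conv using f(3) that by (intro exI[of _ "\<lambda>j. f (i + j)"]) auto
   obtain z where z: "\<And>i. i < m ==> f i \<in> X & f (Suc i) \<in> X & z i ~: X &
     insert (z i) (X - {f i}) \<in> \<B> & insert (z i) (X - {f (Suc i)}) \<in> \<B>"
   proof -
    have "\<forall>i. \<exists>z. i < m \<longrightarrow> f i \<in> X & f (Suc i) \<in> X & z ~: X &
     insert z (X - {f i}) \<in> \<B> & insert z (X - {f (Suc i)}) \<in> \<B>"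
     using f(3) unfolding share_def by blast
    then show ?thesis using that by metis
   qed
   have "m ~= 0" using f X(4) by metis
   consider (one) "m = 1" | (two) "m = 2" | (more) "m \<ge> 3" using \<open>m ~= 0\<close> by linarith
   then have cd: "c \<in> X" "d \<in> X"
    using z[of 0] z[of "m - 1"] f(1,2) \<open>m ~= 0\<close> by auto
   have shareI: "(x, y) \<in> share \<B> X" if "x \<in> X" "y \<in> X" "w ~: X" "insert w (X - {x}) \<in> \<B>" "insert w (X - {y}) \<in> \<B>" for x y w
    using that unfolding share_def by blast
   have rel1: "R ^^ 1 = R" for R :: "('a \<times> 'a) set" by simp
   show ?thesis
    using \<open>m ~= 0\<close>
   proof -
    consider (one) "m = 1" | (two) "m = 2" | (more) "m \<ge> 3" using \<open>m ~= 0\<close> by linarith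
    then show ?thesis
    proof cases
     case one
     then have "f 0 = c" "f (Suc 0) = d" using f by auto
     then show ?thesis using near[OF less.prems(2) cd X(4), of "z 0"] z[of 0] one by auto
    next
     case two
     have f2: "f (Suc (Suc 0)) = d" using f two by (simp add: numeral_2_eq_2)
     have e0: "f (Suc 0) \<in> X" "z 0 ~: X" "insert (z 0) (X - {c}) \<in> \<B>" "insert (z 0) (X - {f (Suc 0)}) \<in> \<B>"
      using z[of 0] two f(1) by auto
     have e1: "z 1 ~: X" "insert (z 1) (X - {f (Suc 0)}) \<in> \<B>" "insert (z 1) (X - {d}) \<in> \<B>"
      using z[of 1] two f2 by auto
     have no: "(c, d) ~: share \<B> X" using False two rel1[of "share \<B> X"] by (metis one_less_numeral_iff semiring_norm(76))
     have n0: "insert (z 0) (X - {d}) ~: \<B>" using no shareI[OF cd e0(2,3)] by blast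
     have n1: "insert (z 1) (X - {c}) ~: \<B>" using no shareI[OF cd e1(1) _ e1(3)] by blast
     have "f (Suc 0) ~= c" using n1 e1(2) by metis
     moreover have "f (Suc 0) ~= d" using n0 e0(4) by metis
     moreover have "z 0 ~= z 1" using n1 e0(3) by metis
     ultimately show ?thesis
      using assms(5)[OF less.prems(2) cd e0(1) X(4) _ _ e0(2) e1(1) _ e0(3,4) n0 e1(2,3) n1] by blast
    next
     case more
     \<comment> \<open>The pivot on \<open>(x, w)\<close> replaces \<open>x\<close> by
       \<open>w\<close> and makes \<open>v\<close> adjacent to both \<open>c\<close> and
       \<open>y\<close>, which saves one step.\<close>
     define x where "x = f 1" define y where "y = f 2" define w where "w = z 1" define v where "v = z 0"
     have xy: "x \<in> X" "y \<in> X" "w ~: X" "v ~: X" "insert w (X - {x}) \<in> \<B>" "insert w (X - {y}) \<in> \<B>"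
      "insert v (X - {c}) \<in> \<B>" "insert v (X - {x}) \<in> \<B>"
      using z[of 0] z[of 1] more f(1) unfolding x_def y_def w_def v_def by (auto simp: numeral_2_eq_2)
     have tail: "(f i, d) \<in> share \<B> X ^^ (m - i)" if "i \<le> m" for i
      using seg[of i "m - i"] that f(2) by simp
     have no: "(c, d) ~: share \<B> X ^^ k" if "k < m" for k using False that by blast
     have no2: "(c, p) ~: share \<B> X" if "(p, d) \<in> share \<B> X ^^ k" "Suc k < m" for p k
      using no[OF that(2)] relpow_Suc_I2[OF _ that(1)] by blast
     have cx: "(c, x) \<in> share \<B> X" using f(3)[of 0] f(1) more x_def by auto
     have no3: "(x, p) ~: share \<B> X" if "(p, d) \<in> share \<B> X ^^ k" "Suc (Suc k) < m" for p k
      using no[OF that(2)] relpow_Suc_I2[OF cx relpow_Suc_I2[OF _ that(1)]] by blast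
     have ncw: "insert w (X - {c}) ~: \<B>"
      using no2[OF tail[of 2]] shareI[OF cd(1) xy(2,3) _ xy(6)] more y_def by auto
     have ndw: "insert w (X - {d}) ~: \<B>"
      using no3[of d 0] shareI[OF xy(1) cd(2) xy(3,5)] more by auto
     have nyv: "insert v (X - {y}) ~: \<B>"
      using no2[OF tail[of 2]] shareI[OF cd(1) xy(2,4,7)] more y_def by auto
     have nxz: "insert (z i) (X - {x}) ~: \<B>" if "2 \<le> i" "i < m" for i
     proof
      assume "insert (z i) (X - {x}) \<in> \<B>"
      then have "(x, f (Suc i)) \<in> share \<B> X" using shareI[OF xy(1), of "f (Suc i)" "z i"] z[OF that(2)] by blast
      then show False using no3[OF tail[of "Suc i"]] that by auto
     qed
     have neq: "x ~= c" "x ~= d" "x ~= y" "y ~= c" "w ~= v"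
      using ncw ndw xy nyv by metis+
     define X' where "X' = insert w (X - {x})"
     have X': "X' \<in> \<B>" "c \<in> X'" "d \<in> X'" "y \<in> X'" using xy cd neq unfolding X'_def by auto
     have v': "v ~: X'" "insert v (X' - {c}) \<in> \<B>" "insert v (X' - {y}) \<in> \<B>"
     proof -
      show "v ~: X'" using xy neq unfolding X'_def by blast
      show "insert v (X' - {c}) \<in> \<B>"
       unfolding X'_def using pivot_basis[OF M xy(1) cd(1) neq(1) xy(3,4) neq(5) xy(5,7)] ncw by blast
      show "insert v (X' - {y}) \<in> \<B>"
       unfolding X'_def using pivot_basis_new[OF M xy(1,2) neq(3) xy(3,4) neq(5) xy(5,6,8) nyv] .
     qed
     \<comment> \<open>The rest of the path survives the pivot because its columns
       \<open>z i\<close> vanish on the row \<open>x\<close>, again by minimality.\<close>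
     have step: "(f i, f (Suc i)) \<in> share \<B> X'" if i: "2 \<le> i" "i < m" for i
     proof -
      have zi: "z i ~: X" "z i ~= w" using z[OF i(2)] nxz[OF i] xy by metis+
      have fx: "f i ~= x" "f (Suc i) ~= x" using nxz[OF i] z[OF i(2)] by metis+
      have "insert (z i) (X' - {f i}) \<in> \<B>" "insert (z i) (X' - {f (Suc i)}) \<in> \<B>"
       unfolding X'_def
       using pivot_basis[OF M xy(1) _ fx(1)[symmetric] xy(3) zi(1) zi(2)[symmetric] xy(5)]
        pivot_basis[OF M xy(1) _ fx(2)[symmetric] xy(3) zi(1) zi(2)[symmetric] xy(5)]
        z[OF i(2)] nxz[OF i] by blast+
      moreover have "z i ~: X'" "f i \<in> X'" "f (Suc i) \<in> X'" using zi fx z[OF i(2)] nxz[OF i] unfolding X'_def by auto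
      ultimately show ?thesis unfolding share_def by blast
     qed
     have "(y, d) \<in> share \<B> X' ^^ (m - 2)"
     proof -
      have "2 + (m - 2) = m" using more by simp
      then show ?thesis
       unfolding relpow_fun_conv using step f(2) y_def by (intro exI[of _ "\<lambda>j. f (2 + j)"]) auto
     qed
     moreover have "(c, y) \<in> share \<B> X'" using X' v' unfolding share_def by blast
     ultimately have "(c, d) \<in> share \<B> X' ^^ (Suc (m - 2))" using relpow_Suc_I2 by metis
     moreover have "Suc (m - 2) < m" using more by linarith
     ultimately have "Q X' c d" using less.IH X'(1) by blast
     then show ?thesis
      using pivot[OF less.prems(2) cd xy(1) X(4) neq(1,2) xy(3,5) ncw ndw] X'_def by blast
    qed
   qed
  qed
 qed
 then show ?thesis using connected_share[OF M C X(1-3)] X(1) rtrancl_power by blast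
qed

lemma separator_dual:
 assumes "finite E" "\<And>B. B \<in> \<B> ==> B \<subseteq> E" "S \<subseteq> E"
 shows "separator ((-) E ` \<B>) S \<longleftrightarrow> separator \<B> S"
proof -
 have fS: "finite S" using assms finite_subset by blast
 have c: "card ((E - B) \<inter> S) = card S - card (B \<inter> S)" for B
 proof -
  have "(E - B) \<inter> S = S - (B \<inter> S)" using assms(3) by blast
  then show ?thesis using fS by (simp add: card_Diff_subset)
 qed
 have le: "card (B \<inter> S) \<le> card S" for B using fS by (simp add: card_mono)
 have "card S - card (B \<inter> S) = card S - card (B' \<inter> S) \<longleftrightarrow> card (B \<inter> S) = card (B' \<inter> S)" for B B'
  using le[of B] le[of B'] by linarith
 then show ?thesis unfolding separator_def by (simp add: c)
qed

lemma connected_dual: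
 assumes "matroid E \<B>"
 shows "connected_matroid E ((-) E ` \<B>) \<longleftrightarrow> connected_matroid E \<B>"
 unfolding connected_matroid_def
 using separator_dual[OF matroid_finite[OF assms] matroid_basis_subset[OF assms]] by blast

lemma dual_delete: "{C \<in> (-) E ` \<B>. e ~: C} = (-) E ` {B \<in> \<B>. e \<in> B}" if "e \<in> E"
 using that by blast

lemma connected_dual_delete:
 assumes "matroid E \<B>" "e \<in> E"
 shows "connected_matroid (E - {e}) {C \<in> (-) E ` \<B>. e ~: C} \<longleftrightarrow> connected_matroid (E - {e}) {B \<in> \<B>. e \<in> B}"
proof -
 have "separator ((-) E ` {B \<in> \<B>. e \<in> B}) S \<longleftrightarrow> separator {B \<in> \<B>. e \<in> B} S" if "S \<subseteq> E - {e}" for S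
  using separator_dual[OF matroid_finite[OF assms(1)], of "{B \<in> \<B>. e \<in> B}" S] matroid_basis_subset[OF assms(1)] that
  by blast
 then show ?thesis unfolding connected_matroid_def dual_delete[OF assms(2)] by blast
qed

section \<open>Functions on bases that are trivial on all quadrangles\<close>

definition unit_subgroup :: "'k::field set => bool" where
 "unit_subgroup G \<longleftrightarrow> 1 \<in> G & 0 ~: G & (\<forall>x\<in>G. \<forall>y\<in>G. x * y \<in> G) & (\<forall>x\<in>G. inverse x \<in> G)"

lemma unit_subgroupD:
 assumes "unit_subgroup G"
 shows "1 \<in> G" "x \<in> G ==> x ~= 0" "x \<in> G ==> y \<in> G ==> x * y \<in> G" "x \<in> G ==> inverse x \<in> G"
  "x \<in> G ==> y \<in> G ==> x / y \<in> G"
 using assms unfolding unit_subgroup_def by (auto simp: divide_inverse)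

lemma unit_subgroup_prod:
 assumes "unit_subgroup G" "\<And>e. e \<in> A ==> g e \<in> G" shows "prod g A \<in> G"
 using assms(2) by (induction A rule: infinite_finite_induct) (auto simp: unit_subgroupD[OF assms(1)])

text \<open>The multiplicative relations satisfied by the quotient of two lifts of one function. Two
  opposite pairs of bases of the quadrangle are compared, whether or not the third pair consists of
  bases.\<close>

definition quad_trivial :: "'a set set => ('a set => 'k::field) => bool" where
 "quad_trivial \<B> u \<longleftrightarrow> (\<forall>J a b c d. distinct [a, b, c, d] \<longrightarrow> J \<inter> {a, b, c, d} = {} \<longrightarrow>
   insert a (insert c J) \<in> \<B> \<longrightarrow> insert b (insert d J) \<in> \<B> \<longrightarrow>
   insert a (insert d J) \<in> \<B> \<longrightarrow> insert b (insert c J) \<in> \<B> \<longrightarrow>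
   u (insert a (insert c J)) * u (insert b (insert d J)) =
   u (insert a (insert d J)) * u (insert b (insert c J)))"

lemma quad_trivialD:
 assumes "quad_trivial \<B> u" "distinct [a, b, c, d]" "J \<inter> {a, b, c, d} = {}"
   "insert a (insert c J) \<in> \<B>" "insert b (insert d J) \<in> \<B>"
   "insert a (insert d J) \<in> \<B>" "insert b (insert c J) \<in> \<B>"
  shows "u (insert a (insert c J)) * u (insert b (insert d J)) =
   u (insert a (insert d J)) * u (insert b (insert c J))"
 using assms unfolding quad_trivial_def by blast

lemma quad_trivial_rect:
 assumes q: "quad_trivial \<B> u" and X: "x \<in> X" "y \<in> X" "x ~= y" "z ~: X" "w ~: X" "z ~= w"
  and B: "insert z (X - {x}) \<in> \<B>" "insert w (X - {y}) \<in> \<B>" "insert w (X - {x}) \<in> \<B>" "insert z (X - {y}) \<in> \<B>"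
 shows "u (insert z (X - {x})) * u (insert w (X - {y})) = u (insert w (X - {x})) * u (insert z (X - {y}))"
proof -
 have s: "insert z (X - {x}) = insert z (insert y (X - {x, y}))" "insert w (X - {y}) = insert w (insert x (X - {x, y}))"
  "insert w (X - {x}) = insert w (insert y (X - {x, y}))" "insert z (X - {y}) = insert z (insert x (X - {x, y}))"
  using X by blast+
 have "distinct [z, w, y, x]" "(X - {x, y}) \<inter> {z, w, y, x} = {}" using X by auto
 from quad_trivialD[OF q this] show ?thesis using B unfolding s by (simp add: mult.commute)
qed

lemma quad_trivial_pivot:
 assumes q: "quad_trivial \<B> u" and X: "x \<in> X" "y \<in> X" "x ~= y" "z ~: X" "w ~: X" "z ~= w"
  and B: "X \<in> \<B>" "insert z (X - {x}) \<in> \<B>" "insert w (X - {y}) \<in> \<B>" "insert w (insert z (X - {x}) - {y}) \<in> \<B>"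
 shows "u X * u (insert w (insert z (X - {x}) - {y})) = u (insert z (X - {x})) * u (insert w (X - {y}))"
proof -
 have s: "insert z (X - {x}) = insert z (insert y (X - {x, y}))" "insert w (X - {y}) = insert x (insert w (X - {x, y}))"
  "insert w (insert z (X - {x}) - {y}) = insert z (insert w (X - {x, y}))" "X = insert x (insert y (X - {x, y}))"
  using X by blast+
 have "distinct [x, z, y, w]" "(X - {x, y}) \<inter> {x, z, y, w} = {}" using X by auto
 from quad_trivialD[OF q this] show ?thesis using B s by (metis mult.commute)
qed

text \<open>The functions obtained from the constant 1 by rescaling the elements and by a global
  factor \<open>t\<close>.\<close>

definition torus_function :: "'k::field set => 'a set set => ('a set => 'k) => bool" where
 "torus_function G \<B> u \<longleftrightarrow> (\<exists>t\<in>G. \<exists>g. (\<forall>e. g e \<in> G) & (\<forall>B\<in>\<B>. u B = t * prod g B))"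

text \<open>After division by the product known on the deletion, \<open>u\<close> becomes 1 on the
  bases avoiding \<open>a\<close>. If it is then constant on the bases through \<open>a\<close>,
  this constant is the factor of \<open>a\<close>.\<close>

lemma torus_function_delete:
 fixes u :: "'a set => 'k::field"
 assumes M: "matroid E \<B>" and G: "unit_subgroup G" and uG: "\<And>B. B \<in> \<B> ==> u B \<in> G"
  and q: "quad_trivial \<B> u" and a: "a \<in> E" "\<exists>B\<in>\<B>. a ~: B"
  and C: "connected_matroid (E - {a}) {B \<in> \<B>. a ~: B}"
  and T: "torus_function G {B \<in> \<B>. a ~: B} u"
 shows "torus_function G \<B> u"
proof -
 let ?N = "{B \<in> \<B>. a ~: B}"
 have MN: "matroid (E - {a}) ?N" using matroid_delete[OF M a(2)] .
 obtain t g0 where t: "t \<in> G" "\<And>e. g0 e \<in> G" "\<And>B. B \<in> ?N ==> u B = t * prod g0 B"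
  using T unfolding torus_function_def by blast
 define g where "g = g0(a := 1)"
 have gG: "g e \<in> G" for e using t(2) unit_subgroupD(1)[OF G] unfolding g_def by simp
 have gu: "u B = t * prod g B" if "B \<in> ?N" for B
 proof -
  have "prod g0 B = prod g B" using that unfolding g_def by (intro prod.cong) auto
  then show ?thesis using t(3)[OF that] by simp
 qed
 define v where "v B = u B / (t * prod g B)" for B
 have nz: "t * prod g B ~= 0" for B
  using unit_subgroupD(2)[OF G unit_subgroupD(3)[OF G t(1) unit_subgroup_prod[OF G gG]]] .
 have v1: "v B = 1" if "B \<in> ?N" for B using gu[OF that] nz unfolding v_def by simp
 have qv: "quad_trivial \<B> v"
  unfolding quad_trivial_def
 proof (intro allI impI)
  fix J a b c d
  assume h: "distinct [a, b, c, d]" "J \<inter> {a, b, c, d} = {}"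
   "insert a (insert c J) \<in> \<B>" "insert b (insert d J) \<in> \<B>"
   "insert a (insert d J) \<in> \<B>" "insert b (insert c J) \<in> \<B>"
  have fJ: "finite J" using matroid_basis_finite[OF M h(3)] by simp
  have "prod g (insert x (insert y J)) = g x * (g y * prod g J)"
   if "x \<in> {a,b}" "y \<in> {c,d}" for x y
  proof -
   have "x ~: insert y J" "y ~: J" using h(1,2) that by auto
   then show ?thesis using fJ by simp
  qed
  then show "v (insert a (insert c J)) * v (insert b (insert d J)) = v (insert a (insert d J)) * v (insert b (insert c J))"
   using quad_trivialD[OF q h] unfolding v_def by (simp add: field_simps)
 qed
 \<comment> \<open>Compares the two bases through \<open>a\<close> that arise from a basis
   \<open>X\<close> of the deletion by exchanging \<open>c\<close> or \<open>d\<close>; this is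
   propagated along paths of the fundamental graph.\<close>
 define Q where "Q X c d \<longleftrightarrow> (insert a (X - {c}) \<in> \<B> \<longrightarrow> insert a (X - {d}) \<in> \<B> \<longrightarrow>
   v (insert a (X - {c})) = v (insert a (X - {d})))" for X c d
 have near: "Q X c d" if "X \<in> ?N" "c \<in> X" "d \<in> X" "c ~= d" "z ~: X"
   "insert z (X - {c}) \<in> ?N" "insert z (X - {d}) \<in> ?N" for X c d z
  unfolding Q_def
 proof (intro impI)
  assume h: "insert a (X - {c}) \<in> \<B>" "insert a (X - {d}) \<in> \<B>"
  have "a ~: X" "a ~= z" using that by auto
  then have "v (insert a (X - {c})) * v (insert z (X - {d})) = v (insert z (X - {c})) * v (insert a (X - {d}))"
   using that h by (intro quad_trivial_rect[OF qv]) auto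
  then show "v (insert a (X - {c})) = v (insert a (X - {d}))" using v1 that by simp
 qed
 \<comment> \<open>A pivot that does not alter the entry \<open>(c, a)\<close> does not alter the
   value either, because \<open>v\<close> is 1 at the old and at the new basis.\<close>
 have stay: "insert a (insert z (X - {x}) - {c}) \<in> \<B> & v (insert a (insert z (X - {x}) - {c})) = v (insert a (X - {c}))"
  if "X \<in> ?N" "c \<in> X" "x \<in> X" "x ~= c" "z ~: X" "insert z (X - {x}) \<in> ?N"
   "insert z (X - {c}) ~: ?N \<or> insert a (X - {x}) ~: \<B>" "insert a (X - {c}) \<in> \<B>" for X c x z
 proof
  have az: "a ~: X" "z ~= a" using that by auto
  have "insert z (X - {c}) ~: \<B> \<or> insert a (X - {x}) ~: \<B>" using that az by auto
  then show b: "insert a (insert z (X - {x}) - {c}) \<in> \<B>"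
   using that az by (intro pivot_basis[OF M that(3,2,4,5)]) auto
  have "v X * v (insert a (insert z (X - {x}) - {c})) = v (insert z (X - {x})) * v (insert a (X - {c}))"
   using that az b by (intro quad_trivial_pivot[OF qv]) auto
  then show "v (insert a (insert z (X - {x}) - {c})) = v (insert a (X - {c}))" using v1 that by simp
 qed
 have Qall: "Q X c d" if X: "X \<in> ?N" "c \<in> X" "d \<in> X" "c ~= d" for X c d
 proof (rule connected_path_induct[where Q = Q, OF MN C near _ _ X])
  fix X c d x z
  assume h: "X \<in> ?N" "c \<in> X" "d \<in> X" "x \<in> X" "c ~= d" "x ~= c" "x ~= d" "z ~: X"
   "insert z (X - {x}) \<in> ?N" "insert z (X - {c}) ~: ?N" "insert z (X - {d}) ~: ?N"
   "Q (insert z (X - {x})) c d"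
  show "Q X c d" unfolding Q_def
   using stay[OF h(1,2,4,6,8,9) disjI1[OF h(10)]] stay[OF h(1,3,4,7,8,9) disjI1[OF h(11)]] h(12)
   unfolding Q_def by metis
 next
  fix X c d x z z'
  assume h: "X \<in> ?N" "c \<in> X" "d \<in> X" "x \<in> X" "c ~= d" "x ~= c" "x ~= d" "z ~: X" "z' ~: X" "z ~= z'"
   "insert z (X - {c}) \<in> ?N" "insert z (X - {x}) \<in> ?N" "insert z (X - {d}) ~: ?N"
   "insert z' (X - {x}) \<in> ?N" "insert z' (X - {d}) \<in> ?N" "insert z' (X - {c}) ~: ?N"
  show "Q X c d"
  proof (cases "insert a (X - {x}) \<in> \<B>")
   case True
   have "Q X c x" using near[OF h(1,2,4) h(6)[symmetric] h(8,11,12)] .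
   moreover have "Q X x d" using near[OF h(1,4,3) h(7) h(9,14,15)] .
   ultimately show ?thesis using True unfolding Q_def by metis
  next
   \<comment> \<open>The column \<open>a\<close> vanishes at \<open>x\<close>, so the pivot on
     \<open>(x, z)\<close> is harmless for \<open>a\<close>, and after it \<open>c\<close> and
     \<open>d\<close> have the common neighbour \<open>z'\<close>.\<close>
   case False
   have "insert z' (insert z (X - {x}) - {c}) \<in> ?N"
    using pivot_basis_new[OF MN h(4,2,6,8,9,10,12,11,14,16)] .
   moreover have "insert z' (insert z (X - {x}) - {d}) \<in> ?N"
    using pivot_basis[OF MN h(4,3,7,8,9,10,12,15)] h(13) by blast
   ultimately have "Q (insert z (X - {x})) c d"
    using h by (intro near[where z = z']) auto
   then show ?thesis unfolding Q_def
    using stay[OF h(1,2,4,6,8,12) disjI2[OF False]] stay[OF h(1,3,4,7,8,12) disjI1[OF h(13)]] by metis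
  qed
 qed
 have one: "v (insert y (B - {x})) = v B"
  if B: "B \<in> \<B>" "a \<in> B" "x \<in> B" "x ~= a" "y ~: B" "insert y (B - {x}) \<in> \<B>" for B x y
 proof -
  define J where "J = B - {a, x}"
  have J: "a ~: J" "x ~: J" "y ~: J" "y ~= x" "y ~= a" using B unfolding J_def by auto
  have s: "B = insert a (insert x J)" "insert y (B - {x}) = insert a (insert y J)" using B J unfolding J_def by auto
  show ?thesis
  proof (cases "insert x (insert y J) \<in> \<B>")
   case True
   let ?X = "insert x (insert y J)"
   have "?X \<in> ?N" using True J B by auto
   then have "Q ?X x y" using J by (intro Qall) auto
   moreover have "?X - {x} = insert y J" "?X - {y} = insert x J" using J by auto
   ultimately show ?thesis using B s unfolding Q_def by simp
  next
   \<comment> \<open>Now \<open>x\<close> and \<open>y\<close> are parallel over \<open>J\<close>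
     and \<open>a\<close> is adjacent to neither alone. A basis avoiding \<open>a\<close> supplies
     \<open>b\<close> completing \<open>insert x J\<close>, and \<open>b\<close> completes
     \<open>insert y J\<close> as well; in the quadrangle of \<open>a, b\<close> against
     \<open>x, y\<close> the two bases with \<open>b\<close> have value 1.\<close>
   case False
   obtain B0 where B0: "B0 \<in> \<B>" "a ~: B0" using a by blast
   have "insert x J \<subseteq> B" using s by blast
   then obtain B' where B': "B' \<in> \<B>" "insert x J \<subseteq> B'" "B' \<subseteq> insert x J \<union> B0"
    using matroid_extend[OF M B(1) _ B0(1), of "insert x J"] by blast
   have aB': "a ~: B'" using B' B0 J B(4) by blast
   have fin: "finite B'" "finite J" using matroid_basis_finite[OF M] B' B J_def by auto
   have "card B' = Suc (Suc (card J))"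
    using matroid_basis_card[OF M B'(1) B(1)] s fin J B(4) by simp
   then have "card (B' - insert x J) = 1" using B' fin J by (simp add: card_Diff_subset)
   then obtain b where b: "B' - insert x J = {b}" by (meson card_1_singletonE)
   then have Bb: "B' = insert b (insert x J)" "b ~: J" "b ~= x" "b ~= a" using B' aB' by auto
   have "b ~= y" using False Bb B' by (metis insert_commute)
   have "insert b (insert y J) \<in> \<B>"
   proof -
    have "x \<in> insert b (insert x J) - insert a (insert y J)" using J B(4) by auto
    moreover have "insert b (insert x J) \<in> \<B>" "insert a (insert y J) \<in> \<B>" using Bb B' s B by auto
    ultimately obtain w where w: "w \<in> insert a (insert y J) - insert b (insert x J)"
     "insert w (insert b (insert x J) - {x}) \<in> \<B>"
     using matroid_exchange[OF M] by blast
    have e: "insert b (insert x J) - {x} = insert b J" using Bb J by auto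
    consider "w = y" | "w = a" using w by auto
    then show ?thesis
    proof cases
     case 1 then show ?thesis using w e by (simp add: insert_commute)
    next
     case 2
     have "a \<in> insert a (insert b J) - insert b (insert x J)" using J B(4) Bb by auto
     then have t1: "insert b (insert a J) \<in> \<B>" using w e 2 by (simp add: insert_commute)
     show ?thesis
     proof (rule ccontr)
      assume n: "insert b (insert y J) ~: \<B>"
      have "a \<in> insert a (insert y J) - insert b (insert x J)" using J B(4) Bb by auto
      moreover have "insert a (insert y J) \<in> \<B>" "insert b (insert x J) \<in> \<B>" using s B Bb B' by auto
      ultimately obtain w' where w': "w' \<in> insert b (insert x J) - insert a (insert y J)"
       "insert w' (insert a (insert y J) - {a}) \<in> \<B>" using matroid_exchange[OF M] by blast
      have "insert a (insert y J) - {a} = insert y J" using J by auto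
      then show False using w' n False by (auto simp: insert_commute)
     qed
    qed
   qed
   then have "v (insert a (insert x J)) * v (insert b (insert y J)) = v (insert a (insert y J)) * v (insert b (insert x J))"
    using J Bb B s B' \<open>b ~= y\<close> by (intro quad_trivialD[OF qv]) auto
   moreover have "insert b (insert y J) \<in> ?N" "insert b (insert x J) \<in> ?N"
    using \<open>insert b (insert y J) \<in> \<B>\<close> B' Bb J aB' by auto
   ultimately show ?thesis using v1 s by simp
  qed
 qed
 have const: "v B = v B'" if BB: "B \<in> \<B>" "a \<in> B" "B' \<in> \<B>" "a \<in> B'" for B B'
  using BB(1,2)
 proof (induction "card (B - B')" arbitrary: B)
  case 0
  then have "B \<subseteq> B'" using matroid_basis_finite[OF M] by auto
  then have "B = B'" using card_subset_eq matroid_basis_card[OF M 0(2) BB(3)] matroid_basis_finite[OF M BB(3)] by metis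
  then show ?case by simp
 next
  case (Suc n)
  then obtain x where x: "x \<in> B - B'" by (metis card.empty ex_in_conv nat.distinct(1))
  then obtain y where y: "y \<in> B' - B" "insert y (B - {x}) \<in> \<B>"
   using matroid_exchange[OF M Suc.prems(1) BB(3)] by blast
  have xa: "x ~= a" using x BB by blast
  have "insert y (B - {x}) - B' = (B - B') - {x}" using y by blast
  then have "card (insert y (B - {x}) - B') = n"
   using Suc.hyps(2) x matroid_basis_finite[OF M Suc.prems(1)] by simp
  then have "v (insert y (B - {x})) = v B'" using Suc.hyps(1) y Suc.prems(2) xa by auto
  then show ?case using one[OF Suc.prems, of x y] x xa y by auto
 qed
 have vG: "v B \<in> G" if "B \<in> \<B>" for B
  unfolding v_def
  using unit_subgroupD(5)[OF G uG[OF that] unit_subgroupD(3)[OF G t(1) unit_subgroup_prod[OF G gG]]] .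
 obtain \<kappa> where \<kappa>: "\<kappa> \<in> G" "\<And>B. B \<in> \<B> ==> a \<in> B ==> v B = \<kappa>"
 proof (cases "\<exists>B\<in>\<B>. a \<in> B")
  case True
  then obtain B where "B \<in> \<B>" "a \<in> B" by blast
  then show ?thesis using that[of "v B"] const vG by blast
 next
  case False
  then show ?thesis using that[of 1] unit_subgroupD(1)[OF G] by blast
 qed
 have "u B = t * prod (g(a := \<kappa>)) B" if B: "B \<in> \<B>" for B
 proof (cases "a \<in> B")
  case False
  then have "prod (g(a := \<kappa>)) B = prod g B" by (intro prod.cong) auto
  then show ?thesis using gu False B by simp
 next
  case True
  have fin: "finite B" using matroid_basis_finite[OF M B] .
  have "prod (g(a := \<kappa>)) B = \<kappa> * prod (g(a := \<kappa>)) (B - {a})" using prod.remove[OF fin True, of "g(a := \<kappa>)"] by simp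
  also have "prod (g(a := \<kappa>)) (B - {a}) = prod g (B - {a})" by (intro prod.cong) auto
  also have "prod g (B - {a}) = prod g B" using prod.remove[OF fin True, of g] by (simp add: g_def)
  finally have e: "prod (g(a := \<kappa>)) B = \<kappa> * prod g B" .
  have "u B = v B * (t * prod g B)" using nz[of B] unfolding v_def by simp
  then show ?thesis using e \<kappa>(2)[OF B True] by simp
 qed
 moreover have "(g(a := \<kappa>)) e \<in> G" for e using gG \<kappa>(1) by simp
 ultimately show ?thesis unfolding torus_function_def using t(1) by blast
qed

lemma quad_trivial_dual:
 assumes M: "matroid E \<B>" and q: "quad_trivial \<B> u"
 shows "quad_trivial ((-) E ` \<B>) (\<lambda>B. u (E - B))"
 unfolding quad_trivial_def
proof (intro allI impI)
 fix J a b c d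
 assume h: "distinct [a, b, c, d]" "J \<inter> {a, b, c, d} = {}"
  "insert a (insert c J) \<in> (-) E ` \<B>" "insert b (insert d J) \<in> (-) E ` \<B>"
  "insert a (insert d J) \<in> (-) E ` \<B>" "insert b (insert c J) \<in> (-) E ` \<B>"
 define K where "K = E - J - {a, b, c, d}"
 have sub: "J \<subseteq> E" "a \<in> E" "b \<in> E" "c \<in> E" "d \<in> E" using h by auto
 have s: "E - insert a (insert c J) = insert b (insert d K)" "E - insert b (insert d J) = insert a (insert c K)"
   "E - insert a (insert d J) = insert b (insert c K)" "E - insert b (insert c J) = insert a (insert d K)"
  using sub h(1,2) unfolding K_def by auto
 have "E - C \<in> \<B>" if "C \<in> (-) E ` \<B>" for C
  using that matroid_basis_subset[OF M] by (auto simp: double_diff)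
 then have "u (insert a (insert c K)) * u (insert b (insert d K)) = u (insert a (insert d K)) * u (insert b (insert c K))"
  using h(1,3-6) s by (intro quad_trivialD[OF q]) (metis | simp add: K_def; blast)+
 then show "u (E - insert a (insert c J)) * u (E - insert b (insert d J)) =
   u (E - insert a (insert d J)) * u (E - insert b (insert c J))"
  unfolding s by (simp add: mult.commute)
qed

text \<open>A product over a complement is the product over \<open>E\<close> divided by the product
  over the set.\<close>

lemma torus_function_dual:
 fixes u :: "'a set => 'k::field"
 assumes M: "matroid E \<B>" and G: "unit_subgroup G"
  and T: "torus_function G ((-) E ` \<B>) (\<lambda>B. u (E - B))"
 shows "torus_function G \<B> u"
proof -
 obtain t g where tg: "t \<in> G" "(\<forall>e. g e \<in> G) & (\<forall>B\<in>(-) E ` \<B>. u (E - B) = t * prod g B)"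
  using T unfolding torus_function_def by (elim bexE exE) (rule that)
 note t = tg(1) spec[OF conjunct1[OF tg(2)]] conjunct2[OF tg(2)]
 have "u B = (t * prod g E) * prod (\<lambda>e. inverse (g e)) B" if B: "B \<in> \<B>" for B
 proof -
  have sub: "B \<subseteq> E" using matroid_basis_subset[OF M B] .
  have nz: "prod g B ~= 0" using unit_subgroupD(2)[OF G unit_subgroup_prod[OF G t(2)]] .
  have "u B = t * prod g (E - B)" using bspec[OF t(3), of "E - B"] B sub by (simp add: double_diff)
  moreover have "prod g E = prod g (E - B) * prod g B"
   using prod.subset_diff[OF sub matroid_finite[OF M]] .
  ultimately show ?thesis using nz prod_inversef[of g B, unfolded o_def] by simp
 qed
 moreover have "t * prod g E \<in> G" "inverse (g e) \<in> G" for e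
  using unit_subgroupD(3)[OF G t(1) unit_subgroup_prod[OF G t(2)]] unit_subgroupD(4)[OF G t(2)] by auto
 ultimately show ?thesis unfolding torus_function_def
  by (intro bexI[of _ "t * prod g E"] exI[of _ "\<lambda>e. inverse (g e)"]) simp_all
qed

text \<open>Some single-element deletion or contraction stays connected. Contraction is deletion in
  the dual, where triviality on quadrangles is the same condition.\<close>

lemma quad_trivial_imp_torus:
 fixes u :: "'a set => 'k::field"
 assumes "matroid E \<B>" "connected_matroid E \<B>" "unit_subgroup G" "\<And>B. B \<in> \<B> ==> u B \<in> G" "quad_trivial \<B> u"
 shows "torus_function G \<B> u"
 using assms
proof (induction "card E" arbitrary: E \<B> u rule: less_induct)
 case less
 note M = less.prems(1) and C = less.prems(2) and G = less.prems(3) and uG = less.prems(4) and q = less.prems(5)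
 show ?case
 proof (cases "\<exists>B. \<B> = {B}")
  case True
  then obtain B where "\<B> = {B}" by blast
  then show ?thesis unfolding torus_function_def using uG unit_subgroupD(1)[OF G]
   by (intro bexI[of _ "u B"] exI[of _ "\<lambda>_. 1"]) auto
 next
  case False
  then obtain B1 B2 where B: "B1 \<in> \<B>" "B2 \<in> \<B>" "B1 ~= B2" using matroid_nonempty[OF M] by blast
  then have "B1 - B2 ~= {}"
   using card_subset_eq matroid_basis_card[OF M B(1,2)] matroid_basis_finite[OF M B(2)] by blast
  then obtain e where e: "e \<in> E" "\<exists>B\<in>\<B>. e ~: B" "\<exists>B\<in>\<B>. e \<in> B"
   using B matroid_basis_subset[OF M B(1)] by blast
  have lt: "card (E - {e}) < card E" using e(1) matroid_finite[OF M] by (meson card_Diff1_less)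
  have del: "torus_function G \<B>' u'" if M': "matroid E \<B>'" and uG': "\<And>B. B \<in> \<B>' ==> u' B \<in> G" and q': "quad_trivial \<B>' u'"
   and e': "\<exists>B\<in>\<B>'. e ~: B" and C': "connected_matroid (E - {e}) {B \<in> \<B>'. e ~: B}" for \<B>' u'
  proof -
   have "quad_trivial {B \<in> \<B>'. e ~: B} u'" using q' unfolding quad_trivial_def by blast
   then have "torus_function G {B \<in> \<B>'. e ~: B} u'"
    using less.hyps[OF lt matroid_delete[OF M' e'] C' G] uG' by blast
   then show ?thesis using torus_function_delete[OF M' G uG' q' e(1) e' C'] by blast
  qed
  from connected_delete_or_contract[OF M C e] show ?thesis
  proof
   assume "connected_matroid (E - {e}) {B \<in> \<B>. e ~: B}"
   then show ?thesis using del[OF M uG q e(2)] by blast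
  next
   assume "connected_matroid (E - {e}) {B \<in> \<B>. e \<in> B}"
   then have "connected_matroid (E - {e}) {C \<in> (-) E ` \<B>. e ~: C}" using connected_dual_delete[OF M e(1)] by blast
   moreover have "u (E - C) \<in> G" if "C \<in> (-) E ` \<B>" for C
    using that uG matroid_basis_subset[OF M] by (auto simp: double_diff)
   moreover have "\<exists>B\<in>(-) E ` \<B>. e ~: B" using e by blast
   ultimately have "torus_function G ((-) E ` \<B>) (\<lambda>B. u (E - B))"
    using del[OF matroid_dual[OF M] _ quad_trivial_dual[OF M q]] by blast
   then show ?thesis using torus_function_dual[OF M G] by blast
  qed
 qed
qed

section \<open>Lifting null triples\<close>

definition alt2 :: "('a => 'a => 'f::field) => bool" where
 "alt2 F \<longleftrightarrow> (\<forall>x y. F y x = - F x y) & (\<forall>x. F x x = 0)"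

definition alt3 :: "('a => 'a => 'a => 'f::field) => bool" where
 "alt3 T \<longleftrightarrow> (\<forall>x y z. T y x z = - T x y z) & (\<forall>x y z. T x z y = - T x y z) & (\<forall>x z. T x x z = 0)"

text \<open>The three-term Grassmann-Pluecker relation over a field.\<close>

definition K3 :: "('a => 'a => 'f::field) => 'a => 'a => 'a => 'a => bool" where
 "K3 F a b c d \<longleftrightarrow> F a b * F c d - F a c * F b d + F a d * F b c = 0"

lemma three_term_zero:
 fixes x y z :: "'f::field" assumes "x - y + z = 0"
 shows "x = 0 ==> y = z" "y = 0 ==> x = - z" "z = 0 ==> x = y"
 using assms by (auto simp: eq_neg_iff_add_eq_0 diff_eq_eq)

lemma alt2_flip: "alt2 F ==> F y x = - F x y" unfolding alt2_def by blast

lemma alt3_perms: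
 assumes "alt3 T"
 shows "T y x z = - T x y z" "T x z y = - T x y z" "T y z x = T x y z" "T z x y = T x y z" "T z y x = - T x y z"
proof -
 show s: "T y x z = - T x y z" "T x z y = - T x y z" for x y z using assms unfolding alt3_def by blast+
 have "T y z x = - T y x z" by (rule s)
 also have "\<dots> = T x y z" using s(1)[of x y z] by simp
 finally show c: "T y z x = T x y z" .
 have "T z x y = - T x z y" by (rule s)
 also have "\<dots> = T x y z" using s(2)[of x y z] by simp
 finally show "T z x y = T x y z" .
 have "T z y x = - T y z x" by (rule s)
 then show "T z y x = - T x y z" using c by simp
qed

lemma alt3_zero:
 assumes "alt3 T"
 shows "T y x z = 0 \<longleftrightarrow> T x y z = 0" "T x z y = 0 \<longleftrightarrow> T x y z = 0"
 by (metis alt3_perms(1)[OF assms] neg_equal_0_iff_equal) (metis alt3_perms(2)[OF assms] neg_equal_0_iff_equal)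

lemma alt3_alt2: "alt3 T ==> alt2 (T x)"
 unfolding alt2_def
proof (intro conjI allI)
 assume a: "alt3 T"
 show "T x z y = - T x y z" for y z by (rule alt3_perms(2)[OF a])
 have "T y y x = 0" for y using a unfolding alt3_def by blast
 then show "T x y y = 0" for y using alt3_perms(3)[OF a, of y y x] alt3_perms(4)[OF a, of x y y] by simp
qed

text \<open>The source pasture sits multiplicatively in the field \<open>'p\<close>, whose addition
  decides which triples with a zero entry are null; for nonzero entries nullity is expressed by the
  existence of an \<open>L\<close>-lift. \<open>L_unique\<close> is the rigidity behind every
  comparison of lifts, \<open>L_ratio\<close> keeps the constructed values in
  \<open>\<Gamma>\<close>, and \<open>two\<close> excludes the Fano plane.\<close>

locale lifting =
 fixes L :: "'p::field => 'p => 'p => 'k::field => 'k => 'k => bool" and \<Gamma> :: "'k set"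
 assumes two: "(2::'p) ~= 0"
  and subgroup: "unit_subgroup \<Gamma>" and neg_one: "- 1 \<in> \<Gamma>"
  and L_nz: "L x y z x' y' z' ==> x ~= 0 & y ~= 0 & z ~= 0 & x' ~= 0 & y' ~= 0 & z' ~= 0"
  and L_sum: "L x y z x' y' z' ==> x' + y' + z' = 0"
  and L_rot: "L x y z x' y' z' ==> L y z x y' z' x'"
  and L_swap: "L x y z x' y' z' ==> L y x z y' x' z'"
  and L_scale: "L x y z x' y' z' ==> c ~= 0 ==> c' ~= 0 ==> L (c * x) (c * y) (c * z) (c' * x') (c' * y') (c' * z')"
  and L_unique: "L x y z x' y' z' ==> L x y z x'' y'' z'' ==> \<exists>c. c ~= 0 & x'' = c * x' & y'' = c * y' & z'' = c * z'"
  and L_ratio: "L x y z x' y' z' ==> x' / y' \<in> \<Gamma>"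
begin

text \<open>Completes \<open>L\<close> by the triples with a zero entry and requires the same zero
  pattern on both sides.\<close>

definition RL :: "'p => 'p => 'p => 'k => 'k => 'k => bool" where
 "RL x y z x' y' z' \<longleftrightarrow> (x = 0 \<longleftrightarrow> x' = 0) & (y = 0 \<longleftrightarrow> y' = 0) & (z = 0 \<longleftrightarrow> z' = 0) & x' + y' + z' = 0 &
   (L x y z x' y' z' \<or> (x = 0 \<or> y = 0 \<or> z = 0) & x + y + z = 0)"

lemma RL_rot: "RL x y z x' y' z' ==> RL y z x y' z' x'"
 unfolding RL_def using L_rot[of x y z x' y' z'] by (auto simp: algebra_simps)

lemma RL_swap: "RL x y z x' y' z' ==> RL y x z y' x' z'"
 unfolding RL_def using L_swap[of x y z x' y' z'] by (auto simp: algebra_simps)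

lemma RL_swap23: assumes "RL x y z x' y' z'" shows "RL x z y x' z' y'"
 using RL_rot[OF RL_swap[OF assms]] .

lemma RL_scale:
 assumes "RL x y z x' y' z'" "c ~= 0" "c' ~= 0"
 shows "RL (c * x) (c * y) (c * z) (c' * x') (c' * y') (c' * z')"
proof -
 have "c' * x' + c' * y' + c' * z' = c' * (x' + y' + z')" "c * x + c * y + c * z = c * (x + y + z)"
  by (simp_all add: algebra_simps)
 then show ?thesis using assms L_scale[of x y z x' y' z' c c'] unfolding RL_def by auto
qed

lemma RL_unique:
 assumes "RL x y z x' y' z'" "RL x y z x'' y'' z''"
 shows "\<exists>c. c ~= 0 & x'' = c * x' & y'' = c * y' & z'' = c * z'"
proof (cases "x = 0 \<or> y = 0 \<or> z = 0")
 case False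
 then have "L x y z x' y' z'" "L x y z x'' y'' z''" using assms unfolding RL_def by auto
 then show ?thesis by (rule L_unique)
next
 case True
 note h = assms[unfolded RL_def]
 have nL: "\<not> L x y z x' y' z'" using True L_nz[of x y z x' y' z'] by blast
 then have sum: "x + y + z = 0" using h by blast
 consider "x = 0" "y = 0" "z = 0" | "x = 0" "y ~= 0" "z ~= 0" | "y = 0" "x ~= 0" "z ~= 0" | "z = 0" "x ~= 0" "y ~= 0"
  using True sum by fastforce
 then show ?thesis
 proof cases
  case 1 then show ?thesis using h by (intro exI[of _ 1]) auto
 next
  case 2
  then have "x' = 0" "x'' = 0" "y' ~= 0" "y'' ~= 0" "z' = - y'" "z'' = - y''" using h by (auto simp: eq_neg_iff_add_eq_0 add.commute)
  then show ?thesis by (intro exI[of _ "y'' / y'"]) auto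
 next
  case 3
  then have "y' = 0" "y'' = 0" "x' ~= 0" "x'' ~= 0" "z' = - x'" "z'' = - x''" using h by (auto simp: eq_neg_iff_add_eq_0 add.commute)
  then show ?thesis by (intro exI[of _ "x'' / x'"]) auto
 next
  case 4
  then have "z' = 0" "z'' = 0" "x' ~= 0" "x'' ~= 0" "y' = - x'" "y'' = - x''" using h by (auto simp: eq_neg_iff_add_eq_0 add.commute)
  then show ?thesis by (intro exI[of _ "x'' / x'"]) auto
 qed
qed

text \<open>Exchanging the equal entries produces a second lift. It is a multiple of the first, and
  the nonzero first entry shows that the factor is 1.\<close>

lemma RL_harmonic:
 assumes "RL x y y x' y' z'" "x ~= 0"
 shows "y' = z'"
proof -
 have "RL x y y x' z' y'" using RL_swap23[OF assms(1)] .
 then obtain c where "c ~= 0" "x' = c * x'" "z' = c * y'" using RL_unique[OF assms(1)] by blast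
 moreover have "x' ~= 0" using assms unfolding RL_def by blast
 ultimately show ?thesis by simp
qed

text \<open>The three-term relation of the source; having a lift stands in for membership in the
  null set.\<close>

definition N3 :: "('a => 'a => 'p) => 'a => 'a => 'a => 'a => bool" where
 "N3 F a b c d \<longleftrightarrow> (\<exists>x' y' z'. RL (F a b * F c d) (- (F a c * F b d)) (F a d * F b c) x' y' z')"

definition RLF :: "('a => 'a => 'p) => ('a => 'a => 'k) => 'a => 'a => 'a => 'a => bool" where
 "RLF F F' a b c d \<longleftrightarrow> RL (F a b * F c d) (- (F a c * F b d)) (F a d * F b c)
   (F' a b * F' c d) (- (F' a c * F' b d)) (F' a d * F' b c)"

lemma RLF_N3: "RLF F F' a b c d ==> N3 F a b c d"
 unfolding RLF_def N3_def by blast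

lemma RLF_K3: "RLF F F' a b c d ==> K3 F' a b c d"
 unfolding RLF_def RL_def K3_def by simp

lemma RL_neg: "RL x y z x' y' z' ==> RL (- x) (- y) (- z) (- x') (- y') (- z')"
 using RL_scale[of x y z x' y' z' "- 1" "- 1"] by simp

lemma RLF_swap12:
 assumes "alt2 F" "alt2 F'" "RLF F F' a b c d" shows "RLF F F' b a c d"
 using RL_swap23[OF RL_neg[OF assms(3)[unfolded RLF_def]]]
 unfolding RLF_def alt2_flip[OF assms(1), of b a] alt2_flip[OF assms(2), of b a] by (simp add: mult.commute)

lemma RLF_swap34:
 assumes "alt2 F" "alt2 F'" "RLF F F' a b c d" shows "RLF F F' a b d c"
 using RL_swap23[OF RL_neg[OF assms(3)[unfolded RLF_def]]]
 unfolding RLF_def alt2_flip[OF assms(1), of d c] alt2_flip[OF assms(2), of d c] by (simp add: mult.commute)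

lemma RLF_swap23:
 assumes "alt2 F" "alt2 F'" "RLF F F' a b c d" shows "RLF F F' a c b d"
 using RL_swap[OF RL_neg[OF assms(3)[unfolded RLF_def]]]
 unfolding RLF_def alt2_flip[OF assms(1), of c b] alt2_flip[OF assms(2), of c b] by (simp add: mult.commute)

lemma N3_zero:
 assumes "N3 F a b c d"
 shows "F a b * F c d = 0 ==> F a c * F b d = F a d * F b c"
  "F a c * F b d = 0 ==> F a b * F c d = - (F a d * F b c)"
  "F a d * F b c = 0 ==> F a b * F c d = F a c * F b d"
proof -
 obtain x' y' z' where r: "RL (F a b * F c d) (- (F a c * F b d)) (F a d * F b c) x' y' z'" using assms unfolding N3_def by blast
 have s: "F a b * F c d - F a c * F b d + F a d * F b c = 0"
  if "F a b * F c d = 0 \<or> F a c * F b d = 0 \<or> F a d * F b c = 0"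
  using r L_nz[of "F a b * F c d" "- (F a c * F b d)" "F a d * F b c" x' y' z'] that unfolding RL_def by auto
 show "F a b * F c d = 0 ==> F a c * F b d = F a d * F b c" using s three_term_zero(1) by blast
 show "F a c * F b d = 0 ==> F a b * F c d = - (F a d * F b c)" using s three_term_zero(2) by blast
 show "F a d * F b c = 0 ==> F a b * F c d = F a c * F b d" using s three_term_zero(3) by blast
qed

lemma K3_zero:
 assumes "K3 F a b c d"
 shows "F a b * F c d = 0 ==> F a c * F b d = F a d * F b c"
  "F a c * F b d = 0 ==> F a b * F c d = - (F a d * F b c)"
  "F a d * F b c = 0 ==> F a b * F c d = F a c * F b d"
 using three_term_zero[OF assms[unfolded K3_def]] by blast+

lemma RLF_degI:
 assumes N: "N3 F a b c d" and K: "K3 F' a b c d"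
  and S: "F a b * F c d = 0 \<longleftrightarrow> F' a b * F' c d = 0" "F a c * F b d = 0 \<longleftrightarrow> F' a c * F' b d = 0"
   "F a d * F b c = 0 \<longleftrightarrow> F' a d * F' b c = 0"
  and Z: "F a b * F c d = 0 \<or> F a c * F b d = 0 \<or> F a d * F b c = 0"
 shows "RLF F F' a b c d"
proof -
 have "F a b * F c d + - (F a c * F b d) + F a d * F b c = 0"
  using Z N3_zero[OF N] by auto
 moreover have "F' a b * F' c d + - (F' a c * F' b d) + F' a d * F' b c = 0" using K unfolding K3_def by simp
 ultimately show ?thesis unfolding RLF_def RL_def using S Z by simp
qed

text \<open>The supports of the first products are not compared in advance, because
  \<open>F' a b\<close> will be a value under construction. Once another product vanishes, the
  relation is binomial and determines this support.\<close>

lemma RLF_trivial: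
 assumes N: "N3 F a b c d" and K: "K3 F' a b c d"
  and S: "F a c * F b d = 0 \<longleftrightarrow> F' a c * F' b d = 0" "F a d * F b c = 0 \<longleftrightarrow> F' a d * F' b c = 0"
  and Z: "F a c * F b d = 0 \<or> F a d * F b c = 0"
 shows "RLF F F' a b c d"
proof (rule RLF_degI[OF N K _ S])
 show "F a b * F c d = 0 \<or> F a c * F b d = 0 \<or> F a d * F b c = 0" using Z by blast
 show "F a b * F c d = 0 \<longleftrightarrow> F' a b * F' c d = 0"
  using Z
 proof
  assume z: "F a c * F b d = 0"
  then have z': "F' a c * F' b d = 0" using S by blast
  show ?thesis using N3_zero(2)[OF N z] K3_zero(2)[OF K z'] S(2) by (metis neg_equal_0_iff_equal)
 next
  assume z: "F a d * F b c = 0"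
  then have z': "F' a d * F' b c = 0" using S by blast
  show ?thesis using N3_zero(3)[OF N z] K3_zero(3)[OF K z'] S(1) by metis
 qed
qed

lemma RLF_parallelI:
 assumes R: "RLF F F' f b c d" and k: "k ~= 0" "k' ~= 0"
  and e: "F e b = k * F f b" "F e c = k * F f c" "F e d = k * F f d"
  and e': "F' e b = k' * F' f b" "F' e c = k' * F' f c" "F' e d = k' * F' f d"
 shows "RLF F F' e b c d"
 using RL_scale[OF R[unfolded RLF_def] k] unfolding RLF_def e e' by (simp add: mult.assoc)

lemma parallel_ratio:
 assumes "N3 F e f b c" "F e f = 0" "F e b ~= 0" "F f b ~= 0"
 shows "F e c = F e b / F f b * F f c"
 using N3_zero(1)[OF assms(1)] assms(2-4) by (simp add: field_simps)

lemma parallel_ratio_K: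
 assumes "K3 F e f b c" "F e f = 0" "F e b ~= 0" "F f b ~= 0"
 shows "F e c = F e b / F f b * F f c"
 using K3_zero(1)[OF assms(1)] assms(2-4) by (simp add: field_simps)

text \<open>Parallel \<open>e\<close> and \<open>f\<close> have proportional rows on both sides, so
  the relation for \<open>f\<close> is rescaled to one for \<open>e\<close>.\<close>

lemma RLF_parallel:
 assumes R: "RLF F F' f b c d"
  and N: "N3 F e f b c" "N3 F e f b d" and K: "K3 F' e f b c" "K3 F' e f b d"
  and z: "F e f = 0" "F' e f = 0" and nz: "F e b ~= 0" "F f b ~= 0" "F' e b ~= 0" "F' f b ~= 0"
 shows "RLF F F' e b c d"
 using parallel_ratio[OF N(1) z(1) nz(1,2)] parallel_ratio[OF N(2) z(1) nz(1,2)]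
  parallel_ratio_K[OF K(1) z(2) nz(3,4)] parallel_ratio_K[OF K(2) z(2) nz(3,4)] nz
 by (intro RLF_parallelI[OF R, where k = "F e b / F f b" and k' = "F' e b / F' f b"]) auto

text \<open>If \<open>e\<close> and \<open>f\<close> are parallel on the source side, uniqueness of lifts makes them parallel on the target side.\<close>

lemma parallel_unique:
 assumes R: "RLF F F' e w q r" "RLF F F' f w q r"
  and N: "N3 F e f q r" "N3 F e f q w" and K: "K3 F' e f q r"
  and z: "F e f = 0" and nz: "F e q ~= 0" "F f q ~= 0" "F' w q ~= 0" "F' w r ~= 0" "F' q r ~= 0"
 shows "F' e f = 0"
proof -
 define k where "k = F e q / F f q"
 have k: "k ~= 0" using nz unfolding k_def by simp
 have e: "F e q = k * F f q" "F e r = k * F f r" "F e w = k * F f w"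
  using parallel_ratio[OF N(1) z nz(1,2)] parallel_ratio[OF N(2) z nz(1,2)] nz unfolding k_def by auto
 have "RL (k * (F f w * F q r)) (k * (- (F f q * F w r))) (k * (F f r * F w q))
   (F' e w * F' q r) (- (F' e q * F' w r)) (F' e r * F' w q)"
  using R(1) unfolding RLF_def e by (simp add: mult.assoc)
 moreover have "RL (k * (F f w * F q r)) (k * (- (F f q * F w r))) (k * (F f r * F w q))
   (1 * (F' f w * F' q r)) (1 * (- (F' f q * F' w r))) (1 * (F' f r * F' w q))"
  using RL_scale[OF R(2)[unfolded RLF_def] k, of 1] by simp
 ultimately obtain c where c: "c ~= 0" "- (F' f q * F' w r) = c * (- (F' e q * F' w r))" "F' f r * F' w q = c * (F' e r * F' w q)"
  using RL_unique by (metis mult_1)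
 then have "F' f q = c * F' e q" "F' f r = c * F' e r" using nz by auto
 then have "F' e q * F' f r = F' e r * F' f q" by simp
 then show ?thesis using K nz unfolding K3_def by simp
qed

text \<open>Rank two; \<open>U\<close> expresses that \<open>a, b, q, r, w0\<close> are not five
  pairwise independent elements. As \<open>q, r, w0\<close> are independent in pairs, a vanishing
  pair involves \<open>a\<close> or \<open>b\<close>: it makes the relation degenerate, or
  \<open>a\<close> and \<open>b\<close> are parallel and uniqueness carries this over, or one of
  them is parallel to \<open>w0\<close> and a known relation is copied.\<close>

lemma common_neighbour:
 assumes alt: "alt2 F" "alt2 F'"
  and N: "\<And>x y z w. {x, y, z, w} \<subseteq> {a, b, q, r, w0} ==> N3 F x y z w"
  and K: "\<And>x y z w. {x, y, z, w} \<subseteq> {a, b, q, r, w0} ==> K3 F' x y z w"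
  and S: "\<And>x y. {x, y} \<subseteq> {a, b, q, r, w0} ==> \<not> {a, b} \<subseteq> {x, y} ==> F x y = 0 \<longleftrightarrow> F' x y = 0"
  and ab: "a ~= b" "a ~: {q, r, w0}" "b ~: {q, r, w0}"
  and R: "RLF F F' a w0 q r" "RLF F F' b w0 q r"
  and nz: "F q r ~= 0" "F w0 q ~= 0" "F w0 r ~= 0"
  and U: "F a b = 0 \<or> F a q = 0 \<or> F a r = 0 \<or> F a w0 = 0 \<or> F b q = 0 \<or> F b r = 0 \<or> F b w0 = 0"
 shows "RLF F F' a b q r"
proof (cases "F a q = 0 \<or> F a r = 0 \<or> F b q = 0 \<or> F b r = 0")
 case True
 have s: "F a q = 0 \<longleftrightarrow> F' a q = 0" "F a r = 0 \<longleftrightarrow> F' a r = 0" "F b q = 0 \<longleftrightarrow> F' b q = 0" "F b r = 0 \<longleftrightarrow> F' b r = 0"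
  using ab by (auto intro!: S)
 have N4: "N3 F a b q r" "K3 F' a b q r" by (auto intro!: N K)
 show ?thesis by (rule RLF_trivial[OF N4]) (use s True in auto)
next
 case False
 have s: "F a q = 0 \<longleftrightarrow> F' a q = 0" "F a r = 0 \<longleftrightarrow> F' a r = 0" "F b q = 0 \<longleftrightarrow> F' b q = 0" "F b r = 0 \<longleftrightarrow> F' b r = 0"
  "F q r = 0 \<longleftrightarrow> F' q r = 0" "F w0 q = 0 \<longleftrightarrow> F' w0 q = 0" "F w0 r = 0 \<longleftrightarrow> F' w0 r = 0"
  "F a w0 = 0 \<longleftrightarrow> F' a w0 = 0" "F b w0 = 0 \<longleftrightarrow> F' b w0 = 0"
  using ab by (auto intro!: S)
 consider (ab) "F a b = 0" | (aw) "F a w0 = 0" | (bw) "F b w0 = 0" using U False by blast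
 then show ?thesis
 proof cases
  case ab
  have "F' a b = 0"
   by (rule parallel_unique[OF R N N K ab]) (use False s nz in auto)
  then show ?thesis using ab s False by (intro RLF_degI N K) auto
 next
  case aw
  have Q: "RLF F F' w0 q r b" using RLF_swap34[OF alt RLF_swap23[OF alt RLF_swap12[OF alt R(2)]]] .
  have "RLF F F' a q r b"
   by (rule RLF_parallel[OF Q N N K K aw]) (use False s nz aw in auto)
  then show ?thesis using RLF_swap23[OF alt RLF_swap34[OF alt]] by blast
 next
  case bw
  have Q: "RLF F F' w0 q r a" using RLF_swap34[OF alt RLF_swap23[OF alt RLF_swap12[OF alt R(1)]]] .
  have "RLF F F' b q r a"
   by (rule RLF_parallel[OF Q N N K K bw]) (use False s nz bw in auto)
  then show ?thesis using RLF_swap12[OF alt RLF_swap23[OF alt RLF_swap34[OF alt]]] by blast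
 qed
qed

end

section \<open>Rank three configurations\<close>

lemma neg_cancel:
 fixes x a b c :: "'f::field"
 assumes "- (x * a) = c * (x * b)" "x ~= 0" shows "a = - (c * b)"
proof -
 have "x * (a + c * b) = 0" using assms(1) by (simp add: distrib_left mult.left_commute neg_eq_iff_add_eq_0)
 then show ?thesis using assms(2) by (simp add: eq_neg_iff_add_eq_0)
qed

text \<open>A point configuration of rank three: \<open>T x y z\<close> vanishes on collinear
  triples, and \<open>T x\<close> is the bracket of the pencil at \<open>x\<close>. The excluded
  minors appear as \<open>noU25\<close> in the pencils and as \<open>noU35\<close> in the plane
  itself.\<close>

locale plane = lifting L \<Gamma> for L :: "'p::field => 'p => 'p => 'k::field => 'k => 'k => bool" and \<Gamma> +
 fixes T :: "'a => 'a => 'a => 'p" and T' :: "'a => 'a => 'a => 'k" and P :: "'a set"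
 assumes altT: "alt3 T" and altT': "alt3 T'"
  and N: "x \<in> P ==> p \<in> P ==> q \<in> P ==> r \<in> P ==> s \<in> P ==> N3 (T x) p q r s"
  and K: "x \<in> P ==> p \<in> P ==> q \<in> P ==> r \<in> P ==> s \<in> P ==> K3 (T' x) p q r s"
  and noU25: "x \<in> P ==> p1 \<in> P ==> p2 \<in> P ==> p3 \<in> P ==> p4 \<in> P ==> p5 \<in> P ==>
   T x p1 p2 = 0 \<or> T x p1 p3 = 0 \<or> T x p1 p4 = 0 \<or> T x p1 p5 = 0 \<or> T x p2 p3 = 0 \<or>
   T x p2 p4 = 0 \<or> T x p2 p5 = 0 \<or> T x p3 p4 = 0 \<or> T x p3 p5 = 0 \<or> T x p4 p5 = 0"
  and noU35: "p1 \<in> P ==> p2 \<in> P ==> p3 \<in> P ==> p4 \<in> P ==> p5 \<in> P ==>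
   T p1 p2 p3 = 0 \<or> T p1 p2 p4 = 0 \<or> T p1 p2 p5 = 0 \<or> T p1 p3 p4 = 0 \<or> T p1 p3 p5 = 0 \<or>
   T p1 p4 p5 = 0 \<or> T p2 p3 p4 = 0 \<or> T p2 p3 p5 = 0 \<or> T p2 p4 p5 = 0 \<or> T p3 p4 p5 = 0"
begin

lemmas z = alt3_zero[OF altT]
lemmas z' = alt3_zero[OF altT']
lemmas perms = alt3_perms[OF altT]
lemmas perms' = alt3_perms[OF altT']

abbreviation "R x p q r s \<equiv> RLF (T x) (T' x) p q r s"

lemma R_swap12: "R x p q r s ==> R x q p r s"
 using RLF_swap12[OF alt3_alt2[OF altT] alt3_alt2[OF altT']] .
lemma R_swap23: "R x p q r s ==> R x p r q s"
 using RLF_swap23[OF alt3_alt2[OF altT] alt3_alt2[OF altT']] .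
lemma R_swap34: "R x p q r s ==> R x p q s r"
 using RLF_swap34[OF alt3_alt2[OF altT] alt3_alt2[OF altT']] .

lemma R_supp: "R p a b q r ==> T p q r ~= 0 ==> T' p q r ~= 0 ==> T p a b = 0 \<longleftrightarrow> T' p a b = 0"
 unfolding RLF_def RL_def by auto

text \<open>Points on one line through \<open>p\<close> have proportional rows in the pencil at
  \<open>p\<close>.\<close>

lemma collinear:
 assumes "p \<in> P" "e \<in> P" "f \<in> P" "y \<in> P" "y' \<in> P" "T p e f = 0"
 shows "T p e y * T p f y' = T p e y' * T p f y"
 using N3_zero(1)[OF N[OF assms(1-5)]] assms(6) by simp

lemma collinear':
 assumes "p \<in> P" "e \<in> P" "f \<in> P" "y \<in> P" "y' \<in> P" "T' p e f = 0"
 shows "T' p e y * T' p f y' = T' p e y' * T' p f y"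
 using K3_zero(1)[OF K[OF assms(1-5)]] assms(6) by simp

lemma collinear_nz:
 assumes "p \<in> P" "e \<in> P" "f \<in> P" "y \<in> P" "y' \<in> P" "T p e f = 0" "T p e y ~= 0" "T p f y' ~= 0"
 shows "T p f y ~= 0"
 using collinear[OF assms(1-6)] assms(7,8) by auto

lemma collinear_nz':
 assumes "p \<in> P" "e \<in> P" "f \<in> P" "y \<in> P" "y' \<in> P" "T' p e f = 0" "T' p e y ~= 0" "T' p f y' ~= 0"
 shows "T' p f y ~= 0"
 using collinear'[OF assms(1-6)] assms(7,8) by auto

text \<open>Perspectivity: the pencils at \<open>u\<close> and \<open>v\<close> cut the line through \<open>l1, l2, l3\<close> in the same points.\<close>

lemma perspectivity:
 assumes P: "u \<in> P" "v \<in> P" "l1 \<in> P" "l2 \<in> P" "l3 \<in> P" and l: "T l1 l2 l3 = 0" "T' l1 l2 l3 = 0"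
  and nz: "T u l1 l2 ~= 0" "T v l1 l2 ~= 0" "T' u l1 l2 ~= 0" "T' v l1 l2 ~= 0"
  and R: "R v u l1 l2 l3"
 shows "R u v l1 l2 l3"
proof -
 \<comment> \<open>The brackets of two points of the line with \<open>u\<close> and with
   \<open>v\<close> are proportional, with factor \<open>k\<close>. The sign in \<open>- k\<close>
   comes from exchanging the two centres in the remaining bracket.\<close>
 define k where "k = T u l1 l2 / T v l1 l2"
 define k' where "k' = T' u l1 l2 / T' v l1 l2"
 have k: "- k ~= 0" "- k' ~= 0" using nz unfolding k_def k'_def by auto
 have "T l1 l2 u * T l1 l3 v = T l1 l2 v * T l1 l3 u" "T l2 l1 u * T l2 l3 v = T l2 l1 v * T l2 l3 u"
  using collinear[of l1 l2 l3 u v] collinear[of l2 l1 l3 u v] P l by (auto simp: z)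
 then have e: "T u l1 l2 = k * T v l1 l2" "T u l1 l3 = k * T v l1 l3" "T u l2 l3 = k * T v l2 l3"
  using nz unfolding k_def perms(3)[where x = u and y = l1 and z = l2] perms(3)[where x = u and y = l1 and z = l3] perms(3)[where x = v and y = l1 and z = l2] perms(3)[where x = v and y = l1 and z = l3]
   perms(3)[where x = u and y = l2 and z = l3] perms(3)[where x = v and y = l2 and z = l3] perms(5)[where x = u and y = l1 and z = l2] perms(5)[where x = v and y = l1 and z = l2] by (auto simp: field_simps)
 have "T' l1 l2 u * T' l1 l3 v = T' l1 l2 v * T' l1 l3 u" "T' l2 l1 u * T' l2 l3 v = T' l2 l1 v * T' l2 l3 u"
  using collinear'[of l1 l2 l3 u v] collinear'[of l2 l1 l3 u v] P l by (auto simp: z')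
 then have e': "T' u l1 l2 = k' * T' v l1 l2" "T' u l1 l3 = k' * T' v l1 l3" "T' u l2 l3 = k' * T' v l2 l3"
  using nz unfolding k'_def perms'(3)[where x = u and y = l1 and z = l2] perms'(3)[where x = u and y = l1 and z = l3] perms'(3)[where x = v and y = l1 and z = l2] perms'(3)[where x = v and y = l1 and z = l3]
   perms'(3)[where x = u and y = l2 and z = l3] perms'(3)[where x = v and y = l2 and z = l3] perms'(5)[where x = u and y = l1 and z = l2] perms'(5)[where x = v and y = l1 and z = l2] by (auto simp: field_simps)
 have f: "T v u y = - T u v y" "T' v u y = - T' u v y" for y by (rule perms(1), rule perms'(1))
 show ?thesis
  using RL_scale[OF R[unfolded RLF_def] k] unfolding RLF_def e e' f by (simp add: mult.assoc mult.left_commute)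
qed

text \<open>On the source side the pencils at \<open>u\<close> and \<open>v\<close> yield the same
  triple up to scale. Uniqueness makes the two target pencils proportional on
  \<open>l1, l2, l3\<close> as well, and the relation at \<open>l1\<close> turns this into
  collinearity.\<close>

lemma perspectivity_unique:
 assumes P: "u \<in> P" "v \<in> P" "l1 \<in> P" "l2 \<in> P" "l3 \<in> P" and l: "T l1 l2 l3 = 0"
  and nz: "T u l1 l2 ~= 0" "T v l1 l2 ~= 0" "T' u v l1 ~= 0" "T' u v l2 ~= 0" "T' u v l3 ~= 0"
  and R: "R u v l1 l2 l3" "R v u l1 l2 l3"
 shows "T' l1 l2 l3 = 0"
proof -
 define k where "k = T u l1 l2 / T v l1 l2"
 have k: "- k ~= 0" using nz unfolding k_def by auto
 have "T l1 l2 u * T l1 l3 v = T l1 l2 v * T l1 l3 u" "T l2 l1 u * T l2 l3 v = T l2 l1 v * T l2 l3 u"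
  using collinear[of l1 l2 l3 u v] collinear[of l2 l1 l3 u v] P l by (auto simp: z)
 then have e: "T u l1 l2 = k * T v l1 l2" "T u l1 l3 = k * T v l1 l3" "T u l2 l3 = k * T v l2 l3"
  using nz unfolding k_def perms(3)[where x = u and y = l1 and z = l2] perms(3)[where x = u and y = l1 and z = l3] perms(3)[where x = v and y = l1 and z = l2] perms(3)[where x = v and y = l1 and z = l3]
   perms(3)[where x = u and y = l2 and z = l3] perms(3)[where x = v and y = l2 and z = l3] perms(5)[where x = u and y = l1 and z = l2] perms(5)[where x = v and y = l1 and z = l2] by (auto simp: field_simps)
 have f: "T v u y = - T u v y" "T' v u y = - T' u v y" for y by (rule perms(1), rule perms'(1))
 have "RL (T u v l1 * T u l2 l3) (- (T u v l2 * T u l1 l3)) (T u v l3 * T u l1 l2)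
  (1 * (T' v u l1 * T' v l2 l3)) (1 * (- (T' v u l2 * T' v l1 l3))) (1 * (T' v u l3 * T' v l1 l2))"
  using RL_scale[OF R(2)[unfolded RLF_def] k, of 1] unfolding e f by (simp add: mult.left_commute)
 from RL_unique[OF R(1)[unfolded RLF_def] this] obtain c where
  "T' v u l1 * T' v l2 l3 = c * (T' u v l1 * T' u l2 l3)" "T' v u l2 * T' v l1 l3 = c * (T' u v l2 * T' u l1 l3)"
  "T' v u l3 * T' v l1 l2 = c * (T' u v l3 * T' u l1 l2)" by auto
 then have e': "T' v l2 l3 = - c * T' u l2 l3" "T' v l1 l3 = - c * T' u l1 l3" "T' v l1 l2 = - c * T' u l1 l2"
  using nz neg_cancel unfolding f by (metis mult_minus_left)+
 have "T' l1 l2 l3 * T' l1 u v - T' l1 l2 u * T' l1 l3 v + T' l1 l2 v * T' l1 l3 u = 0"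
  using K[of l1 l2 l3 u v] P unfolding K3_def by blast
 moreover have "T' l1 l2 u * T' l1 l3 v = T' l1 l2 v * T' l1 l3 u"
  unfolding perms'(3)[where x = u and y = l1 and z = l2] perms'(3)[where x = u and y = l1 and z = l3] perms'(3)[where x = v and y = l1 and z = l2] perms'(3)[where x = v and y = l1 and z = l3] e' by simp
 moreover have "T' l1 u v ~= 0" using nz(3) perms'(4)[where x = u and y = v and z = l1] by simp
 ultimately show ?thesis by simp
qed

text \<open>Four collinear points seen from two centres.\<close>

lemma perspectivity4:
 assumes P: "u \<in> P" "v \<in> P" "l1 \<in> P" "l2 \<in> P" "l3 \<in> P" "l4 \<in> P"
  and l: "T l3 l4 l1 = 0" "T l3 l4 l2 = 0" "T l1 l2 l3 = 0" "T' l3 l4 l1 = 0" "T' l3 l4 l2 = 0" "T' l1 l2 l3 = 0"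
  and nz: "T u l3 l4 ~= 0" "T v l3 l4 ~= 0" "T v l1 l3 ~= 0" "T' u l3 l4 ~= 0" "T' v l3 l4 ~= 0" "T' v l1 l3 ~= 0"
  and R: "R v l1 l2 l3 l4"
 shows "R u l1 l2 l3 l4"
proof -
 \<comment> \<open>Every product in the relation has two brackets along the line, so the factor
   enters squared.\<close>
 define k where "k = T u l3 l4 / T v l3 l4"
 define k' where "k' = T' u l3 l4 / T' v l3 l4"
 have k: "k ~= 0" "k' ~= 0" "k * k ~= 0" "k' * k' ~= 0" using nz unfolding k_def k'_def by auto
 have "T l3 l4 u * T l3 y v = T l3 l4 v * T l3 y u" "T l4 l3 u * T l4 y v = T l4 l3 v * T l4 y u" if "y = l1 \<or> y = l2" for y
  using collinear[of l3 l4 y u v] collinear[of l4 l3 y u v] P l that by (auto simp: z)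
 then have e0: "T l3 y u = k * T l3 y v" "T l4 y u = k * T l4 y v" if "y = l1 \<or> y = l2" for y
  using nz that unfolding k_def perms(3)[where x = u and y = l3 and z = l4] perms(3)[where x = v and y = l3 and z = l4] perms(5)[where x = u and y = l3 and z = l4] perms(5)[where x = v and y = l3 and z = l4]
  by (auto simp: field_simps)
 have e: "T u y l3 = k * T v y l3" "T u y l4 = k * T v y l4" if "y = l1 \<or> y = l2" for y
  using e0[OF that] unfolding perms(5)[where x = u and y = y and z = l3] perms(5)[where x = v and y = y and z = l3] perms(5)[where x = u and y = y and z = l4] perms(5)[where x = v and y = y and z = l4] by auto
 have e34: "T u l3 l4 = k * T v l3 l4" using nz unfolding k_def by simp
 have "T l1 l3 u * T l1 l2 v = T l1 l3 v * T l1 l2 u"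
  using collinear[of l1 l3 l2 u v] P l by (auto simp: z)
 then have e12: "T u l1 l2 = k * T v l1 l2"
  using e(1)[of l1] nz k unfolding perms(3)[where x = u and y = l1 and z = l3] perms(3)[where x = v and y = l1 and z = l3] perms(3)[where x = u and y = l1 and z = l2] perms(3)[where x = v and y = l1 and z = l2] by auto
 have "T' l3 l4 u * T' l3 y v = T' l3 l4 v * T' l3 y u" "T' l4 l3 u * T' l4 y v = T' l4 l3 v * T' l4 y u" if "y = l1 \<or> y = l2" for y
  using collinear'[of l3 l4 y u v] collinear'[of l4 l3 y u v] P l that by (auto simp: z')
 then have e0': "T' l3 y u = k' * T' l3 y v" "T' l4 y u = k' * T' l4 y v" if "y = l1 \<or> y = l2" for y
  using nz that unfolding k'_def perms'(3)[where x = u and y = l3 and z = l4] perms'(3)[where x = v and y = l3 and z = l4] perms'(5)[where x = u and y = l3 and z = l4] perms'(5)[where x = v and y = l3 and z = l4]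
  by (auto simp: field_simps)
 have e': "T' u y l3 = k' * T' v y l3" "T' u y l4 = k' * T' v y l4" if "y = l1 \<or> y = l2" for y
  using e0'[OF that] unfolding perms'(5)[where x = u and y = y and z = l3] perms'(5)[where x = v and y = y and z = l3] perms'(5)[where x = u and y = y and z = l4] perms'(5)[where x = v and y = y and z = l4] by auto
 have e34': "T' u l3 l4 = k' * T' v l3 l4" using nz unfolding k'_def by simp
 have "T' l1 l3 u * T' l1 l2 v = T' l1 l3 v * T' l1 l2 u"
  using collinear'[of l1 l3 l2 u v] P l by (auto simp: z')
 then have e12': "T' u l1 l2 = k' * T' v l1 l2"
  using e'(1)[of l1] nz k unfolding perms'(3)[where x = u and y = l1 and z = l3] perms'(3)[where x = v and y = l1 and z = l3] perms'(3)[where x = u and y = l1 and z = l2] perms'(3)[where x = v and y = l1 and z = l2] by auto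
 show ?thesis
  using RL_scale[OF R[unfolded RLF_def] k(3,4)] unfolding RLF_def e12 e34 e12' e34'
  by (simp add: e e' mult.assoc mult.left_commute)
qed

text \<open>Two centres \<open>u, v\<close> that are parallel as seen from each of the four points.\<close>

lemma centre_change:
 assumes P: "u \<in> P" "v \<in> P" "e1 \<in> P" "e2 \<in> P" "e3 \<in> P" "e4 \<in> P"
  and l: "T u v e1 = 0" "T u v e3 = 0" "T u v e4 = 0" "T' u v e1 = 0" "T' u v e3 = 0" "T' u v e4 = 0"
  and nz: "T u e3 e4 ~= 0" "T v e3 e4 ~= 0" "T v e1 e3 ~= 0" "T' u e3 e4 ~= 0" "T' v e3 e4 ~= 0" "T' v e1 e3 ~= 0"
  and R: "R v e1 e2 e3 e4"
 shows "R u e1 e2 e3 e4"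
proof -
 define k where "k = T u e3 e4 / T v e3 e4"
 define k' where "k' = T' u e3 e4 / T' v e3 e4"
 have k: "k ~= 0" "k' ~= 0" "k * k ~= 0" "k' * k' ~= 0" using nz unfolding k_def k'_def by auto
 have "T e3 u e4 * T e3 v y = T e3 u y * T e3 v e4" "T e4 u e3 * T e4 v y = T e4 u y * T e4 v e3" if "y = e1 \<or> y = e2" for y
  using collinear[of e3 u v e4 y] collinear[of e4 u v e3 y] P l that by (auto simp: z)
 then have e0: "T e3 u y = k * T e3 v y" "T e4 u y = k * T e4 v y" if "y = e1 \<or> y = e2" for y
  using nz that unfolding k_def perms(4)[where x = u and y = e3 and z = e4] perms(4)[where x = v and y = e3 and z = e4]
   perms(1)[where x = u and y = e3 and z = e4] perms(1)[where x = v and y = e3 and z = e4] by (auto simp: field_simps)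
 have e: "T u y e3 = k * T v y e3" "T u y e4 = k * T v y e4" if "y = e1 \<or> y = e2" for y
  using e0[OF that] unfolding perms(4)[where x = u and y = y and z = e3] perms(4)[where x = v and y = y and z = e3] perms(4)[where x = u and y = y and z = e4] perms(4)[where x = v and y = y and z = e4] by auto
 have e34: "T u e3 e4 = k * T v e3 e4" using nz unfolding k_def by simp
 have "T e1 u e3 * T e1 v e2 = T e1 u e2 * T e1 v e3"
  using collinear[of e1 u v e3 e2] P l by (auto simp: z)
 then have e12: "T u e1 e2 = k * T v e1 e2"
  using e(1)[of e1] nz k unfolding perms(1)[where x = u and y = e1 and z = e3] perms(1)[where x = v and y = e1 and z = e3] perms(1)[where x = u and y = e1 and z = e2] perms(1)[where x = v and y = e1 and z = e2] by auto
 have "T' e3 u e4 * T' e3 v y = T' e3 u y * T' e3 v e4" "T' e4 u e3 * T' e4 v y = T' e4 u y * T' e4 v e3" if "y = e1 \<or> y = e2" for y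
  using collinear'[of e3 u v e4 y] collinear'[of e4 u v e3 y] P l that by (auto simp: z')
 then have e0': "T' e3 u y = k' * T' e3 v y" "T' e4 u y = k' * T' e4 v y" if "y = e1 \<or> y = e2" for y
  using nz that unfolding k'_def perms'(4)[where x = u and y = e3 and z = e4] perms'(4)[where x = v and y = e3 and z = e4]
   perms'(1)[where x = u and y = e3 and z = e4] perms'(1)[where x = v and y = e3 and z = e4] by (auto simp: field_simps)
 have e': "T' u y e3 = k' * T' v y e3" "T' u y e4 = k' * T' v y e4" if "y = e1 \<or> y = e2" for y
  using e0'[OF that] unfolding perms'(4)[where x = u and y = y and z = e3] perms'(4)[where x = v and y = y and z = e3] perms'(4)[where x = u and y = y and z = e4] perms'(4)[where x = v and y = y and z = e4] by auto
 have e34': "T' u e3 e4 = k' * T' v e3 e4" using nz unfolding k'_def by simp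
 have "T' e1 u e3 * T' e1 v e2 = T' e1 u e2 * T' e1 v e3"
  using collinear'[of e1 u v e3 e2] P l by (auto simp: z')
 then have e12': "T' u e1 e2 = k' * T' v e1 e2"
  using e'(1)[of e1] nz k unfolding perms'(1)[where x = u and y = e1 and z = e3] perms'(1)[where x = v and y = e1 and z = e3] perms'(1)[where x = u and y = e1 and z = e2] perms'(1)[where x = v and y = e1 and z = e2] by auto
 show ?thesis
  using RL_scale[OF R[unfolded RLF_def] k(3,4)] unfolding RLF_def e12 e34 e12' e34'
  by (simp add: e e' mult.assoc mult.left_commute)
qed

lemma parallel_change:
 assumes P: "p \<in> P" "e \<in> P" "f \<in> P" "b \<in> P" "c \<in> P" "d \<in> P" and l: "T p e f = 0" "T' p e f = 0"
  and nz: "T p e b ~= 0" "T p f b ~= 0" "T' p e b ~= 0" "T' p f b ~= 0"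
  and R: "R p f b c d"
 shows "R p e b c d"
 by (rule RLF_parallel[OF R N[OF P(1-5)] N[OF P(1-4,6)] K[OF P(1-5)] K[OF P(1-4,6)] l nz])

end

subsection \<open>The quadrangle\<close>

definition quadrangle :: "('a => 'a => 'a => 'f::field) => 'a => 'a => 'a => 'a => 'a => 'a => 'a => bool" where
 "quadrangle S o' i j k u v w \<longleftrightarrow> S o' i u = 0 & S j k u = 0 & S o' j v = 0 & S i k v = 0 & S i j w = 0 &
   S o' i j ~= 0 & S o' i k ~= 0 & S o' i w ~= 0 & S j k v ~= 0"

text \<open>\<open>u, v, w\<close> are the diagonal points of the quadrangle \<open>o', i, j, k\<close>, with \<open>w\<close> on \<open>i j\<close>; it is also on \<open>o' k\<close>
 exactly if \<open>v, w\<close> are harmonic with respect to the two sides through \<open>u\<close>.\<close>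

lemma quadrangle_equations:
 fixes S :: "'a => 'a => 'a => 'f::field"
 assumes alt: "alt3 S"
  and col: "\<And>p e f y y'. {p, e, f, y, y'} \<subseteq> {o', i, j, k, u, v, w} ==> S p e f = 0 ==> S p e y * S p f y' = S p e y' * S p f y"
  and l: "S o' i u = 0" "S j k u = 0" "S o' j v = 0" "S i k v = 0" "S i j w = 0"
 shows "S o' i v * S o' u w = S o' i w * S o' u v" "S j k v * S j u w = S j k w * S j u v"
  "S o' i j * S o' i k * S j k v = S o' j k * S i j k * S o' i v" "S o' i j * S j k w = - S i j k * S o' j w"
proof -
 note p = alt3_perms[OF alt]
 note z = alt3_zero[OF alt]
 show "S o' i v * S o' u w = S o' i w * S o' u v" using l by (intro col) auto
 show "S j k v * S j u w = S j k w * S j u v" using l by (intro col) auto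
 have "S o' j i * S o' v k = S o' j k * S o' v i" using l by (intro col) auto
 then have E1: "S o' i j * S o' k v = - S o' j k * S o' i v"
  unfolding p(2)[where x = o' and y = i and z = j] p(2)[where x = o' and y = k and z = v] p(2)[where x = o' and y = i and z = v] by simp
 have "S k i o' * S k v j = S k i j * S k v o'" using l by (intro col) (auto simp: z)
 then have E2: "- S o' i k * S j k v = S i j k * S o' k v"
  unfolding p(5)[where x = o' and y = i and z = k] p(3)[where x = j and y = k and z = v] p(4)[where x = i and y = j and z = k] p(3)[where x = o' and y = k and z = v] by simp
 have "S o' i j * (S o' i k * S j k v) = - (S i j k * (S o' i j * S o' k v))" 
 proof -
  have "S o' i k * S j k v = - (S i j k * S o' k v)" unfolding E2[symmetric] by simp
  then show ?thesis by (simp add: mult.left_commute)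
 qed
 then show "S o' i j * S o' i k * S j k v = S o' j k * S i j k * S o' i v" unfolding E1 by (simp add: algebra_simps)
 have "S j i o' * S j w k = S j i k * S j w o'" using l by (intro col) (auto simp: z)
 then show "S o' i j * S j k w = - S i j k * S o' j w"
  unfolding p(5)[where x = o' and y = i and z = j] p(2)[where x = j and y = k and z = w] p(1)[where x = i and y = j and z = k] p(3)[where x = o' and y = j and z = w] by simp
qed

context plane
begin

text \<open>The extra line through \<open>o', k, w\<close> gives one more equation, with which all
  brackets outside the pencil at \<open>u\<close> cancel; two products of opposite sign
  remain.\<close>

lemma harmonic_aux:
 fixes S :: "'a => 'a => 'a => 'f::field"
 assumes alt: "alt3 S"
  and col: "\<And>p e f y y'. {p, e, f, y, y'} \<subseteq> {o', i, j, k, u, v, w} ==> S p e f = 0 ==> S p e y * S p f y' = S p e y' * S p f y"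
  and q: "quadrangle S o' i j k u v w" and l: "S o' k w = 0"
 shows "S u v o' * S u w j = - (S u v j * S u w o')"
proof -
 note p = alt3_perms[OF alt]
 note qq = q[unfolded quadrangle_def]
 have l5: "S o' i u = 0" "S j k u = 0" "S o' j v = 0" "S i k v = 0" "S i j w = 0" using qq by blast+
 have e: "S o' i v * S o' u w = S o' i w * S o' u v" "S j k v * S j u w = S j k w * S j u v"
  "S o' i j * S o' i k * S j k v = S o' j k * S i j k * S o' i v" "S o' i j * S j k w = - S i j k * S o' j w"
  by (rule quadrangle_equations(1)[OF alt _ l5], erule (1) col,
    rule quadrangle_equations(2)[OF alt _ l5], erule (1) col,
    rule quadrangle_equations(3)[OF alt _ l5], erule (1) col,
    rule quadrangle_equations(4)[OF alt _ l5], erule (1) col)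
 have "S o' k i * S o' w j = S o' k j * S o' w i" using l by (intro col) auto
 then have E3: "S o' i k * S o' j w = S o' j k * S o' i w"
  unfolding p(2)[where x = o' and y = i and z = k] p(2)[where x = o' and y = j and z = w] p(2)[where x = o' and y = j and z = k] p(2)[where x = o' and y = i and z = w] by simp
 have W: "S o' i j * S o' i k * S j k w = - (S o' j k * S i j k * S o' i w)"
 proof -
  have "S o' i j * S o' i k * S j k w = S o' i k * (S o' i j * S j k w)" by simp
  also have "\<dots> = - (S i j k * (S o' i k * S o' j w))" unfolding e(4) by simp
  finally show ?thesis unfolding E3 by simp
 qed
 have "(S o' i j * S o' i k) * (S o' i w * S j k v) = (S o' i j * S o' i k) * (- (S o' i v * S j k w))"
 proof -
  have "(S o' i j * S o' i k) * (S o' i w * S j k v) = S o' i w * (S o' i j * S o' i k * S j k v)" by simp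
  also have "\<dots> = - (S o' i v * (S o' i j * S o' i k * S j k w))" unfolding e(3) W by simp
  finally show ?thesis by simp
 qed
 moreover have "S o' i j * S o' i k ~= 0" using qq by simp
 ultimately have X: "S o' i w * S j k v = - (S o' i v * S j k w)" using mult_left_cancel by blast
 have "(S o' i w * S j k v) * (S o' u v * S j u w) = (S o' i w * S o' u v) * (S j k v * S j u w)" by simp
 also have "\<dots> = (S o' i v * S j k w) * (S o' u w * S j u v)" unfolding e(1)[symmetric] e(2) by simp
 also have "\<dots> = (S o' i w * S j k v) * (- (S o' u w * S j u v))" unfolding X by simp
 finally have "(S o' i w * S j k v) * (S o' u v * S j u w) = (S o' i w * S j k v) * (- (S o' u w * S j u v))" .
 moreover have "S o' i w * S j k v ~= 0" using qq by simp
 ultimately have "S o' u v * S j u w = - (S o' u w * S j u v)" using mult_left_cancel by blast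
 then show ?thesis unfolding p(3)[where x = o' and y = u and z = v] p(3)[where x = j and y = u and z = w] p(3)[where x = j and y = u and z = v] p(3)[where x = o' and y = u and z = w] by (simp add: mult.commute)
qed

lemma harmonic:
 assumes "{o', i, j, k, u, v, w} \<subseteq> P" "quadrangle T o' i j k u v w" "T o' k w = 0"
 shows "T u v o' * T u w j = - (T u v j * T u w o')"
proof -
 have col: "T p e y * T p f y' = T p e y' * T p f y" if "{p, e, f, y, y'} \<subseteq> {o', i, j, k, u, v, w}" "T p e f = 0" for p e f y y'
  using collinear[of p e f y y'] that assms(1) by blast
 show ?thesis by (rule harmonic_aux[OF altT _ assms(2,3)], erule (1) col)
qed

lemma harmonic':
 assumes "{o', i, j, k, u, v, w} \<subseteq> P" "quadrangle T' o' i j k u v w" "T' o' k w = 0"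
 shows "T' u v o' * T' u w j = - (T' u v j * T' u w o')"
proof -
 have col: "T' p e y * T' p f y' = T' p e y' * T' p f y" if "{p, e, f, y, y'} \<subseteq> {o', i, j, k, u, v, w}" "T' p e f = 0" for p e f y y'
  using collinear'[of p e f y y'] that assms(1) by blast
 show ?thesis by (rule harmonic_aux[OF altT' _ assms(2,3)], erule (1) col)
qed

text \<open>The same elimination run backwards yields equality of two products in the pencil at
  \<open>o'\<close>, and the three-term relation there then forces \<open>o', k, w\<close> to be
  collinear.\<close>

lemma harmonic_converse':
 assumes P: "{o', i, j, k, u, v, w} \<subseteq> P" and q: "quadrangle T' o' i j k u v w"
  and h: "T' u v o' * T' u w j = - (T' u v j * T' u w o')"
  and nz: "T' u v j ~= 0" "T' u w o' ~= 0" "T' i j k ~= 0" "T' o' i v ~= 0"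
 shows "T' o' k w = 0"
proof -
 note p = perms'
 note qq = q[unfolded quadrangle_def]
 have col: "T' p e y * T' p f y' = T' p e y' * T' p f y" if "{p, e, f, y, y'} \<subseteq> {o', i, j, k, u, v, w}" "T' p e f = 0" for p e f y y'
  using collinear'[of p e f y y'] that P by blast
 have l5: "T' o' i u = 0" "T' j k u = 0" "T' o' j v = 0" "T' i k v = 0" "T' i j w = 0" using qq by blast+
 have e: "T' o' i v * T' o' u w = T' o' i w * T' o' u v" "T' j k v * T' j u w = T' j k w * T' j u v"
  "T' o' i j * T' o' i k * T' j k v = T' o' j k * T' i j k * T' o' i v" "T' o' i j * T' j k w = - T' i j k * T' o' j w"
  by (rule quadrangle_equations(1)[OF altT' _ l5], erule (1) col,
    rule quadrangle_equations(2)[OF altT' _ l5], erule (1) col,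
    rule quadrangle_equations(3)[OF altT' _ l5], erule (1) col,
    rule quadrangle_equations(4)[OF altT' _ l5], erule (1) col)
 have h': "T' o' u v * T' j u w = - (T' j u v * T' o' u w)"
  using h unfolding p(3)[where x = o' and y = u and z = v] p(3)[where x = j and y = u and z = w] p(3)[where x = j and y = u and z = v] p(3)[where x = o' and y = u and z = w] .
 have nz': "T' j u v * T' o' u w ~= 0" using nz unfolding p(3)[where x = j and y = u and z = v] p(3)[where x = o' and y = u and z = w] by simp
 have "(T' o' i w * T' j k v) * (T' o' u v * T' j u w) = (T' o' i w * T' o' u v) * (T' j k v * T' j u w)" by simp
 also have "\<dots> = (T' o' i v * T' j k w) * (T' j u v * T' o' u w)" unfolding e(1)[symmetric] e(2) by simp
 finally have X: "- (T' o' i w * T' j k v) = T' o' i v * T' j k w" using nz' unfolding h'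
  by (metis mult_minus_left mult_minus_right mult_right_cancel)
 have "T' o' i v * T' i j k * (T' o' i k * T' o' j w) = - (T' o' i k * (T' o' i v * (- T' i j k * T' o' j w)))" by simp
 also have "\<dots> = - (T' o' i j * T' o' i k * (T' o' i v * T' j k w))" unfolding e(4)[symmetric] by simp
 also have "\<dots> = T' o' i w * (T' o' i j * T' o' i k * T' j k v)" unfolding X[symmetric] by simp
 also have "\<dots> = T' o' i v * T' i j k * (T' o' j k * T' o' i w)" unfolding e(3) by simp
 finally have "T' o' i v * T' i j k * (T' o' i k * T' o' j w) = T' o' i v * T' i j k * (T' o' j k * T' o' i w)" .
 moreover have "T' o' i v * T' i j k ~= 0" using nz by simp
 ultimately have Y: "T' o' i k * T' o' j w = T' o' j k * T' o' i w" using mult_left_cancel by blast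
 have "T' o' k w * T' o' i j - T' o' k i * T' o' w j + T' o' k j * T' o' w i = 0"
  using K[of o' k w i j] P unfolding K3_def by blast
 then have "T' o' k w * T' o' i j = T' o' i k * T' o' j w - T' o' j k * T' o' i w"
  unfolding p(2)[where x = o' and y = i and z = k] p(2)[where x = o' and y = j and z = w] p(2)[where x = o' and y = j and z = k] p(2)[where x = o' and y = i and z = w] by (simp add: algebra_simps)
 then show ?thesis using Y qq by simp
qed

end

context lifting
begin

text \<open>By \<open>RL_harmonic\<close> the lifts of \<open>(x, y, y)\<close> are multiples of
  \<open>(-2, 1, 1)\<close>, and every target triple of this shape is such a multiple.\<close>

lemma RL_harmonicI:
 assumes "RL x y y x' y' z'" "x ~= 0" "y ~= 0" "X + Y + Y = 0" "Y ~= 0"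
 shows "RL x y y X Y Y"
proof -
 have e: "y' = z'" using RL_harmonic[OF assms(1,2)] .
 have nz: "y' ~= 0" "x' + y' + y' = 0" using assms(1,3) e unfolding RL_def by auto
 have "RL (1 * x) (1 * y) (1 * y) (Y / y' * x') (Y / y' * y') (Y / y' * z')"
  using assms(5) nz by (intro RL_scale[OF assms(1)]) auto
 moreover have "Y / y' * x' = X"
 proof -
  have "x' = - (y' + y')" "X = - (Y + Y)" using nz(2) assms(4) by (auto simp: eq_neg_iff_add_eq_0 add.assoc)
  then show ?thesis using nz(1) by (simp add: field_simps)
 qed
 ultimately show ?thesis using e nz by simp
qed

end

text \<open>The situation during gluing: supports and relations are known wherever \<open>a\<close>
  and \<open>b\<close> do not occur together. The goal is the relation \<open>R p a b q r\<close>
  for further points.\<close>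

locale plane_pair = plane L \<Gamma> T T' P for L :: "'p::field => 'p => 'p => 'k::field => 'k => 'k => bool" and \<Gamma>
  and T :: "'a => 'a => 'a => 'p" and T' :: "'a => 'a => 'a => 'k" and P +
 fixes a b :: 'a
 assumes abP: "a \<in> P" "b \<in> P" "a ~= b"
  and supp: "x \<in> P ==> y \<in> P ==> z \<in> P ==> \<not> {a, b} \<subseteq> {x, y, z} ==> T x y z = 0 \<longleftrightarrow> T' x y z = 0"
  and R0: "x \<in> P ==> p \<in> P ==> q \<in> P ==> r \<in> P ==> s \<in> P ==> \<not> {a, b} \<subseteq> {x, p, q, r, s} ==> R x p q r s"
begin

definition "nzb x y z \<longleftrightarrow> T x y z ~= 0 & T' x y z ~= 0"
definition "zb x y z \<longleftrightarrow> T x y z = 0 & T' x y z = 0"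

lemma nzb_perm: "nzb y x z \<longleftrightarrow> nzb x y z" "nzb x z y \<longleftrightarrow> nzb x y z"
 unfolding nzb_def using z z' by blast+

lemma zb_perm: "zb y x z \<longleftrightarrow> zb x y z" "zb x z y \<longleftrightarrow> zb x y z"
 unfolding zb_def using z z' by blast+

lemma nzbD: "nzb x y z ==> T x y z ~= 0" "nzb x y z ==> T' x y z ~= 0"
 unfolding nzb_def by blast+

lemma zbD: "zb x y z ==> T x y z = 0" "zb x y z ==> T' x y z = 0"
 unfolding zb_def by blast+

lemma supp_cases:
 "x \<in> P ==> y \<in> P ==> z \<in> P ==> \<not> {a, b} \<subseteq> {x, y, z} ==> zb x y z \<or> nzb x y z"
 using supp unfolding zb_def nzb_def by blast

lemma collinear_nzb:
 assumes "p \<in> P" "e \<in> P" "f \<in> P" "y \<in> P" "y' \<in> P" "zb p e f" "nzb p e y" "nzb p f y'"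
 shows "nzb p f y"
 using collinear_nz[OF assms(1-5)] collinear_nz'[OF assms(1-5)] assms(6-8) unfolding zb_def nzb_def by blast

lemma persp:
 assumes "u \<in> P" "v \<in> P" "l1 \<in> P" "l2 \<in> P" "l3 \<in> P" "zb l1 l2 l3" "nzb u l1 l2" "nzb v l1 l2" "R v u l1 l2 l3"
 shows "R u v l1 l2 l3"
 using perspectivity[OF assms(1-5)] assms(6-9) unfolding zb_def nzb_def by blast

lemma par:
 assumes "p \<in> P" "e \<in> P" "f \<in> P" "b' \<in> P" "c \<in> P" "d \<in> P" "zb p e f" "nzb p e b'" "nzb p f b'" "R p f b' c d"
 shows "R p e b' c d"
 using parallel_change[OF assms(1-6)] assms(7-10) unfolding zb_def nzb_def by blast

text \<open>\<open>common_neighbour\<close> in the pencil at \<open>p\<close>: the point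
  \<open>w\<close> is independent of \<open>q\<close> and \<open>r\<close> there, so
  \<open>noU25\<close> leaves a vanishing pair that involves \<open>a\<close> or
  \<open>b\<close>.\<close>

lemma good:
 assumes P: "p \<in> P" "q \<in> P" "r \<in> P" "w \<in> P" and ne: "a ~: {p, q, r, w}" "b ~: {p, q, r, w}"
  and nz: "nzb p q r" "nzb p w q" "nzb p w r"
 shows "R p a b q r"
proof (rule common_neighbour[where ?w0.0 = w])
 show "alt2 (T p)" "alt2 (T' p)" by (rule alt3_alt2[OF altT], rule alt3_alt2[OF altT'])
 show "N3 (T p) x y s t" if "{x, y, s, t} \<subseteq> {a, b, q, r, w}" for x y s t using that P abP by (intro N) auto
 show "K3 (T' p) x y s t" if "{x, y, s, t} \<subseteq> {a, b, q, r, w}" for x y s t using that P abP by (intro K) auto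
 show "T p x y = 0 \<longleftrightarrow> T' p x y = 0" if "{x, y} \<subseteq> {a, b, q, r, w}" "\<not> {a, b} \<subseteq> {x, y}" for x y
  using that P abP ne by (intro supp) auto
 show "a ~= b" "a ~: {q, r, w}" "b ~: {q, r, w}" using ne abP by auto
 show "R p a w q r" "R p b w q r" using P abP ne by (auto intro!: R0)
 show "T p q r ~= 0" "T p w q ~= 0" "T p w r ~= 0" using nz nzbD by auto
 show "T p a b = 0 \<or> T p a q = 0 \<or> T p a r = 0 \<or> T p a w = 0 \<or> T p b q = 0 \<or> T p b r = 0 \<or> T p b w = 0"
  using noU25[OF P(1) abP(1,2) P(2,3,4)] nz by (auto simp: nzb_def z)
qed

text \<open>A lifted relation with \<open>p, q, r\<close> independent decides the collinearity of
  \<open>p, a, b\<close> in the same way on both sides.\<close>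

lemma good_supp:
 assumes "R p a b q r" "nzb p q r"
 shows "zb p a b \<or> nzb p a b"
 using R_supp[OF assms(1)] assms(2) unfolding nzb_def zb_def by blast

lemma degenerate_target:
 assumes P: "p \<in> P" "q \<in> P" "r \<in> P" and ne: "a ~: {p, q, r}" "b ~: {p, q, r}" and z: "zb p a b"
 shows "R p a b q r"
proof (rule RLF_degI)
 show "N3 (T p) a b q r" "K3 (T' p) a b q r" using N K P abP by auto
 have "T p a q = 0 \<longleftrightarrow> T' p a q = 0" "T p a r = 0 \<longleftrightarrow> T' p a r = 0" "T p b q = 0 \<longleftrightarrow> T' p b q = 0" "T p b r = 0 \<longleftrightarrow> T' p b r = 0"
  using P abP ne by (simp_all add: supp)
 then show "T p a q * T p b r = 0 \<longleftrightarrow> T' p a q * T' p b r = 0" "T p a r * T p b q = 0 \<longleftrightarrow> T' p a r * T' p b q = 0" by auto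
 show "T p a b * T p q r = 0 \<longleftrightarrow> T' p a b * T' p q r = 0"
  "T p a b * T p q r = 0 \<or> T p a q * T p b r = 0 \<or> T p a r * T p b q = 0" using z zbD by auto
qed

end

text \<open>A triangle \<open>c, x, d\<close> with \<open>z1\<close> on the side \<open>c x\<close>
  and \<open>z2\<close> on the side \<open>x d\<close>: the case of a path of length two. Seen from
  \<open>x\<close>, the point \<open>z1\<close> is parallel to \<open>c\<close> and
  \<open>z2\<close> to \<open>d\<close>, so neither can serve in \<open>good\<close> at
  \<open>x\<close>; the relation at \<open>x\<close> has to be derived from those at
  \<open>c\<close>, \<open>d\<close>, \<open>z1\<close>, \<open>z2\<close>. By \<open>A\<close>, the
  relation has no zero outside its first product.\<close>

locale path_config = plane_pair L \<Gamma> T T' P a b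
  for L :: "'p::field => 'p => 'p => 'k::field => 'k => 'k => bool" and \<Gamma>
  and T :: "'a => 'a => 'a => 'p" and T' :: "'a => 'a => 'a => 'k" and P a b +
 fixes c x d z1 z2 :: 'a
 assumes P: "c \<in> P" "x \<in> P" "d \<in> P" "z1 \<in> P" "z2 \<in> P"
  and ne: "a ~: {c, x, d, z1, z2}" "b ~: {c, x, d, z1, z2}"
  and base: "nzb c x d" and Z1: "zb c x z1" "nzb z1 x d" "nzb c z1 d" and Z2: "zb x d z2" "nzb c x z2" "nzb c z2 d"
  and A: "nzb x a c" "nzb x a d" "nzb x b c" "nzb x b d"
begin

lemma base_nz: "nzb d z1 z2" "nzb c z1 z2"
proof -
 have "nzb d z2 z1" by (rule collinear_nzb[where e = x and y' = c]) (use base Z1 Z2 in \<open>simp_all add: P zb_perm nzb_perm\<close>)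
 then show "nzb d z1 z2" by (simp add: nzb_perm)
 show "nzb c z1 z2" by (rule collinear_nzb[where e = x and y' = d]) (use base Z1 Z2 in \<open>simp_all add: P zb_perm nzb_perm\<close>)
qed

lemma good_z1: "R z1 a b c d"
 using ne base_nz Z1(3) by (intro good[OF P(4,1,3,5)]) (simp_all add: nzb_perm)

lemma good_z2: "R z2 a b c d"
 using ne base_nz Z2(3) by (intro good[OF P(5,1,3,4)]) (simp_all add: nzb_perm)

lemma good_d: "R d a b c x"
 using ne base Z1 by (intro good[OF P(3,1,2,4)]) (simp_all add: nzb_perm)

lemma good_c: "R c a b x d"
 using ne base Z2 by (intro good[OF P(1,2,3,5)]) (simp_all add: nzb_perm)

text \<open>Among \<open>a, b, c, x, d\<close> only triples through \<open>a\<close> and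
  \<open>b\<close> can be dependent, so \<open>noU35\<close> makes one of them collinear. The lines
  \<open>a d b\<close> and \<open>a c b\<close> carry the relation from \<open>c\<close> or
  \<open>d\<close> to \<open>x\<close> by perspectivity; for the line \<open>a x b\<close>,
  uniqueness makes the target degenerate.\<close>

lemma both_off:
 assumes O: "nzb c a d" "nzb c b d"
 shows "R x a b c d"
proof -
 have "T a b c = 0 \<or> T a b x = 0 \<or> T a b d = 0"
  using noU35[OF abP(1,2) P(1,2,3)] base A O by (auto simp: nzb_def z)
 then consider "T a b d = 0" | "T a b c = 0" | "T a b x = 0" by blast
 then show ?thesis
 proof cases
  case 1
  have "zb d a b" using good_supp[OF good_d] 1 base by (auto simp: nzb_def zb_def z z')
  moreover have "R c x a d b" using R_swap34[OF R_swap12[OF R_swap23[OF good_c]]] .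
  ultimately have "R x c a d b"
   using A O by (intro persp[OF P(2,1) abP(1) P(3) abP(2)]) (simp_all add: nzb_perm zb_perm)
  then show ?thesis using R_swap23[OF R_swap12[OF R_swap34]] by blast
 next
  case 2
  have "zb c a b" using good_supp[OF good_c] 2 base by (auto simp: nzb_def zb_def z z')
  moreover have "R d x a c b" using R_swap12[OF R_swap23[OF R_swap34[OF R_swap23[OF good_d]]]] R_swap34 R_swap23 R_swap12 by blast
  ultimately have "R x d a c b"
   using A O by (intro persp[OF P(2,3) abP(1) P(1) abP(2)]) (simp_all add: nzb_perm zb_perm)
  then show ?thesis using R_swap12 R_swap23 R_swap34 by blast
 next
  case 3
  have "T' a x b = 0"
  proof (rule perspectivity_unique[of c d])
   show "R c d a x b" using good_c R_swap12 R_swap23 R_swap34 by blast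
   show "R d c a x b" using good_d R_swap12 R_swap23 R_swap34 by blast
   show "T a x b = 0" using 3 by (simp add: z)
   show "T c a x ~= 0" "T d a x ~= 0" "T' c d a ~= 0" "T' c d x ~= 0" "T' c d b ~= 0"
    using A base O by (auto simp: nzb_def zb_def z z')
  qed (auto simp: P abP)
  then have "zb x a b" using 3 unfolding zb_def by (simp add: z z')
  then show ?thesis using ne by (intro degenerate_target) (auto simp: P)
 qed
qed

text \<open>Here \<open>a, b, c, d\<close> lie on one line, and \<open>x\<close> sees it as
  \<open>z1\<close> does.\<close>

lemma both_on:
 assumes O: "zb c a d" "zb c b d"
 shows "R x a b c d"
proof -
 have "T c a d * T c b x = T c a x * T c b d" "T' c a d * T' c b x = T' c a x * T' c b d" using O zbD by auto
 have "K3 (T' c) a b d x" "N3 (T c) a b d x" using N K P abP by auto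
 then have "T c a b * T c d x = 0" "T' c a b * T' c d x = 0"
  using N3_zero(3)[of "T c" a b d x] K3_zero(3)[of "T' c" a b d x] N3_zero(2)[of "T c" a b d x] K3_zero(2)[of "T' c" a b d x]
   zbD[OF O(1)] zbD[OF O(2)] by auto
 then have ab: "zb c a b" using base by (auto simp: nzb_def zb_def z z')
 have n: "nzb z1 a c"
 proof -
  have "nzb c z1 a" by (rule collinear_nzb[where e = x and y' = d]) (use base Z1 A in \<open>simp_all add: P abP zb_perm nzb_perm\<close>)
  then show ?thesis by (simp add: nzb_perm)
 qed
 show ?thesis
  by (rule perspectivity4[OF P(2,4) abP(1,2) P(1,3)])
   (use O ab base Z1 n good_z1 in \<open>auto simp: nzb_def zb_def z z'\<close>)
qed

text \<open>From here on \<open>a\<close> is off the line \<open>c d\<close> and \<open>b\<close> is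
  on it. The brackets listed cannot vanish, which leaves only a few possible collinearities to
  distinguish.\<close>

lemma one_on_nz:
 assumes O: "nzb c a d" "zb c b d"
 shows "nzb a c z1" "nzb a x z1" "nzb a d z2" "nzb a x z2" "nzb b c z1" "nzb b x z1" "nzb b d z2" "nzb b x z2"
  "nzb b d z1" "nzb b c z2" "nzb a b c" "nzb a b d"
proof -
 have *: "nzb c z1 y" "nzb x z1 y" "nzb d z2 y" "nzb x z2 y" if y: "y \<in> P" "nzb x y c" "nzb x y d" for y
 proof -
  show "nzb c z1 y" by (rule collinear_nzb[OF P(1,2,4) y(1) P(3)]) (use Z1 y in \<open>simp_all add: zb_perm nzb_perm\<close>)
  show "nzb x z1 y" by (rule collinear_nzb[OF P(2,1,4) y(1) P(3)]) (use Z1 y in \<open>simp_all add: zb_perm nzb_perm\<close>)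
  show "nzb d z2 y" by (rule collinear_nzb[OF P(3,2,5) y(1) P(1)]) (use Z2 y in \<open>simp_all add: zb_perm nzb_perm\<close>)
  show "nzb x z2 y" by (rule collinear_nzb[OF P(2,3,5) y(1) P(1)]) (use Z2 y in \<open>simp_all add: zb_perm nzb_perm\<close>)
 qed
 show "nzb a c z1" "nzb a x z1" "nzb a d z2" "nzb a x z2" using *[OF abP(1) A(1,2)] by (simp_all add: nzb_perm)
 show "nzb b c z1" "nzb b x z1" "nzb b d z2" "nzb b x z2" using *[OF abP(2) A(3,4)] by (simp_all add: nzb_perm)
 have "nzb d b z1" by (rule collinear_nzb[where e = c and y' = x]) (use base Z1 A O in \<open>simp_all add: P abP zb_perm nzb_perm\<close>)
 then show "nzb b d z1" by (simp add: nzb_perm)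
 have "nzb c b z2" by (rule collinear_nzb[where e = d and y' = x]) (use base Z2 A O in \<open>simp_all add: P abP zb_perm nzb_perm\<close>)
 then show "nzb b c z2" by (simp add: nzb_perm)
 have "nzb c b a" by (rule collinear_nzb[where e = d and y' = x]) (use base A O in \<open>simp_all add: P abP zb_perm nzb_perm\<close>)
 then show "nzb a b c" by (simp add: nzb_perm)
 have "nzb d b a" by (rule collinear_nzb[where e = c and y' = x]) (use base A O in \<open>simp_all add: P abP zb_perm nzb_perm\<close>)
 then show "nzb a b d" by (simp add: nzb_perm)
qed

text \<open>The points \<open>c, d, b\<close> are collinear, so a perspectivity replaces the pencil
  at \<open>x\<close> by the one at \<open>a\<close>.\<close>

lemma one_on_final:
 assumes O: "nzb c a d" "zb c b d" and R: "R a x b c d"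
 shows "R x a b c d"
proof -
 have "R a x c d b" using R R_swap23 R_swap34 by blast
 then have "R x a c d b"
  using O base by (intro persp[OF P(2) abP(1) P(1,3) abP(2)]) (simp_all add: zb_perm nzb_perm)
 then show ?thesis using R_swap23 R_swap34 by blast
qed

text \<open>In the pencil at \<open>a\<close> the source sees \<open>b\<close> and \<open>x\<close>
  as parallel. Both are compared with \<open>w, c, d\<close>, and uniqueness makes them parallel in
  the target too.\<close>

lemma one_on_unique:
 assumes O: "nzb c a d" "zb c b d" and I5: "T a b x = 0"
  and w: "w = z1 \<or> w = z2" "nzb a w c" "nzb a w d"
 shows "R x a b c d"
proof -
 have wP: "w \<in> P" "w ~= a" "w ~= b" using w(1) P ne by auto
 have "R w a c d b" using w(1) good_z1 good_z2 R_swap23 R_swap34 by blast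
 moreover have "nzb w c d" using w(1) Z1(3) Z2(3) by (auto simp: nzb_perm)
 ultimately have "R a w c d b" 
  using O by (intro persp[OF abP(1) wP(1) P(1,3) abP(2)]) (simp_all add: zb_perm nzb_perm)
 then have 1: "R a b w c d" using R_swap12 R_swap23 R_swap34 by blast
 have 2: "R a x w c d" using ne P wP abP by (intro R0) auto
 note nz = one_on_nz[OF O]
 have "T' a b x = 0"
 proof (rule parallel_unique[OF 1 2])
  show "T a b c ~= 0" "T a x c ~= 0" "T' a w c ~= 0" "T' a w d ~= 0" "T' a c d ~= 0"
   using nz A O w(2,3) by (simp_all add: nzb_def z z')
 qed (use P abP wP I5 in \<open>auto intro!: N K\<close>)
 then have "zb x a b" using I5 unfolding zb_def by (simp add: z z')
 then show ?thesis using ne by (intro degenerate_target) (auto simp: P)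
qed

text \<open>The quadrangle \<open>x, c, d, a\<close> has the diagonal points
  \<open>z1, z2, b\<close>. Were these collinear, the source would contain a Fano plane, against
  \<open>two\<close>. Otherwise the known relation of \<open>z2, b, x, d\<close> at
  \<open>z1\<close> is harmonic, so is its lift, and this puts \<open>b\<close> on the line
  \<open>x a\<close> in the target.\<close>

lemma one_on_fano:
 assumes O: "nzb c a d" "zb c b d" and I: "T a b x = 0" "T a d z1 = 0" "T a c z2 = 0"
 shows "R x a b c d"
proof -
 note nz = one_on_nz[OF O]
 have I': "zb a d z1" "zb a c z2" using I supp_cases[of a d z1] supp_cases[of a c z2] P abP ne by (auto simp: nzb_def)
 have q: "quadrangle T x c d a z1 z2 b" "quadrangle T' x c d a z1 z2 b"
  unfolding quadrangle_def using base Z1 Z2 I' O A nz by (simp_all add: nzb_def zb_def z z')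
 have sub: "{x, c, d, a, z1, z2, b} \<subseteq> P" using P abP by auto
 have h: "T z1 z2 x * T z1 b d = - (T z1 z2 d * T z1 b x)"
  by (rule harmonic[OF sub q(1)]) (use I in \<open>simp add: z\<close>)
 have nz0: "T z1 z2 d ~= 0" "T z1 b x ~= 0" "T' z1 z2 d ~= 0" "T' z1 b x ~= 0"
  using base_nz nz by (simp_all add: nzb_def z z')
 show ?thesis
 proof (cases "T z1 z2 b = 0")
  case True
  then have "T z1 z2 x * T z1 b d = T z1 z2 d * T z1 b x"
   by (intro collinear[OF P(4,5) abP(2) P(2,3)])
  then have "2 * (T z1 z2 d * T z1 b x) = 0" using h by (metis add.right_inverse mult_2)
  then show ?thesis using two nz0 by simp
 next
  case False
  have r: "R z1 z2 b x d" using ne P abP by (intro R0) auto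
  have "T z1 x d ~= 0" using Z1 by (auto simp: nzb_def z)
  moreover have "- (T z1 z2 x * T z1 b d) = T z1 z2 d * T z1 b x" using h by simp
  ultimately have "- (T' z1 z2 x * T' z1 b d) = T' z1 z2 d * T' z1 b x"
   using r False unfolding RLF_def by (intro RL_harmonic[where x = "T z1 z2 b * T z1 x d" and y = "T z1 z2 d * T z1 b x"]) auto
  then have h': "T' z1 z2 x * T' z1 b d = - (T' z1 z2 d * T' z1 b x)" by (metis minus_minus)
  have "T' x a b = 0"
   by (rule harmonic_converse'[OF sub q(2) h' nz0(3,4)]) (use O Z2 in \<open>auto simp: nzb_def zb_def z'\<close>)
  then have "zb x a b" using I unfolding zb_def by (simp add: z z')
  then show ?thesis using ne by (intro degenerate_target) (auto simp: P)
 qed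
qed

text \<open>Now the quadrangle is \<open>c, z1, z2, d\<close> with diagonal points
  \<open>x, a, b\<close>, on both sides. Harmonicity makes two terms of the relation at
  \<open>x\<close> equal in source and target, and such a triple has only one lift up to scale. This
  gives the relation with \<open>z2\<close>, which is parallel to \<open>d\<close> in the pencil at
  \<open>x\<close>.\<close>

lemma one_on_nonfano:
 assumes O: "nzb c a d" "zb c b d" and I: "T a b x ~= 0" "T a d z1 = 0" "T a c z2 = 0" "T b z1 z2 = 0"
 shows "R x a b c d"
proof -
 note nz = one_on_nz[OF O]
 have I': "zb a d z1" "zb a c z2" "zb b z1 z2"
  using I supp_cases[of a d z1] supp_cases[of a c z2] supp_cases[of b z1 z2] P abP ne by (auto simp: nzb_def)
 have q: "quadrangle T c z1 z2 d x a b" "quadrangle T' c z1 z2 d x a b"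
  unfolding quadrangle_def using base base_nz Z1 Z2 I' O A nz by (simp_all add: nzb_def zb_def z z')
 have sub: "{c, z1, z2, d, x, a, b} \<subseteq> P" using P abP by auto
 have h: "T x a c * T x b z2 = - (T x a z2 * T x b c)"
  by (rule harmonic[OF sub q(1)]) (use O in \<open>auto simp: zb_def z\<close>)
 have h': "T' x a c * T' x b z2 = - (T' x a z2 * T' x b c)"
  by (rule harmonic'[OF sub q(2)]) (use O in \<open>auto simp: zb_def z'\<close>)
 obtain x' y' z' where n: "RL (T x a b * T x c z2) (- (T x a c * T x b z2)) (T x a z2 * T x b c) x' y' z'"
  using N[OF P(2) abP(1,2) P(1,5)] unfolding N3_def by blast
 have eq: "- (T x a c * T x b z2) = T x a z2 * T x b c" "- (T' x a c * T' x b z2) = T' x a z2 * T' x b c"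
  using h h' by simp_all
 have "K3 (T' x) a b c z2" using K P abP by auto
 then have s: "T' x a b * T' x c z2 + T' x a z2 * T' x b c + T' x a z2 * T' x b c = 0"
  unfolding K3_def using eq(2) by (metis diff_conv_add_uminus)
 have "RL (T x a b * T x c z2) (T x a z2 * T x b c) (T x a z2 * T x b c) (T' x a b * T' x c z2) (T' x a z2 * T' x b c) (T' x a z2 * T' x b c)"
  by (rule RL_harmonicI[OF n[unfolded eq] _ _ s]) (use I nz A Z2 in \<open>auto simp: nzb_def zb_def z z'\<close>)
 then have "R x a b c z2" unfolding RLF_def eq .
 then have "R x z2 c a b" using R_swap12 R_swap23 R_swap34 by blast
 then have "R x d c a b"
  using Z2 base by (intro par[OF P(2,3,5,1) abP(1,2)]) (simp_all add: zb_perm nzb_perm)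
 then show ?thesis using R_swap12 R_swap23 R_swap34 by blast
qed

lemma one_on:
 assumes O: "nzb c a d" "zb c b d"
 shows "R x a b c d"
proof -
 note nz = one_on_nz[OF O]
 have s1: "zb z1 a b \<or> nzb z1 a b" using good_supp[OF good_z1] Z1(3) by (simp add: nzb_perm)
 have s2: "zb z2 a b \<or> nzb z2 a b" using good_supp[OF good_z2] Z2(3) by (simp add: nzb_perm)
 have s3: "zb a d z1 \<or> nzb a d z1" "zb a c z2 \<or> nzb a c z2" 
  using supp_cases[of a d z1] supp_cases[of a c z2] P abP ne by auto
 show ?thesis
 proof (cases "zb z1 a b \<or> zb z2 a b")
  case True
  \<comment> \<open>Seen from \<open>a\<close>, the point \<open>b\<close> is parallel to
    \<open>z1\<close> or to \<open>z2\<close>, so the relation at \<open>a\<close> is copied from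
    one without \<open>b\<close>.\<close>
  have r1: "R a z1 c x d" "R a z2 d x c" using ne P abP by (auto intro!: R0)
  have "R a x b c d"
   using True
  proof
   assume "zb z1 a b"
   then have "R a b c x d" using nz r1 by (intro par[OF abP(1,2) P(4,1,2,3)]) (simp_all add: zb_perm nzb_perm)
   then show ?thesis using R_swap12 R_swap23 R_swap34 by blast
  next
   assume "zb z2 a b"
   then have "R a b d x c" using nz r1 by (intro par[OF abP(1,2) P(5,3,2,1)]) (simp_all add: zb_perm nzb_perm)
   then show ?thesis using R_swap12 R_swap23 R_swap34 by blast
  qed
  then show ?thesis using one_on_final[OF O] by blast
 next
  case False
  then have I67: "T a b z1 ~= 0" "T a b z2 ~= 0" using s1 s2 by (auto simp: nzb_def z)
  show ?thesis
  proof (cases "T a b x = 0")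
   case True
   show ?thesis
   proof (cases "zb a d z1 & zb a c z2")
    case t: True
    then show ?thesis using one_on_fano[OF O True] zbD by blast
   next
    case f: False
    then consider "nzb a d z1" | "nzb a c z2" using s3 by blast
    then show ?thesis
    proof cases
     case 1
     show ?thesis by (rule one_on_unique[OF O True, of z1]) (use 1 nz in \<open>auto simp: nzb_perm\<close>)
    next
     case 2
     show ?thesis by (rule one_on_unique[OF O True, of z2]) (use 2 nz in \<open>auto simp: nzb_perm\<close>)
    qed
   qed
  next
   \<comment> \<open>In each of the three pencils below all pairs but one are known to be
     independent, so \<open>noU25\<close> yields exactly the stated collinearity.\<close>
   case F: False
   have "T a d z1 = 0"
    using noU25[OF abP(1) P(1,2,3,4) abP(2)] A O nz I67 F by (auto simp: nzb_def z)
   moreover have "T a c z2 = 0"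
    using noU25[OF abP(1) P(1,2,3,5) abP(2)] A O nz I67 F by (auto simp: nzb_def z)
   moreover have "T b z1 z2 = 0"
    using noU25[OF abP(2) P(1,2,4,5) abP(1)] A O nz I67 F by (auto simp: nzb_def z)
   ultimately show ?thesis using one_on_nonfano[OF O F] by blast
  qed
 qed
qed

end

text \<open>The hypotheses are symmetric in \<open>a\<close> and \<open>b\<close>; this provides
  \<open>one_on\<close> with the two exchanged.\<close>

sublocale path_config \<subseteq> swapped: path_config L \<Gamma> T T' P b a c x d z1 z2
 using P ne base Z1 Z2 A abP R0 supp by unfold_locales (auto simp: insert_commute)

context path_config
begin

lemma target: "R x a b c d"
proof -
 have "zb c a d \<or> nzb c a d" "zb c b d \<or> nzb c b d"
  using supp_cases[of c a d] supp_cases[of c b d] P abP ne by auto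
 then show ?thesis
  using both_off both_on one_on R_swap12[OF swapped.one_on] by blast
qed

end

lemma (in plane_pair) path_target:
 assumes P: "c \<in> P" "x \<in> P" "d \<in> P" "z1 \<in> P" "z2 \<in> P"
  and ne: "a ~: {c, x, d, z1, z2}" "b ~: {c, x, d, z1, z2}"
  and base: "T c x d ~= 0" and Z1: "T c x z1 = 0" "T z1 x d ~= 0" "T c z1 d ~= 0"
  and Z2: "T x d z2 = 0" "T c x z2 ~= 0" "T c z2 d ~= 0"
 shows "R x a b c d"
proof (cases "T x a c = 0 \<or> T x a d = 0 \<or> T x b c = 0 \<or> T x b d = 0")
 case True
 have s: "T x a c = 0 \<longleftrightarrow> T' x a c = 0" "T x a d = 0 \<longleftrightarrow> T' x a d = 0" "T x b c = 0 \<longleftrightarrow> T' x b c = 0"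
  "T x b d = 0 \<longleftrightarrow> T' x b d = 0" using P abP ne by (simp_all add: supp)
 show ?thesis by (rule RLF_trivial[OF N K]) (use P abP s True in auto)
next
 case False
 have c: "zb u v w \<longleftrightarrow> T u v w = 0" "nzb u v w \<longleftrightarrow> T u v w ~= 0" if "{u, v, w} \<subseteq> P" "a ~: {u, v, w} \<or> b ~: {u, v, w}" for u v w
  using supp[of u v w] that unfolding zb_def nzb_def by auto
 interpret path_config L \<Gamma> T T' P a b c x d z1 z2
  by unfold_locales (use False assms abP in \<open>simp_all add: c\<close>)
 show ?thesis by (rule target)
qed

section \<open>Relations in a pencil deduced from the pencils at other points\<close>

context plane
begin

text \<open>No bracket through \<open>p\<close> vanishes and \<open>q2, q3, q4\<close> are
  independent, so \<open>noU35\<close> puts \<open>q1\<close> on a line with two of them. The third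
  one is the other centre of a perspectivity.\<close>

lemma pencil_basis:
 assumes P: "p \<in> P" "q1 \<in> P" "q2 \<in> P" "q3 \<in> P" "q4 \<in> P"
  and full: "\<And>x y z. x \<in> P ==> y \<in> P ==> z \<in> P ==> T x y z = 0 \<longleftrightarrow> T' x y z = 0"
  and nz: "T p q1 q2 ~= 0" "T p q1 q3 ~= 0" "T p q1 q4 ~= 0" "T p q2 q3 ~= 0" "T p q2 q4 ~= 0" "T p q3 q4 ~= 0" "T q2 q3 q4 ~= 0"
  and C: "R q2 p q3 q4 q1" "R q3 p q2 q4 q1" "R q4 p q2 q3 q1"
 shows "R p q1 q2 q3 q4"
proof -
 have persp: "R u v l1 l2 l3" if "u \<in> P" "v \<in> P" "l1 \<in> P" "l2 \<in> P" "l3 \<in> P" "T l1 l2 l3 = 0" "T u l1 l2 ~= 0" "T v l1 l2 ~= 0"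
   "R v u l1 l2 l3" for u v l1 l2 l3
  using perspectivity[OF that(1-6)] full[OF that(3,4,5)] full[OF that(1,3,4)] full[OF that(2,3,4)] that(6-9) by blast
 have "T q1 q2 q3 = 0 \<or> T q1 q2 q4 = 0 \<or> T q1 q3 q4 = 0"
  using noU35[OF P] nz by blast
 then consider "T q3 q4 q1 = 0" | "T q2 q4 q1 = 0" | "T q2 q3 q1 = 0"
  unfolding perms(3)[where x = q1 and y = q3 and z = q4] perms(3)[where x = q1 and y = q2 and z = q4] perms(3)[where x = q1 and y = q2 and z = q3] by blast
 then show ?thesis
 proof cases
  case 1
  have "R p q2 q3 q4 q1" using persp[OF P(1,3,4,5,2) 1 nz(6,7) C(1)] .
  then show ?thesis using R_swap12[OF R_swap23[OF R_swap34]] by blast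
 next
  case 2
  have "T q3 q2 q4 ~= 0" using nz(7) by (simp add: z)
  then have "R p q3 q2 q4 q1" using persp[OF P(1,4,3,5,2) 2 nz(5) _ C(2)] by blast
  then show ?thesis using R_swap12 R_swap23 R_swap34 by blast
 next
  case 3
  have "T q4 q2 q3 ~= 0" using nz(7) perms(4)[where x = q2 and y = q3 and z = q4] by simp
  then have "R p q4 q2 q3 q1" using persp[OF P(1,5,3,4,2) 3 nz(4) _ C(3)] by blast
  then show ?thesis using R_swap12 R_swap23 R_swap34 by blast
 qed
qed

text \<open>If \<open>q2, q3, q4\<close> are collinear, the point \<open>g\<close> off their line
  helps. Either \<open>g\<close> is parallel to \<open>p\<close> and the relation at
  \<open>g\<close> is moved to \<open>p\<close>, or \<open>noU25\<close> at \<open>p\<close> makes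
  \<open>g\<close> parallel to one of the four points, which is replaced by \<open>g\<close> so that
  \<open>pencil_basis\<close> applies.\<close>

lemma pencil:
 assumes P: "p \<in> P" "q1 \<in> P" "q2 \<in> P" "q3 \<in> P" "q4 \<in> P" "g \<in> P"
  and full: "\<And>x y z. x \<in> P ==> y \<in> P ==> z \<in> P ==> T x y z = 0 \<longleftrightarrow> T' x y z = 0"
  and nz: "T p q1 q2 ~= 0" "T p q1 q3 ~= 0" "T p q1 q4 ~= 0" "T p q2 q3 ~= 0" "T p q2 q4 ~= 0" "T p q3 q4 ~= 0"
  and g: "T q2 q3 g ~= 0"
  and C: "\<And>n x y z w. n \<in> {q2, q3, q4, g} ==> {x, y, z, w} \<subseteq> P ==> R n x y z w"
 shows "R p q1 q2 q3 q4"
proof (cases "T q2 q3 q4 = 0")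
 case False
 show ?thesis using P by (intro pencil_basis[OF P(1-5) full nz False] C) auto
next
 case line: True
 have par: "R r e b c d" if "r \<in> P" "e \<in> P" "f \<in> P" "b \<in> P" "c \<in> P" "d \<in> P" "T r e f = 0" "T r e b ~= 0" "T r f b ~= 0" "R r f b c d"
  for r e f b c d
  using parallel_change[OF that(1-7)] full[OF that(1-3)] full[OF that(1,2,4)] full[OF that(1,3,4)] that(7-10) by blast
 have l': "T q3 q2 q4 = 0" using line by (simp add: z)
 have n0: "T q3 q2 g ~= 0" "T q3 q4 p ~= 0" "T q2 q4 p ~= 0" using g nz by (simp_all add: z)
 have "T q3 q4 g ~= 0" using collinear_nz[OF P(4,3,5,6,1) l' n0(1,2)] .
 then have g34: "T g q3 q4 ~= 0" by (simp add: z)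
 have "T q2 q4 g ~= 0" using collinear_nz[OF P(3,4,5,6,1) line g n0(3)] .
 then have g24: "T q2 g q4 ~= 0" by (simp add: z)
 show ?thesis
 proof (cases "T p g q2 = 0 & T p g q3 = 0")
  case True
  have loop: "T p g y = 0" if "y \<in> P" for y
  proof -
   have "T p g y * T p q2 q3 = T p g q3 * T p q2 y" using collinear[OF P(1,6,3) that P(4)] True by blast
   then show ?thesis using True nz by simp
  qed
  have "T q3 p g = 0" "T q3 p q1 ~= 0" "T q3 g q2 ~= 0" using loop[OF P(4)] nz(2) g by (simp_all add: z)
  then have "T q3 g q1 ~= 0" using collinear_nz[OF P(4,1,6,2,3)] by blast
  then have gn: "T g q1 q3 ~= 0" by (simp add: z)
  have r: "R g q1 q2 q3 q4" using P by (intro C) auto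
  show ?thesis
   by (rule centre_change[OF P(1,6,2,3,4,5) loop[OF P(2)] loop[OF P(4)] loop[OF P(5)] _ _ _ nz(6) g34 gn _ _ _ r])
    (use loop[OF P(2)] loop[OF P(4)] loop[OF P(5)] nz(6) g34 gn full[OF P(1,6,2)] full[OF P(1,6,4)] full[OF P(1,6,5)]
     full[OF P(1,4,5)] full[OF P(6,4,5)] full[OF P(6,2,4)] in blast)+
 next
  case False
  then obtain y where y: "y \<in> P" "T p g y ~= 0" using P by blast
  have gq: "T p g q ~= 0" "T p q g ~= 0" if "q' \<in> P" "q \<in> P" "T p q' g = 0" "T p q' q ~= 0" for q q'
  proof -
   show "T p g q ~= 0" using collinear_nz[OF P(1) that(1) P(6) that(2) y(1) that(3,4) y(2)] .
   then show "T p q g ~= 0" by (simp add: z)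
  qed
  have Cg: "R n x y z w" if "n = q2 \<or> n = q3 \<or> n = q4 \<or> n = g" "x \<in> P" "y \<in> P" "z \<in> P" "w \<in> P" for n x y z w
   using C[of n x y z w] that by auto
  have "T p q1 g = 0 \<or> T p q2 g = 0 \<or> T p q3 g = 0 \<or> T p q4 g = 0"
   using noU25[OF P] nz by blast
  then consider "T p q1 g = 0" | "T p q2 g = 0" | "T p q3 g = 0" | "T p q4 g = 0" by blast
  then show ?thesis
  proof cases
   case 1
   note n = gq[OF P(2) P(3) 1 nz(1)] gq[OF P(2) P(4) 1 nz(2)] gq[OF P(2) P(5) 1 nz(3)]
   have "R p q2 g q3 q4"
    by (rule pencil_basis[OF P(1,3,6,4,5) full n(2) nz(4,5) n(3,5) nz(6) g34]) (auto intro!: Cg simp: P)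
   then have r: "R p g q2 q3 q4" by (rule R_swap12)
   show ?thesis by (rule par[OF P(1,2,6,3,4,5) 1 nz(1) n(1) r])
  next
   case 2
   have s: "T p q2 q1 ~= 0" using nz by (simp add: z)
   note n = gq[OF P(3) P(2) 2 s] gq[OF P(3) P(4) 2 nz(4)] gq[OF P(3) P(5) 2 nz(5)]
   have "R p q1 g q3 q4"
    by (rule pencil_basis[OF P(1,2,6,4,5) full n(2) nz(2,3) n(3,5) nz(6) g34]) (auto intro!: Cg simp: P)
   then have r: "R p g q1 q3 q4" by (rule R_swap12)
   have "R p q2 q1 q3 q4" by (rule par[OF P(1,3,6,2,4,5) 2 s n(1) r])
   then show ?thesis by (rule R_swap12)
  next
   case 3
   have s: "T p q3 q1 ~= 0" "T p q3 q2 ~= 0" using nz by (simp_all add: z)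
   note n = gq[OF P(4) P(2) 3 s(1)] gq[OF P(4) P(3) 3 s(2)] gq[OF P(4) P(5) 3 nz(6)]
   have "R p q1 q2 g q4"
    by (rule pencil_basis[OF P(1,2,3,6,5) full nz(1) n(2) nz(3) n(4) nz(5) n(5) g24]) (auto intro!: Cg simp: P)
   then have r: "R p g q1 q2 q4" using R_swap12 R_swap23 by blast
   have "R p q3 q1 q2 q4" by (rule par[OF P(1,4,6,2,3,5) 3 s(1) n(1) r])
   then show ?thesis using R_swap12 R_swap23 by blast
  next
   case 4
   have s: "T p q4 q1 ~= 0" "T p q4 q2 ~= 0" "T p q4 q3 ~= 0" using nz by (simp_all add: z)
   note n = gq[OF P(5) P(2) 4 s(1)] gq[OF P(5) P(3) 4 s(2)] gq[OF P(5) P(4) 4 s(3)]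
   have "R p q1 q2 q3 g"
    by (rule pencil_basis[OF P(1,2,3,4,6) full nz(1,2) n(2) nz(4) n(4) n(6) g]) (auto intro!: Cg simp: P)
   then have r: "R p g q1 q2 q3" using R_swap12 R_swap23 R_swap34 by blast
   have "R p q4 q1 q2 q3" by (rule par[OF P(1,5,6,2,3,4) 4 s(1) n(1) r])
   then show ?thesis using R_swap12 R_swap23 R_swap34 by blast
  qed
 qed
qed

end

section \<open>Three-term relations from coordinates\<close>

lemma K3_swap12: "alt2 F ==> K3 F a b c d ==> K3 F b a c d"
 unfolding K3_def using alt2_flip[of F a b] by (simp add: algebra_simps)

lemma K3_swap23: "alt2 F ==> K3 F a b c d ==> K3 F a c b d"
 unfolding K3_def using alt2_flip[of F b c] by (simp add: algebra_simps)

lemma K3_swap34: "alt2 F ==> K3 F a b c d ==> K3 F a b d c"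
 unfolding K3_def using alt2_flip[of F c d] by (simp add: algebra_simps)

text \<open>Relative to the frame \<open>e, f\<close> every bracket is a two by two determinant of
  coordinates, and for these the relation is an identity.\<close>

lemma K3_coords2:
 fixes F :: "'a => 'a => 'f::field"
 assumes nz: "F e f ~= 0"
  and K: "\<And>x y. {x, y} \<subseteq> {a, b, c, d} ==> K3 F x y e f"
 shows "K3 F a b c d"
proof -
 have k: "F x y * F e f = F x e * F y f - F x f * F y e" if "{x, y} \<subseteq> {a, b, c, d}" for x y
  using K[OF that] unfolding K3_def by (simp add: algebra_simps)
 have k': "F a b * F e f = F a e * F b f - F a f * F b e" "F c d * F e f = F c e * F d f - F c f * F d e"
  "F a c * F e f = F a e * F c f - F a f * F c e" "F b d * F e f = F b e * F d f - F b f * F d e"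
  "F a d * F e f = F a e * F d f - F a f * F d e" "F b c * F e f = F b e * F c f - F b f * F c e"
  by (auto intro!: k)
 have "(F a b * F e f) * (F c d * F e f) - (F a c * F e f) * (F b d * F e f) + (F a d * F e f) * (F b c * F e f) = 0"
  unfolding k' by (simp add: algebra_simps)
 then have "(F e f * F e f) * (F a b * F c d - F a c * F b d + F a d * F b c) = 0" by (simp add: algebra_simps)
 then show ?thesis unfolding K3_def using nz by simp
qed

definition det3 :: "'f::field => 'f => 'f => 'f => 'f => 'f => 'f => 'f => 'f => 'f" where
 "det3 x1 x2 x3 y1 y2 y3 z1 z2 z3 = x1 * (y2 * z3 - y3 * z2) - x2 * (y1 * z3 - y3 * z1) + x3 * (y1 * z2 - y2 * z1)"

text \<open>Cramer's rule for the frame \<open>e1, e2, e3\<close>. The relations at the frame points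
  express their brackets by two by two minors, and those at \<open>w\<close> express
  \<open>T w u v\<close> times each coordinate of \<open>w\<close>. Some coordinate is nonzero
  unless \<open>w\<close> is a loop, which is what \<open>loop\<close> is for.\<close>

lemma det3_coords:
 fixes T :: "'a => 'a => 'a => 'f::field"
 assumes alt: "alt3 T" and e: "e1 \<in> N0" "e2 \<in> N0" "e3 \<in> N0" and P: "N0 \<subseteq> P" and nz: "T e1 e2 e3 ~= 0"
  and K: "\<And>w p q r t. w \<in> N0 ==> {p, q, r, t} \<subseteq> P ==> K3 (T w) p q r t"
  and loop: "\<And>w u v. w \<in> N0 ==> {u, v} \<subseteq> P ==> T w e1 e2 = 0 ==> T w e1 e3 = 0 ==> T w e2 e3 = 0 ==> T w u v = 0"
  and w: "w \<in> N0" "u \<in> P" "v \<in> P"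
 shows "T w u v * (T e1 e2 e3 * T e1 e2 e3) = det3 (T w e2 e3) (T e1 w e3) (T e1 e2 w) (T u e2 e3) (T e1 u e3) (T e1 e2 u)
  (T v e2 e3) (T e1 v e3) (T e1 e2 v)"
proof -
 note p = alt3_perms[OF alt]
 let ?t = "T e1 e2 e3"
 have eP: "e1 \<in> P" "e2 \<in> P" "e3 \<in> P" "w \<in> P" using e P w by auto
 have c1: "T e1 x y * ?t = T e1 x e3 * T e1 e2 y - T e1 e2 x * T e1 y e3" if "x \<in> P" "y \<in> P" for x y
 proof -
  have "T e1 x y * T e1 e2 e3 - T e1 x e2 * T e1 y e3 + T e1 x e3 * T e1 y e2 = 0"
   using K[OF e(1), of x y e2 e3] that eP unfolding K3_def by auto
  then show ?thesis unfolding p(2)[where x = e1 and y = e2 and z = x] p(2)[where x = e1 and y = e2 and z = y]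
   by (simp add: algebra_simps)
 qed
 have c2: "T e2 x y * ?t = T e1 e2 x * T y e2 e3 - T x e2 e3 * T e1 e2 y" if "x \<in> P" "y \<in> P" for x y
 proof -
  have "T e2 x y * T e2 e3 e1 - T e2 x e3 * T e2 y e1 + T e2 x e1 * T e2 y e3 = 0"
   using K[OF e(2), of x y e3 e1] that eP unfolding K3_def by auto
  then show ?thesis unfolding p(3)[where x = e1 and y = e2 and z = e3] p(1)[where x = x and y = e2 and z = e3]
    p(1)[where x = y and y = e2 and z = e3] p(3)[where x = e1 and y = e2 and z = x] p(3)[where x = e1 and y = e2 and z = y]
   by (simp add: algebra_simps)
 qed
 have c3: "T e3 x y * ?t = T x e2 e3 * T e1 y e3 - T e1 x e3 * T y e2 e3" if "x \<in> P" "y \<in> P" for x y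
 proof -
  have "T e3 x y * T e3 e1 e2 - T e3 x e1 * T e3 y e2 + T e3 x e2 * T e3 y e1 = 0"
   using K[OF e(3), of x y e1 e2] that eP unfolding K3_def by auto
  then show ?thesis unfolding p(4)[where x = e1 and y = e2 and z = e3] p(5)[where x = e1 and y = x and z = e3] p(2)[where x = e1 and y = x and z = e3]
    p(4)[where x = y and y = e2 and z = e3] p(4)[where x = x and y = e2 and z = e3] p(4)[where x = e1 and y = y and z = e3]
    p(3)[where x = e1 and y = x and z = e3] p(3)[where x = e1 and y = y and z = e3] p(4)[where x = e1 and y = x and z = e3]
    p(5)[where x = y and y = e2 and z = e3] p(5)[where x = x and y = e2 and z = e3] p(5)[where x = e1 and y = y and z = e3]
   by (simp add: algebra_simps)
 qed
 have r: "T w x e1 = T e1 w x" "T w x e2 = T e2 w x" "T w x e3 = T e3 w x" for x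
  by (rule p(3))+
 show ?thesis
 proof (cases "T w e1 e2 = 0 & T w e1 e3 = 0 & T w e2 e3 = 0")
  case True
  then have "T e1 e2 w = 0" "T e1 w e3 = 0" "T w e2 e3 = 0" using alt3_zero[OF alt] by metis+
  then show ?thesis using loop[OF w(1), of u v] True w unfolding det3_def by simp
 next
  case False
  have "T w u v * T w e1 e2 - T w u e1 * T w v e2 + T w u e2 * T w v e1 = 0"
   using K[OF w(1), of u v e1 e2] w eP unfolding K3_def by auto
  then have k3: "T w u v * T e1 e2 w = T e1 w u * T e2 w v - T e2 w u * T e1 w v"
   unfolding r[of u] r[of v] p(4)[where x = e1 and y = e2 and z = w] by (simp add: algebra_simps)
  have "T w u v * T w e2 e3 - T w u e2 * T w v e3 + T w u e3 * T w v e2 = 0"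
   using K[OF w(1), of u v e2 e3] w eP unfolding K3_def by auto
  then have k1: "T w u v * T w e2 e3 = T e2 w u * T e3 w v - T e3 w u * T e2 w v"
   unfolding r[of u] r[of v] by (simp add: algebra_simps)
  have "T w u v * T w e3 e1 - T w u e3 * T w v e1 + T w u e1 * T w v e3 = 0"
   using K[OF w(1), of u v e3 e1] w eP unfolding K3_def by auto
  then have k2: "T w u v * T e1 w e3 = T e3 w u * T e1 w v - T e1 w u * T e3 w v"
   unfolding r[of u] r[of v] p(3)[where x = e1 and y = w and z = e3] by (simp add: algebra_simps)
  note cs = c1[OF eP(4) w(2)] c1[OF eP(4) w(3)] c2[OF eP(4) w(2)] c2[OF eP(4) w(3)] c3[OF eP(4) w(2)] c3[OF eP(4) w(3)]
  let ?d = "det3 (T w e2 e3) (T e1 w e3) (T e1 e2 w) (T u e2 e3) (T e1 u e3) (T e1 e2 u) (T v e2 e3) (T e1 v e3) (T e1 e2 v)"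
  have "T w u v * (?t * ?t) * T e1 e2 w = ?d * T e1 e2 w"
  proof -
   have "T w u v * (?t * ?t) * T e1 e2 w = (?t * ?t) * (T e1 w u * T e2 w v - T e2 w u * T e1 w v)" unfolding k3[symmetric] by (simp add: ac_simps)
   also have "\<dots> = (T e1 w u * ?t) * (T e2 w v * ?t) - (T e2 w u * ?t) * (T e1 w v * ?t)" by (simp add: algebra_simps)
   also have "\<dots> = ?d * T e1 e2 w" unfolding cs det3_def by (simp add: algebra_simps)
   finally show ?thesis .
  qed
  moreover have "T w u v * (?t * ?t) * T w e2 e3 = ?d * T w e2 e3"
  proof -
   have "T w u v * (?t * ?t) * T w e2 e3 = (?t * ?t) * (T e2 w u * T e3 w v - T e3 w u * T e2 w v)" unfolding k1[symmetric] by (simp add: ac_simps)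
   also have "\<dots> = (T e2 w u * ?t) * (T e3 w v * ?t) - (T e3 w u * ?t) * (T e2 w v * ?t)" by (simp add: algebra_simps)
   also have "\<dots> = ?d * T w e2 e3" unfolding cs det3_def by (simp add: algebra_simps)
   finally show ?thesis .
  qed
  moreover have "T w u v * (?t * ?t) * T e1 w e3 = ?d * T e1 w e3"
  proof -
   have "T w u v * (?t * ?t) * T e1 w e3 = (?t * ?t) * (T e3 w u * T e1 w v - T e1 w u * T e3 w v)" unfolding k2[symmetric] by (simp add: ac_simps)
   also have "\<dots> = (T e3 w u * ?t) * (T e1 w v * ?t) - (T e1 w u * ?t) * (T e3 w v * ?t)" by (simp add: algebra_simps)
   also have "\<dots> = ?d * T e1 w e3" unfolding cs det3_def by (simp add: algebra_simps)
   finally show ?thesis .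
  qed
  moreover have "T e1 e2 w ~= 0 \<or> T e1 w e3 ~= 0 \<or> T w e2 e3 ~= 0" using False alt3_zero[OF alt] by metis
  ultimately show ?thesis using mult_right_cancel by blast
 qed
qed

text \<open>Relations are supposed at centres in \<open>N0\<close> only; rewriting brackets as
  determinants extends them to an arbitrary centre \<open>z\<close> and an arbitrary first argument
  \<open>p\<close>. Each bracket occurring here contains a point of \<open>N0\<close>, to which
  \<open>det3_coords\<close> applies. In the gluing, \<open>N0\<close> avoids \<open>a\<close> and
  \<open>b\<close>.\<close>

lemma K3_coords3:
 fixes T :: "'a => 'a => 'a => 'f::field"
 assumes alt: "alt3 T" and e: "e1 \<in> N0" "e2 \<in> N0" "e3 \<in> N0" and P: "N0 \<subseteq> P" and nz: "T e1 e2 e3 ~= 0"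
  and K: "\<And>w p q r t. w \<in> N0 ==> {p, q, r, t} \<subseteq> P ==> K3 (T w) p q r t"
  and loop: "\<And>w u v. w \<in> N0 ==> {u, v} \<subseteq> P ==> T w e1 e2 = 0 ==> T w e1 e3 = 0 ==> T w e2 e3 = 0 ==> T w u v = 0"
  and z: "z \<in> P" "p \<in> P" "q \<in> N0" "r \<in> N0" "t \<in> N0"
 shows "K3 (T z) p q r t"
proof -
 have d: "T z x y * (T e1 e2 e3 * T e1 e2 e3) = det3 (T z e2 e3) (T e1 z e3) (T e1 e2 z) (T x e2 e3) (T e1 x e3) (T e1 e2 x)
  (T y e2 e3) (T e1 y e3) (T e1 e2 y)" if "x \<in> P" "y \<in> N0" for x y
 proof -
  have "T z x y = T y z x" by (rule alt3_perms(3)[OF alt])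
  moreover have "T y z x * (T e1 e2 e3 * T e1 e2 e3) = det3 (T y e2 e3) (T e1 y e3) (T e1 e2 y) (T z e2 e3) (T e1 z e3) (T e1 e2 z)
   (T x e2 e3) (T e1 x e3) (T e1 e2 x)"
   by (rule det3_coords[OF alt e P nz _ _ that(2) z(1) that(1)]; (rule K | rule loop); assumption)
  ultimately show ?thesis unfolding det3_def by (simp add: algebra_simps)
 qed
 let ?t = "T e1 e2 e3 * T e1 e2 e3"
 have zP: "q \<in> P" "r \<in> P" "t \<in> P" using z P by auto
 have "(T z p q * ?t) * (T z r t * ?t) - (T z p r * ?t) * (T z q t * ?t) + (T z p t * ?t) * (T z q r * ?t) = 0"
  unfolding d[OF z(2,3)] d[OF zP(2) z(5)] d[OF z(2,4)] d[OF zP(1) z(5)] d[OF z(2,5)] d[OF zP(1) z(4)] det3_def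
  by (simp add: algebra_simps)
 then have "(?t * ?t) * (T z p q * T z r t - T z p r * T z q t + T z p t * T z q r) = 0" by (simp add: algebra_simps)
 then show ?thesis using nz unfolding K3_def by simp
qed

section \<open>Set functions with signs\<close>

lemma K3_nondistinct:
 assumes alt: "alt2 F" and "\<not> distinct [a, b, c, d]" shows "K3 F a b c d"
proof -
 have z: "F x x = 0" for x using alt unfolding alt2_def by blast
 have f: "F y x = - F x y" for x y using alt2_flip[OF alt] .
 consider "a = b" | "a = c" | "a = d" | "b = c" | "b = d" | "c = d" using assms(2) by auto
 then show ?thesis
 proof cases
  case 2 then show ?thesis using f[of a b] by (simp add: K3_def z mult.commute)
 next
  case 3 then show ?thesis using f[of b d] f[of c d] by (simp add: K3_def z mult.commute)
 next
  case 5 then show ?thesis using f[of b c] by (simp add: K3_def z mult.commute)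
 qed (simp_all add: K3_def z mult.commute)
qed

locale signed_lifting = lifting L \<Gamma> for L :: "'p::field => 'p => 'p => 'k::field => 'k => 'k => bool" and \<Gamma> +
 fixes s :: "'a => 'a => int"
 assumes s_flip: "s y x = - s x y" and s_unit: "x ~= y ==> s x y = 1 \<or> s x y = - 1"
begin

text \<open>\<open>s\<close> plays the role of the sign of the order of two elements. An alternating function on
 tuples becomes a function \<open>D\<close> on sets; \<open>br\<close> and \<open>T3\<close> restore the alternation in two and three arguments.\<close>

definition br :: "('a set => 'f::field) => 'a set => 'a => 'a => 'f" where
 "br D J x y = of_int (s x y) * D (insert x (insert y J))"

definition T3 :: "('a set => 'f::field) => 'a set => 'a => 'a => 'a => 'f" where
 "T3 D K x y z = of_int (s x y) * of_int (s x z) * of_int (s y z) * D (insert x (insert y (insert z K)))"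

lemma s_self: "s x x = 0" using s_flip[of x x] by simp

lemma s_sq: "x ~= y ==> (of_int (s x y) :: 'f::field) * of_int (s x y) = 1"
 using s_unit[of x y] by auto

lemma s_nz: "x ~= y ==> (of_int (s x y) :: 'f::field) ~= 0"
 using s_unit[of x y] by auto

lemma s_\<Gamma>: "x ~= y ==> (of_int (s x y) :: 'k) \<in> \<Gamma>"
 using s_unit[of x y] unit_subgroupD(1)[OF subgroup] neg_one by auto

lemma alt2_br: "alt2 (br D J)"
 unfolding alt2_def br_def by (metis (no_types, opaque_lifting) insert_commute mult_minus_left mult_zero_left of_int_0 of_int_minus s_flip s_self)

lemma alt3_T3: "alt3 (T3 D K)"
 unfolding alt3_def
proof (intro conjI allI)
 show "T3 D K y x z = - T3 D K x y z" for x y z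
  unfolding T3_def s_flip[of y x] by (simp add: insert_commute)
 show "T3 D K x z y = - T3 D K x y z" for x y z
  unfolding T3_def s_flip[of z y] by (simp add: insert_commute)
 show "T3 D K x x z = 0" for x z unfolding T3_def by (simp add: s_self)
qed

lemma br_zero: "br D J x y = 0 \<longleftrightarrow> x = y \<or> D (insert x (insert y J)) = 0"
 unfolding br_def using s_nz[of x y] by (auto simp: s_self)

lemma T3_zero: "T3 D K x y z = 0 \<longleftrightarrow> x = y \<or> x = z \<or> y = z \<or> D (insert x (insert y (insert z K))) = 0"
 unfolding T3_def using s_nz[of x y] s_nz[of x z] s_nz[of y z] by (auto simp: s_self)

text \<open>Contracting \<open>x\<close> costs the signs \<open>s x y\<close> and
  \<open>s x z\<close>, each depending on one argument, hence a mere rescaling of the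
  pencil.\<close>

lemma br_T3:
 assumes "x ~= y" "x ~= z"
 shows "br D (insert x K) y z = of_int (s x y) * of_int (s x z) * T3 D K x y z"
proof -
 have "insert y (insert z (insert x K)) = insert x (insert y (insert z K))" by blast
 moreover have "of_int (s x y) * of_int (s x z) * (of_int (s x y) * of_int (s x z) * of_int (s y z) * D (insert x (insert y (insert z K))))
  = (of_int (s x y) * of_int (s x y)) * (of_int (s x z) * of_int (s x z)) * (of_int (s y z) * D (insert x (insert y (insert z K))))"
  by (simp add: ac_simps)
 ultimately show ?thesis unfolding br_def T3_def by (simp add: s_sq assms)
qed

lemma T3_br:
 assumes "x ~= y" "x ~= z"
 shows "T3 D K x y z = of_int (s x y) * of_int (s x z) * br D (insert x K) y z"
proof -
 have "of_int (s x y) * of_int (s x z) * (of_int (s x y) * of_int (s x z) * T3 D K x y z)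
  = (of_int (s x y) * of_int (s x y)) * (of_int (s x z) * of_int (s x z)) * T3 D K x y z" by (simp add: ac_simps)
 then show ?thesis unfolding br_T3[OF assms] by (simp add: s_sq assms)
qed

text \<open>Each of the three products contains every one of the four points once, so factors
  attached to points come out as one common factor.\<close>

lemma RLF_scaled:
 assumes R: "RLF G G' p q r t"
  and f: "\<And>x. x \<in> {p, q, r, t} ==> f x ~= 0" "\<And>x. x \<in> {p, q, r, t} ==> f' x ~= 0"
  and F: "\<And>x y. {x, y} \<subseteq> {p, q, r, t} ==> F x y = f x * f y * G x y"
  and F': "\<And>x y. {x, y} \<subseteq> {p, q, r, t} ==> F' x y = f' x * f' y * G' x y"
 shows "RLF F F' p q r t"
proof -
 let ?c = "f p * f q * f r * f t" and ?c' = "f' p * f' q * f' r * f' t"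
 have "F p q * F r t = ?c * (G p q * G r t)" "- (F p r * F q t) = ?c * (- (G p r * G q t))" "F p t * F q r = ?c * (G p t * G q r)"
  by (simp_all add: F ac_simps)
 moreover have "F' p q * F' r t = ?c' * (G' p q * G' r t)" "- (F' p r * F' q t) = ?c' * (- (G' p r * G' q t))" "F' p t * F' q r = ?c' * (G' p t * G' q r)"
  by (simp_all add: F' ac_simps)
 moreover have "?c ~= 0" "?c' ~= 0" using f by auto
 ultimately show ?thesis using RL_scale[OF R[unfolded RLF_def], of ?c ?c'] unfolding RLF_def by metis
qed

lemma N3_scaled:
 assumes R: "N3 G p q r t"
  and f: "\<And>x. x \<in> {p, q, r, t} ==> f x ~= 0"
  and F: "\<And>x y. {x, y} \<subseteq> {p, q, r, t} ==> F x y = f x * f y * G x y"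
 shows "N3 F p q r t"
proof -
 let ?c = "f p * f q * f r * f t"
 have e: "F p q * F r t = ?c * (G p q * G r t)" "- (F p r * F q t) = ?c * (- (G p r * G q t))" "F p t * F q r = ?c * (G p t * G q r)"
  by (simp_all add: F ac_simps)
 have "?c ~= 0" using f by auto
 moreover obtain x' y' z' where r: "RL (G p q * G r t) (- (G p r * G q t)) (G p t * G q r) x' y' z'" using R unfolding N3_def by blast
 ultimately show ?thesis unfolding N3_def e using RL_scale[OF r _ one_neq_zero] by blast
qed

lemma K3_scaled:
 assumes R: "K3 G p q r t"
  and F: "\<And>x y. {x, y} \<subseteq> {p, q, r, t} ==> F x y = f x * f y * G x y"
 shows "K3 F p q r t"
proof -
 let ?c = "f p * f q * f r * f t"
 have e: "F p q * F r t = ?c * (G p q * G r t)" "F p r * F q t = ?c * (G p r * G q t)" "F p t * F q r = ?c * (G p t * G q r)"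
  by (simp_all add: F ac_simps)
 have "F p q * F r t - F p r * F q t + F p t * F q r = ?c * (G p q * G r t - G p r * G q t + G p t * G q r)"
  unfolding e by (simp add: algebra_simps)
 then show ?thesis using R unfolding K3_def by simp
qed

lemma RL_zero: "RL 0 0 0 0 0 0" unfolding RL_def by simp

lemma T3_self: "T3 D K x x y = 0" "T3 D K x y x = 0"
 unfolding T3_def by (simp_all add: s_self)

lemma RLF_T3I:
 assumes "x ~: {p, q, r, t} ==> RLF (br D (insert x K)) (br D' (insert x K)) p q r t"
 shows "RLF (T3 D K x) (T3 D' K x) p q r t"
proof (cases "x \<in> {p, q, r, t}")
 case True
 then show ?thesis unfolding RLF_def by (elim insertE) (simp_all add: T3_self RL_zero)
next
 case False
 show ?thesis
  by (rule RLF_scaled[OF assms[OF False], where f = "\<lambda>y. of_int (s x y)" and f' = "\<lambda>y. of_int (s x y)"])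
   (use False in \<open>auto intro!: T3_br s_nz\<close>)
qed

lemma RLF_brI:
 assumes "RLF (T3 D K x) (T3 D' K x) p q r t" "x ~: {p, q, r, t}"
 shows "RLF (br D (insert x K)) (br D' (insert x K)) p q r t"
 by (rule RLF_scaled[OF assms(1), where f = "\<lambda>y. of_int (s x y)" and f' = "\<lambda>y. of_int (s x y)"])
   (use assms(2) in \<open>auto intro!: br_T3 s_nz\<close>)

lemma N3_T3I:
 assumes "x ~: {p, q, r, t} ==> N3 (br D (insert x K)) p q r t"
 shows "N3 (T3 D K x) p q r t"
proof (cases "x \<in> {p, q, r, t}")
 case True
 then show ?thesis unfolding N3_def by (elim insertE) (use RL_zero in \<open>auto simp: T3_self\<close>)
next
 case False
 show ?thesis
  by (rule N3_scaled[OF assms[OF False], where f = "\<lambda>y. of_int (s x y)"])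
   (use False in \<open>auto intro!: T3_br s_nz\<close>)
qed

lemma K3_T3I:
 assumes "x ~: {p, q, r, t} ==> K3 (br D (insert x K)) p q r t"
 shows "K3 (T3 D K x) p q r t"
proof (cases "x \<in> {p, q, r, t}")
 case True
 then show ?thesis unfolding K3_def by (elim insertE) (simp_all add: T3_self)
next
 case False
 show ?thesis
  by (rule K3_scaled[OF assms[OF False], where f = "\<lambda>y. of_int (s x y)"])
   (use False in \<open>auto intro!: T3_br\<close>)
qed

lemma K3_brI:
 assumes "K3 (T3 D K x) p q r t" "x ~: {p, q, r, t}"
 shows "K3 (br D (insert x K)) p q r t"
 by (rule K3_scaled[OF assms(1), where f = "\<lambda>y. of_int (s x y)"]) (use assms(2) in \<open>auto intro!: br_T3\<close>)

lemma RLF_nondistinct: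
 assumes "\<not> distinct [a, b, c, d]"
  and S: "\<And>x y. {x, y} \<subseteq> {a, b, c, d} ==> br D J x y = 0 \<longleftrightarrow> br D' J x y = 0"
 shows "RLF (br D J) (br D' J) a b c d"
proof -
 have k: "K3 (br D J) a b c d" "K3 (br D' J) a b c d" using K3_nondistinct[OF alt2_br assms(1)] by auto
 have s: "br D J a b = 0 \<longleftrightarrow> br D' J a b = 0" "br D J a c = 0 \<longleftrightarrow> br D' J a c = 0" "br D J a d = 0 \<longleftrightarrow> br D' J a d = 0"
  "br D J b c = 0 \<longleftrightarrow> br D' J b c = 0" "br D J b d = 0 \<longleftrightarrow> br D' J b d = 0" "br D J c d = 0 \<longleftrightarrow> br D' J c d = 0"
  by (rule S; simp)+
 have z: "br D J a b * br D J c d = 0 \<or> br D J a c * br D J b d = 0 \<or> br D J a d * br D J b c = 0"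
  using assms(1) by (auto simp: br_zero)
 have "br D J a b * br D J c d + - (br D J a c * br D J b d) + br D J a d * br D J b c = 0"
  "br D' J a b * br D' J c d + - (br D' J a c * br D' J b d) + br D' J a d * br D' J b c = 0"
  using k unfolding K3_def by simp_all
 then show ?thesis unfolding RLF_def RL_def using s z by simp
qed

text \<open>\<open>prep E \<B> D\<close>: \<open>D\<close> represents the matroid over the source pasture. \<open>right E \<B> D D'\<close>: \<open>D'\<close> has values in \<open>\<Gamma>\<close>
 and lifts every three-term relation of \<open>D\<close>.\<close>

definition prep :: "'a set => 'a set set => ('a set => 'p) => bool" where
 "prep E \<B> D \<longleftrightarrow> (\<forall>B\<subseteq>E. D B ~= 0 \<longleftrightarrow> B \<in> \<B>) &
   (\<forall>J\<subseteq>E. \<forall>a\<in>E - J. \<forall>b\<in>E - J. \<forall>c\<in>E - J. \<forall>d\<in>E - J. N3 (br D J) a b c d)"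

definition right :: "'a set => 'a set set => ('a set => 'p) => ('a set => 'k) => bool" where
 "right E \<B> D D' \<longleftrightarrow> (\<forall>B\<subseteq>E. D' B ~= 0 \<longleftrightarrow> B \<in> \<B>) & (\<forall>B\<in>\<B>. D' B \<in> \<Gamma>) &
   (\<forall>J\<subseteq>E. \<forall>a\<in>E - J. \<forall>b\<in>E - J. \<forall>c\<in>E - J. \<forall>d\<in>E - J. RLF (br D J) (br D' J) a b c d)"

end

text \<open>No minor is uniform of rank \<open>k\<close> on five elements: \<open>J\<close> is contracted and \<open>A\<close> is kept.\<close>

definition noU :: "nat => 'a set => 'a set set => bool" where
 "noU k E \<B> \<longleftrightarrow> (\<forall>J A. J \<union> A \<subseteq> E \<longrightarrow> J \<inter> A = {} \<longrightarrow> card A = 5 \<longrightarrow> (\<exists>C\<subseteq>A. card C = k & J \<union> C ~: \<B>))"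

lemma noUD:
 assumes "noU k E \<B>" "J \<union> A \<subseteq> E" "J \<inter> A = {}" "card A = 5"
 shows "\<exists>C. C \<subseteq> A & card C = k & J \<union> C ~: \<B>"
 using assms unfolding noU_def by blast

section \<open>Planes obtained by contraction\<close>

context signed_lifting
begin

text \<open>On the target side the three-term relations suffice, so the plane is at hand for the
  glued function before any lifting relation through \<open>a\<close> and \<open>b\<close> is
  proved.\<close>

lemma plane_contract:
 assumes D: "prep E \<B> D" and U: "noU 2 E \<B>" "noU 3 E \<B>" and K: "K \<subseteq> E"
  and K3: "\<And>J p q r t. J \<subseteq> E ==> {p, q, r, t} \<subseteq> E - J ==> K3 (br D' J) p q r t"
 shows "plane L \<Gamma> (T3 D K) (T3 D' K) (E - K)"
proof -
 have supp: "D B = 0 \<longleftrightarrow> B ~: \<B>" if "B \<subseteq> E" for B using D that unfolding prep_def by blast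
 note z = alt3_zero[OF alt3_T3]
 have self: "T3 D K x y y = 0" for x y unfolding T3_def by (simp add: s_self)
 show ?thesis
 proof unfold_locales
  show "alt3 (T3 D K)" "alt3 (T3 D' K)" by (rule alt3_T3)+
  show "N3 (T3 D K x) p q r t" if "x \<in> E - K" "p \<in> E - K" "q \<in> E - K" "r \<in> E - K" "t \<in> E - K" for x p q r t
  proof (rule N3_T3I)
   assume "x ~: {p, q, r, t}"
   then show "N3 (br D (insert x K)) p q r t" using D K that unfolding prep_def by auto
  qed
  show "K3 (T3 D' K x) p q r t" if "x \<in> E - K" "p \<in> E - K" "q \<in> E - K" "r \<in> E - K" "t \<in> E - K" for x p q r t
  proof (rule K3_T3I)
   assume "x ~: {p, q, r, t}"
   then show "K3 (br D' (insert x K)) p q r t" using K that by (intro K3) auto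
  qed
 next
  fix x p1 p2 p3 p4 p5
  assume h: "x \<in> E - K" "p1 \<in> E - K" "p2 \<in> E - K" "p3 \<in> E - K" "p4 \<in> E - K" "p5 \<in> E - K"
  let ?A = "{p1, p2, p3, p4, p5}"
  have ex: "\<exists>u\<in>?A. \<exists>v\<in>?A. u ~= v & T3 D K x u v = 0" if d: "distinct [p1, p2, p3, p4, p5]" "x ~: ?A"
  proof -
   have c: "card ?A = 5" using d(1) by simp
   have "insert x K \<union> ?A \<subseteq> E" "insert x K \<inter> ?A = {}" using h K d(2) by auto
   from noUD[OF U(1) this c] obtain C where C: "C \<subseteq> ?A" "card C = 2" "insert x K \<union> C ~: \<B>"
    by (elim exE conjE)
   then obtain u v where uv: "C = {u, v}" "u ~= v" by (meson card_2_iff)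
   have eq: "insert x (insert u (insert v K)) = insert x K \<union> C" using uv by blast
   have "insert x K \<union> C \<subseteq> E" using C(1) h K by auto
   then have "T3 D K x u v = 0" unfolding T3_zero eq using C(3) supp by blast
   moreover have "u \<in> ?A" "v \<in> ?A" using uv C(1) by auto
   ultimately show ?thesis using uv(2) by (intro bexI[of _ u] bexI[of _ v] conjI) assumption+
  qed
  show "T3 D K x p1 p2 = 0 \<or> T3 D K x p1 p3 = 0 \<or> T3 D K x p1 p4 = 0 \<or> T3 D K x p1 p5 = 0 \<or> T3 D K x p2 p3 = 0 \<or>
   T3 D K x p2 p4 = 0 \<or> T3 D K x p2 p5 = 0 \<or> T3 D K x p3 p4 = 0 \<or> T3 D K x p3 p5 = 0 \<or> T3 D K x p4 p5 = 0"
  proof (cases "distinct [p1, p2, p3, p4, p5] & x ~: ?A")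
   case True
   from ex[OF conjunct1[OF True] conjunct2[OF True]] obtain u v where "u \<in> ?A" "v \<in> ?A" "u ~= v" "T3 D K x u v = 0"
    by (elim bexE conjE)
   then show ?thesis by (auto simp: z)
  next
   case False
   then show ?thesis by (auto simp: T3_self self)
  qed
 next
  fix p1 p2 p3 p4 p5
  assume h: "p1 \<in> E - K" "p2 \<in> E - K" "p3 \<in> E - K" "p4 \<in> E - K" "p5 \<in> E - K"
  let ?A = "{p1, p2, p3, p4, p5}"
  have ex: "\<exists>u\<in>?A. \<exists>v\<in>?A. \<exists>w\<in>?A. u ~= v & u ~= w & v ~= w & T3 D K u v w = 0" if d: "distinct [p1, p2, p3, p4, p5]"
  proof -
   have c: "card ?A = 5" using d by simp
   have "K \<union> ?A \<subseteq> E" "K \<inter> ?A = {}" using h K by auto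
   from noUD[OF U(2) this c] obtain C where C: "C \<subseteq> ?A" "card C = 3" "K \<union> C ~: \<B>"
    by (elim exE conjE)
   then obtain u v w where uvw: "C = {u, v, w}" "u ~= v" "u ~= w" "v ~= w" by (metis card_3_iff)
   have eq: "insert u (insert v (insert w K)) = K \<union> C" using uvw by blast
   have "K \<union> C \<subseteq> E" using C(1) h K by auto
   then have "T3 D K u v w = 0" unfolding T3_zero eq using C(3) supp by blast
   moreover have "u \<in> ?A" "v \<in> ?A" "w \<in> ?A" using uvw C(1) by auto
   ultimately show ?thesis using uvw(2-4) by (intro bexI[of _ u] bexI[of _ v] bexI[of _ w] conjI) assumption+
  qed
  show "T3 D K p1 p2 p3 = 0 \<or> T3 D K p1 p2 p4 = 0 \<or> T3 D K p1 p2 p5 = 0 \<or> T3 D K p1 p3 p4 = 0 \<or> T3 D K p1 p3 p5 = 0 \<or>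
   T3 D K p1 p4 p5 = 0 \<or> T3 D K p2 p3 p4 = 0 \<or> T3 D K p2 p3 p5 = 0 \<or> T3 D K p2 p4 p5 = 0 \<or> T3 D K p3 p4 p5 = 0"
  proof (cases "distinct [p1, p2, p3, p4, p5]")
   case True
   from ex[OF True] obtain u v w where "u \<in> ?A" "v \<in> ?A" "w \<in> ?A" "u ~= v" "u ~= w" "v ~= w" "T3 D K u v w = 0"
    by (elim bexE conjE)
   then show ?thesis by (auto simp: z)
  next
   case False
   then show ?thesis by (auto simp: T3_self self)
  qed
 qed
qed

end

section \<open>Gluing lifts of two deletions\<close>

text \<open>\<open>D0\<close> combines lifts of the two deletions that have been made to agree; it
  is correct on every set that does not contain both \<open>a\<close> and \<open>b\<close>. By
  \<open>NE\<close> and \<open>C\<close>, deleting both keeps the rank and leaves a connected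
  matroid, along whose fundamental graphs the new relations will be propagated.\<close>

locale gluing = signed_lifting L \<Gamma> s
  for L :: "'p::field => 'p => 'p => 'k::field => 'k => 'k => bool" and \<Gamma> and s :: "'a => 'a => int" +
 fixes E :: "'a set" and \<B> :: "'a set set" and D :: "'a set => 'p" and D0 :: "'a set => 'k" and a b :: 'a
 assumes M: "matroid E \<B>" and D: "prep E \<B> D" and U: "noU 2 E \<B>" "noU 3 E \<B>"
  and ab: "a \<in> E" "b \<in> E" "a ~= b"
  and NE: "\<exists>B\<in>\<B>. a ~: B & b ~: B"
  and C: "connected_matroid (E - {a} - {b}) {B \<in> \<B>. a ~: B & b ~: B}"
  and supp0: "B \<subseteq> E ==> \<not> {a, b} \<subseteq> B ==> D0 B ~= 0 \<longleftrightarrow> B \<in> \<B>"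
  and gam0: "B \<in> \<B> ==> \<not> {a, b} \<subseteq> B ==> D0 B \<in> \<Gamma>"
  and R0: "J \<subseteq> E ==> {p, q, r, t} \<subseteq> E - J ==> \<not> {a, b} \<subseteq> J \<union> {p, q, r, t} ==> RLF (br D J) (br D0 J) p q r t"
begin

abbreviation "\<N> \<equiv> {B \<in> \<B>. a ~: B & b ~: B}"

lemma MN: "matroid (E - {a} - {b}) \<N>"
proof -
 have "\<exists>B\<in>\<B>. a ~: B" "\<exists>B\<in>{B \<in> \<B>. a ~: B}. b ~: B" using NE by auto
 then have "matroid (E - {a} - {b}) {B \<in> {B \<in> \<B>. a ~: B}. b ~: B}" using matroid_delete[OF matroid_delete[OF M]] by blast
 moreover have "{B \<in> {B \<in> \<B>. a ~: B}. b ~: B} = \<N>" by blast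
 ultimately show ?thesis by simp
qed

lemma suppD: "B \<subseteq> E ==> D B = 0 \<longleftrightarrow> B ~: \<B>"
 using D unfolding prep_def by blast

text \<open>Independent sets can be completed away from \<open>a\<close> and \<open>b\<close>,
  because some basis avoids both.\<close>

lemma extend_N:
 assumes "I \<subseteq> B" "B \<in> \<B>"
 shows "\<exists>B'\<in>\<B>. I \<subseteq> B' & B' - I \<subseteq> E - {a, b} & card (B' - I) = card (B - I)"
proof -
 obtain B0 where B0: "B0 \<in> \<B>" "a ~: B0" "b ~: B0" using NE by blast
 obtain B' where B': "B' \<in> \<B>" "I \<subseteq> B'" "B' \<subseteq> I \<union> B0" using matroid_extend[OF M assms(2,1) B0(1)] by blast
 have fin: "finite B" "finite B'" "finite I" using matroid_basis_finite[OF M] assms B' finite_subset by blast+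
 have "card (B' - I) = card (B - I)"
  using matroid_basis_card[OF M B'(1) assms(2)] card_Diff_subset[OF fin(3) B'(2)] card_Diff_subset[OF fin(3) assms(1)] by simp
 moreover have "B' - I \<subseteq> E - {a, b}" using B' B0 matroid_basis_subset[OF M B0(1)] by blast
 ultimately show ?thesis using B' by blast
qed

definition frame :: "'a set => 'a => 'a => bool" where
 "frame J c d \<longleftrightarrow> c ~= d & c \<in> E - {a, b} - J & d \<in> E - {a, b} - J & insert c (insert d J) \<in> \<B>"

text \<open>The relation of \<open>a, b, c, d\<close> over \<open>J\<close>, solved for the bracket
  of \<open>a, b\<close> at one chosen frame; the factor \<open>s a b\<close> turns the bracket back
  into a set function. That every frame gives the same value will follow from
  \<open>K3_level1\<close>. Without a frame no two elements complete \<open>J\<close> to a basis,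
  whence the default 0.\<close>

definition val :: "'a set => 'k" where
 "val J = (if \<exists>p. frame J (fst p) (snd p)
   then let p = SOME p. frame J (fst p) (snd p); c = fst p; d = snd p in
    of_int (s a b) * ((br D0 J a c * br D0 J b d - br D0 J a d * br D0 J b c) / br D0 J c d)
   else 0)"

definition D' :: "'a set => 'k" where
 "D' B = (if {a, b} \<subseteq> B then val (B - {a, b}) else D0 B)"

lemma D'_same: "\<not> {a, b} \<subseteq> B ==> D' B = D0 B"
 unfolding D'_def by auto

lemma br'_same: "\<not> {a, b} \<subseteq> insert x (insert y J) ==> br D' J x y = br D0 J x y"
 unfolding br_def using D'_same by metis

lemma frameI:
 assumes "J \<subseteq> E" "a ~: J" "b ~: J" "insert u (insert v J) \<in> \<B>" "u ~= v" "u ~: J" "v ~: J"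
 shows "\<exists>c d. frame J c d"
proof -
 obtain B' where B': "B' \<in> \<B>" "J \<subseteq> B'" "B' - J \<subseteq> E - {a, b}" "card (B' - J) = card (insert u (insert v J) - J)"
  using extend_N[of J, OF _ assms(4)] by blast
 have "insert u (insert v J) - J = {u, v}" using assms by auto
 then have "card (B' - J) = 2" using B'(4) assms(5) by simp
 then obtain c d where cd: "B' - J = {c, d}" "c ~= d" by (meson card_2_iff)
 then have "insert c (insert d J) = B'" using B'(2) by blast
 moreover have "c \<in> B' - J" "d \<in> B' - J" using cd by auto
 ultimately show ?thesis unfolding frame_def using cd(2) B'(1,3) by (intro exI[of _ c] exI[of _ d]) auto
qed

lemma br'_ab_frame:
 assumes J: "J \<subseteq> E" "a ~: J" "b ~: J" and ex: "frame J c d"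
 shows "\<exists>c d. frame J c d & K3 (br D' J) a b c d"
proof -
 have ex': "\<exists>p. frame J (fst p) (snd p)" using ex by (intro exI[of _ "(c, d)"]) simp
 define p where "p = (SOME p. frame J (fst p) (snd p))"
 define c where "c = fst p" define d where "d = snd p"
 have f: "frame J c d" unfolding c_def d_def p_def using someI_ex[OF ex'] .
 have nz: "br D0 J c d ~= 0"
 proof -
  have "insert c (insert d J) \<subseteq> E" "\<not> {a, b} \<subseteq> insert c (insert d J)" using f J unfolding frame_def by auto
  then show ?thesis using supp0 f unfolding br_zero frame_def by blast
 qed
 have "insert a (insert b J) - {a, b} = J" using J by auto
 then have "D' (insert a (insert b J)) = of_int (s a b) * ((br D0 J a c * br D0 J b d - br D0 J a d * br D0 J b c) / br D0 J c d)"
  unfolding D'_def val_def using ex' by (simp add: c_def d_def p_def Let_def)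
 then have "br D' J a b = (of_int (s a b) * of_int (s a b)) * ((br D0 J a c * br D0 J b d - br D0 J a d * br D0 J b c) / br D0 J c d)"
  unfolding br_def[of D' J a b] by (simp add: mult.assoc)
 then have e: "br D' J a b * br D0 J c d = br D0 J a c * br D0 J b d - br D0 J a d * br D0 J b c"
  using nz by (simp add: s_sq ab(3))
 have cd: "c ~: {a, b}" "d ~: {a, b}" using f unfolding frame_def by auto
 have "br D' J c d = br D0 J c d" "br D' J a c = br D0 J a c" "br D' J b d = br D0 J b d" "br D' J a d = br D0 J a d" "br D' J b c = br D0 J b c"
  using cd J ab(3) by (auto intro!: br'_same)
 then have "K3 (br D' J) a b c d" unfolding K3_def using e by simp
 then show ?thesis using f by blast
qed

lemma br'_zero_noframe:
 assumes J: "J \<subseteq> E" "a ~: J" "b ~: J" and no: "\<not> (\<exists>c d. frame J c d)" and u: "u \<in> E - J" "v \<in> E - J"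
 shows "br D' J u v = 0"
proof (cases "{a, b} \<subseteq> insert u (insert v J)")
 case True
 then have "insert u (insert v J) - {a, b} = J" using J u ab(3) by auto
 moreover have "\<not> (\<exists>p. frame J (fst p) (snd p))" using no by blast
 ultimately have "D' (insert u (insert v J)) = 0" unfolding D'_def val_def using True by simp
 then show ?thesis unfolding br_def by simp
next
 case False
 have "u = v \<or> insert u (insert v J) ~: \<B>" using frameI[OF J, of u v] no u by blast
 moreover have "insert u (insert v J) \<subseteq> E" using J u by blast
 ultimately have "br D0 J u v = 0" using supp0[OF _ False] unfolding br_zero by blast
 then show ?thesis using br'_same[OF False] by simp
qed

lemma K3_free:
 assumes J: "J \<subseteq> E" "{p, q, r, t} \<subseteq> E - J" "\<not> {a, b} \<subseteq> J \<union> {p, q, r, t}"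
 shows "K3 (br D' J) p q r t"
proof -
 have "K3 (br D0 J) p q r t" using RLF_K3[OF R0[OF J]] .
 moreover have "br D' J x y = br D0 J x y" if "x \<in> {p, q, r, t}" "y \<in> {p, q, r, t}" for x y
  using that J(3) by (intro br'_same) blast
 ultimately show ?thesis unfolding K3_def by simp
qed

text \<open>For the chosen frame \<open>e, f\<close>, a relation \<open>x, y, e, f\<close> either
  does not involve both \<open>a\<close> and \<open>b\<close> or is the defining one up to order.
  \<open>K3_coords2\<close> gives the rest.\<close>

lemma K3_level1:
 assumes J: "J \<subseteq> E" "a ~: J" "b ~: J" and P: "{p, q, r, t} \<subseteq> E - J"
 shows "K3 (br D' J) p q r t"
proof (cases "\<exists>c d. frame J c d")
 case False
 then show ?thesis using br'_zero_noframe[OF J] P unfolding K3_def by simp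
next
 case True
 then obtain e f where ef: "frame J e f" "K3 (br D' J) a b e f" using br'_ab_frame[OF J] by blast
 have e: "e \<in> E - J" "f \<in> E - J" "e ~: {a, b}" "f ~: {a, b}" "e ~= f" using ef unfolding frame_def by auto
 have nz: "br D' J e f ~= 0"
 proof -
  have n: "\<not> {a, b} \<subseteq> insert e (insert f J)" using e J by auto
  have "insert e (insert f J) \<subseteq> E" using e J by auto
  then have "br D0 J e f ~= 0" using supp0[OF _ n] ef e unfolding br_zero frame_def by blast
  then show ?thesis using br'_same[OF n] by simp
 qed
 show ?thesis
 proof (rule K3_coords2[where F = "br D' J", OF nz])
  fix x y assume xy: "{x, y} \<subseteq> {p, q, r, t}"
  show "K3 (br D' J) x y e f"
  proof (cases "{a, b} \<subseteq> {x, y}")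
   case False
   then have "\<not> {a, b} \<subseteq> J \<union> {x, y, e, f}" using e J by auto
   moreover have "{x, y, e, f} \<subseteq> E - J" using xy P e by auto
   ultimately show ?thesis using K3_free[OF J(1)] by blast
  next
   case True
   then have "x = a & y = b \<or> x = b & y = a" using ab(3) by auto
   then show ?thesis using ef(2) K3_swap12[OF alt2_br ef(2)] by blast
  qed
 qed
qed

text \<open>At this point the support of \<open>D'\<close> on sets through \<open>a\<close> and
  \<open>b\<close> is still open. A nonzero value forces another nonzero term in the defining
  relation, and so a basis made of \<open>B - {b}\<close> and a frame element.\<close>

lemma D'_nonzero:
 assumes "B \<subseteq> E" "D' B ~= 0"
 shows "\<exists>B'\<in>\<B>. B - {b} \<subseteq> B' & card B' = card B"
proof (cases "{a, b} \<subseteq> B")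
 case False
 then have "B \<in> \<B>" using supp0[OF assms(1) False] D'_same[OF False] assms(2) by simp
 then show ?thesis by (intro bexI[of _ B]) auto
next
 case True
 define J where "J = B - {a, b}"
 have J: "J \<subseteq> E" "a ~: J" "b ~: J" "B = insert a (insert b J)" using True assms(1) unfolding J_def by auto
 have nz: "br D' J a b ~= 0" unfolding br_zero using assms(2) J(4) ab(3) by simp
 have "a \<in> E - J" "b \<in> E - J" using ab J by auto
 then have "\<exists>c d. frame J c d" using br'_zero_noframe[OF J(1-3)] nz by blast
 then obtain c d where f: "frame J c d" "K3 (br D' J) a b c d" using br'_ab_frame[OF J(1-3)] by blast
 have c: "c \<in> E - J" "d \<in> E - J" "c ~: {a, b}" "d ~: {a, b}" "c ~= d" using f unfolding frame_def by auto
 have ncd: "\<not> {a, b} \<subseteq> insert c (insert d J)" "insert c (insert d J) \<subseteq> E" using c J by auto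
 have "D0 (insert c (insert d J)) ~= 0" using supp0[OF ncd(2,1)] f(1) unfolding frame_def by blast
 then have "br D' J c d ~= 0" unfolding br_zero D'_same[OF ncd(1)] using c(5) by blast
 then have "br D' J a c ~= 0 \<or> br D' J a d ~= 0" using f(2) nz unfolding K3_def by auto
 then obtain e where e: "e = c \<or> e = d" "br D' J a e ~= 0" by blast
 have ne: "\<not> {a, b} \<subseteq> insert a (insert e J)" "insert a (insert e J) \<subseteq> E" using e c J ab by auto
 have "D0 (insert a (insert e J)) ~= 0" using e(2) unfolding br_zero D'_same[OF ne(1)] by blast
 then have "insert a (insert e J) \<in> \<B>" using supp0[OF ne(2,1)] by blast
 moreover have "B - {b} \<subseteq> insert a (insert e J)" using J by auto
 moreover have "finite J" using J(1) matroid_finite[OF M] finite_subset by blast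
 then have "card (insert a (insert e J)) = card B" using J e c ab(3) by auto
 ultimately show ?thesis by blast
qed

text \<open>The frame is taken outside \<open>a\<close> and \<open>b\<close>, where the pencils are
  controlled by \<open>HK\<close>. If no three such elements have a nonzero bracket, every bracket
  of the relation vanishes.\<close>

lemma K3_centre:
 assumes K: "K \<subseteq> E" "b ~: K"
  and HK: "\<And>w p q r t. w \<in> E - {a, b} - K ==> {p, q, r, t} \<subseteq> E - K ==> K3 (T3 D' K w) p q r t"
  and z: "z \<in> E - K" "p \<in> E - K" "q \<in> E - {a, b} - K" "r \<in> E - {a, b} - K" "t \<in> E - {a, b} - K"
 shows "K3 (T3 D' K z) p q r t"
proof -
 have fK: "finite K" using K matroid_finite[OF M] finite_subset by blast
 have ind: "\<exists>B'\<in>\<B>. insert w K \<subseteq> B' & card B' = card K + 3"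
  if "T3 D' K w u v ~= 0" "w \<in> E - K" "w ~= b" "u \<in> E - K" "v \<in> E - K" for w u v
 proof -
  have d: "w ~= u" "w ~= v" "u ~= v" "D' (insert w (insert u (insert v K))) ~= 0" using that(1) unfolding T3_zero by auto
  have "insert w (insert u (insert v K)) \<subseteq> E" using that K by auto
  then obtain B' where B': "B' \<in> \<B>" "insert w (insert u (insert v K)) - {b} \<subseteq> B'" "card B' = card (insert w (insert u (insert v K)))"
   using D'_nonzero d(4) by blast
  moreover have "card (insert w (insert u (insert v K))) = card K + 3" using fK d that by simp
  moreover have "insert w K \<subseteq> insert w (insert u (insert v K)) - {b}" using that(3) K(2) by auto
  ultimately show ?thesis by (metis subset_trans)
 qed
 show ?thesis
 proof (cases "\<exists>e1 e2 e3. e1 \<in> E - {a, b} - K & e2 \<in> E - {a, b} - K & e3 \<in> E - {a, b} - K & T3 D' K e1 e2 e3 ~= 0")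
  case True
  then obtain e1 e2 e3 where e: "e1 \<in> E - {a, b} - K" "e2 \<in> E - {a, b} - K" "e3 \<in> E - {a, b} - K" "T3 D' K e1 e2 e3 ~= 0" by blast
  have dist: "e1 ~= e2" "e1 ~= e3" "e2 ~= e3" using e(4) unfolding T3_zero by auto
  let ?X = "insert e1 (insert e2 (insert e3 K))"
  have X: "?X \<in> \<B>"
  proof -
   have n: "\<not> {a, b} \<subseteq> ?X" "?X \<subseteq> E" using e K by auto
   have "D' ?X ~= 0" using e(4) unfolding T3_zero by blast
   then show ?thesis unfolding D'_same[OF n(1)] using supp0[OF n(2,1)] by blast
  qed
  \<comment> \<open>A nonzero bracket at \<open>w\<close> makes \<open>w\<close> independent over
    \<open>K\<close>; exchanging \<open>w\<close> into the frame then gives a nonzero bracket of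
    \<open>w\<close> with two frame elements.\<close>
  have loop: "T3 D' K w u v = 0" if w: "w \<in> E - {a, b} - K" "{u, v} \<subseteq> E - K"
   and l: "T3 D' K w e1 e2 = 0" "T3 D' K w e1 e3 = 0" "T3 D' K w e2 e3 = 0" for w u v
  proof (rule ccontr)
   assume "T3 D' K w u v ~= 0"
   then obtain B0 where B0: "B0 \<in> \<B>" "insert w K \<subseteq> B0" "card B0 = card K + 3" using ind[of w u v] w by auto
   have we: "w ~= e1" "w ~= e2" "w ~= e3"
    using l e(4) alt3_perms[OF alt3_T3[of D' K]] by (metis neg_equal_0_iff_equal)+
   obtain B' where B': "B' \<in> \<B>" "insert w K \<subseteq> B'" "B' \<subseteq> insert w K \<union> ?X"
    using matroid_extend[OF M B0(1,2) X] by blast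
   have "w ~: ?X" "B' \<subseteq> insert w ?X" "w \<in> B'" using we w B' by auto
   then obtain y where y: "y \<in> ?X - B'" "B' = insert w (?X - {y})" using basis_swapI[OF M X B'(1)] by blast
   have "y ~: K" using y B' by blast
   then have "B' = insert w (insert e1 (insert e2 K)) \<or> B' = insert w (insert e1 (insert e3 K)) \<or> B' = insert w (insert e2 (insert e3 K))"
    using y dist e by auto
   moreover have "insert w (insert x (insert x' K)) ~: \<B>" if "x \<in> {e1, e2, e3}" "x' \<in> {e1, e2, e3}" "x ~= x'" "T3 D' K w x x' = 0" for x x'
   proof -
    have n: "\<not> {a, b} \<subseteq> insert w (insert x (insert x' K))" "insert w (insert x (insert x' K)) \<subseteq> E" using that(1,2) e K w by auto
    have "w ~= x" "w ~= x'" using we that by auto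
    then have "D' (insert w (insert x (insert x' K))) = 0" using that(3,4) unfolding T3_zero by blast
    then show ?thesis unfolding D'_same[OF n(1)] using supp0[OF n(2,1)] by blast
   qed
   ultimately show False using B'(1) l dist by auto
  qed
  show ?thesis
   by (rule K3_coords3[OF alt3_T3 e(1-3) _ e(4) _ _ z(1,2,3,4,5)]; (rule HK | rule loop | blast); assumption)
 next
  case False
  have "T3 D' K x y w = 0" if h: "x \<in> E - K" "y \<in> E - K" "w \<in> E - {a, b} - K" for x y w
  proof (rule ccontr)
   assume nz: "T3 D' K x y w ~= 0"
   then have "T3 D' K w x y ~= 0" using alt3_perms(4)[OF alt3_T3[of D' K], where x = x and y = y and z = w] by simp
   then obtain B0 where B0: "B0 \<in> \<B>" "insert w K \<subseteq> B0" "card B0 = card K + 3" using ind[of w x y] h by auto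
   obtain B' where B': "B' \<in> \<B>" "K \<subseteq> B'" "B' - K \<subseteq> E - {a, b}" "card (B' - K) = card (B0 - K)"
    using extend_N[OF _ B0(1), of K] B0(2) by blast
   have "card (B' - K) = 3" using B'(4) B0 fK by (simp add: card_Diff_subset)
   then obtain e1 e2 e3 where e: "B' - K = {e1, e2, e3}" "e1 ~= e2" "e1 ~= e3" "e2 ~= e3" by (metis card_3_iff)
   have eq: "insert e1 (insert e2 (insert e3 K)) = B'" using e(1) B'(2) by blast
   have mem: "e1 \<in> E - {a, b} - K" "e2 \<in> E - {a, b} - K" "e3 \<in> E - {a, b} - K" using e(1) B'(3) by blast+
   then have n: "\<not> {a, b} \<subseteq> B'" "B' \<subseteq> E" using eq K by auto
   have "D' B' ~= 0" using D'_same[OF n(1)] supp0[OF n(2,1)] B'(1) by simp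
   then have "T3 D' K e1 e2 e3 ~= 0" unfolding T3_zero eq using e by blast
   then show False using False mem by blast
  qed
  then show ?thesis using z unfolding K3_def by simp
 qed
qed

lemma K3_level2:
 assumes K: "K \<subseteq> E" "a ~: K" "b ~: K" and z: "z = a & w = b \<or> z = b & w = a" and P: "{p, q, r, t} \<subseteq> E - insert z K"
 shows "K3 (br D' (insert z K)) p q r t"
proof (cases "w \<in> {p, q, r, t} & distinct [p, q, r, t]")
 case True
 have HK: "K3 (T3 D' K v) p q r t" if "v \<in> E - {a, b} - K" "{p, q, r, t} \<subseteq> E - K" for v p q r t
 proof (rule K3_T3I)
  assume "v ~: {p, q, r, t}"
  then show "K3 (br D' (insert v K)) p q r t" using that K by (intro K3_level1) auto
 qed
 have main: "K3 (br D' (insert z K)) w x y v" if "{x, y, v} \<subseteq> E - {a, b} - K" for x y v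
 proof (rule K3_brI)
  show "z ~: {w, x, y, v}" using that z ab(3) by auto
  show "K3 (T3 D' K z) w x y v" using that z ab K by (intro K3_centre[OF K(1,3) HK]) auto
 qed
 have sub: "{x, y, v} \<subseteq> E - {a, b} - K" if "{x, y, v} \<subseteq> {p, q, r, t}" "w ~: {x, y, v}" for x y v
  using that P z by auto
 note a2 = alt2_br[of D' "insert z K"]
 consider "w = p" | "w = q" | "w = r" | "w = t" using True by auto
 then show ?thesis
 proof cases
  case 1
  have "K3 (br D' (insert z K)) w q r t" using True 1 by (intro main sub) auto
  then show ?thesis using 1 by simp
 next
  case 2
  have "K3 (br D' (insert z K)) w p r t" using True 2 by (intro main sub) auto
  then show ?thesis using 2 K3_swap12[OF a2] by blast
 next
  case 3
  have "K3 (br D' (insert z K)) w p q t" using True 3 by (intro main sub) auto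
  then show ?thesis using 3 K3_swap12[OF a2] K3_swap23[OF a2] by blast
 next
  case 4
  have "K3 (br D' (insert z K)) w p q r" using True 4 by (intro main sub) auto
  then show ?thesis using 4 K3_swap12[OF a2] K3_swap23[OF a2] K3_swap34[OF a2] by blast
 qed
next
 case False
 then show ?thesis
 proof (cases "distinct [p, q, r, t]")
  case True
  then have "w ~: {p, q, r, t}" using False by blast
  then have "\<not> {a, b} \<subseteq> insert z K \<union> {p, q, r, t}" using z K P ab(3) by auto
  then show ?thesis using K z ab P by (intro K3_free) auto
 next
  case False
  then show ?thesis by (rule K3_nondistinct[OF alt2_br])
 qed
qed

lemma K3_all:
 assumes J: "J \<subseteq> E" and P: "{p, q, r, t} \<subseteq> E - J"
 shows "K3 (br D' J) p q r t"
proof -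
 consider "a ~: J" "b ~: J" | "a \<in> J" "b ~: J" | "a ~: J" "b \<in> J" | "a \<in> J" "b \<in> J" by blast
 then show ?thesis
 proof cases
  case 1 then show ?thesis using K3_level1[OF J] P by blast
 next
  case 2
  then have "J = insert a (J - {a})" by blast
  then show ?thesis using K3_level2[of "J - {a}" a b p q r t] 2 J P by auto
 next
  case 3
  then have "J = insert b (J - {b})" by blast
  then show ?thesis using K3_level2[of "J - {b}" b a p q r t] 3 J P by auto
 next
  case 4
  \<comment> \<open>Keeping \<open>a\<close> in \<open>K\<close>, the pencils at elements other than
    \<open>a, b\<close> are covered by \<open>K3_level2\<close>, and \<open>K3_centre\<close> moves
    the centre to \<open>b\<close>.\<close>
  define K where "K = J - {b}"
  have K: "J = insert b K" "K \<subseteq> E" "b ~: K" "a \<in> K" using 4 J ab(3) unfolding K_def by auto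
  have HK: "K3 (T3 D' K v) x y u w" if v: "v \<in> E - {a, b} - K" "{x, y, u, w} \<subseteq> E - K" for v x y u w
  proof (rule K3_T3I)
   assume n: "v ~: {x, y, u, w}"
   have "insert v K = insert a (insert v (K - {a}))" using K by blast
   then show "K3 (br D' (insert v K)) x y u w"
    using K3_level2[of "insert v (K - {a})" a b x y u w] K v n ab by auto
  qed
  have "K3 (T3 D' K b) p q r t" using P K ab 4 by (intro K3_centre[OF K(2,3) HK]) auto
  then show ?thesis unfolding K(1) using P K by (intro K3_brI) auto
 qed
qed

end

section \<open>Lifting the relations of the glued function\<close>

context gluing
begin

lemma plane_K: "K \<subseteq> E ==> plane L \<Gamma> (T3 D K) (T3 D' K) (E - K)"
 by (rule plane_contract[OF D U]) (use K3_all in auto)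

lemma N3_D: "J \<subseteq> E ==> {p, q, r, t} \<subseteq> E - J ==> N3 (br D J) p q r t"
 using D unfolding prep_def by auto

lemma supp': "B \<subseteq> E ==> \<not> {a, b} \<subseteq> B ==> D B = 0 \<longleftrightarrow> D' B = 0"
 using suppD[of B] supp0[of B] D'_same[of B] by auto

lemma RLF_free:
 assumes J: "J \<subseteq> E" "{p, q, r, t} \<subseteq> E - J" "\<not> {a, b} \<subseteq> J \<union> {p, q, r, t}"
 shows "RLF (br D J) (br D' J) p q r t"
proof -
 have "br D' J x y = br D0 J x y" if "x \<in> {p, q, r, t}" "y \<in> {p, q, r, t}" for x y
  using that J(3) by (intro br'_same) blast
 then show ?thesis using R0[OF J] unfolding RLF_def by simp
qed

lemma plane_pair_K:
 assumes KK: "K \<subseteq> E" "a ~: K" "b ~: K"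
 shows "plane_pair L \<Gamma> (T3 D K) (T3 D' K) (E - K) a b"
proof -
 interpret plane L \<Gamma> "T3 D K" "T3 D' K" "E - K" using plane_K[OF KK(1)] .
 show ?thesis
 proof unfold_locales
  show "a \<in> E - K" "b \<in> E - K" "a ~= b" using ab KK by auto
  show "T3 D K x y z = 0 \<longleftrightarrow> T3 D' K x y z = 0" if "x \<in> E - K" "y \<in> E - K" "z \<in> E - K" "\<not> {a, b} \<subseteq> {x, y, z}" for x y z
  proof -
   have "insert x (insert y (insert z K)) \<subseteq> E" "\<not> {a, b} \<subseteq> insert x (insert y (insert z K))" using that KK by auto
   from supp'[OF this] show ?thesis unfolding T3_zero by blast
  qed
  show "RLF (T3 D K x) (T3 D' K x) p q r t" if "x \<in> E - K" "p \<in> E - K" "q \<in> E - K" "r \<in> E - K" "t \<in> E - K" "\<not> {a, b} \<subseteq> {x, p, q, r, t}" for x p q r t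
  proof (rule RLF_T3I)
   assume "x ~: {p, q, r, t}"
   then show "RLF (br D (insert x K)) (br D' (insert x K)) p q r t" using that KK by (intro RLF_free) auto
  qed
 qed
qed

definition Q :: "'a set => 'a => 'a => bool" where
 "Q X c d \<longleftrightarrow> RLF (br D (X - {c, d})) (br D' (X - {c, d})) a b c d"

lemma X_mem:
 assumes "X \<in> \<N>"
 shows "X \<subseteq> E" "a ~: X" "b ~: X"
 using assms matroid_basis_subset[OF M] by auto

text \<open>A common neighbour \<open>z\<close> of \<open>c\<close> and \<open>d\<close> is
  independent of both over \<open>J\<close>, which makes it the fifth element for
  \<open>common_neighbour\<close>.\<close>

lemma Q_near:
 assumes X: "X \<in> \<N>" "c \<in> X" "d \<in> X" "c ~= d" "z ~: X" "insert z (X - {c}) \<in> \<N>" "insert z (X - {d}) \<in> \<N>"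
 shows "Q X c d"
proof -
 define J where "J = X - {c, d}"
 note mem = X_mem[OF X(1)] X_mem[OF X(6)]
 have J: "J \<subseteq> E" "a ~: J" "b ~: J" "c ~: J" "d ~: J" "z ~: J" using mem X unfolding J_def by auto
 have el: "c \<in> E" "d \<in> E" "z \<in> E" "z ~= a" "z ~= b" "c ~= a" "c ~= b" "d ~= a" "d ~= b" "z ~= c" "z ~= d" using mem X by auto
 have sub: "{a, b, c, d, z} \<subseteq> E - J" using J el ab by auto
 have sets: "insert c (insert d J) = X" "insert z (insert c J) = insert z (X - {d})" "insert z (insert d J) = insert z (X - {c})"
  using X unfolding J_def by auto
 have nz: "D (insert c (insert d J)) ~= 0" "D (insert z (insert c J)) ~= 0" "D (insert z (insert d J)) ~= 0"
  unfolding sets using suppD[of X] suppD[of "insert z (X - {c})"] suppD[of "insert z (X - {d})"] X mem by auto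
 show ?thesis
  unfolding Q_def J_def[symmetric]
 proof (rule common_neighbour[where ?w0.0 = z, OF alt2_br alt2_br])
  show "N3 (br D J) x y u w" if "{x, y, u, w} \<subseteq> {a, b, c, d, z}" for x y u w
   using that sub by (intro N3_D[OF J(1)]) auto
  show "K3 (br D' J) x y u w" if "{x, y, u, w} \<subseteq> {a, b, c, d, z}" for x y u w
   using that sub J(1) by (intro K3_all) auto
  show "br D J x y = 0 \<longleftrightarrow> br D' J x y = 0" if "{x, y} \<subseteq> {a, b, c, d, z}" "\<not> {a, b} \<subseteq> {x, y}" for x y
  proof -
   have "insert x (insert y J) \<subseteq> E" "\<not> {a, b} \<subseteq> insert x (insert y J)" using that sub J by auto
   from supp'[OF this] show ?thesis unfolding br_zero by blast
  qed
  show "a ~= b" "a ~: {c, d, z}" "b ~: {c, d, z}" using el ab by auto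
  show "RLF (br D J) (br D' J) a z c d" "RLF (br D J) (br D' J) b z c d"
   using sub J el ab by (auto intro!: RLF_free)
  show "br D J c d ~= 0" "br D J z c ~= 0" "br D J z d ~= 0" using nz el X(4) unfolding br_zero by auto
  show "br D J a b = 0 \<or> br D J a c = 0 \<or> br D J a d = 0 \<or> br D J a z = 0 \<or> br D J b c = 0 \<or> br D J b d = 0 \<or> br D J b z = 0"
  proof -
   have c5: "card {a, b, c, d, z} = 5" using el ab X(4) by simp
   have "J \<union> {a, b, c, d, z} \<subseteq> E" "J \<inter> {a, b, c, d, z} = {}" using sub J by auto
   from noUD[OF U(1) this c5] obtain W where W: "W \<subseteq> {a, b, c, d, z}" "card W = 2" "J \<union> W ~: \<B>" by (elim exE conjE)
   then obtain u v where uv: "W = {u, v}" "u ~= v" by (meson card_2_iff)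
   have "J \<union> W = insert u (insert v J)" "insert u (insert v J) \<subseteq> E" using uv W sub J by auto
   then have z: "D (insert u (insert v J)) = 0" "D (insert v (insert u J)) = 0" using suppD W(3) by (auto simp: insert_commute)
   have "u \<in> {a, b, c, d, z}" "v \<in> {a, b, c, d, z}" using uv W by auto
   then show ?thesis unfolding br_zero using z nz uv(2) by (elim insertE) (auto simp: insert_commute)
  qed
 qed
qed

lemma pivot_config:
 assumes X: "X \<in> \<N>" "c \<in> X" "d \<in> X" "x \<in> X" "c ~= d" "x ~= c" "x ~= d"
 defines "K \<equiv> X - {c, d, x}"
 shows "K \<subseteq> E" "a ~: K" "b ~: K" "{c, d, x} \<subseteq> E - K" "X - {c, d} = insert x K"
  "\<And>z. z ~: X ==> insert z (X - {c}) = insert z (insert x (insert d K))"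
  "\<And>z. z ~: X ==> insert z (X - {d}) = insert z (insert c (insert x K))"
  "\<And>z. z ~: X ==> insert z (X - {x}) = insert z (insert c (insert d K))"
  "X = insert c (insert x (insert d K))"
 using X_mem[OF X(1)] X unfolding K_def by auto

text \<open>The column \<open>z\<close> vanishes on \<open>c\<close> and \<open>d\<close>, so over
  \<open>K\<close> the point \<open>z\<close> lies on both lines \<open>x c\<close> and
  \<open>x d\<close>. Hence \<open>z\<close> and \<open>x\<close> are parallel, and the relation at
  \<open>z\<close> transfers to \<open>x\<close> by \<open>centre_change\<close>.\<close>

lemma Q_pivot:
 assumes X: "X \<in> \<N>" "c \<in> X" "d \<in> X" "x \<in> X" "c ~= d" "x ~= c" "x ~= d" "z ~: X" "insert z (X - {x}) \<in> \<N>"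
  "insert z (X - {c}) ~: \<N>" "insert z (X - {d}) ~: \<N>" and q: "Q (insert z (X - {x})) c d"
 shows "Q X c d"
proof -
 define K where "K = X - {c, d, x}"
 note KK = pivot_config[OF X(1-7), folded K_def]
 note mem = X_mem[OF X(1)] X_mem[OF X(9)]
 have zz: "z \<in> E - K" "z ~= a" "z ~= b" "z ~= c" "z ~= d" "z ~= x" using mem X unfolding K_def by auto
 interpret plane_pair L \<Gamma> "T3 D K" "T3 D' K" "E - K" a b using plane_pair_K[OF KK(1-3)] .
 have cdx: "c \<in> E - K" "d \<in> E - K" "x \<in> E - K" "a ~: {c, d, x}" "b ~: {c, d, x}" using KK(4) X mem by auto
 have e: "insert z (X - {x}) - {c, d} = insert z K" using X z unfolding K_def by auto
 have q': "R z a b c d" using q unfolding Q_def e using zz by (intro RLF_T3I)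
 have base: "T3 D K c x d ~= 0" unfolding T3_zero using KK(9) X suppD mem by auto
 have zn: "insert z (X - {c}) ~: \<B>" "insert z (X - {d}) ~: \<B>" using X(10,11) mem zz by auto
 have zc: "T3 D K x z d = 0"
 proof -
  have "insert x (insert z (insert d K)) = insert z (X - {c})" using KK(6)[OF X(8)] by auto
  moreover have "insert z (X - {c}) \<subseteq> E" using mem zz by auto
  ultimately show ?thesis unfolding T3_zero using zn suppD by metis
 qed
 have zd: "T3 D K x z c = 0"
 proof -
  have "insert x (insert z (insert c K)) = insert z (X - {d})" using KK(7)[OF X(8)] by auto
  moreover have "insert z (X - {d}) \<subseteq> E" using mem zz by auto
  ultimately show ?thesis unfolding T3_zero using zn suppD by metis
 qed
 have zcd: "T3 D K z c d ~= 0"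
 proof -
  have "insert z (insert c (insert d K)) = insert z (X - {x})" using KK(8)[OF X(8)] by auto
  then show ?thesis unfolding T3_zero using X suppD mem zz by auto
 qed
 have S: "T3 D K u v w = 0 \<longleftrightarrow> T3 D' K u v w = 0" if "{u, v, w} \<subseteq> {c, d, x, z}" for u v w
  using that cdx zz by (intro supp) auto
 have S1: "T3 D K u v y = 0 \<longleftrightarrow> T3 D' K u v y = 0" if "{u, v} \<subseteq> {c, d, x, z}" "y = a \<or> y = b" for u v y
  using that cdx zz abP by (intro supp) auto
 have xcd: "T3 D K x c d ~= 0" using base zz by (simp add: alt3_zero[OF alt3_T3])
 have za: "T3 D K x z a = 0" "T3 D' K x z a = 0"
 proof -
  have "T3 D K x z d * T3 D K x c a = T3 D K x z a * T3 D K x c d"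
   using collinear[OF cdx(3) zz(1) cdx(1,2) abP(1) zd] .
  then show "T3 D K x z a = 0" using zc xcd by simp
  then show "T3 D' K x z a = 0" using S1[of x z a] by simp
 qed
 have "R x a b c d"
 proof (cases "T3 D K x a c = 0 \<or> T3 D K x a d = 0 \<or> T3 D K x b c = 0 \<or> T3 D K x b d = 0")
  case True
  have s: "T3 D K x a c = 0 \<longleftrightarrow> T3 D' K x a c = 0" "T3 D K x a d = 0 \<longleftrightarrow> T3 D' K x a d = 0" "T3 D K x b c = 0 \<longleftrightarrow> T3 D' K x b c = 0"
   "T3 D K x b d = 0 \<longleftrightarrow> T3 D' K x b d = 0" using cdx abP by (auto intro!: supp[THEN iffD1] supp[THEN iffD2])
  show ?thesis by (rule RLF_trivial[OF N[OF cdx(3) abP(1,2) cdx(1,2)] K[OF cdx(3) abP(1,2) cdx(1,2)]]) (use s True in auto)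
 next
  case False
  have cx: "T3 D K c x z = 0" "T3 D K c x a ~= 0" "T3 D K c z d ~= 0" using zd False zcd by (simp_all add: alt3_zero[OF alt3_T3])
  have "T3 D K c z a ~= 0" using collinear_nz[OF cdx(1,3) zz(1) abP(1) cdx(2) cx] .
  then have n: "T3 D K z a c ~= 0" "T3 D' K z a c ~= 0"
   using S1[of c z a] unfolding alt3_perms(3)[OF alt3_T3, where x = c and y = z and z = a] by auto
  show ?thesis
   by (rule centre_change[OF cdx(3) zz(1) abP(1,2) cdx(1,2) za(1) zd zc za(2) _ _ xcd zcd n(1) _ _ n(2) q'])
    (use S zd zc xcd zcd in auto)
 qed
 then show ?thesis unfolding Q_def KK(5) using cdx X(6,7) by (intro RLF_brI) auto
qed

text \<open>The two missing adjacencies say that over \<open>K\<close> the point \<open>z\<close> is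
  on the line \<open>c x\<close> and \<open>z'\<close> on the line \<open>x d\<close>, which is the
  configuration of \<open>path_target\<close>.\<close>

lemma Q_two:
 assumes X: "X \<in> \<N>" "c \<in> X" "d \<in> X" "x \<in> X" "c ~= d" "x ~= c" "x ~= d" "z ~: X" "z' ~: X" "z ~= z'"
  "insert z (X - {c}) \<in> \<N>" "insert z (X - {x}) \<in> \<N>" "insert z (X - {d}) ~: \<N>"
  "insert z' (X - {x}) \<in> \<N>" "insert z' (X - {d}) \<in> \<N>" "insert z' (X - {c}) ~: \<N>"
 shows "Q X c d"
proof -
 define K where "K = X - {c, d, x}"
 note KK = pivot_config[OF X(1-7), folded K_def]
 note mem = X_mem[OF X(1)] X_mem[OF X(12)] X_mem[OF X(14)]
 have zz: "z \<in> E - K" "z ~= a" "z ~= b" "z ~= c" "z ~= d" "z ~= x" "z' \<in> E - K" "z' ~= a" "z' ~= b" "z' ~= c" "z' ~= d" "z' ~= x"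
  using mem X unfolding K_def by auto
 interpret plane_pair L \<Gamma> "T3 D K" "T3 D' K" "E - K" a b using plane_pair_K[OF KK(1-3)] .
 have cdx: "c \<in> E - K" "d \<in> E - K" "x \<in> E - K" "a ~: {c, d, x}" "b ~: {c, d, x}" using KK(4) X mem by auto
 have zn: "insert z (X - {d}) ~: \<B>" "insert z' (X - {c}) ~: \<B>" using X(13,16) mem zz by auto
 have sub: "insert z (X - {d}) \<subseteq> E" "insert z' (X - {c}) \<subseteq> E" "insert z (X - {c}) \<subseteq> E" "insert z (X - {x}) \<subseteq> E"
  "insert z' (X - {x}) \<subseteq> E" "insert z' (X - {d}) \<subseteq> E" using mem zz by auto
 have e: "insert c (insert x (insert z K)) = insert z (X - {d})" "insert z (insert x (insert d K)) = insert z (X - {c})"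
  "insert c (insert z (insert d K)) = insert z (X - {x})" "insert x (insert d (insert z' K)) = insert z' (X - {c})"
  "insert c (insert x (insert z' K)) = insert z' (X - {d})" "insert c (insert z' (insert d K)) = insert z' (X - {x})"
  using KK(6,7,8)[OF X(8)] KK(6,7,8)[OF X(9)] by auto
 have "R x a b c d"
 proof (rule path_target[OF cdx(1,3,2) zz(1,7)])
  show "a ~: {c, x, d, z, z'}" "b ~: {c, x, d, z, z'}" using cdx zz by auto
  show "T3 D K c x d ~= 0" unfolding T3_zero using KK(9) X suppD mem by auto
  show "T3 D K c x z = 0" unfolding T3_zero e using suppD[OF sub(1)] zn by blast
  show "T3 D K z x d ~= 0" unfolding T3_zero e using suppD[OF sub(3)] X zz by auto
  show "T3 D K c z d ~= 0" unfolding T3_zero e using suppD[OF sub(4)] X zz by auto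
  show "T3 D K x d z' = 0" unfolding T3_zero e using suppD[OF sub(2)] zn by blast
  show "T3 D K c x z' ~= 0" unfolding T3_zero e using suppD[OF sub(6)] X zz by auto
  show "T3 D K c z' d ~= 0" unfolding T3_zero e using suppD[OF sub(5)] X zz by auto
 qed
 then show ?thesis unfolding Q_def KK(5) using cdx X(6,7) by (intro RLF_brI) auto
qed

lemma Q_all:
 assumes "X \<in> \<N>" "c \<in> X" "d \<in> X" "c ~= d"
 shows "Q X c d"
proof (rule connected_path_induct[where Q = Q, OF MN C _ _ _ assms])
 show "Q X c d" if "X \<in> \<N>" "c \<in> X" "d \<in> X" "c ~= d" "z ~: X" "insert z (X - {c}) \<in> \<N>" "insert z (X - {d}) \<in> \<N>" for X c d z
  using Q_near[OF that] .
next
 fix X c d x z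
 assume h: "X \<in> \<N>" "c \<in> X" "d \<in> X" "x \<in> X" "c ~= d" "x ~= c" "x ~= d" "z ~: X" "insert z (X - {x}) \<in> \<N>"
  "insert z (X - {c}) ~: \<N>" "insert z (X - {d}) ~: \<N>" "Q (insert z (X - {x})) c d"
 show "Q X c d" using Q_pivot[OF h] .
next
 fix X c d x z z'
 assume h: "X \<in> \<N>" "c \<in> X" "d \<in> X" "x \<in> X" "c ~= d" "x ~= c" "x ~= d" "z ~: X" "z' ~: X" "z ~= z'"
  "insert z (X - {c}) \<in> \<N>" "insert z (X - {x}) \<in> \<N>" "insert z (X - {d}) ~: \<N>"
  "insert z' (X - {x}) \<in> \<N>" "insert z' (X - {d}) \<in> \<N>" "insert z' (X - {c}) ~: \<N>"
 show "Q X c d" using Q_two[OF h] .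
qed

lemma RLF_frame:
 assumes "J \<subseteq> E" "a ~: J" "b ~: J" "frame J c d"
 shows "RLF (br D J) (br D' J) a b c d"
proof -
 let ?X = "insert c (insert d J)"
 have "?X \<in> \<N>" using assms unfolding frame_def by auto
 then have "Q ?X c d" using assms unfolding frame_def by (intro Q_all) auto
 moreover have "?X - {c, d} = J" using assms unfolding frame_def by auto
 ultimately show ?thesis unfolding Q_def by simp
qed

text \<open>For a set through \<open>a\<close> and \<open>b\<close>, the support is read off the
  lifted relation at a frame.\<close>

lemma full_supp: "B \<subseteq> E ==> D B = 0 \<longleftrightarrow> D' B = 0"
proof (cases "{a, b} \<subseteq> B")
 case False then show "B \<subseteq> E ==> D B = 0 \<longleftrightarrow> D' B = 0" using supp' by blast
next
 case True
 assume BE: "B \<subseteq> E"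
 define J where "J = B - {a, b}"
 have J: "J \<subseteq> E" "a ~: J" "b ~: J" "B = insert a (insert b J)" using True BE unfolding J_def by auto
 have "br D J a b = 0 \<longleftrightarrow> br D' J a b = 0"
 proof (cases "\<exists>c d. frame J c d")
  case True
  then obtain c d where f: "frame J c d" by blast
  have n: "insert c (insert d J) \<subseteq> E" "\<not> {a, b} \<subseteq> insert c (insert d J)" using f J unfolding frame_def by auto
  have "br D J c d ~= 0" "br D' J c d ~= 0" using f supp'[OF n] suppD[OF n(1)] unfolding br_zero frame_def by auto
  then show ?thesis using RLF_frame[OF J(1-3) f] unfolding RLF_def RL_def by auto
 next
  case False
  have "br D' J a b = 0" using br'_zero_noframe[OF J(1-3) False] ab J by auto
  moreover have "B ~: \<B>" using frameI[OF J(1-3), of a b] False ab J by auto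
  ultimately show ?thesis using suppD[OF BE] J(4) unfolding br_zero by blast
 qed
 then show "D B = 0 \<longleftrightarrow> D' B = 0" using J(4) ab(3) unfolding br_zero by simp
qed

text \<open>Once supports agree, a relation with a zero term follows from the three-term relations
  on both sides; only the nondegenerate ones remain.\<close>

lemma RLF_generic:
 assumes J: "J \<subseteq> E" and P: "{p, q, r, t} \<subseteq> E - J"
  and nd: "br D J p q ~= 0 ==> br D J p r ~= 0 ==> br D J p t ~= 0 ==> br D J q r ~= 0 ==> br D J q t ~= 0 ==> br D J r t ~= 0 ==>
   RLF (br D J) (br D' J) p q r t"
 shows "RLF (br D J) (br D' J) p q r t"
proof (cases "br D J p q * br D J r t = 0 \<or> br D J p r * br D J q t = 0 \<or> br D J p t * br D J q r = 0")
 case True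
 have s: "br D J x y = 0 \<longleftrightarrow> br D' J x y = 0" if "{x, y} \<subseteq> {p, q, r, t}" for x y
 proof -
  have "insert x (insert y J) \<subseteq> E" using that P J by auto
  from full_supp[OF this] show ?thesis unfolding br_zero by blast
 qed
 have ss: "br D J p q = 0 \<longleftrightarrow> br D' J p q = 0" "br D J p r = 0 \<longleftrightarrow> br D' J p r = 0" "br D J p t = 0 \<longleftrightarrow> br D' J p t = 0"
  "br D J q r = 0 \<longleftrightarrow> br D' J q r = 0" "br D J q t = 0 \<longleftrightarrow> br D' J q t = 0" "br D J r t = 0 \<longleftrightarrow> br D' J r t = 0"
  by (rule s; simp)+
 have N: "N3 (br D J) p q r t" using D J P unfolding prep_def by auto
 show ?thesis by (rule RLF_degI[OF N K3_all[OF J P] _ _ _ True]) (use ss in auto)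
next
 case False then show ?thesis using nd by auto
qed

lemma frame_iff:
 assumes "J \<subseteq> E" "{c, d} \<subseteq> E - J - {a, b}" "br D J c d ~= 0"
 shows "frame J c d"
proof -
 have "insert c (insert d J) \<subseteq> E" using assms by auto
 then show ?thesis using assms suppD unfolding frame_def br_zero by auto
qed

lemma RLF_reorder:
 assumes P: "\<And>u v x y. {u, v, x, y} = {p, q, r, t} ==> distinct [u, v, x, y] ==> w = u ==> RLF F F' u v x y"
  and alt: "alt2 F" "alt2 F'" and w: "w \<in> {p, q, r, t}" "distinct [p, q, r, t]"
 shows "RLF F F' p q r t"
proof -
 consider "w = p" | "w = q" | "w = r" | "w = t" using w by auto
 then show ?thesis
 proof cases
  case 1 then show ?thesis using w by (intro P) auto
 next
  case 2
  have "RLF F F' q p r t" using w 2 by (intro P) auto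
  then show ?thesis by (rule RLF_swap12[OF alt])
 next
  case 3
  have "RLF F F' r p q t" using w 3 by (intro P) auto
  then show ?thesis using RLF_swap23[OF alt RLF_swap12[OF alt]] by blast
 next
  case 4
  have "RLF F F' t p q r" using w 4 by (intro P) auto
  then show ?thesis using RLF_swap34[OF alt RLF_swap23[OF alt RLF_swap12[OF alt]]] by blast
 qed
qed

lemma br_nz_distinct: "br D J p q ~= 0 ==> p ~= q"
 unfolding br_zero by blast

lemma RLF_level1:
 assumes J: "J \<subseteq> E" "a ~: J" "b ~: J" and P: "{p, q, r, t} \<subseteq> E - J"
 shows "RLF (br D J) (br D' J) p q r t"
proof (cases "{a, b} \<subseteq> {p, q, r, t} & distinct [p, q, r, t]")
 case True
 have main: "RLF (br D J) (br D' J) a b x y" if "{x, y} \<subseteq> E - J - {a, b}" for x y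
 proof (rule RLF_generic[OF J(1)])
  show "{a, b, x, y} \<subseteq> E - J" using that ab J by auto
  assume "br D J x y ~= 0"
  then show "RLF (br D J) (br D' J) a b x y" using RLF_frame[OF J frame_iff[OF J(1)]] that by blast
 qed
 note alt = alt2_br[of D J] alt2_br[of D' J]
 show ?thesis
 proof (rule RLF_reorder[where w = a, OF _ alt])
  show "a \<in> {p, q, r, t}" "distinct [p, q, r, t]" using True by auto
  fix u v x y assume u: "{u, v, x, y} = {p, q, r, t}" "distinct [u, v, x, y]" "a = u"
  have sub: "{v, x, y} \<subseteq> E - J" using u(1) P by blast
  have "b \<in> {u, v, x, y}" using True u(1) by simp
  then consider "b = v" | "b = x" | "b = y" using u(3) ab(3) by auto
  then show "RLF (br D J) (br D' J) u v x y"
  proof cases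
   case 1 then show ?thesis using main[of x y] u sub by auto
  next
   case 2
   have "RLF (br D J) (br D' J) a b v y" using 2 u sub by (intro main) auto
   then show ?thesis using 2 u RLF_swap23[OF alt] by blast
  next
   case 3
   have "RLF (br D J) (br D' J) a b v x" using 3 u sub by (intro main) auto
   then show ?thesis using 3 u RLF_swap34[OF alt RLF_swap23[OF alt]] by blast
  qed
 qed
next
 case False
 show ?thesis
 proof (cases "distinct [p, q, r, t]")
  case True
  then have "\<not> {a, b} \<subseteq> J \<union> {p, q, r, t}" using False J by auto
  then show ?thesis using RLF_free[OF J(1) P] by blast
 next
  case nd: False
  show ?thesis by (rule RLF_generic[OF J(1) P]) (use nd br_nz_distinct in auto)
 qed
qed

text \<open>\<open>pencil\<close> with centre \<open>z\<close>, using the pencils at elements of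
  \<open>N0\<close>. The point \<open>g\<close> off the line \<open>q r\<close> can be found in
  \<open>N0\<close> because the basis through \<open>q, r, z\<close> can be changed to one whose
  last element avoids \<open>a\<close> and \<open>b\<close>.\<close>

lemma RLF_centre:
 assumes KK: "K \<subseteq> E" "b ~: K" and N0: "N0 = E - {a, b} - K"
  and C0: "\<And>n x y u v. n \<in> N0 ==> {x, y, u, v} \<subseteq> E - insert n K ==> RLF (br D (insert n K)) (br D' (insert n K)) x y u v"
  and zz: "z \<in> E - K" and p: "p \<in> E - K" "p ~= z" and q: "{q, r, t} \<subseteq> N0" "z ~: {q, r, t}"
 shows "RLF (br D (insert z K)) (br D' (insert z K)) p q r t"
proof (rule RLF_generic)
 show zK: "insert z K \<subseteq> E" "{p, q, r, t} \<subseteq> E - insert z K" using KK zz p q N0 by auto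
 interpret plane L \<Gamma> "T3 D K" "T3 D' K" "E - K" using plane_K[OF KK(1)] .
 assume nz: "br D (insert z K) p q ~= 0" "br D (insert z K) p r ~= 0" "br D (insert z K) p t ~= 0" "br D (insert z K) q r ~= 0"
  "br D (insert z K) q t ~= 0" "br D (insert z K) r t ~= 0"
 have T: "T3 D K z x y ~= 0" if "br D (insert z K) x y ~= 0" "x ~= z" "y ~= z" for x y
 proof -
  have "insert x (insert y (insert z K)) = insert z (insert x (insert y K))" by auto
  then show ?thesis using that unfolding T3_zero br_zero by auto
 qed
 have qP: "q \<in> E - K" "r \<in> E - K" "t \<in> E - K" "q ~= z" "r ~= z" "t ~= z" using q N0 by auto
 have "insert q (insert r (insert z K)) \<in> \<B>" using nz(4) suppD[of "insert q (insert r (insert z K))"] zK unfolding br_zero by auto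
 moreover have "insert q (insert r K) \<subseteq> insert q (insert r (insert z K))" by auto
 ultimately obtain B' where B': "B' \<in> \<B>" "insert q (insert r K) \<subseteq> B'" "B' - insert q (insert r K) \<subseteq> E - {a, b}"
  "card (B' - insert q (insert r K)) = card (insert q (insert r (insert z K)) - insert q (insert r K))"
  using extend_N by blast
 have "insert q (insert r (insert z K)) - insert q (insert r K) = {z}" using zz qP by auto
 then have "card (B' - insert q (insert r K)) = 1" using B'(4) by simp
 then obtain g where g: "B' - insert q (insert r K) = {g}" by (meson card_1_singletonE)
 have gN: "g \<in> N0" "g ~= q" "g ~= r" using g B'(3) N0 by auto
 have gP: "g \<in> E - K" using gN N0 by auto
 have "insert q (insert r (insert g K)) = B'" using g B'(2) by auto
 then have "T3 D K q r g ~= 0" unfolding T3_zero using B'(1) suppD[of B'] matroid_basis_subset[OF M B'(1)] gN br_nz_distinct[OF nz(4)] by auto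
 moreover have "RLF (T3 D K n) (T3 D' K n) x y u v" if "n \<in> {q, r, t, g}" "{x, y, u, v} \<subseteq> E - K" for n x y u v
 proof (rule RLF_T3I)
  assume "n ~: {x, y, u, v}"
  then show "RLF (br D (insert n K)) (br D' (insert n K)) x y u v" using that q gN by (intro C0) auto
 qed
 moreover have "T3 D K x y w = 0 \<longleftrightarrow> T3 D' K x y w = 0" if "x \<in> E - K" "y \<in> E - K" "w \<in> E - K" for x y w
 proof -
  have "insert x (insert y (insert w K)) \<subseteq> E" using that KK by auto
  from full_supp[OF this] show ?thesis unfolding T3_zero by blast
 qed
 ultimately have "RLF (T3 D K z) (T3 D' K z) p q r t"
  by (intro pencil[OF zz p(1) qP(1-3) gP _ T[OF nz(1) p(2) qP(4)] T[OF nz(2) p(2) qP(5)] T[OF nz(3) p(2) qP(6)]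
    T[OF nz(4) qP(4,5)] T[OF nz(5) qP(4,6)] T[OF nz(6) qP(5,6)]])
 then show "RLF (br D (insert z K)) (br D' (insert z K)) p q r t" using p q by (intro RLF_brI) auto
qed

lemma RLF_level2:
 assumes K: "K \<subseteq> E" "a ~: K" "b ~: K" and z: "z = a & w = b \<or> z = b & w = a" and P: "{p, q, r, t} \<subseteq> E - insert z K"
 shows "RLF (br D (insert z K)) (br D' (insert z K)) p q r t"
proof (cases "w \<in> {p, q, r, t} & distinct [p, q, r, t]")
 case True
 have C0: "RLF (br D (insert n K)) (br D' (insert n K)) x y u v" if "n \<in> E - {a, b} - K" "{x, y, u, v} \<subseteq> E - insert n K" for n x y u v
  using that K by (intro RLF_level1) auto
 have main: "RLF (br D (insert z K)) (br D' (insert z K)) w x y v" if "{x, y, v} \<subseteq> E - {a, b} - K" for x y v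
  using that z ab K by (intro RLF_centre[OF K(1,3) refl C0]) auto
 show ?thesis
 proof (rule RLF_reorder[where w = w, OF _ alt2_br alt2_br])
  show "w \<in> {p, q, r, t}" "distinct [p, q, r, t]" using True by auto
  fix u v x y assume u: "{u, v, x, y} = {p, q, r, t}" "distinct [u, v, x, y]" "w = u"
  have sub: "{v, x, y} \<subseteq> E - insert z K" using u(1) P by blast
  have "{v, x, y} \<subseteq> E - {a, b} - K" using sub u z by auto
  then show "RLF (br D (insert z K)) (br D' (insert z K)) u v x y" using main u(3) by blast
 qed
next
 case False
 show ?thesis
 proof (cases "distinct [p, q, r, t]")
  case True
  then have "w ~: {p, q, r, t}" using False by blast
  then have "\<not> {a, b} \<subseteq> insert z K \<union> {p, q, r, t}" using z K P ab(3) by auto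
  then show ?thesis using K z ab P by (intro RLF_free) auto
 next
  case nd: False
  have "insert z K \<subseteq> E" using K z ab by auto
  then show ?thesis by (rule RLF_generic[OF _ P]) (use nd br_nz_distinct in auto)
 qed
qed

lemma RLF_all:
 assumes J: "J \<subseteq> E" and P: "{p, q, r, t} \<subseteq> E - J"
 shows "RLF (br D J) (br D' J) p q r t"
proof -
 consider "a ~: J" "b ~: J" | "a \<in> J" "b ~: J" | "a ~: J" "b \<in> J" | "a \<in> J" "b \<in> J" by blast
 then show ?thesis
 proof cases
  case 1 then show ?thesis using RLF_level1[OF J] P by blast
 next
  case 2
  then have "J = insert a (J - {a})" by blast
  then show ?thesis using RLF_level2[of "J - {a}" a b p q r t] 2 J P by auto
 next
  case 3
  then have "J = insert b (J - {b})" by blast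
  then show ?thesis using RLF_level2[of "J - {b}" b a p q r t] 3 J P by auto
 next
  case 4
  define K where "K = J - {b}"
  have K: "J = insert b K" "K \<subseteq> E" "b ~: K" "a \<in> K" using 4 J ab(3) unfolding K_def by auto
  have C0: "RLF (br D (insert n K)) (br D' (insert n K)) x y u v" if v: "n \<in> E - {a, b} - K" "{x, y, u, v} \<subseteq> E - insert n K" for n x y u v
  proof -
   have "insert n K = insert a (insert n (K - {a}))" using K by blast
   then show ?thesis using RLF_level2[of "insert n (K - {a})" a b x y u v] K v ab by auto
  qed
  show ?thesis unfolding K(1) using P K ab 4 by (intro RLF_centre[OF K(2,3) refl C0]) auto
 qed
qed

text \<open>Two nonzero entries of a lifted triple have their ratio in \<open>\<Gamma>\<close>, by
  \<open>L_ratio\<close> or because they are opposite. The relation at a frame writes the new value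
  as such a ratio times old values.\<close>

lemma D'_\<Gamma>:
 assumes "B \<in> \<B>"
 shows "D' B \<in> \<Gamma>"
proof (cases "{a, b} \<subseteq> B")
 case False then show ?thesis using gam0[OF assms] D'_same by simp
next
 case True
 define J where "J = B - {a, b}"
 have BE: "B \<subseteq> E" using matroid_basis_subset[OF M assms] .
 have J: "J \<subseteq> E" "a ~: J" "b ~: J" "B = insert a (insert b J)" using True BE unfolding J_def by auto
 obtain c d where f: "frame J c d" using frameI[OF J(1-3), of a b] assms J ab by auto
 have cd: "c ~= d" "c ~: {a, b}" "d ~: {a, b}" "c \<in> E - J" "d \<in> E - J" using f unfolding frame_def by auto
 let ?F = "br D J" and ?G = "br D' J"
 have brG: "?G x y \<in> \<Gamma>" if "?F x y ~= 0" "{x, y} \<subseteq> E - J" "\<not> {a, b} \<subseteq> {x, y}" for x y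
 proof -
  have n: "\<not> {a, b} \<subseteq> insert x (insert y J)" "insert x (insert y J) \<subseteq> E" using that J by auto
  have "x ~= y" "insert x (insert y J) \<in> \<B>" using that suppD[OF n(2)] unfolding br_zero by auto
  then show ?thesis unfolding br_def D'_same[OF n(1)] using gam0[OF _ n(1)] s_\<Gamma>[of x y] unit_subgroupD(3)[OF subgroup] by blast
 qed
 have R: "RLF ?F ?G a b c d" using RLF_frame[OF J(1-3) f] .
 have nz: "?F a b ~= 0" "?F c d ~= 0"
  using suppD[of "insert c (insert d J)"] suppD[OF BE] assms J f cd ab(3) unfolding br_zero frame_def by auto
 note G = unit_subgroupD[OF subgroup]
 have ratio: "x' / y' \<in> \<Gamma>" if "RL x y w x' y' w'" "x ~= 0" "y ~= 0" for x y w x' y' w'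
 proof -
  have nz: "x' ~= 0" "y' ~= 0" using that unfolding RL_def by auto
  have "L x y w x' y' w' \<or> w = 0" using that unfolding RL_def by auto
  then consider "L x y w x' y' w'" | "w = 0" by blast
  then show ?thesis
  proof cases
   case 1 then show ?thesis by (rule L_ratio)
  next
   case 2
   then have "x' + y' = 0" using that(1) unfolding RL_def by auto
   then have "x' = - y'" by (simp add: eq_neg_iff_add_eq_0)
   then show ?thesis using nz neg_one by simp
  qed
 qed
 have cdG: "?G c d \<in> \<Gamma>" using nz cd by (intro brG) auto
 have "?F a c * ?F b d ~= 0 \<or> ?F a d * ?F b c ~= 0"
  using N3_zero(2)[OF RLF_N3[OF R]] nz by auto
 then have "?G a b * ?G c d \<in> \<Gamma>"
 proof
  assume n: "?F a c * ?F b d ~= 0"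
  have "(?G a b * ?G c d) / (- (?G a c * ?G b d)) \<in> \<Gamma>" 
   using ratio[OF R[unfolded RLF_def]] n nz by auto
  moreover have "- (?G a c * ?G b d) \<in> \<Gamma>"
  proof -
   have "?G a c \<in> \<Gamma>" "?G b d \<in> \<Gamma>" using n cd ab J by (auto intro!: brG)
   then have "- 1 * (?G a c * ?G b d) \<in> \<Gamma>" using G(3) neg_one by blast
   then show ?thesis by simp
  qed
  ultimately have "(?G a b * ?G c d) / (- (?G a c * ?G b d)) * (- (?G a c * ?G b d)) \<in> \<Gamma>" using G(3) by blast
  moreover have "- (?G a c * ?G b d) ~= 0" using \<open>- (?G a c * ?G b d) \<in> \<Gamma>\<close> G(2) by blast
  ultimately show ?thesis by (metis nonzero_eq_divide_eq)
 next
  assume n: "?F a d * ?F b c ~= 0"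
  have "RL (?F a b * ?F c d) (?F a d * ?F b c) (- (?F a c * ?F b d)) (?G a b * ?G c d) (?G a d * ?G b c) (- (?G a c * ?G b d))"
   using RL_swap23[OF R[unfolded RLF_def]] .
  from ratio[OF this] have "(?G a b * ?G c d) / (?G a d * ?G b c) \<in> \<Gamma>" using n nz by auto
  moreover have p: "?G a d * ?G b c \<in> \<Gamma>"
  proof -
   have "?G a d \<in> \<Gamma>" "?G b c \<in> \<Gamma>" using n cd ab J by (auto intro!: brG)
   then show ?thesis using G(3) by blast
  qed
  ultimately have "(?G a b * ?G c d) / (?G a d * ?G b c) * (?G a d * ?G b c) \<in> \<Gamma>" using G(3) by blast
  moreover have "?G a d * ?G b c ~= 0" using p G(2) by blast
  ultimately show ?thesis by (metis nonzero_eq_divide_eq)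
 qed
 then have "?G a b * ?G c d / ?G c d \<in> \<Gamma>" using cdG G(5) by blast
 moreover have "?G c d ~= 0" using cdG G(2) by blast
 ultimately have "?G a b \<in> \<Gamma>" by simp
 moreover have "D' B = of_int (s a b) * ?G a b"
  unfolding br_def J(4) using s_sq[OF ab(3), where 'f = 'k] by (simp add: mult.assoc[symmetric])
 ultimately show ?thesis using G(3) s_\<Gamma>[OF ab(3)] by simp
qed

theorem glued: "right E \<B> D D'"
 unfolding right_def
proof (intro conjI allI impI ballI)
 show "D' B ~= 0 \<longleftrightarrow> B \<in> \<B>" if "B \<subseteq> E" for B using full_supp[OF that] suppD[OF that] by blast
 show "D' B \<in> \<Gamma>" if "B \<in> \<B>" for B using D'_\<Gamma>[OF that] .
 show "RLF (br D J) (br D' J) p q r t" if "J \<subseteq> E" "p \<in> E - J" "q \<in> E - J" "r \<in> E - J" "t \<in> E - J" for J p q r t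
  using that by (intro RLF_all) auto
qed

end

section \<open>Symmetry and duality of lifts, and rank at most one\<close>

context lifting
begin

lemma RL_LI: "L x y z x' y' z' ==> RL x y z x' y' z'"
 unfolding RL_def using L_nz L_sum by blast

lemma RL_degI:
 assumes "x + y + z = 0" "x = 0 \<or> y = 0 \<or> z = 0" shows "\<exists>x' y' z'. RL x y z x' y' z'"
proof -
 consider "x = 0" "y = - z" | "y = 0" "x = - z" | "z = 0" "x = - y"
  using assms by (auto simp: eq_neg_iff_add_eq_0)
 then show ?thesis
 proof cases
  case 1
  then have "RL x y z 0 (if z = 0 then 0 else 1) (if z = 0 then 0 else - 1)" unfolding RL_def by auto
  then show ?thesis by blast
 next
  case 2
  then have "RL x y z (if z = 0 then 0 else 1) 0 (if z = 0 then 0 else - 1)" unfolding RL_def by auto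
  then show ?thesis by blast
 next
  case 3
  then have "RL x y z (if y = 0 then 0 else 1) (if y = 0 then 0 else - 1) 0" unfolding RL_def by auto
  then show ?thesis by blast
 qed
qed

end

context signed_lifting
begin

text \<open>All 24 orders of the arguments are reached by swaps of neighbours; the list spells out
  one word for each.\<close>

lemma RLF_perm:
 assumes alt: "alt2 F" "alt2 F'" and R: "RLF F F' p q r t"
  and d: "distinct [a, b, c, d]" "{a, b, c, d} \<subseteq> {p, q, r, t}"
 shows "RLF F F' a b c d"
proof -
 note all = R
  RLF_swap12[OF alt R]
  RLF_swap23[OF alt R]
  RLF_swap34[OF alt R]
  RLF_swap23[OF alt RLF_swap12[OF alt R]]
  RLF_swap34[OF alt RLF_swap12[OF alt R]]
  RLF_swap12[OF alt RLF_swap23[OF alt R]]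
  RLF_swap34[OF alt RLF_swap23[OF alt R]]
  RLF_swap23[OF alt RLF_swap34[OF alt R]]
  RLF_swap12[OF alt RLF_swap23[OF alt RLF_swap12[OF alt R]]]
  RLF_swap34[OF alt RLF_swap23[OF alt RLF_swap12[OF alt R]]]
  RLF_swap23[OF alt RLF_swap34[OF alt RLF_swap12[OF alt R]]]
  RLF_swap34[OF alt RLF_swap12[OF alt RLF_swap23[OF alt R]]]
  RLF_swap23[OF alt RLF_swap34[OF alt RLF_swap23[OF alt R]]]
  RLF_swap12[OF alt RLF_swap23[OF alt RLF_swap34[OF alt R]]]
  RLF_swap34[OF alt RLF_swap12[OF alt RLF_swap23[OF alt RLF_swap12[OF alt R]]]]
  RLF_swap23[OF alt RLF_swap34[OF alt RLF_swap23[OF alt RLF_swap12[OF alt R]]]]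
  RLF_swap12[OF alt RLF_swap23[OF alt RLF_swap34[OF alt RLF_swap12[OF alt R]]]]
  RLF_swap23[OF alt RLF_swap34[OF alt RLF_swap12[OF alt RLF_swap23[OF alt R]]]]
  RLF_swap12[OF alt RLF_swap23[OF alt RLF_swap34[OF alt RLF_swap23[OF alt R]]]]
  RLF_swap23[OF alt RLF_swap34[OF alt RLF_swap12[OF alt RLF_swap23[OF alt RLF_swap12[OF alt R]]]]]
  RLF_swap12[OF alt RLF_swap23[OF alt RLF_swap34[OF alt RLF_swap23[OF alt RLF_swap12[OF alt R]]]]]
  RLF_swap12[OF alt RLF_swap23[OF alt RLF_swap34[OF alt RLF_swap12[OF alt RLF_swap23[OF alt R]]]]]
  RLF_swap12[OF alt RLF_swap23[OF alt RLF_swap34[OF alt RLF_swap12[OF alt RLF_swap23[OF alt RLF_swap12[OF alt R]]]]]]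
 have "a \<in> {p, q, r, t}" "b \<in> {p, q, r, t}" "c \<in> {p, q, r, t}" "d \<in> {p, q, r, t}" using d(2) by auto
 then show ?thesis using d(1) by (elim insertE emptyE) (simp_all add: all)
qed

lemma N3_degI:
 assumes K: "K3 F a b c d" and Z: "F a b * F c d = 0 \<or> F a c * F b d = 0 \<or> F a d * F b c = 0"
 shows "N3 F a b c d"
 using K Z unfolding N3_def K3_def by (intro RL_degI) auto

lemma prepI:
 assumes S: "\<And>B. B \<subseteq> E ==> D B ~= 0 \<longleftrightarrow> B \<in> \<B>"
  and N: "\<And>J a b c d. J \<subseteq> E ==> {a, b, c, d} \<subseteq> E - J ==> distinct [a, b, c, d] ==> N3 (br D J) a b c d"
 shows "prep E \<B> D"
 unfolding prep_def
proof (intro conjI allI impI ballI)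
 show "D B ~= 0 \<longleftrightarrow> B \<in> \<B>" if "B \<subseteq> E" for B using S[OF that] .
 show "N3 (br D J) a b c d" if "J \<subseteq> E" "a \<in> E - J" "b \<in> E - J" "c \<in> E - J" "d \<in> E - J" for J a b c d
 proof (cases "distinct [a, b, c, d]")
  case True then show ?thesis using that by (intro N) auto
 next
  case False
  show ?thesis by (rule N3_degI[OF K3_nondistinct[OF alt2_br False]]) (use False in \<open>auto simp: br_zero\<close>)
 qed
qed

lemma prepD:
 assumes "prep E \<B> D"
 shows "B \<subseteq> E ==> D B ~= 0 \<longleftrightarrow> B \<in> \<B>" "J \<subseteq> E ==> {a, b, c, d} \<subseteq> E - J ==> N3 (br D J) a b c d"
 using assms unfolding prep_def by auto

lemma rightI:
 assumes P: "prep E \<B> D" and S: "\<And>B. B \<subseteq> E ==> D' B ~= 0 \<longleftrightarrow> B \<in> \<B>"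
  and G: "\<And>B. B \<in> \<B> ==> D' B \<in> \<Gamma>"
  and N: "\<And>J a b c d. J \<subseteq> E ==> {a, b, c, d} \<subseteq> E - J ==> distinct [a, b, c, d] ==> RLF (br D J) (br D' J) a b c d"
 shows "right E \<B> D D'"
 unfolding right_def
proof (intro conjI allI impI ballI)
 show "D' B ~= 0 \<longleftrightarrow> B \<in> \<B>" if "B \<subseteq> E" for B using S[OF that] .
 show "D' B \<in> \<Gamma>" if "B \<in> \<B>" for B using G[OF that] .
 show "RLF (br D J) (br D' J) a b c d" if h: "J \<subseteq> E" "a \<in> E - J" "b \<in> E - J" "c \<in> E - J" "d \<in> E - J" for J a b c d
 proof (cases "distinct [a, b, c, d]")
  case True then show ?thesis using h by (intro N) auto
 next
  case False
  show ?thesis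
  proof (rule RLF_nondistinct[OF False])
   fix x y assume "{x, y} \<subseteq> {a, b, c, d}"
   then have "insert x (insert y J) \<subseteq> E" using h by auto
   then show "br D J x y = 0 \<longleftrightarrow> br D' J x y = 0" unfolding br_zero using prepD(1)[OF P] S by blast
  qed
 qed
qed

lemma rightD:
 assumes "right E \<B> D D'"
 shows "B \<subseteq> E ==> D' B ~= 0 \<longleftrightarrow> B \<in> \<B>" "B \<in> \<B> ==> D' B \<in> \<Gamma>"
  "J \<subseteq> E ==> {a, b, c, d} \<subseteq> E - J ==> RLF (br D J) (br D' J) a b c d"
 using assms unfolding right_def by auto

lemma prep_delete:
 assumes "prep E \<B> D" shows "prep (E - {e}) {B \<in> \<B>. e ~: B} D"
proof (rule prepI)
 fix B assume B: "B \<subseteq> E - {e}"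
 then have "B \<subseteq> E" "e ~: B" by auto
 then show "D B ~= 0 \<longleftrightarrow> B \<in> {B \<in> \<B>. e ~: B}" using prepD(1)[OF assms, of B] by simp
next
 fix J a b c d assume "J \<subseteq> E - {e}" "{a, b, c, d} \<subseteq> E - {e} - J"
 then show "N3 (br D J) a b c d" by (intro prepD(2)[OF assms]) auto
qed

text \<open>Complementation exchanges the two factors of each product, up to the signs
  \<open>s\<close>, which both sides share.\<close>

lemma br_dual:
 assumes "J \<subseteq> E" "{a, b, c, d} \<subseteq> E - J" "distinct [a, b, c, d]"
 defines "K \<equiv> E - J - {a, b, c, d}"
 shows "br (\<lambda>B. D (E - B)) J a b * br (\<lambda>B. D (E - B)) J c d = br D K a b * br D K c d"
  "br (\<lambda>B. D (E - B)) J a c * br (\<lambda>B. D (E - B)) J b d = br D K a c * br D K b d"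
  "br (\<lambda>B. D (E - B)) J a d * br (\<lambda>B. D (E - B)) J b c = br D K a d * br D K b c"
proof -
 have "E - insert a (insert b J) = insert c (insert d K)" "E - insert c (insert d J) = insert a (insert b K)"
  "E - insert a (insert c J) = insert b (insert d K)" "E - insert b (insert d J) = insert a (insert c K)"
  "E - insert a (insert d J) = insert b (insert c K)" "E - insert b (insert c J) = insert a (insert d K)"
  using assms(1-3) unfolding K_def by auto
 then show "br (\<lambda>B. D (E - B)) J a b * br (\<lambda>B. D (E - B)) J c d = br D K a b * br D K c d"
  "br (\<lambda>B. D (E - B)) J a c * br (\<lambda>B. D (E - B)) J b d = br D K a c * br D K b d"
  "br (\<lambda>B. D (E - B)) J a d * br (\<lambda>B. D (E - B)) J b c = br D K a d * br D K b c"
  unfolding br_def by (simp_all add: ac_simps)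
qed

lemma mem_dual:
 assumes M: "matroid E \<B>" and B: "B \<subseteq> E"
 shows "B \<in> (-) E ` \<B> \<longleftrightarrow> E - B \<in> \<B>"
proof
 assume "B \<in> (-) E ` \<B>"
 then obtain C where C: "C \<in> \<B>" "B = E - C" by (elim imageE)
 then have "E - B = C" using matroid_basis_subset[OF M C(1)] by (simp add: double_diff)
 then show "E - B \<in> \<B>" using C by simp
next
 assume "E - B \<in> \<B>"
 moreover have "B = E - (E - B)" using B by (simp add: double_diff)
 ultimately show "B \<in> (-) E ` \<B>" by (rule rev_image_eqI)
qed

lemma prep_dual:
 assumes M: "matroid E \<B>" and P: "prep E \<B> D"
 shows "prep E ((-) E ` \<B>) (\<lambda>B. D (E - B))"
proof (rule prepI)
 fix B assume B: "B \<subseteq> E"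
 have "D (E - B) ~= 0 \<longleftrightarrow> E - B \<in> \<B>" using prepD(1)[OF P, of "E - B"] by blast
 also have "\<dots> \<longleftrightarrow> B \<in> (-) E ` \<B>" by (rule mem_dual[OF M B, symmetric])
 finally show "D (E - B) ~= 0 \<longleftrightarrow> B \<in> (-) E ` \<B>" .
next
 fix J a b c d assume h: "J \<subseteq> E" "{a, b, c, d} \<subseteq> E - J" "distinct [a, b, c, d]"
 have "N3 (br D (E - J - {a, b, c, d})) a b c d" using h by (intro prepD(2)[OF P]) auto
 then show "N3 (br (\<lambda>B. D (E - B)) J) a b c d" unfolding N3_def br_dual[OF h] .
qed

lemma right_dual:
 assumes M: "matroid E \<B>" and P: "prep E \<B> D" and R: "right E ((-) E ` \<B>) (\<lambda>B. D (E - B)) D1"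
 shows "right E \<B> D (\<lambda>B. D1 (E - B))"
proof (rule rightI[OF P])
 fix B assume B: "B \<subseteq> E"
 have "D1 (E - B) ~= 0 \<longleftrightarrow> E - B \<in> (-) E ` \<B>" by (rule rightD(1)[OF R]) simp
 also have "\<dots> \<longleftrightarrow> B \<in> \<B>" using mem_dual[OF M, of "E - B"] B by (simp add: double_diff)
 finally show "D1 (E - B) ~= 0 \<longleftrightarrow> B \<in> \<B>" .
next
 fix B assume "B \<in> \<B>"
 then show "D1 (E - B) \<in> \<Gamma>" by (intro rightD(2)[OF R] imageI)
next
 fix J a b c d assume h: "J \<subseteq> E" "{a, b, c, d} \<subseteq> E - J" "distinct [a, b, c, d]"
 let ?K = "E - J - {a, b, c, d}"
 have h': "?K \<subseteq> E" "{a, b, c, d} \<subseteq> E - ?K" "E - ?K - {a, b, c, d} = J" using h by auto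
 have r: "RLF (br (\<lambda>B. D (E - B)) ?K) (br D1 ?K) a b c d" using rightD(3)[OF R h'(1,2)] .
 note e = br_dual[OF h'(1,2) h(3), of D, unfolded h'(3)]
 note e' = br_dual[OF h, of D1]
 show "RLF (br D J) (br (\<lambda>B. D1 (E - B)) J) a b c d"
  using r unfolding RLF_def e e' .
qed

text \<open>No basis contains two elements, so every term of every relation vanishes.\<close>

lemma trivial_lift:
 assumes M: "matroid E \<B>" and P: "prep E \<B> D" and r: "\<And>B. B \<in> \<B> ==> card B \<le> 1"
 shows "\<exists>D'. right E \<B> D D'"
proof (intro exI rightI[OF P])
 let ?D = "\<lambda>B. if B \<in> \<B> then 1 else (0::'k)"
 show "?D B ~= 0 \<longleftrightarrow> B \<in> \<B>" for B by simp
 show "?D B \<in> \<Gamma>" if "B \<in> \<B>" for B using that unit_subgroupD(1)[OF subgroup] by simp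
 fix J a b c d assume h: "J \<subseteq> E" "{a, b, c, d} \<subseteq> E - J" "distinct [a, b, c, d]"
 have n: "insert x (insert y J) ~: \<B>" if "x ~= y" for x y
 proof
  assume b: "insert x (insert y J) \<in> \<B>"
  have "card {x, y} \<le> card (insert x (insert y J))" using matroid_basis_finite[OF M b] by (intro card_mono) auto
  then show False using r[OF b] that by simp
 qed
 have z: "br D J x y = 0" "br ?D J x y = 0" if "{x, y} \<subseteq> {a, b, c, d}" for x y
 proof -
  have "insert x (insert y J) \<subseteq> E" using that h by auto
  then have "x ~= y ==> D (insert x (insert y J)) = 0" using n[of x y] prepD(1)[OF P, of "insert x (insert y J)"] by simp
  then show "br D J x y = 0" "br ?D J x y = 0" unfolding br_zero using n[of x y] by auto
 qed
 show "RLF (br D J) (br ?D J) a b c d" unfolding RLF_def by (simp add: z RL_zero)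
qed

end

lemma noU_delete: "noU k E \<B> ==> noU k (E - {e}) {B \<in> \<B>. e ~: B}"
 unfolding noU_def by (intro allI impI) (metis (no_types, lifting) Diff_subset mem_Collect_eq subset_trans)

text \<open>Complementing inside \<open>A\<close> turns \<open>k\<close>-subsets into
  \<open>l\<close>-subsets, so the two excluded minors are exchanged by duality.\<close>

lemma noU_dual:
 assumes M: "matroid E \<B>" and U: "noU k E \<B>" and k: "k + l = 5"
 shows "noU l E ((-) E ` \<B>)"
 unfolding noU_def
proof (intro allI impI)
 fix J A assume h: "J \<union> A \<subseteq> E" "J \<inter> A = {}" "card A = 5"
 have "(E - J - A) \<union> A \<subseteq> E" "(E - J - A) \<inter> A = {}" using h by auto
 from noUD[OF U this h(3)] obtain C where C: "C \<subseteq> A" "card C = k" "(E - J - A) \<union> C ~: \<B>" by blast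
 have fA: "finite A" using h(3) card.infinite by fastforce
 have "card (A - C) = l" using C h(3) k fA by (simp add: card_Diff_subset finite_subset)
 moreover have "J \<union> (A - C) ~: (-) E ` \<B>"
 proof
  assume "J \<union> (A - C) \<in> (-) E ` \<B>"
  then obtain B where B: "B \<in> \<B>" "J \<union> (A - C) = E - B" by blast
  have "B = E - (J \<union> (A - C))" unfolding B(2) using matroid_basis_subset[OF M B(1)] by blast
  also have "\<dots> = (E - J - A) \<union> C" using h C(1) by blast
  finally show False using B(1) C(3) by simp
 qed
 ultimately show "\<exists>C\<subseteq>A. card C = l & J \<union> C ~: (-) E ` \<B>" by blast
qed

section \<open>Making the lifts of two deletions agree\<close>

context signed_lifting
begin

lemma RLF_const:
 assumes "RLF F G a b c d" "k ~= 0"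
 shows "RLF F (\<lambda>x y. k * G x y) a b c d"
proof -
 have "RL (1 * (F a b * F c d)) (1 * (- (F a c * F b d))) (1 * (F a d * F b c))
  (k * k * (G a b * G c d)) (k * k * (- (G a c * G b d))) (k * k * (G a d * G b c))"
  using assms by (intro RL_scale) (auto simp: RLF_def)
 then show ?thesis unfolding RLF_def by (simp add: ac_simps)
qed

text \<open>On the bases avoiding \<open>a\<close> and \<open>b\<close> both deletions lift the same
  function. By uniqueness of lifts their quotient is trivial on quadrangles, by connectedness it is
  a torus function, and rescaling \<open>D2\<close> by it makes the two lifts agree.\<close>

lemma glue_lift:
 assumes M: "matroid E \<B>" and D: "prep E \<B> D" and U: "noU 2 E \<B>" "noU 3 E \<B>"
  and ab: "a \<in> E" "b \<in> E" "a ~= b"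
  and NE: "\<exists>B\<in>\<B>. a ~: B & b ~: B"
  and C: "connected_matroid (E - {a} - {b}) {B \<in> \<B>. a ~: B & b ~: B}"
  and D1: "right (E - {a}) {B \<in> \<B>. a ~: B} D D1" and D2: "right (E - {b}) {B \<in> \<B>. b ~: B} D D2"
 shows "\<exists>D'. right E \<B> D D'"
proof -
 let ?N = "{B \<in> \<B>. a ~: B & b ~: B}"
 have MN: "matroid (E - {a} - {b}) ?N"
 proof -
  have "\<exists>B\<in>\<B>. a ~: B" "\<exists>B\<in>{B \<in> \<B>. a ~: B}. b ~: B" using NE by auto
  then have "matroid (E - {a} - {b}) {B \<in> {B \<in> \<B>. a ~: B}. b ~: B}" using matroid_delete[OF matroid_delete[OF M]] by blast
  moreover have "{B \<in> {B \<in> \<B>. a ~: B}. b ~: B} = ?N" by blast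
  ultimately show ?thesis by simp
 qed
 note G = unit_subgroupD[OF subgroup]
 define u where "u B = D1 B / D2 B" for B
 have uG: "u B \<in> \<Gamma>" if "B \<in> ?N" for B
  using rightD(2)[OF D1, of B] rightD(2)[OF D2, of B] that G(5) unfolding u_def by auto
 have q: "quad_trivial ?N u"
  unfolding quad_trivial_def
 proof (intro allI impI)
  fix J p q r t assume d: "distinct [p, q, r, t]" "J \<inter> {p, q, r, t} = {}"
   and B: "insert p (insert r J) \<in> ?N" "insert q (insert t J) \<in> ?N" "insert p (insert t J) \<in> ?N" "insert q (insert r J) \<in> ?N"
  have sub: "J \<subseteq> E - {a} - {b}" "{p, q, r, t} \<subseteq> E - {a} - {b} - J"
   using matroid_basis_subset[OF MN B(1)] matroid_basis_subset[OF MN B(2)] d(2) by auto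
  have r1: "RLF (br D J) (br D1 J) p q r t" using sub by (intro rightD(3)[OF D1]) auto
  have r2: "RLF (br D J) (br D2 J) p q r t" using sub by (intro rightD(3)[OF D2]) auto
  obtain k where k: "- (br D2 J p r * br D2 J q t) = k * (- (br D1 J p r * br D1 J q t))" "br D2 J p t * br D2 J q r = k * (br D1 J p t * br D1 J q r)"
   using RL_unique[OF r1[unfolded RLF_def] r2[unfolded RLF_def]] by blast
  have nz: "D2 B ~= 0" if "B \<in> ?N" for B using rightD(2)[OF D2, of B] that G(2) by auto
  have nz1: "D1 B ~= 0" if "B \<in> ?N" for B using rightD(2)[OF D1, of B] that G(2) by auto
  have div: "x / y * (z / w) = 1 / k" if "y * w = k * (x * z)" "k ~= 0" "x ~= 0" "z ~= 0" for x y z w :: 'k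
  proof -
   have "x / y * (z / w) = x * z / (k * (x * z))" using that(1) by simp
   then show ?thesis using that by simp
  qed
  have sn: "(of_int (s p r) :: 'k) ~= 0" "(of_int (s q t) :: 'k) ~= 0" "(of_int (s p t) :: 'k) ~= 0" "(of_int (s q r) :: 'k) ~= 0"
   using d(1) by (auto intro!: s_nz)
  have "br D2 J p r * br D2 J q t = k * (br D1 J p r * br D1 J q t)" using k(1) by simp
  then have "(of_int (s p r) * of_int (s q t)) * (D2 (insert p (insert r J)) * D2 (insert q (insert t J)))
   = (of_int (s p r) * of_int (s q t)) * (k * (D1 (insert p (insert r J)) * D1 (insert q (insert t J))))"
   unfolding br_def by (simp add: ac_simps)
  then have e1: "D2 (insert p (insert r J)) * D2 (insert q (insert t J)) = k * (D1 (insert p (insert r J)) * D1 (insert q (insert t J)))"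
   using sn by simp
  have "(of_int (s p t) * of_int (s q r)) * (D2 (insert p (insert t J)) * D2 (insert q (insert r J)))
   = (of_int (s p t) * of_int (s q r)) * (k * (D1 (insert p (insert t J)) * D1 (insert q (insert r J))))"
   using k(2) unfolding br_def by (simp add: ac_simps)
  then have e2: "D2 (insert p (insert t J)) * D2 (insert q (insert r J)) = k * (D1 (insert p (insert t J)) * D1 (insert q (insert r J)))"
   using sn by simp
  have k0: "k ~= 0" using e1 nz[OF B(1)] nz[OF B(2)] by auto
  have "u (insert p (insert r J)) * u (insert q (insert t J)) = 1 / k"
   unfolding u_def by (rule div[OF e1 k0 nz1[OF B(1)] nz1[OF B(2)]])
  moreover have "u (insert p (insert t J)) * u (insert q (insert r J)) = 1 / k"
   unfolding u_def by (rule div[OF e2 k0 nz1[OF B(3)] nz1[OF B(4)]])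
  ultimately show "u (insert p (insert r J)) * u (insert q (insert t J)) = u (insert p (insert t J)) * u (insert q (insert r J))" by simp
 qed
 have "torus_function \<Gamma> ?N u" by (rule quad_trivial_imp_torus[OF MN C subgroup uG q])
 then obtain t g where t: "t \<in> \<Gamma>" "\<And>e. g e \<in> \<Gamma>" "\<And>B. B \<in> ?N ==> u B = t * prod g B"
  unfolding torus_function_def by blast
 \<comment> \<open>\<open>D1\<close> on sets without \<open>a\<close>, the rescaled
   \<open>D2\<close> on sets with \<open>a\<close>. By \<open>D0b\<close> it is the rescaled
   \<open>D2\<close> on all subsets of \<open>E\<close> without \<open>b\<close>, so each relation
   that avoids \<open>a\<close> or \<open>b\<close> comes from one of the two lifts.\<close>
 define D0 where "D0 B = (if a \<in> B then t * prod g B * D2 B else D1 B)" for B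
 have tg: "t * prod g B \<in> \<Gamma>" "t * prod g B ~= 0" for B
 proof -
  show "t * prod g B \<in> \<Gamma>" by (rule G(3)[OF t(1) unit_subgroup_prod[OF subgroup t(2)]])
  then show "t * prod g B ~= 0" using G(2) by metis
 qed
 have D0b: "D0 B = t * prod g B * D2 B" if B: "B \<subseteq> E" "b ~: B" for B
 proof (cases "a \<in> B")
  case False
  show ?thesis
  proof (cases "B \<in> \<B>")
   case True
   then have "u B = t * prod g B" "D2 B ~= 0" using t(3) False B rightD(2)[OF D2, of B] G(2) by auto
   then show ?thesis unfolding D0_def u_def using False by (simp add: field_simps)
  next
   case nB: False
   have "B \<subseteq> E - {a}" "B \<subseteq> E - {b}" using False B by auto
   then have "D1 B = 0" "D2 B = 0" using rightD(1)[OF D1, of B] rightD(1)[OF D2, of B] nB by auto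
   then show ?thesis unfolding D0_def using False by simp
  qed
 qed (simp add: D0_def)
 interpret gluing L \<Gamma> s E \<B> D D0 a b
 proof unfold_locales
  show "matroid E \<B>" "prep E \<B> D" "noU 2 E \<B>" "noU 3 E \<B>" "a \<in> E" "b \<in> E" "a ~= b"
   "\<exists>B\<in>\<B>. a ~: B & b ~: B" "connected_matroid (E - {a} - {b}) ?N" by fact+
 next
  fix B assume B: "B \<subseteq> E" "\<not> {a, b} \<subseteq> B"
  show "D0 B ~= 0 \<longleftrightarrow> B \<in> \<B>"
  proof (cases "a \<in> B")
   case True
   then have "b ~: B" "B \<subseteq> E - {b}" using B by auto
   then show ?thesis using D0b[OF B(1)] tg(2) rightD(1)[OF D2, of B] by simp
  next
   case False
   then have "B \<subseteq> E - {a}" using B by auto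
   then show ?thesis unfolding D0_def using False rightD(1)[OF D1, of B] by simp
  qed
 next
  fix B assume B: "B \<in> \<B>" "\<not> {a, b} \<subseteq> B"
  show "D0 B \<in> \<Gamma>"
  proof (cases "a \<in> B")
   case True
   then have "B \<in> {B \<in> \<B>. b ~: B}" using B by auto
   then show ?thesis unfolding D0_def using True rightD(2)[OF D2, of B] tg G(3) by auto
  next
   case False
   then have "B \<in> {B \<in> \<B>. a ~: B}" using B by auto
   then show ?thesis unfolding D0_def using False rightD(2)[OF D1, of B] by auto
  qed
 next
  fix J p q r w assume h: "J \<subseteq> E" "{p, q, r, w} \<subseteq> E - J" "\<not> {a, b} \<subseteq> J \<union> {p, q, r, w}"
  show "RLF (br D J) (br D0 J) p q r w"
  proof (cases "a \<in> J \<union> {p, q, r, w}")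
   case False
   have "RLF (br D J) (br D1 J) p q r w" using h False by (intro rightD(3)[OF D1]) auto
   moreover have "br D0 J x y = br D1 J x y" if "x \<in> {p, q, r, w}" "y \<in> {p, q, r, w}" for x y
    using that False unfolding br_def D0_def by auto
   ultimately show ?thesis unfolding RLF_def by simp
  next
   case True
   then have nb: "b ~: J \<union> {p, q, r, w}" using h(3) by auto
   have fJ: "finite J" using h(1) matroid_finite[OF M] finite_subset by blast
   have "RLF (br D J) (br D2 J) p q r w" using h nb by (intro rightD(3)[OF D2]) auto
   then have "RLF (br D J) (\<lambda>x y. t * prod g J * br D2 J x y) p q r w" using tg by (intro RLF_const)
   then show ?thesis
   proof (rule RLF_scaled[where f = "\<lambda>_. 1" and f' = g])
    show "g x ~= 0" for x using t(2) G(2) by blast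
    fix x y assume xy: "{x, y} \<subseteq> {p, q, r, w}"
    show "br D0 J x y = g x * g y * (t * prod g J * br D2 J x y)"
    proof (cases "x = y")
     case True then show ?thesis unfolding br_def by (simp add: s_self)
    next
     case False
     have m: "x ~: insert y J" "y ~: J" using xy h(2) False by auto
     have "insert x (insert y J) \<subseteq> E" "b ~: insert x (insert y J)" using xy h nb by auto
     from D0b[OF this] have "D0 (insert x (insert y J)) = t * (g x * (g y * prod g J)) * D2 (insert x (insert y J))"
      using m fJ by simp
     then show ?thesis unfolding br_def by (simp add: ac_simps)
    qed
   qed auto
  qed
 qed
 show ?thesis using glued by blast
qed

end

section \<open>Parallel elements\<close>

lemma parallel_swap:
 assumes M: "matroid E \<B>" and par: "\<And>B. B \<in> \<B> ==> \<not> {e, f} \<subseteq> B" and f: "B \<in> \<B>" "f \<in> B"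
  and K: "insert e K \<in> \<B>" "e ~: K"
 shows "insert f K \<in> \<B>"
proof -
 have "f ~: insert e K" using par[OF K(1)] by blast
 then obtain y where y: "y \<in> insert e K - B" "insert f (insert e K - {y}) \<in> \<B>"
  using matroid_exchange_dual[OF M K(1) f(1)] f(2) by blast
 have "y = e" using par[OF y(2)] by blast
 then show ?thesis using y K(2) by simp
qed

context signed_lifting
begin

lemma RLF_const2:
 assumes "RLF F G a b c d" "k ~= 0" "k' ~= 0"
 shows "RLF (\<lambda>x y. k * F x y) (\<lambda>x y. k' * G x y) a b c d"
proof -
 have "RL (k * k * (F a b * F c d)) (k * k * (- (F a c * F b d))) (k * k * (F a d * F b c))
  (k' * k' * (G a b * G c d)) (k' * k' * (- (G a c * G b d))) (k' * k' * (G a d * G b c))"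
  using assms by (intro RL_scale) (auto simp: RLF_def)
 then show ?thesis unfolding RLF_def by (simp add: ac_simps)
qed

text \<open>The sign of replacing \<open>e\<close> by \<open>f\<close> in \<open>insert e K\<close>.\<close>

definition swap_sign :: "'a => 'a => 'a set => 'f::field" where
 "swap_sign e f K = (\<Prod>k\<in>K. of_int (s e k) * of_int (s f k))"

lemma swap_sign_nz: "e ~: K ==> f ~: K ==> (swap_sign e f K :: 'f::field) ~= 0"
 unfolding swap_sign_def
 by (cases "finite K") (auto intro!: s_nz simp: prod_zero_iff)

lemma swap_sign_insert:
 assumes "finite K" "x ~: K"
 shows "(swap_sign e f (insert x K) :: 'f::field) = of_int (s e x) * of_int (s f x) * swap_sign e f K"
 using assms unfolding swap_sign_def by simp

text \<open>The bracket of \<open>e, f\<close> vanishes, so the relation of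
  \<open>e, f, x, y\<close> over \<open>J\<close> compares the quotient of the two values at
  \<open>insert x J\<close> with that at \<open>insert y J\<close>. Exchanges lead from any such set
  to the reference \<open>K0\<close>.\<close>

lemma parallel_constant:
 assumes M: "matroid E \<B>" and D: "prep E \<B> D" and ef: "e ~= f"
  and par: "\<And>B. B \<in> \<B> ==> \<not> {e, f} \<subseteq> B" and e: "Be \<in> \<B>" "e \<in> Be" and f: "Bf \<in> \<B>" "f \<in> Bf"
 shows "\<exists>k. k ~= 0 & (\<forall>K\<subseteq>E - {e, f}. D (insert f K) = k * swap_sign e f K * D (insert e K))"
proof -
 have E: "e \<in> E" "f \<in> E" using matroid_basis_subset[OF M] e f by auto
 have par': "\<not> {f, e} \<subseteq> B" if "B \<in> \<B>" for B using par[OF that] by blast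
 have sw: "insert f K \<in> \<B> \<longleftrightarrow> insert e K \<in> \<B>" if "K \<subseteq> E - {e, f}" for K
  using parallel_swap[OF M par f, of K] parallel_swap[OF M par' e, of K] that by blast
 have supp: "D (insert f K) ~= 0 \<longleftrightarrow> insert e K \<in> \<B>" "D (insert e K) ~= 0 \<longleftrightarrow> insert e K \<in> \<B>" if "K \<subseteq> E - {e, f}" for K
 proof -
  have "insert f K \<subseteq> E" "insert e K \<subseteq> E" using that E by auto
  then show "D (insert f K) ~= 0 \<longleftrightarrow> insert e K \<in> \<B>" "D (insert e K) ~= 0 \<longleftrightarrow> insert e K \<in> \<B>"
   using prepD(1)[OF D] sw[OF that] by metis+
 qed
 define K0 where "K0 = Be - {e}"
 have K0: "insert e K0 \<in> \<B>" "K0 \<subseteq> E - {e, f}"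
  using e par[OF e(1)] matroid_basis_subset[OF M e(1)] unfolding K0_def by (auto simp: insert_absorb)
 have fin: "finite K" if "K \<subseteq> E - {e, f}" for K using that matroid_finite[OF M] finite_subset by blast
 define k where "k = D (insert f K0) / (swap_sign e f K0 * D (insert e K0))"
 have sg: "(swap_sign e f K :: 'p) ~= 0" if "K \<subseteq> E - {e, f}" for K using that by (intro swap_sign_nz) auto
 have k: "k ~= 0" unfolding k_def using supp[OF K0(2)] K0(1) sg[OF K0(2)] by simp
 have main: "D (insert f K) = k * swap_sign e f K * D (insert e K)"
  if "insert e K \<in> \<B>" "K \<subseteq> E - {e, f}" "card (K - K0) = n" for K n
  using that
 proof (induction n arbitrary: K)
  case 0
  then have "K \<subseteq> K0" using fin[OF 0(2)] by simp
  moreover have "card (insert e K) = card (insert e K0)" using matroid_basis_card[OF M 0(1) K0(1)] .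
  then have "card K = card K0" using 0(2) K0(2) fin[OF 0(2)] fin[OF K0(2)] by (auto simp: card_insert_if split: if_splits)
  ultimately have "K = K0" using fin[OF K0(2)] by (simp add: card_subset_eq)
  then show ?case unfolding k_def using supp[OF K0(2)] K0(1) sg[OF K0(2)] by simp
 next
  case (Suc n)
  then obtain x where x: "x \<in> K - K0" by (metis card.empty equals0I nat.distinct(1))
  have xe: "x ~= e" "x ~= f" using x Suc(3) by auto
  obtain y where y: "y \<in> insert e K0 - insert e K" "insert y (insert e K - {x}) \<in> \<B>"
   using matroid_exchange[OF M Suc(2) K0(1), of x] x xe by blast
  define J where "J = K - {x}"
  have J: "K = insert x J" "x ~: J" "finite J" "J \<subseteq> E - {e, f}" "y ~: J" "y ~= x" "y ~= e" "y ~= f" "y \<in> E" "x \<in> E"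
   using x y Suc(3) fin[OF Suc(3)] K0(2) unfolding J_def by auto
  have "insert y (insert e K - {x}) = insert e (insert y J)" using xe unfolding J_def by auto
  then have Ky: "insert e (insert y J) \<in> \<B>" "insert y J \<subseteq> E - {e, f}" using y(2) J(4,7-9) by auto
  have "insert y J - K0 = (K - K0) - {x}" using y unfolding J_def by auto
  then have "card (insert y J - K0) = n" using Suc(4) x fin[OF Suc(3)] by simp
  from Suc(1)[OF Ky this] have IH: "D (insert f (insert y J)) = k * swap_sign e f (insert y J) * D (insert e (insert y J))" .
  have "N3 (br D J) e f x y" using J E xe by (intro prepD(2)[OF D]) auto
  moreover have "br D J e f = 0" unfolding br_zero
  proof -
   have "insert e (insert f J) \<subseteq> E" using J E by auto
   then show "e = f \<or> D (insert e (insert f J)) = 0" using prepD(1)[OF D] par[of "insert e (insert f J)"] by blast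
  qed
  ultimately have eq: "br D J e x * br D J f y = br D J e y * br D J f x" using N3_zero(1)[of "br D J" e f x y] by simp
  have q: "(of_int (s e y) :: 'p) * of_int (s e y) = 1" "(of_int (s f y) :: 'p) * of_int (s f y) = 1"
   "(of_int (s f x) :: 'p) * of_int (s f x) = 1" using J xe by (auto intro!: s_sq)
  have nz: "D (insert e (insert y J)) ~= 0" using supp(2)[OF Ky(2)] Ky(1) by simp
  let ?d = "D (insert e (insert y J))" and ?X = "D (insert e (insert x J))" and ?Y = "D (insert f (insert x J))"
  let ?g = "swap_sign e f J :: 'p"
  have "of_int (s e x) * ?X * (of_int (s f y) * (k * (of_int (s e y) * of_int (s f y) * ?g) * ?d)) = of_int (s e y) * ?d * (of_int (s f x) * ?Y)"
   using eq IH J unfolding br_def by (simp add: swap_sign_insert)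
  then have "(of_int (s f y) * of_int (s f y)) * of_int (s e y) * ?d * (of_int (s e x) * ?X * k * ?g) = of_int (s e y) * ?d * (of_int (s f x) * ?Y)"
   by (simp add: ac_simps)
  then have "(of_int (s e y) * ?d) * (of_int (s e x) * ?X * k * ?g) = (of_int (s e y) * ?d) * (of_int (s f x) * ?Y)"
   unfolding q by simp
  moreover have "of_int (s e y) * ?d ~= 0" using nz J by (simp add: s_nz)
  ultimately have "of_int (s e x) * ?X * k * ?g = of_int (s f x) * ?Y" by simp
  then have "of_int (s f x) * (of_int (s e x) * ?X * k * ?g) = (of_int (s f x) * of_int (s f x)) * ?Y" by (simp add: ac_simps)
  then show ?case unfolding q J(1) using J by (simp add: swap_sign_insert ac_simps)
 qed
 have "D (insert f K) = k * swap_sign e f K * D (insert e K)" if "K \<subseteq> E - {e, f}" for K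
 proof (cases "insert e K \<in> \<B>")
  case True then show ?thesis using main[OF _ that refl] by blast
 next
  case False then have "D (insert f K) = 0" "D (insert e K) = 0" using supp[OF that] by auto
  then show ?thesis by simp
 qed
 then show ?thesis using k by blast
qed

text \<open>In the target the factor of proportionality may be taken to be 1: the value at
  \<open>insert f K\<close> is the one at \<open>insert e K\<close> with the sign of the
  replacement. A relation with \<open>f\<close> is then a rescaled relation with \<open>e\<close>,
  or all its terms vanish.\<close>

lemma parallel_lift:
 assumes M: "matroid E \<B>" and D: "prep E \<B> D" and ef: "e ~= f"
  and par: "\<And>B. B \<in> \<B> ==> \<not> {e, f} \<subseteq> B" and e: "Be \<in> \<B>" "e \<in> Be" and f: "Bf \<in> \<B>" "f \<in> Bf"
  and D1: "right (E - {f}) {B \<in> \<B>. f ~: B} D D1"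
 shows "\<exists>D'. right E \<B> D D'"
proof -
 obtain k where k: "k ~= 0" "\<And>K. K \<subseteq> E - {e, f} ==> D (insert f K) = k * swap_sign e f K * D (insert e K)"
  using parallel_constant[OF M D ef par e f] by blast
 have E: "e \<in> E" "f \<in> E" using matroid_basis_subset[OF M] e f by auto
 have par': "\<not> {f, e} \<subseteq> B" if "B \<in> \<B>" for B using par[OF that] by blast
 have sw: "insert f K \<in> \<B> \<longleftrightarrow> insert e K \<in> \<B>" if "e ~: K" "f ~: K" for K
  using parallel_swap[OF M par f, of K] parallel_swap[OF M par' e, of K] that by blast
 define D' where "D' B = (if f \<in> B then if e \<in> B then 0 else swap_sign e f (B - {f}) * D1 (insert e (B - {f})) else D1 B)" for B
 have D'f: "D' (insert f K) = swap_sign e f K * D' (insert e K)" if "e ~: K" "f ~: K" for K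
  using that ef unfolding D'_def by simp
 have D'0: "D' B = 0" if "e \<in> B" "f \<in> B" for B using that unfolding D'_def by simp
 have D'1: "D' B = D1 B" if "f ~: B" for B using that unfolding D'_def by simp
 have D0: "D B = 0" if "e \<in> B" "f \<in> B" "B \<subseteq> E" for B using prepD(1)[OF D that(3)] par[of B] that by blast
 have G: "(swap_sign e f K :: 'k) \<in> \<Gamma>" if "e ~: K" "f ~: K" for K
  unfolding swap_sign_def using that unit_subgroupD(3)[OF subgroup]
  by (intro unit_subgroup_prod[OF subgroup] unit_subgroupD(3)[OF subgroup]) (auto intro!: s_\<Gamma>)
 have supp: "D' B ~= 0 \<longleftrightarrow> B \<in> \<B>" if B: "B \<subseteq> E" for B
 proof (cases "f \<in> B")
  case False
  then have "B \<subseteq> E - {f}" using B by blast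
  then show ?thesis using rightD(1)[OF D1, of B] D'1[OF False] False by simp
 next
  case f: True
  show ?thesis
  proof (cases "e \<in> B")
   case True then show ?thesis using f par[of B] D'0 by blast
  next
   case False
   define K where "K = B - {f}"
   have K: "B = insert f K" "e ~: K" "f ~: K" using f False unfolding K_def by auto
   have "insert e K \<subseteq> E - {f}" using K B E ef by auto
   then have "D1 (insert e K) ~= 0 \<longleftrightarrow> insert e K \<in> \<B>" using rightD(1)[OF D1, of "insert e K"] K ef by auto
   moreover have "D' (insert e K) = D1 (insert e K)" using K ef by (intro D'1) auto
   moreover have "(swap_sign e f K :: 'k) ~= 0" using swap_sign_nz K by blast
   ultimately show ?thesis unfolding K(1) D'f[OF K(2,3)] sw[OF K(2,3)] by simp
  qed
 qed
 have "right E \<B> D D'"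
 proof (rule rightI[OF D supp])
  fix B assume B: "B \<in> \<B>"
  show "D' B \<in> \<Gamma>"
  proof (cases "f \<in> B")
   case False then show ?thesis using rightD(2)[OF D1, of B] D'1[OF False] B by simp
  next
   case True
   define K where "K = B - {f}"
   have K: "B = insert f K" "e ~: K" "f ~: K" using True par[OF B] unfolding K_def by auto
   have "insert e K \<in> \<B>" using B sw[OF K(2,3)] K by simp
   then have "D' (insert e K) \<in> \<Gamma>" using rightD(2)[OF D1, of "insert e K"] K ef D'1[of "insert e K"] by auto
   then show ?thesis unfolding K(1) D'f[OF K(2,3)] by (rule unit_subgroupD(3)[OF subgroup G[OF K(2,3)]])
  qed
 next
  fix J a b c d assume h: "J \<subseteq> E" "{a, b, c, d} \<subseteq> E - J" "distinct [a, b, c, d]"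
  have old: "RLF (br D J) (br D' J) p q r t" if "f ~: J" "f ~: {p, q, r, t}" "{p, q, r, t} \<subseteq> E - J" for p q r t
  proof -
   have "RLF (br D J) (br D1 J) p q r t" using that h by (intro rightD(3)[OF D1]) auto
   moreover have "br D' J x y = br D1 J x y" if "x ~= f" "y ~= f" for x y
    using that \<open>f ~: J\<close> unfolding br_def by (simp add: D'1)
   moreover have "p ~= f" "q ~= f" "r ~= f" "t ~= f" using that(2) by auto
   ultimately show ?thesis unfolding RLF_def by simp
  qed
  consider (i) "f ~: J" "f ~: {a, b, c, d}" | (z) "{e, f} \<subseteq> J" | (z1) "f \<in> J" "e \<in> {a, b, c, d}" | (z2) "e \<in> J" "f \<in> {a, b, c, d}"
   | (q) "f \<in> {a, b, c, d}" "e ~: J" | (c) "f \<in> J" "e ~: J" "e ~: {a, b, c, d}" by blast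
  then show "RLF (br D J) (br D' J) a b c d"
  proof cases
   case i then show ?thesis using old h by blast
  next
   case z
   have "br D J x y = 0" "br D' J x y = 0" if "{x, y} \<subseteq> {a, b, c, d}" for x y
    unfolding br_zero using z h that by (auto intro!: D0 D'0)
   then show ?thesis unfolding RLF_def by (simp add: RL_zero)
  next
   case z1
   have "br D J e y = 0" "br D' J e y = 0" "br D J y e = 0" "br D' J y e = 0" if "y \<in> {a, b, c, d}" for y
    unfolding br_zero using z1 h that E by (auto intro!: D0 D'0)
   then show ?thesis unfolding RLF_def using z1(2) by (elim insertE emptyE) (simp_all add: RL_zero)
  next
   case z2
   have "br D J f y = 0" "br D' J f y = 0" "br D J y f = 0" "br D' J y f = 0" if "y \<in> {a, b, c, d}" for y
    unfolding br_zero using z2 h that E by (auto intro!: D0 D'0)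
   then show ?thesis unfolding RLF_def using z2(2) by (elim insertE emptyE) (simp_all add: RL_zero)
  next
   case q
   then have fJ: "f ~: J" using h by auto
   have finJ: "finite J" using h(1) matroid_finite[OF M] finite_subset by blast
   have par_br: "br D J f x = k * swap_sign e f J * br D J e x" "br D' J f x = swap_sign e f J * br D' J e x"
    if x: "x \<in> E - J" "x ~= f" for x
   proof -
    have "br D J f x = k * swap_sign e f J * br D J e x & br D' J f x = swap_sign e f J * br D' J e x"
    proof (cases "x = e")
     case True
     have "br D J f e = 0" "br D' J f e = 0" unfolding br_zero using h E q x True by (auto intro!: D0 D'0)
     moreover have "br D J e e = 0" "br D' J e e = 0" unfolding br_zero by auto
     ultimately show ?thesis using True by simp
    next
     case False
     have K: "insert x J \<subseteq> E - {e, f}" "e ~: insert x J" "f ~: insert x J" "x ~: J" using x False q h fJ by auto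
     have "(of_int (s f x) :: 'p) * of_int (s f x) = 1" "(of_int (s f x) :: 'k) * of_int (s f x) = 1"
      using x by (auto intro!: s_sq)
     moreover have "of_int (s f x) * (k * (of_int (s e x) * of_int (s f x) * swap_sign e f J) * D (insert e (insert x J)))
      = (of_int (s f x) * of_int (s f x)) * (k * swap_sign e f J * (of_int (s e x) * D (insert e (insert x J))))"
      by (simp add: ac_simps)
     moreover have "of_int (s f x) * (of_int (s e x) * of_int (s f x) * swap_sign e f J * D' (insert e (insert x J)))
      = (of_int (s f x) * of_int (s f x)) * (swap_sign e f J * (of_int (s e x) * D' (insert e (insert x J))))"
      by (simp add: ac_simps)
     ultimately show ?thesis unfolding br_def k(2)[OF K(1)] D'f[OF K(2,3)] swap_sign_insert[OF finJ K(4)] by simp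
    qed
    then show "br D J f x = k * swap_sign e f J * br D J e x" "br D' J f x = swap_sign e f J * br D' J e x" by auto
   qed
   have first: "RLF (br D J) (br D' J) f x y z" if "{x, y, z} \<subseteq> E - J" "f ~: {x, y, z}" for x y z
   proof (rule RLF_parallelI)
    show "RLF (br D J) (br D' J) e x y z" using that E ef q fJ by (intro old) auto
    show "k * swap_sign e f J ~= 0" "(swap_sign e f J :: 'k) ~= 0" using k(1) swap_sign_nz q fJ by auto
   qed (use par_br that in auto)
   have alt: "alt2 (br D J)" "alt2 (br D' J)" by (rule alt2_br)+
   consider "f = a" | "f = b" | "f = c" | "f = d" using q by blast
   then show ?thesis
   proof cases
    case 1
    have "RLF (br D J) (br D' J) f b c d" using h 1 by (intro first) auto
    then show ?thesis using 1 by simp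
   next
    case 2 show ?thesis by (rule RLF_perm[OF alt first[of a c d]]) (use 2 h in auto)
   next
    case 3 show ?thesis by (rule RLF_perm[OF alt first[of a b d]]) (use 3 h in auto)
   next
    case 4 show ?thesis by (rule RLF_perm[OF alt first[of a b c]]) (use 4 h in auto)
   qed
  next
   case c
   define K where "K = J - {f}"
   have K: "J = insert f K" "e ~: K" "f ~: K" "K \<subseteq> E" using c h unfolding K_def by auto
   have finK: "finite K" using K(4) matroid_finite[OF M] finite_subset by blast
   have f_nin: "f ~: {a, b, c, d}" using c h by auto
   have "RLF (br D (insert e K)) (br D1 (insert e K)) a b c d"
    using K h c E ef f_nin by (intro rightD(3)[OF D1]) auto
   then have "RLF (\<lambda>x y. k * swap_sign e f K * br D (insert e K) x y) (\<lambda>x y. swap_sign e f K * br D1 (insert e K) x y) a b c d"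
    by (rule RLF_const2) (use k(1) swap_sign_nz K in auto)
   then show ?thesis
   proof (rule RLF_scaled[where f = "\<lambda>x. of_int (s e x) * of_int (s f x)" and f' = "\<lambda>x. of_int (s e x) * of_int (s f x)"])
    fix x assume "x \<in> {a, b, c, d}"
    then have "x ~= e" "x ~= f" using c f_nin by auto
    then show "(of_int (s e x) * of_int (s f x) :: 'p) ~= 0" "(of_int (s e x) * of_int (s f x) :: 'k) ~= 0"
     by (auto intro!: s_nz)
   next
    fix x y assume xy: "{x, y} \<subseteq> {a, b, c, d}"
    have "br D J x y = of_int (s e x) * of_int (s f x) * (of_int (s e y) * of_int (s f y)) * (k * swap_sign e f K * br D (insert e K) x y)
     & br D' J x y = of_int (s e x) * of_int (s f x) * (of_int (s e y) * of_int (s f y)) * (swap_sign e f K * br D1 (insert e K) x y)"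
    proof (cases "x = y")
     case True then show ?thesis unfolding br_def by (simp add: s_self)
    next
     case False
     let ?L = "insert x (insert y K)"
     have L: "?L \<subseteq> E - {e, f}" "e ~: ?L" "f ~: ?L" "x ~: insert y K" "y ~: K" "finite (insert y K)"
      using xy h K c f_nin False finK by auto
     have i: "insert x (insert y J) = insert f ?L" "insert x (insert y (insert e K)) = insert e ?L" using K by auto
     have "D' (insert e ?L) = D1 (insert e ?L)" using L ef by (intro D'1) auto
     then show ?thesis unfolding br_def i k(2)[OF L(1)] D'f[OF L(2,3)]
      swap_sign_insert[OF L(6,4)] swap_sign_insert[OF finK L(5)] by (simp add: ac_simps)
    qed
    then show "br D J x y = of_int (s e x) * of_int (s f x) * (of_int (s e y) * of_int (s f y)) * (k * swap_sign e f K * br D (insert e K) x y)"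
     "br D' J x y = of_int (s e x) * of_int (s f x) * (of_int (s e y) * of_int (s f y)) * (swap_sign e f K * br D1 (insert e K) x y)" by blast+
   qed
  qed
 qed
 then show ?thesis by blast
qed

text \<open>Without five pairwise independent elements a simple matroid of rank two has at most four
  elements. So there is at most one nondegenerate relation up to order, and its lift can be
  distributed over the six bases.\<close>

lemma rank2_simple_lift:
 assumes M: "matroid E \<B>" and P: "prep E \<B> D" and U: "noU 2 E \<B>"
  and r: "\<And>B. B \<in> \<B> ==> card B = 2" and simple: "\<And>x y. x \<in> E ==> y \<in> E ==> x ~= y ==> {x, y} \<in> \<B>"
 shows "\<exists>D'. right E \<B> D D'"
proof -
 have fE: "finite E" using matroid_finite[OF M] .
 have cE: "card E \<le> 4"
 proof (rule ccontr)
  assume "\<not> card E \<le> 4"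
  then have "5 \<le> card E" by simp
  then obtain A where A: "A \<subseteq> E" "card A = 5" using obtain_subset_with_card_n by metis
  then obtain C where C: "C \<subseteq> A" "card C = 2" "{} \<union> C ~: \<B>" using noUD[OF U, of "{}" A] by auto
  then obtain x y where "C = {x, y}" "x ~= y" by (meson card_2_iff)
  then show False using simple[of x y] C A by auto
 qed
 have quad: "J = {} & E = {a, b, c, d}" if "J \<subseteq> E" "{a, b, c, d} \<subseteq> E - J" "distinct [a, b, c, d]" for J a b c d
 proof -
  have c4: "card {a, b, c, d} = 4" using that(3) by simp
  have "{a, b, c, d} = E" using c4 cE that(2) card_mono[OF fE, of "{a, b, c, d}"] by (intro card_subset_eq fE) auto
  then show ?thesis using that by blast
 qed
 show ?thesis
 proof (cases "\<exists>a b c d. distinct [a, b, c, d] & E = {a, b, c, d}")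
  case False
  let ?D = "\<lambda>B. if B \<in> \<B> then 1 else (0::'k)"
  have "right E \<B> D ?D"
  proof (rule rightI[OF P])
   show "?D B ~= 0 \<longleftrightarrow> B \<in> \<B>" for B by simp
   show "?D B \<in> \<Gamma>" if "B \<in> \<B>" for B using that unit_subgroupD(1)[OF subgroup] by simp
   fix J a b c d assume h: "J \<subseteq> E" "{a, b, c, d} \<subseteq> E - J" "distinct [a, b, c, d]"
   show "RLF (br D J) (br ?D J) a b c d" using False quad[OF h] h(3) by blast
  qed
  then show ?thesis by blast
 next
  case True
  then obtain a b c d where d: "distinct [a, b, c, d]" "E = {a, b, c, d}" by blast
  let ?F = "br D {}"
  have "N3 ?F a b c d" using d by (intro prepD(2)[OF P]) auto
  then obtain x y z where R: "RL (?F a b * ?F c d) (- (?F a c * ?F b d)) (?F a d * ?F b c) x y z" unfolding N3_def by blast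
  have Fnz: "?F p q ~= 0" if "p \<in> E" "q \<in> E" "p ~= q" for p q
   unfolding br_zero using that simple[OF that] prepD(1)[OF P, of "{p, q}"] by auto
  then have nz: "?F a b * ?F c d ~= 0" "?F a c * ?F b d ~= 0" "?F a d * ?F b c ~= 0" using d by auto
  then have Lx: "L (?F a b * ?F c d) (- (?F a c * ?F b d)) (?F a d * ?F b c) x y z" using R unfolding RL_def by auto
  then have xyz: "x ~= 0" "y ~= 0" "z ~= 0" using L_nz by blast+
  have g: "x / y \<in> \<Gamma>" "z / y \<in> \<Gamma>" using L_ratio[OF Lx] L_ratio[OF L_swap[OF L_rot[OF Lx]]] by auto
  define o' where "o' p q = (of_int (s p q) :: 'k)" for p q
  \<comment> \<open>Division by \<open>y\<close> makes the three entries ratios in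
    \<open>\<Gamma>\<close>, the middle one being 1. The signs \<open>o'\<close> undo those in
    \<open>br\<close>, and three bases get the value 1.\<close>
  define D' where "D' B = (if B = {a, b} then o' a b * o' c d * (x / y) else if B = {a, c} then - (o' a c * o' b d)
   else if B = {a, d} then o' a d * o' b c * (z / y) else if B \<in> \<B> then 1 else 0)" for B
  have oG: "o' p q \<in> \<Gamma>" if "p ~= q" for p q unfolding o'_def using s_\<Gamma>[OF that] .
  have oq: "o' p q * o' p q = 1" if "p ~= q" for p q unfolding o'_def using s_sq[OF that] .
  note G = unit_subgroupD[OF subgroup]
  have DG: "D' B \<in> \<Gamma>" if "B \<in> \<B>" for B
  proof -
   have "- (o' a c * o' b d) \<in> \<Gamma>" using G(3)[OF neg_one G(3)[OF oG oG], of a c b d] d by simp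
   moreover have "o' a b * o' c d * (x / y) \<in> \<Gamma>" "o' a d * o' b c * (z / y) \<in> \<Gamma>"
    by (rule G(3)[OF G(3)[OF oG oG] g(1)] G(3)[OF G(3)[OF oG oG] g(2)]; use d in simp)+
   ultimately show ?thesis unfolding D'_def using that G(1) by auto
  qed
  have "right E \<B> D D'"
  proof (rule rightI[OF P])
   fix B assume B: "B \<subseteq> E"
   have "{a, b} \<in> \<B>" "{a, c} \<in> \<B>" "{a, d} \<in> \<B>" using d by (auto intro!: simple)
   then have "B ~: \<B> ==> D' B = 0" unfolding D'_def by auto
   then show "D' B ~= 0 \<longleftrightarrow> B \<in> \<B>" using DG[of B] G(2)[of "D' B"] by blast
  next
   show "D' B \<in> \<Gamma>" if "B \<in> \<B>" for B using DG[OF that] .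
  next
   fix J a' b' c' d' assume h: "J \<subseteq> E" "{a', b', c', d'} \<subseteq> E - J" "distinct [a', b', c', d']"
   note q = quad[OF h]
   have v: "D' {a, b} = o' a b * o' c d * (x / y)" "D' {a, c} = - (o' a c * o' b d)" "D' {a, d} = o' a d * o' b c * (z / y)"
    "D' {c, d} = 1" "D' {b, d} = 1" "D' {b, c} = 1"
    unfolding D'_def using d simple[of c d] simple[of b d] simple[of b c] by (auto simp: doubleton_eq_iff)
   have oq': "o' a b * (o' a b * w) = w" "o' c d * (o' c d * w) = w" "o' a c * (o' a c * w) = w" "o' b d * (o' b d * w) = w"
    "o' a d * (o' a d * w) = w" "o' b c * (o' b c * w) = w" for w
    using d by (simp_all add: mult.assoc[symmetric] oq)
   have F': "br D' {} p q = o' p q * D' {p, q}" for p q unfolding br_def o'_def by simp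
   have ab: "br D' {} a b * br D' {} c d = o' a b * (o' a b * (o' c d * (o' c d * (x / y))))" unfolding F' v by (simp add: ac_simps)
   have ac: "br D' {} a c * br D' {} b d = - (o' a c * (o' a c * (o' b d * (o' b d * 1))))" unfolding F' v by (simp add: ac_simps)
   have ad: "br D' {} a d * br D' {} b c = o' a d * (o' a d * (o' b c * (o' b c * (z / y))))" unfolding F' v by (simp add: ac_simps)
   have "RL (1 * (?F a b * ?F c d)) (1 * - (?F a c * ?F b d)) (1 * (?F a d * ?F b c)) (inverse y * x) (inverse y * y) (inverse y * z)"
    using xyz by (intro RL_scale[OF R]) auto
   then have R': "RLF ?F (br D' {}) a b c d" unfolding RLF_def ab ac ad oq' using xyz by (simp add: divide_inverse mult.commute)
   have sub: "{a', b', c', d'} \<subseteq> {a, b, c, d}" using h(2) d(2) by auto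
   show "RLF (br D J) (br D' J) a' b' c' d'"
    unfolding conjunct1[OF q] by (rule RLF_perm[OF alt2_br alt2_br R' h(3) sub])
  qed
  then show ?thesis by blast
 qed
qed

end

section \<open>Choosing a pair to delete\<close>

lemma matroid_superset: "matroid E \<B> ==> E \<subseteq> E' ==> finite E' ==> matroid E' \<B>"
 unfolding matroid_def by blast

lemma matroid_avoid:
 assumes M: "matroid E \<B>" and "\<exists>B\<in>\<B>. a ~: B"
 shows "matroid E {B \<in> \<B>. a ~: B}"
 using matroid_superset[OF matroid_delete[OF assms] _ matroid_finite[OF M]] by blast

lemma matroid_through:
 assumes M: "matroid E \<B>" and "\<exists>B\<in>\<B>. a \<in> B"
 shows "matroid E {B \<in> \<B>. a \<in> B}"
proof -
 have "\<exists>y\<in>B2 - B1. insert y (B1 - {x}) \<in> {B \<in> \<B>. a \<in> B}"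
  if "B1 \<in> {B \<in> \<B>. a \<in> B}" "B2 \<in> {B \<in> \<B>. a \<in> B}" "x \<in> B1 - B2" for B1 B2 x
  using matroid_exchange[OF M, of B1 B2 x] that by blast
 then show ?thesis using M assms(2) unfolding matroid_def by blast
qed

text \<open>Loops and coloops may be left in the ground set, so that iterated minors can be written as
 sets of bases of \<open>M\<close>; \<open>F\<close> collects the elements that have been deleted or contracted.\<close>

definition fixed :: "'a set set => 'a set => bool" where
 "fixed \<B> F \<longleftrightarrow> (\<forall>B\<in>\<B>. \<forall>B'\<in>\<B>. B \<inter> F = B' \<inter> F)"

lemma matroid_remove_fixed:
 assumes M: "matroid E \<B>" and F: "fixed \<B> F"
 shows "matroid (E - F) ((\<lambda>B. B - F) ` \<B>)"
 unfolding matroid_def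
proof (intro conjI ballI)
 show "finite (E - F)" using matroid_finite[OF M] by simp
 show "(\<lambda>B. B - F) ` \<B> ~= {}" using matroid_nonempty[OF M] by blast
 show "X \<subseteq> E - F" if "X \<in> (\<lambda>B. B - F) ` \<B>" for X using that matroid_basis_subset[OF M] by blast
next
 fix X1 X2 x assume h: "X1 \<in> (\<lambda>B. B - F) ` \<B>" "X2 \<in> (\<lambda>B. B - F) ` \<B>" "x \<in> X1 - X2"
 then obtain B1 B2 where B: "B1 \<in> \<B>" "B2 \<in> \<B>" "X1 = B1 - F" "X2 = B2 - F" by (elim imageE)
 then have x: "x \<in> B1 - B2" "x ~: F" using h(3) by auto
 obtain y where y: "y \<in> B2 - B1" "insert y (B1 - {x}) \<in> \<B>" using matroid_exchange[OF M B(1,2) x(1)] by blast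
 have "B1 \<inter> F = B2 \<inter> F" using F B(1,2) unfolding fixed_def by metis
 then have "y ~: F" using y(1) by blast
 then have "insert y (X1 - {x}) = insert y (B1 - {x}) - F" "y \<in> X2 - X1" using y(1) unfolding B(3,4) by auto
 then show "\<exists>y\<in>X2 - X1. insert y (X1 - {x}) \<in> (\<lambda>B. B - F) ` \<B>" using y(2) by (intro bexI[of _ y]) auto
qed

lemma separator_remove:
 assumes "S \<inter> F = {}" shows "separator ((\<lambda>B. B - F) ` \<B>) S \<longleftrightarrow> separator \<B> S"
proof -
 have "(B - F) \<inter> S = B \<inter> S" for B using assms by blast
 then show ?thesis unfolding separator_def ball_simps(9) by simp
qed

lemma connected_cong:
 assumes "\<And>S. S \<subseteq> A ==> separator \<C> S \<longleftrightarrow> separator \<D> S"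
 shows "connected_matroid A \<C> \<longleftrightarrow> connected_matroid A \<D>"
 unfolding connected_matroid_def using assms by meson

lemma connected_remove_fixed:
 "connected_matroid (E - F) ((\<lambda>B. B - F) ` \<B>) \<longleftrightarrow> connected_matroid (E - F) \<B>"
proof -
 have "separator ((\<lambda>B. B - F) ` \<B>) S \<longleftrightarrow> separator \<B> S" if "S \<subseteq> E - F" for S
  using that by (intro separator_remove) blast
 then show ?thesis unfolding connected_matroid_def by blast
qed

lemma connected_nonfixed:
 assumes M: "matroid E \<B>" and F: "fixed \<B> F" and C: "connected_matroid (E - F) \<B>"
  and e: "e \<in> E - F" "E - F ~= {e}"
 shows "\<exists>B\<in>\<B>. e ~: B" "\<exists>B\<in>\<B>. e \<in> B"
 using connected_not_coloop[OF matroid_remove_fixed[OF M F] iffD2[OF connected_remove_fixed C] e] e(1) by auto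

lemma connected_delete_or_contract_fixed:
 assumes M: "matroid E \<B>" and F: "fixed \<B> F" and C: "connected_matroid (E - F) \<B>"
  and e: "e \<in> E - F" "E - F ~= {e}"
 shows "connected_matroid (E - F - {e}) {B \<in> \<B>. e ~: B} \<or> connected_matroid (E - F - {e}) {B \<in> \<B>. e \<in> B}"
proof -
 let ?\<C> = "(\<lambda>B. B - F) ` \<B>"
 have sep: "separator {X \<in> ?\<C>. e ~: X} S \<longleftrightarrow> separator {B \<in> \<B>. e ~: B} S"
  "separator {X \<in> ?\<C>. e \<in> X} S \<longleftrightarrow> separator {B \<in> \<B>. e \<in> B} S" if S: "S \<subseteq> E - F - {e}" for S
 proof -
  have i: "{X \<in> ?\<C>. e ~: X} = (\<lambda>B. B - F) ` {B \<in> \<B>. e ~: B}" "{X \<in> ?\<C>. e \<in> X} = (\<lambda>B. B - F) ` {B \<in> \<B>. e \<in> B}"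
   using e(1) by auto
  have "S \<inter> F = {}" using S by blast
  then show "separator {X \<in> ?\<C>. e ~: X} S \<longleftrightarrow> separator {B \<in> \<B>. e ~: B} S"
   "separator {X \<in> ?\<C>. e \<in> X} S \<longleftrightarrow> separator {B \<in> \<B>. e \<in> B} S"
   unfolding i by (rule separator_remove)+
 qed
 have "connected_matroid (E - F - {e}) {X \<in> ?\<C>. e ~: X} \<or> connected_matroid (E - F - {e}) {X \<in> ?\<C>. e \<in> X}"
  using connected_nonfixed[OF M F C e] e(1)
  by (intro connected_delete_or_contract[OF matroid_remove_fixed[OF M F] iffD2[OF connected_remove_fixed C] e(1)]) auto
 moreover have "connected_matroid (E - F - {e}) {X \<in> ?\<C>. e ~: X} \<longleftrightarrow> connected_matroid (E - F - {e}) {B \<in> \<B>. e ~: B}"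
  by (rule connected_cong) (rule sep(1))
 moreover have "connected_matroid (E - F - {e}) {X \<in> ?\<C>. e \<in> X} \<longleftrightarrow> connected_matroid (E - F - {e}) {B \<in> \<B>. e \<in> B}"
  by (rule connected_cong) (rule sep(2))
 ultimately show ?thesis by argo
qed

text \<open>\<open>P\<close> selects contraction or deletion of \<open>a\<close>. A separator loses
  at most \<open>a\<close> when passing to the minor, so besides the trivial ones only
  \<open>{a}\<close> and its complement are possible; both are excluded because \<open>a\<close> is
  neither a loop nor a coloop.\<close>

lemma connected_extend:
 assumes M: "matroid E \<B>" and F: "fixed \<B> F" and a: "a \<in> E - F" "\<exists>B\<in>\<B>. a ~: B" "\<exists>B\<in>\<B>. a \<in> B"
  and C: "connected_matroid (E - F - {a}) {B \<in> \<B>. a \<in> B \<longleftrightarrow> P}"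
 shows "connected_matroid (E - F) \<B>"
 unfolding connected_matroid_def
proof (intro allI impI)
 fix S assume S: "S \<subseteq> E - F" "separator \<B> S"
 have fS: "finite S" using S(1) matroid_finite[OF M] finite_subset by blast
 have "separator {B \<in> \<B>. a \<in> B \<longleftrightarrow> P} (S - {a})"
  unfolding separator_def
 proof (intro ballI)
  fix B B' assume h: "B \<in> {B \<in> \<B>. a \<in> B \<longleftrightarrow> P}" "B' \<in> {B \<in> \<B>. a \<in> B \<longleftrightarrow> P}"
  then have eq: "card (B \<inter> S) = card (B' \<inter> S)" using S(2) unfolding separator_def by blast
  have "card (X \<inter> (S - {a})) = card (X \<inter> S) - (if a \<in> X & a \<in> S then 1 else 0)" for X
  proof -
   have "X \<inter> (S - {a}) = (X \<inter> S) - {a}" by blast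
   then show ?thesis using fS by (auto simp: card_Diff_singleton_if)
  qed
  then show "card (B \<inter> (S - {a})) = card (B' \<inter> (S - {a}))" using eq h by auto
 qed
 moreover have "S - {a} \<subseteq> E - F - {a}" using S by blast
 ultimately have d: "S - {a} = {} \<or> S - {a} = E - F - {a}" using C unfolding connected_matroid_def by blast
 have nsep: "\<not> separator \<B> {a}"
 proof
  obtain B B' where B: "B \<in> \<B>" "a ~: B" "B' \<in> \<B>" "a \<in> B'" using a by blast
  assume "separator \<B> {a}"
  then have "card (B \<inter> {a}) = card (B' \<inter> {a})" using B unfolding separator_def by blast
  moreover have "B \<inter> {a} = {}" "B' \<inter> {a} = {a}" using B by auto
  ultimately show False by simp
 qed
 show "S = {} \<or> S = E - F"
 proof (cases "a \<in> S")
  case True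
  show ?thesis
  proof (cases "S - {a} = {}")
   case e: True
   then have "S = {a}" using True by blast
   then show ?thesis using nsep S(2) by simp
  next
   case False
   then show ?thesis using d True a(1) by blast
  qed
 next
  case False
  show ?thesis
  proof (cases "S - {a} = {}")
   case True then show ?thesis using False by blast
  next
   case n: False
   then have eq: "S = E - F - {a}" using d False by blast
   let ?\<C> = "(\<lambda>B. B - F) ` \<B>"
   have i: "S \<inter> F = {}" "{a} \<inter> F = {}" using S(1) a(1) by auto
   have "separator ?\<C> S" using S(2) separator_remove[OF i(1)] by blast
   then have "separator ?\<C> (E - F - S)" by (rule separator_compl[OF matroid_remove_fixed[OF M F]])
   moreover have "E - F - S = {a}" using eq a(1) by blast
   ultimately have "separator ?\<C> {a}" by simp
   then have "separator \<B> {a}" using separator_remove[OF i(2)] by blast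
   then show ?thesis using nsep by blast
  qed
 qed
qed

text \<open>Adding \<open>f\<close> to the side of \<open>g\<close> turns a separator of the
  deletion into one of the whole, since replacing \<open>f\<close> by \<open>g\<close> in a basis
  keeps the count.\<close>

lemma connected_delete_parallel:
 assumes M: "matroid E \<B>" and C: "connected_matroid E \<B>" and fg: "f \<in> E" "g \<in> E" "f ~= g"
  and par: "\<And>B. B \<in> \<B> ==> \<not> {f, g} \<subseteq> B" and g: "Bg \<in> \<B>" "g \<in> Bg"
 shows "connected_matroid (E - {f}) {B \<in> \<B>. f ~: B}"
 unfolding connected_matroid_def
proof (intro allI impI)
 fix S assume S: "S \<subseteq> E - {f}" "separator {B \<in> \<B>. f ~: B} S"
 define T where "T = (if g \<in> S then insert f S else S)"
 have sw: "\<exists>B'\<in>\<B>. f ~: B' & card (B \<inter> T) = card (B' \<inter> S)" if B: "B \<in> \<B>" for B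
 proof (cases "f \<in> B")
  case False
  then have "B \<inter> T = B \<inter> S" unfolding T_def by auto
  then show ?thesis using B False by auto
 next
  case True
  define K where "K = B - {f}"
  have K: "B = insert f K" "f ~: K" "g ~: K" "finite K" using True par[OF B] fg(3) matroid_basis_finite[OF M B] unfolding K_def by auto
  have "insert g K \<in> \<B>" using parallel_swap[OF M par g, of K] B K by simp
  moreover have "f ~: insert g K" using K fg by auto
  moreover have "card (B \<inter> T) = card (insert g K \<inter> S)"
  proof (cases "g \<in> S")
   case True
   then have "B \<inter> T = insert f (K \<inter> S)" "insert g K \<inter> S = insert g (K \<inter> S)" using K unfolding T_def by auto
   then show ?thesis using K by simp
  next
   case False
   then have "B \<inter> T = K \<inter> S" "insert g K \<inter> S = K \<inter> S" using K S(1) unfolding T_def by auto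
   then show ?thesis by simp
  qed
  ultimately show ?thesis by blast
 qed
 have "separator \<B> T" unfolding separator_def
 proof (intro ballI)
  fix B1 B2 assume B: "B1 \<in> \<B>" "B2 \<in> \<B>"
  obtain B1' B2' where B': "B1' \<in> \<B>" "f ~: B1'" "card (B1 \<inter> T) = card (B1' \<inter> S)"
   "B2' \<in> \<B>" "f ~: B2'" "card (B2 \<inter> T) = card (B2' \<inter> S)" using sw[OF B(1)] sw[OF B(2)] by blast
  then have "card (B1' \<inter> S) = card (B2' \<inter> S)" using S(2) unfolding separator_def by blast
  then show "card (B1 \<inter> T) = card (B2 \<inter> T)" using B' by simp
 qed
 moreover have "T \<subseteq> E" using S(1) fg unfolding T_def by auto
 ultimately have "T = {} \<or> T = E" using C unfolding connected_matroid_def by blast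
 then show "S = {} \<or> S = E - {f}" using S(1) fg unfolding T_def by (auto split: if_splits)
qed

text \<open>Two equivalence relations that together relate all pairs cannot both be proper.
  Transitivity is asked for distinct ends, as the relations need not be reflexive.\<close>

lemma union_of_equivalences:
 assumes tot: "\<And>x y. x \<in> A ==> y \<in> A ==> x ~= y ==> R x y \<or> S x y"
  and symR: "\<And>x y. R x y ==> R y x" and symS: "\<And>x y. S x y ==> S y x"
  and trR: "\<And>x y z. x \<in> A ==> y \<in> A ==> z \<in> A ==> x ~= z ==> R x y ==> R y z ==> R x z"
  and trS: "\<And>x y z. x \<in> A ==> y \<in> A ==> z \<in> A ==> x ~= z ==> S x y ==> S y z ==> S x z"
 shows "(\<forall>x\<in>A. \<forall>y\<in>A. x ~= y \<longrightarrow> R x y) \<or> (\<forall>x\<in>A. \<forall>y\<in>A. x ~= y \<longrightarrow> S x y)"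
proof (rule disjCI)
 assume "\<not> (\<forall>x\<in>A. \<forall>y\<in>A. x ~= y \<longrightarrow> S x y)"
 then obtain a b where ab: "a \<in> A" "b \<in> A" "a ~= b" "\<not> S a b" by blast
 have Rab: "R a b" using tot[OF ab(1,2,3)] ab(4) by blast
 have Ra: "R a c" if c: "c \<in> A" "c ~= a" for c
 proof (rule ccontr)
  assume n: "\<not> R a c"
  then have cb: "c ~= b" using Rab by blast
  have "S a c" using tot[OF ab(1) c(1)] c(2) n by blast
  then have "\<not> S c b" using trS[OF ab(1) c(1) ab(2,3)] ab(4) by blast
  then have "R b c" using tot[OF c(1) ab(2) cb] symR by blast
  then show False using trR[OF ab(1,2) c(1) _ Rab] c(2) n by blast
 qed
 show "\<forall>x\<in>A. \<forall>y\<in>A. x ~= y \<longrightarrow> R x y"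
 proof (intro ballI impI)
  fix x y assume h: "x \<in> A" "y \<in> A" "x ~= y"
  show "R x y"
  proof (cases "x = a \<or> y = a")
   case True then show ?thesis using Ra[OF h(1)] Ra[OF h(2)] symR h(3) by metis
  next
   case False
   then show ?thesis using trR[OF h(1) ab(1) h(2,3) symR[OF Ra[OF h(1)]] Ra[OF h(2)]] by blast
  qed
 qed
qed

text \<open>Suppose that no pair can be deleted or contracted. Then contracting \<open>f\<close>
  after deleting \<open>e\<close> stays connected, and a further \<open>g\<close> can be deleted or
  contracted there. The first case forces \<open>f, g\<close> to be in series after deleting
  \<open>e\<close>, the second forces \<open>e, f, g\<close> to be dependent. Both relations are
  transitive, by cosimplicity and simplicity, so one of them holds for all pairs, which makes the
  corank or the rank 2.\<close>

theorem pair_or_rank2: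
 assumes M: "matroid E \<B>" and c4: "card E \<ge> 4"
  and simple: "\<And>x y. x \<in> E ==> y \<in> E ==> x ~= y ==> \<exists>B\<in>\<B>. x \<in> B & y \<in> B"
  and cosimple: "\<And>x y. x \<in> E ==> y \<in> E ==> x ~= y ==> \<exists>B\<in>\<B>. x ~: B & y ~: B"
  and e: "e \<in> E" "connected_matroid (E - {e}) {B \<in> \<B>. e ~: B}"
 shows "(\<exists>a\<in>E. \<exists>b\<in>E. a ~= b & connected_matroid (E - {a} - {b}) {B \<in> \<B>. a ~: B & b ~: B}) \<or>
  (\<exists>a\<in>E. \<exists>b\<in>E. a ~= b & connected_matroid (E - {a} - {b}) {B \<in> \<B>. a \<in> B & b \<in> B}) \<or>
  (\<forall>B\<in>\<B>. card B = 2) \<or> (\<forall>B\<in>\<B>. card (E - B) = 2)"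
proof (rule ccontr)
 assume neg: "\<not> ?thesis"
 have nd: "\<not> connected_matroid (E - {a, b}) {B \<in> \<B>. a ~: B & b ~: B}" if "a \<in> E" "b \<in> E" "a ~= b" for a b
  using neg that by (metis Diff_insert2)
 have nc: "\<not> connected_matroid (E - {a, b}) {B \<in> \<B>. a \<in> B & b \<in> B}" if "a \<in> E" "b \<in> E" "a ~= b" for a b
  using neg that by (metis Diff_insert2)
 have fE: "finite E" using matroid_finite[OF M] .
 have small: "\<exists>x\<in>E. x ~: X" if "card X \<le> 3" "finite X" for X
 proof (rule ccontr)
  assume "\<not> ?thesis"
  then have "card E \<le> card X" using that by (intro card_mono) auto
  then show False using c4 that by simp
 qed
 \<comment> \<open>\<open>Ser f g\<close> says that \<open>f, g\<close> are in series once
   \<open>e\<close> is deleted, \<open>Tri f g\<close> that \<open>e, f, g\<close> is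
   dependent.\<close>
 define Ser where "Ser f g \<longleftrightarrow> (\<forall>B\<in>\<B>. e ~: B \<longrightarrow> f \<in> B \<or> g \<in> B)" for f g
 define Tri where "Tri f g \<longleftrightarrow> (\<forall>B\<in>\<B>. \<not> {e, f, g} \<subseteq> B)" for f g
 have SerD: "f \<in> B \<or> g \<in> B" if "Ser f g" "B \<in> \<B>" "e ~: B" for f g B using that unfolding Ser_def by blast
 have TriD: "False" if "Tri f g" "B \<in> \<B>" "e \<in> B" "f \<in> B" "g \<in> B" for f g B using that unfolding Tri_def by blast
 let ?N = "{B \<in> \<B>. e ~: B}"
 obtain e' where e': "e' \<in> E" "e' ~= e" using small[of "{e}"] by auto
 have NE: "\<exists>B\<in>\<B>. e ~: B" using cosimple[OF e(1) e'(1)] e'(2) by blast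
 have MN: "matroid E ?N" using matroid_avoid[OF M NE] .
 have fN: "fixed ?N {e}" unfolding fixed_def by auto
 have key: "Ser f g \<or> Tri f g" if fg: "f \<in> E - {e}" "g \<in> E - {e}" "f ~= g" for f g
 proof -
  have E1: "E - {e} ~= {f}"
  proof
   assume "E - {e} = {f}"
   then have "g \<in> {f}" using fg(2) by simp
   then show False using fg(3) by simp
  qed
  note f1 = connected_nonfixed[OF MN fN e(2) fg(1) E1]
  have "\<not> connected_matroid (E - {e} - {f}) {B \<in> ?N. f ~: B}"
  proof -
   have "{B \<in> ?N. f ~: B} = {B \<in> \<B>. e ~: B & f ~: B}" "E - {e} - {f} = E - {e, f}" by auto
   then show ?thesis using nd[of e f] e(1) fg by auto
  qed
  then have Cf: "connected_matroid (E - {e, f}) {B \<in> ?N. f \<in> B}"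
   using connected_delete_or_contract_fixed[OF MN fN e(2) fg(1) E1] by (metis Diff_insert2)
  let ?Nf = "{B \<in> ?N. f \<in> B}"
  have MNf: "matroid E ?Nf" using matroid_through[OF MN f1(2)] .
  have fNf: "fixed ?Nf {e, f}" unfolding fixed_def by auto
  have "e ~= f" "e ~= g" using fg by auto
  then have "card {e, f, g} = 3" using fg(3) by simp
  then obtain h where h: "h \<in> E" "h ~: {e, f, g}" using small[of "{e, f, g}"] by auto
  have g': "g \<in> E - {e, f}" "E - {e, f} ~= {g}" using fg h by auto
  note g1 = connected_nonfixed[OF MNf fNf Cf g']
  from connected_delete_or_contract_fixed[OF MNf fNf Cf g'] show ?thesis
  proof
   assume c: "connected_matroid (E - {e, f} - {g}) {B \<in> ?Nf. g ~: B}"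
   \<comment> \<open>Otherwise \<open>f\<close> is neither a loop nor a coloop after deleting
     \<open>e\<close> and \<open>g\<close>, and \<open>connected_extend\<close> makes that deletion
     connected.\<close>
   have "Ser f g"
   proof (rule ccontr)
    assume "\<not> Ser f g"
    then obtain B where B: "B \<in> \<B>" "e ~: B" "f ~: B" "g ~: B" unfolding Ser_def by blast
    let ?Q = "{B \<in> \<B>. e ~: B & g ~: B}"
    have Q: "?Q = {B \<in> ?N. g ~: B}" by auto
    have MQ: "matroid E ?Q" unfolding Q by (rule matroid_avoid[OF MN]) (use B in auto)
    have "connected_matroid (E - {e, g}) ?Q"
    proof (rule connected_extend[OF MQ, where a = f and P = True])
     show "fixed ?Q {e, g}" unfolding fixed_def by auto
     show "f \<in> E - {e, g}" using fg by auto
     show "\<exists>B\<in>?Q. f ~: B" using B by blast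
     show "\<exists>B\<in>?Q. f \<in> B" using g1(1) by blast
     have "E - {e, g} - {f} = E - {e, f} - {g}" "{B \<in> ?Q. f \<in> B \<longleftrightarrow> True} = {B \<in> ?Nf. g ~: B}" by auto
     then show "connected_matroid (E - {e, g} - {f}) {B \<in> ?Q. f \<in> B \<longleftrightarrow> True}" using c by simp
    qed
    then show False using nd[of e g] e(1) fg by auto
   qed
   then show ?thesis ..
  next
   assume c: "connected_matroid (E - {e, f} - {g}) {B \<in> ?Nf. g \<in> B}"
   \<comment> \<open>Otherwise \<open>e\<close> is neither a loop nor a coloop after contracting
     \<open>f\<close> and \<open>g\<close>, and that contraction is connected.\<close>
   have "Tri f g"
   proof (rule ccontr)
    assume "\<not> Tri f g"
    then obtain B where B: "B \<in> \<B>" "e \<in> B" "f \<in> B" "g \<in> B" unfolding Tri_def by blast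
    let ?Q = "{B \<in> \<B>. f \<in> B & g \<in> B}"
    have Q: "?Q = {B \<in> {B \<in> \<B>. f \<in> B}. g \<in> B}" by auto
    have MQ: "matroid E ?Q" unfolding Q by (rule matroid_through[OF matroid_through[OF M]]) (use B in auto)
    have "connected_matroid (E - {f, g}) ?Q"
    proof (rule connected_extend[OF MQ, where a = e and P = False])
     show "fixed ?Q {f, g}" unfolding fixed_def by auto
     show "e \<in> E - {f, g}" using fg e by auto
     show "\<exists>B\<in>?Q. e \<in> B" using B by blast
     show "\<exists>B\<in>?Q. e ~: B" using g1(2) by blast
     have "E - {f, g} - {e} = E - {e, f} - {g}" "{B \<in> ?Q. e \<in> B \<longleftrightarrow> False} = {B \<in> ?Nf. g \<in> B}" by auto
     then show "connected_matroid (E - {f, g} - {e}) {B \<in> ?Q. e \<in> B \<longleftrightarrow> False}" using c by simp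
    qed
    then show False using nc[of f g] fg by auto
   qed
   then show ?thesis ..
  qed
 qed
 have "(\<forall>x\<in>E - {e}. \<forall>y\<in>E - {e}. x ~= y \<longrightarrow> Ser x y) \<or> (\<forall>x\<in>E - {e}. \<forall>y\<in>E - {e}. x ~= y \<longrightarrow> Tri x y)"
 proof (rule union_of_equivalences)
  show "Ser x y \<or> Tri x y" if "x \<in> E - {e}" "y \<in> E - {e}" "x ~= y" for x y using key[OF that] .
  show "Ser x y ==> Ser y x" for x y unfolding Ser_def by blast
  show "Tri x y ==> Tri y x" for x y unfolding Tri_def by blast
 next
  fix f g h assume E: "f \<in> E - {e}" "g \<in> E - {e}" "h \<in> E - {e}" "f ~= h" and S: "Ser f g" "Ser g h"
  show "Ser f h" unfolding Ser_def
  proof (intro ballI impI, rule ccontr)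
   fix B assume B: "B \<in> \<B>" "e ~: B" "\<not> (f \<in> B \<or> h \<in> B)"
   then have "g \<in> B" using S(1) unfolding Ser_def by blast
   obtain B' where B': "B' \<in> \<B>" "e ~: B'" "g ~: B'" using cosimple[of e g] e E by auto
   obtain y where y: "y \<in> B' - B" "insert y (B - {g}) \<in> \<B>" using matroid_exchange[OF M B(1) B'(1), of g] \<open>g \<in> B\<close> B'(3) by blast
   have "e ~: insert y (B - {g})" "g ~: insert y (B - {g})" using y(1) B' B by auto
   then have "f \<in> insert y (B - {g})" "h \<in> insert y (B - {g})" using SerD[OF S(1) y(2)] SerD[OF S(2) y(2)] by simp_all
   then show False using B(3) E(4) by auto
  qed
 next
  fix f g h assume E: "f \<in> E - {e}" "g \<in> E - {e}" "h \<in> E - {e}" "f ~= h" and S: "Tri f g" "Tri g h"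
  show "Tri f h" unfolding Tri_def
  proof (intro ballI notI)
   fix B assume B: "B \<in> \<B>" "{e, f, h} \<subseteq> B"
   then have g: "g ~: B" using TriD[OF S(1) B(1)] by auto
   obtain B' where B': "B' \<in> \<B>" "e \<in> B'" "g \<in> B'" using simple[of e g] e E by auto
   obtain x where x: "x \<in> B - B'" "insert g (B - {x}) \<in> \<B>" using matroid_exchange_dual[OF M B(1) B'(1), of g] g B'(3) by blast
   have "e \<in> insert g (B - {x})" "g \<in> insert g (B - {x})" using x(1) B' B by auto
   moreover have "f \<in> insert g (B - {x}) \<or> h \<in> insert g (B - {x})" using B(2) E(4) by auto
   ultimately show False using TriD[OF S(1) x(2)] TriD[OF S(2) x(2)] by metis
  qed
 qed
 then show False
 proof
  assume S: "\<forall>x\<in>E - {e}. \<forall>y\<in>E - {e}. x ~= y \<longrightarrow> Ser x y"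
  obtain B where B: "B \<in> \<B>" "e ~: B" "e' ~: B" using cosimple[OF e(1) e'(1)] e'(2) by blast
  have BE: "B \<subseteq> E" using matroid_basis_subset[OF M B(1)] .
  have "E - B = {e, e'}"
  proof
   show "E - B \<subseteq> {e, e'}"
   proof
    fix x assume x: "x \<in> E - B"
    show "x \<in> {e, e'}"
    proof (rule ccontr)
     assume "x ~: {e, e'}"
     then have "Ser x e'" using S x e' by auto
     then show False using SerD[OF _ B(1,2)] B(3) x by blast
    qed
   qed
   show "{e, e'} \<subseteq> E - B" using B e e' by auto
  qed
  then have "card (E - B) = 2" using e'(2) by simp
  moreover have "card (E - B') = card (E - B)" if "B' \<in> \<B>" for B'
   using matroid_basis_card[OF M that B(1)] matroid_basis_subset[OF M that] BE fE
   by (simp add: card_Diff_subset finite_subset)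
  ultimately show False using neg by auto
 next
  assume T: "\<forall>x\<in>E - {e}. \<forall>y\<in>E - {e}. x ~= y \<longrightarrow> Tri x y"
  obtain B where B: "B \<in> \<B>" "e \<in> B" "e' \<in> B" using simple[OF e(1) e'(1)] e'(2) by blast
  have BE: "B \<subseteq> E" using matroid_basis_subset[OF M B(1)] .
  have "B = {e, e'}"
  proof
   show "B \<subseteq> {e, e'}"
   proof
    fix x assume x: "x \<in> B"
    show "x \<in> {e, e'}"
    proof (rule ccontr)
     assume "x ~: {e, e'}"
     then have "Tri x e'" using T x e' BE by auto
     then show False using TriD[OF _ B(1,2) x B(3)] by blast
    qed
   qed
   show "{e, e'} \<subseteq> B" using B by auto
  qed
  then have "card B = 2" using e'(2) by auto
  then have "\<forall>B'\<in>\<B>. card B' = 2" using matroid_basis_card[OF M _ B(1)] by auto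
  then show False using neg by auto
 qed
qed

section \<open>Induction over connected matroids\<close>

context signed_lifting
begin

definition liftable :: "'a set => 'a set set => bool" where
 "liftable E \<B> \<longleftrightarrow> (\<forall>D. prep E \<B> D \<longrightarrow> (\<exists>D'. right E \<B> D D'))"

lemma liftable_dual:
 assumes M: "matroid E \<B>" and "liftable E ((-) E ` \<B>)" shows "liftable E \<B>"
 unfolding liftable_def
proof (intro allI impI)
 fix D assume P: "prep E \<B> D"
 obtain D1 where "right E ((-) E ` \<B>) (\<lambda>B. D (E - B)) D1"
  using assms(2) prep_dual[OF M P] unfolding liftable_def by blast
 then show "\<exists>D'. right E \<B> D D'" using right_dual[OF M P] by blast
qed

text \<open>By \<open>NE\<close> and \<open>nl\<close> each of \<open>a\<close>, \<open>b\<close> is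
  neither a loop nor a coloop after deleting the other. So both single deletions are connected with
  the double one, and the induction hypothesis lifts them.\<close>

lemma liftable_pair:
 assumes M: "matroid E \<B>" and U: "noU 2 E \<B>" "noU 3 E \<B>" and ab: "a \<in> E" "b \<in> E" "a ~= b"
  and NE: "\<exists>B\<in>\<B>. a ~: B & b ~: B" and nl: "\<exists>B\<in>\<B>. a \<in> B & b ~: B" "\<exists>B\<in>\<B>. b \<in> B & a ~: B"
  and C: "connected_matroid (E - {a} - {b}) {B \<in> \<B>. a ~: B & b ~: B}"
  and IH: "\<And>c. c \<in> E ==> \<exists>B\<in>\<B>. c ~: B ==> connected_matroid (E - {c}) {B \<in> \<B>. c ~: B} ==> liftable (E - {c}) {B \<in> \<B>. c ~: B}"
 shows "liftable E \<B>"
 unfolding liftable_def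
proof (intro allI impI)
 fix D assume D: "prep E \<B> D"
 have conn: "connected_matroid (E - {c}) {B \<in> \<B>. c ~: B}"
  if cd: "c \<in> E" "d \<in> E" "c ~= d" "\<exists>B\<in>\<B>. c ~: B & d ~: B" "\<exists>B\<in>\<B>. d \<in> B & c ~: B"
   "connected_matroid (E - {c} - {d}) {B \<in> \<B>. c ~: B & d ~: B}" for c d
 proof (rule connected_extend[where a = d and P = False])
  show "matroid E {B \<in> \<B>. c ~: B}" using matroid_avoid[OF M] cd by blast
  show "fixed {B \<in> \<B>. c ~: B} {c}" unfolding fixed_def by auto
  have "{B \<in> {B \<in> \<B>. c ~: B}. d \<in> B \<longleftrightarrow> False} = {B \<in> \<B>. c ~: B & d ~: B}" by auto
  then show "connected_matroid (E - {c} - {d}) {B \<in> {B \<in> \<B>. c ~: B}. d \<in> B \<longleftrightarrow> False}" using cd by simp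
 qed (use cd in auto)
 have "connected_matroid (E - {b} - {a}) {B \<in> \<B>. b ~: B & a ~: B}"
 proof -
  have "E - {b} - {a} = E - {a} - {b}" "{B \<in> \<B>. b ~: B & a ~: B} = {B \<in> \<B>. a ~: B & b ~: B}" by auto
  then show ?thesis using C by simp
 qed
 then have "connected_matroid (E - {b}) {B \<in> \<B>. b ~: B}" using conn[of b a] ab NE nl by blast
 then have "liftable (E - {b}) {B \<in> \<B>. b ~: B}" using IH ab NE by blast
 then obtain D2 where D2: "right (E - {b}) {B \<in> \<B>. b ~: B} D D2" using prep_delete[OF D] unfolding liftable_def by blast
 have "connected_matroid (E - {a}) {B \<in> \<B>. a ~: B}" using conn[of a b] ab NE nl C by blast
 then have "liftable (E - {a}) {B \<in> \<B>. a ~: B}" using IH ab NE by blast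
 then obtain D1 where D1: "right (E - {a}) {B \<in> \<B>. a ~: B} D D1" using prep_delete[OF D] unfolding liftable_def by blast
 show "\<exists>D'. right E \<B> D D'" by (rule glue_lift[OF M D U ab NE C D1 D2])
qed

lemma liftable_parallel:
 assumes M: "matroid E \<B>" and C: "connected_matroid E \<B>" and fg: "f \<in> E" "g \<in> E" "f ~= g"
  and par: "\<And>B. B \<in> \<B> ==> \<not> {f, g} \<subseteq> B"
  and IH: "\<And>c. c \<in> E ==> \<exists>B\<in>\<B>. c ~: B ==> connected_matroid (E - {c}) {B \<in> \<B>. c ~: B} ==> liftable (E - {c}) {B \<in> \<B>. c ~: B}"
 shows "liftable E \<B>"
 unfolding liftable_def
proof (intro allI impI)
 fix D assume D: "prep E \<B> D"
 have ne: "E ~= {f}" "E ~= {g}" using fg by auto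
 obtain Bf Bf' Bg where B: "Bf \<in> \<B>" "f \<in> Bf" "Bf' \<in> \<B>" "f ~: Bf'" "Bg \<in> \<B>" "g \<in> Bg"
  using connected_not_coloop[OF M C fg(1) ne(1)] connected_not_coloop[OF M C fg(2) ne(2)] by blast
 have "connected_matroid (E - {f}) {B \<in> \<B>. f ~: B}" using connected_delete_parallel[OF M C fg par B(5,6)] .
 then have "liftable (E - {f}) {B \<in> \<B>. f ~: B}" using IH fg B by blast
 then obtain D1 where D1: "right (E - {f}) {B \<in> \<B>. f ~: B} D D1" using prep_delete[OF D] unfolding liftable_def by blast
 have par': "\<not> {g, f} \<subseteq> B" if "B \<in> \<B>" for B using par[OF that] by blast
 show "\<exists>D'. right E \<B> D D'" by (rule parallel_lift[OF M D fg(3)[symmetric] par' B(5,6) B(1,2) D1])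
qed

end

text \<open>Exchange \<open>b\<close> out of \<open>B2\<close> towards the basis that avoids both;
  \<open>a\<close> stays.\<close>

lemma exists_in_out:
 assumes M: "matroid E \<B>" and "B1 \<in> \<B>" "a ~: B1" "b ~: B1" and "B2 \<in> \<B>" "a \<in> B2" "a ~= b"
 shows "\<exists>B\<in>\<B>. a \<in> B & b ~: B"
proof (cases "b \<in> B2")
 case True
 then obtain y where y: "y \<in> B1 - B2" "insert y (B2 - {b}) \<in> \<B>" using matroid_exchange[OF M assms(5,2), of b] assms by blast
 then have "a \<in> insert y (B2 - {b})" "b ~: insert y (B2 - {b})" using assms by auto
 then show ?thesis by (intro bexI[OF _ y(2)] conjI)
qed (use assms in blast)

lemma card_remove_lt: "card (E - {c}) < card E" if "c \<in> E" "finite E" for c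
 using that by (intro psubset_card_mono) auto

context signed_lifting
begin

lemma liftable_delete_connected:
 assumes M: "matroid E \<B>" and C: "connected_matroid E \<B>" and U: "noU 2 E \<B>" "noU 3 E \<B>" and c4: "card E \<ge> 4"
  and simple: "\<And>x y. x \<in> E ==> y \<in> E ==> x ~= y ==> \<exists>B\<in>\<B>. x \<in> B & y \<in> B"
  and cosimple: "\<And>x y. x \<in> E ==> y \<in> E ==> x ~= y ==> \<exists>B\<in>\<B>. x ~: B & y ~: B"
  and e: "e \<in> E" "connected_matroid (E - {e}) {B \<in> \<B>. e ~: B}"
  and IH: "\<And>F \<C>. card F < card E ==> matroid F \<C> ==> connected_matroid F \<C> ==> noU 2 F \<C> ==> noU 3 F \<C> ==> liftable F \<C>"
 shows "liftable E \<B>"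
proof -
 have fE: "finite E" using matroid_finite[OF M] .
 have io: "\<exists>B\<in>\<B>. a \<in> B & b ~: B" if ab: "a \<in> E" "b \<in> E" "a ~= b" for a b
 proof -
  obtain B1 B2 where "B1 \<in> \<B>" "a ~: B1" "b ~: B1" "B2 \<in> \<B>" "a \<in> B2" using simple[OF ab] cosimple[OF ab] by blast
  then show ?thesis using exists_in_out[OF M _ _ _ _ _ ab(3)] by metis
 qed
 let ?\<D> = "(-) E ` \<B>"
 have MD: "matroid E ?\<D>" using matroid_dual[OF M] .
 have UD: "noU 2 E ?\<D>" "noU 3 E ?\<D>" using noU_dual[OF M U(2)] noU_dual[OF M U(1)] by auto
 have IH': "liftable (E - {c}) {B \<in> \<C>. c ~: B}"
  if "matroid E \<C>" "noU 2 E \<C>" "noU 3 E \<C>" "c \<in> E" "\<exists>B\<in>\<C>. c ~: B" "connected_matroid (E - {c}) {B \<in> \<C>. c ~: B}" for \<C> c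
  by (rule IH[OF card_remove_lt[OF that(4) fE] matroid_delete[OF that(1,5)] that(6) noU_delete[OF that(2)] noU_delete[OF that(3)]])
 consider (d) a b where "a \<in> E" "b \<in> E" "a ~= b" "connected_matroid (E - {a} - {b}) {B \<in> \<B>. a ~: B & b ~: B}"
  | (c) a b where "a \<in> E" "b \<in> E" "a ~= b" "connected_matroid (E - {a} - {b}) {B \<in> \<B>. a \<in> B & b \<in> B}"
  | (r) "\<forall>B\<in>\<B>. card B = 2" | (k) "\<forall>B\<in>\<B>. card (E - B) = 2"
  using pair_or_rank2[OF M c4 simple cosimple e] by blast
 then show ?thesis
 proof cases
  case d
  show ?thesis
   by (rule liftable_pair[OF M U d(1-3) cosimple[OF d(1-3)] io[OF d(1-3)] io[OF d(2,1) d(3)[symmetric]] d(4)])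
    (rule IH'[OF M U])
 next
  case c
  show ?thesis
  proof (rule liftable_dual[OF M], rule liftable_pair[OF MD UD c(1-3)])
   obtain B where "B \<in> \<B>" "a \<in> B" "b \<in> B" using simple[OF c(1-3)] by blast
   then show "\<exists>B\<in>?\<D>. a ~: B & b ~: B" by (intro bexI[of _ "E - B"] imageI) auto
   obtain B where "B \<in> \<B>" "a \<in> B" "b ~: B" using io[OF c(1-3)] by blast
   then show "\<exists>B\<in>?\<D>. b \<in> B & a ~: B" using c(2) by (intro bexI[of _ "E - B"] imageI) auto
   obtain B where "B \<in> \<B>" "b \<in> B" "a ~: B" using io[OF c(2,1) c(3)[symmetric]] by blast
   then show "\<exists>B\<in>?\<D>. a \<in> B & b ~: B" using c(1) by (intro bexI[of _ "E - B"] imageI) auto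
   have i: "{C \<in> ?\<D>. a ~: C & b ~: C} = (-) E ` {B \<in> \<B>. a \<in> B & b \<in> B}" using c(1,2) by auto
   have "connected_matroid (E - {a} - {b}) ((-) E ` {B \<in> \<B>. a \<in> B & b \<in> B})
    \<longleftrightarrow> connected_matroid (E - {a} - {b}) {B \<in> \<B>. a \<in> B & b \<in> B}"
    by (rule connected_cong, rule separator_dual[OF fE]) (use matroid_basis_subset[OF M] in auto)
   then show "connected_matroid (E - {a} - {b}) {C \<in> ?\<D>. a ~: C & b ~: C}" unfolding i using c(4) by blast
  qed (rule IH'[OF MD UD])
 next
  case r
  show ?thesis unfolding liftable_def
  proof (intro allI impI, rule rank2_simple_lift[OF M _ U(1)])
   fix x y assume xy: "x \<in> E" "y \<in> E" "x ~= y"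
   then obtain B where B: "B \<in> \<B>" "x \<in> B" "y \<in> B" using simple by blast
   have "card B = 2" "finite B" using r B matroid_basis_finite[OF M] by auto
   then have "{x, y} = B" using B xy(3) by (intro card_subset_eq) auto
   then show "{x, y} \<in> \<B>" using B by simp
  qed (use r in auto)
 next
  case k
  show ?thesis
  proof (rule liftable_dual[OF M], unfold liftable_def, intro allI impI, rule rank2_simple_lift[OF MD _ UD(1)])
   fix x y assume xy: "x \<in> E" "y \<in> E" "x ~= y"
   then obtain B where B: "B \<in> \<B>" "x ~: B" "y ~: B" using cosimple by blast
   have "card (E - B) = 2" "finite (E - B)" using k B fE by auto
   then have "{x, y} = E - B" using B xy by (intro card_subset_eq) auto
   then show "{x, y} \<in> ?\<D>" using B by simp
  qed (use k in auto)
 qed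
qed

lemma liftable_rank_le_1:
 assumes "matroid E \<B>" "B \<in> \<B>" "card B \<le> 1" shows "liftable E \<B>"
 unfolding liftable_def using trivial_lift[OF assms(1)] assms matroid_basis_card[OF assms(1) _ assms(2)] by metis

text \<open>Parallel pairs are handled by \<open>liftable_parallel\<close>, series pairs by the same
  lemma in the dual. What remains is simple and cosimple, and an element can be deleted from it or
  from its dual without losing connectedness.\<close>

theorem liftable_connected:
 assumes "matroid E \<B>" "connected_matroid E \<B>" "noU 2 E \<B>" "noU 3 E \<B>"
 shows "liftable E \<B>"
 using assms
proof (induction "card E" arbitrary: E \<B> rule: less_induct)
 case less
 note M = less(2) and C = less(3) and U = less(4,5)
 have fE: "finite E" using matroid_finite[OF M] .
 obtain B0 where B0: "B0 \<in> \<B>" using matroid_nonempty[OF M] by blast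
 have B0E: "B0 \<subseteq> E" using matroid_basis_subset[OF M B0] .
 let ?\<D> = "(-) E ` \<B>"
 have MD: "matroid E ?\<D>" using matroid_dual[OF M] .
 have CD: "connected_matroid E ?\<D>" using connected_dual[OF M] C by blast
 have UD: "noU 2 E ?\<D>" "noU 3 E ?\<D>" using noU_dual[OF M U(2)] noU_dual[OF M U(1)] by auto
 have IH: "liftable F \<C>" if "card F < card E" "matroid F \<C>" "connected_matroid F \<C>" "noU 2 F \<C>" "noU 3 F \<C>" for F \<C>
  using less(1)[OF that] .
 have IH': "liftable (E - {c}) {B \<in> \<C>. c ~: B}"
  if "matroid E \<C>" "noU 2 E \<C>" "noU 3 E \<C>" "c \<in> E" "\<exists>B\<in>\<C>. c ~: B" "connected_matroid (E - {c}) {B \<in> \<C>. c ~: B}" for \<C> c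
  by (rule IH[OF card_remove_lt[OF that(4) fE] matroid_delete[OF that(1,5)] that(6) noU_delete[OF that(2)] noU_delete[OF that(3)]])
 show ?case
 proof (cases "card E \<ge> 4")
  \<comment> \<open>On at most three elements the rank or the corank is at most one.\<close>
  case False
  have "card E = card B0 + card (E - B0)" using B0E fE by (metis card_Diff_subset card_mono finite_subset le_add_diff_inverse)
  then consider "card B0 \<le> 1" | "card (E - B0) \<le> 1" using False by linarith
  then show ?thesis
  proof cases
   case 1 then show ?thesis by (rule liftable_rank_le_1[OF M B0])
  next
   case 2
   show ?thesis by (rule liftable_dual[OF M], rule liftable_rank_le_1[OF MD imageI[OF B0] 2])
  qed
 next
  case c4: True
  show ?thesis
  proof (cases "\<exists>f g. f \<in> E & g \<in> E & f ~= g & (\<forall>B\<in>\<B>. \<not> {f, g} \<subseteq> B)")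
   case True
   then obtain f g where p: "f \<in> E" "g \<in> E" "f ~= g" "\<forall>B\<in>\<B>. \<not> {f, g} \<subseteq> B" by (elim exE conjE)
   show ?thesis
   proof (rule liftable_parallel[OF M C p(1-3)])
    show "\<not> {f, g} \<subseteq> B" if "B \<in> \<B>" for B using p(4) that by (rule bspec)
   qed (rule IH'[OF M U])
  next
   case ns: False
   show ?thesis
   proof (cases "\<exists>f g. f \<in> E & g \<in> E & f ~= g & (\<forall>B\<in>\<B>. f \<in> B \<or> g \<in> B)")
    case True
    then obtain f g where p: "f \<in> E" "g \<in> E" "f ~= g" "\<forall>B\<in>\<B>. f \<in> B \<or> g \<in> B" by (elim exE conjE)
    show ?thesis
    proof (rule liftable_dual[OF M], rule liftable_parallel[OF MD CD p(1-3)])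
     show "\<not> {f, g} \<subseteq> B" if B: "B \<in> ?\<D>" for B
     proof -
      obtain A where "A \<in> \<B>" "B = E - A" using B by (elim imageE)
      then show ?thesis using bspec[OF p(4), of A] by auto
     qed
    qed (rule IH'[OF MD UD])
  next
   case nc: False
   have simple: "\<exists>B\<in>\<B>. x \<in> B & y \<in> B" if "x \<in> E" "y \<in> E" "x ~= y" for x y
    using ns that by auto
   have cosimple: "\<exists>B\<in>\<B>. x ~: B & y ~: B" if "x \<in> E" "y \<in> E" "x ~= y" for x y
    using nc that by auto
   have "E ~= {}" using c4 by auto
   then obtain e where e: "e \<in> E" by blast
   have ne: "E ~= {e}" using c4 by auto
   from connected_delete_or_contract[OF M C e connected_not_coloop[OF M C e ne]] show ?thesis
   proof
    assume c: "connected_matroid (E - {e}) {B \<in> \<B>. e ~: B}"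
    show ?thesis by (rule liftable_delete_connected[OF M C U c4 _ _ e c]) (rule simple cosimple IH; assumption)+
   next
    assume c: "connected_matroid (E - {e}) {B \<in> \<B>. e \<in> B}"
    have c': "connected_matroid (E - {e}) {B \<in> ?\<D>. e ~: B}" using connected_dual_delete[OF M e] c by blast
    have simple': "\<exists>B\<in>?\<D>. x \<in> B & y \<in> B" if "x \<in> E" "y \<in> E" "x ~= y" for x y using cosimple[OF that] that by auto
    have cosimple': "\<exists>B\<in>?\<D>. x ~: B & y ~: B" if "x \<in> E" "y \<in> E" "x ~= y" for x y using simple[OF that] that by auto
    show ?thesis
     by (rule liftable_dual[OF M], rule liftable_delete_connected[OF MD CD UD c4 _ _ e c']) (rule simple' cosimple' IH; assumption)+
   qed
  qed
  qed
 qed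
qed

subsection \<open>Direct sums\<close>

text \<open>On a direct sum \<open>D\<close> factors only up to rescaling, so here the source triples are no longer tied to \<open>D\<close>.\<close>

definition W3 :: "('b => 'b => 'k) => 'b => 'b => 'b => 'b => bool" where
 "W3 F a b c d \<longleftrightarrow> (\<exists>x y z. RL x y z (F a b * F c d) (- (F a c * F b d)) (F a d * F b c))"

definition weakright :: "'a set => 'a set set => ('a set => 'k) => bool" where
 "weakright E \<B> D \<longleftrightarrow> (\<forall>B\<subseteq>E. D B ~= 0 \<longleftrightarrow> B \<in> \<B>) & (\<forall>B\<in>\<B>. D B \<in> \<Gamma>) &
   (\<forall>J a b c d. J \<subseteq> E \<longrightarrow> {a, b, c, d} \<subseteq> E - J \<longrightarrow> distinct [a, b, c, d] \<longrightarrow> W3 (br D J) a b c d)"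

lemma weakrightD:
 assumes "weakright E \<B> D"
 shows "B \<subseteq> E ==> D B ~= 0 \<longleftrightarrow> B \<in> \<B>" "B \<in> \<B> ==> D B \<in> \<Gamma>"
  "J \<subseteq> E ==> {a, b, c, d} \<subseteq> E - J ==> distinct [a, b, c, d] ==> W3 (br D J) a b c d"
 using assms unfolding weakright_def by blast+

lemma right_weakright: "right E \<B> D D' ==> weakright E \<B> D'"
 unfolding weakright_def
proof (intro conjI allI impI ballI)
 assume R: "right E \<B> D D'"
 show "D' B ~= 0 \<longleftrightarrow> B \<in> \<B>" if "B \<subseteq> E" for B using rightD(1)[OF R that] .
 show "D' B \<in> \<Gamma>" if "B \<in> \<B>" for B using rightD(2)[OF R that] .
 show "W3 (br D' J) a b c d" if "J \<subseteq> E" "{a, b, c, d} \<subseteq> E - J" for J a b c d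
  using rightD(3)[OF R that] unfolding RLF_def W3_def by blast
qed

lemma W3_degI:
 assumes K: "K3 F a b c d" and Z: "F a b * F c d = 0 \<or> F a c * F b d = 0 \<or> F a d * F b c = 0"
 shows "W3 F a b c d"
proof -
 let ?x = "F a b * F c d" and ?y = "F a c * F b d" and ?z = "F a d * F b c"
 have s: "?x + - ?y + ?z = 0" using K unfolding K3_def by simp
 have e: "?x = 0 ==> ?y = ?z" "?y = 0 ==> ?x = - ?z" "?z = 0 ==> ?x = ?y" using K3_zero[OF K] by auto
 define i where "i u = (if u = 0 then 0 else 1 :: 'p)" for u :: 'k
 from Z consider "?x = 0" | "?y = 0" | "?z = 0" by blast
 then have "\<exists>x y z. RL x y z ?x (- ?y) ?z"
 proof cases
  case 1 then show ?thesis using s e(1) unfolding RL_def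
   by (intro exI[of _ 0] exI[of _ "- i ?y"] exI[of _ "i ?z"]) (auto simp: i_def)
 next
  case 2 then show ?thesis using s e(2) unfolding RL_def
   by (intro exI[of _ "i ?x"] exI[of _ 0] exI[of _ "- i ?z"]) (auto simp: i_def)
 next
  case 3 then show ?thesis using s e(3) unfolding RL_def
   by (intro exI[of _ "i ?x"] exI[of _ "- i ?y"] exI[of _ 0]) (auto simp: i_def)
 qed
 then show ?thesis unfolding W3_def .
qed

lemma W3_scaled:
 assumes R: "W3 G p q r t" and k: "k ~= 0"
  and f: "\<And>x. x \<in> {p, q, r, t} ==> f x ~= 0"
  and F: "\<And>x y. {x, y} \<subseteq> {p, q, r, t} ==> x ~= y ==> F x y = k * (f x * f y * G x y)" and d: "distinct [p, q, r, t]"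
 shows "W3 F p q r t"
proof -
 let ?c = "k * k * (f p * f q * f r * f t)"
 have e: "F p q * F r t = ?c * (G p q * G r t)" "- (F p r * F q t) = ?c * (- (G p r * G q t))" "F p t * F q r = ?c * (G p t * G q r)"
  using d by (simp_all add: F ac_simps)
 have "?c ~= 0" using f k by auto
 moreover obtain x y z where r: "RL x y z (G p q * G r t) (- (G p r * G q t)) (G p t * G q r)" using R unfolding W3_def by blast
 ultimately show ?thesis unfolding W3_def e using RL_scale[OF r one_neq_zero] by blast
qed

end

text \<open>Extend \<open>B1 \<inter> S\<close> by elements of \<open>B2\<close>: the fixed count on
  \<open>S\<close> forbids any addition inside \<open>S\<close>, so all of \<open>B2 - S\<close> is
  taken.\<close>

lemma separator_mix:
 assumes M: "matroid E \<B>" and S: "S \<subseteq> E" "separator \<B> S" and B: "B1 \<in> \<B>" "B2 \<in> \<B>"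
 shows "(B1 \<inter> S) \<union> (B2 - S) \<in> \<B>"
proof -
 obtain B where B': "B \<in> \<B>" "B1 \<inter> S \<subseteq> B" "B \<subseteq> (B1 \<inter> S) \<union> B2"
  using matroid_extend[OF M B(1) _ B(2), of "B1 \<inter> S"] by blast
 have fin: "finite B" "finite B2" using matroid_basis_finite[OF M] B' B by auto
 have c: "card (B \<inter> S) = card (B1 \<inter> S)" "card (B \<inter> S) = card (B2 \<inter> S)" using S(2) B B'(1) unfolding separator_def by blast+
 have "B1 \<inter> S = B \<inter> S" using c(1) B'(2) fin by (intro card_subset_eq) auto
 moreover have "B - S = B2 - S"
 proof (rule card_subset_eq)
  show "B - S \<subseteq> B2 - S" using B'(3) by blast
  have "card B = card (B \<inter> S) + card (B - S)" "card B2 = card (B2 \<inter> S) + card (B2 - S)" using fin by (metis card_Int_Diff)+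
  then show "card (B - S) = card (B2 - S)" using c(2) matroid_basis_card[OF M B'(1) B(2)] by linarith
 qed (use fin in simp)
 ultimately have "B = (B1 \<inter> S) \<union> (B2 - S)" by blast
 then show ?thesis using B'(1) by simp
qed

lemma matroid_part:
 assumes M: "matroid E \<B>" and S: "S \<subseteq> E" "T0 \<subseteq> E - S" and ne: "X0 \<union> T0 \<in> \<B>" "X0 \<subseteq> S"
 shows "matroid S {X. X \<subseteq> S & X \<union> T0 \<in> \<B>}"
 unfolding matroid_def
proof (intro conjI ballI)
 show "finite S" using S(1) matroid_finite[OF M] finite_subset by blast
 show "{X. X \<subseteq> S & X \<union> T0 \<in> \<B>} ~= {}" using ne by blast
 show "X \<subseteq> S" if "X \<in> {X. X \<subseteq> S & X \<union> T0 \<in> \<B>}" for X using that by blast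
next
 fix X1 X2 x assume h: "X1 \<in> {X. X \<subseteq> S & X \<union> T0 \<in> \<B>}" "X2 \<in> {X. X \<subseteq> S & X \<union> T0 \<in> \<B>}" "x \<in> X1 - X2"
 then have "x \<in> (X1 \<union> T0) - (X2 \<union> T0)" using S(2) by blast
 then obtain y where y: "y \<in> (X2 \<union> T0) - (X1 \<union> T0)" "insert y ((X1 \<union> T0) - {x}) \<in> \<B>"
  using matroid_exchange[OF M, of "X1 \<union> T0" "X2 \<union> T0" x] h by blast
 have "insert y ((X1 \<union> T0) - {x}) = insert y (X1 - {x}) \<union> T0" using h S(2) by blast
 then show "\<exists>y\<in>X2 - X1. insert y (X1 - {x}) \<in> {X. X \<subseteq> S & X \<union> T0 \<in> \<B>}"
  using y h by (intro bexI[of _ y]) auto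
qed

lemma noU_part:
 assumes U: "noU k E \<B>" and S: "S \<subseteq> E" "T0 \<subseteq> E - S"
 shows "noU k S {X. X \<subseteq> S & X \<union> T0 \<in> \<B>}"
 unfolding noU_def
proof (intro allI impI)
 fix J A assume h: "J \<union> A \<subseteq> S" "J \<inter> A = {}" "card A = 5"
 have "(J \<union> T0) \<union> A \<subseteq> E" "(J \<union> T0) \<inter> A = {}" using h S by auto
 from noUD[OF U this h(3)] obtain C where C: "C \<subseteq> A" "card C = k" "J \<union> T0 \<union> C ~: \<B>" by (elim exE conjE)
 have "J \<union> T0 \<union> C = (J \<union> C) \<union> T0" by blast
 then show "\<exists>C\<subseteq>A. card C = k & J \<union> C ~: {X. X \<subseteq> S & X \<union> T0 \<in> \<B>}" using C by (intro exI[of _ C]) auto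
qed

context signed_lifting
begin

lemma prep_part:
 assumes P: "prep E \<B> D" and S: "S \<subseteq> E" "T0 \<subseteq> E - S"
 shows "prep S {X. X \<subseteq> S & X \<union> T0 \<in> \<B>} (\<lambda>X. D (X \<union> T0))"
proof (rule prepI)
 fix X assume X: "X \<subseteq> S"
 then have "X \<union> T0 \<subseteq> E" using S by auto
 then show "D (X \<union> T0) ~= 0 \<longleftrightarrow> X \<in> {X. X \<subseteq> S & X \<union> T0 \<in> \<B>}" using prepD(1)[OF P, of "X \<union> T0"] X by simp
next
 fix J a b c d assume h: "J \<subseteq> S" "{a, b, c, d} \<subseteq> S - J"
 have "N3 (br D (J \<union> T0)) a b c d" using h S by (intro prepD(2)[OF P]) auto
 moreover have "br (\<lambda>X. D (X \<union> T0)) J x y = br D (J \<union> T0) x y" for x y unfolding br_def by simp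
 ultimately show "N3 (br (\<lambda>X. D (X \<union> T0)) J) a b c d" unfolding N3_def by simp
qed

text \<open>The signs between two parts. With this factor, a bracket over the union is a product of
  brackets over the parts, up to rescaling single elements.\<close>

definition cross_sign :: "'a set => 'a set => 'k" where
 "cross_sign X Y = (\<Prod>x\<in>X. \<Prod>y\<in>Y. of_int (s x y))"

lemma cross_sign_insert:
 assumes "finite X" "finite Y"
 shows "x ~: X ==> cross_sign (insert x X) Y = (\<Prod>y\<in>Y. of_int (s x y)) * cross_sign X Y"
  "y ~: Y ==> cross_sign X (insert y Y) = (\<Prod>x\<in>X. of_int (s x y)) * cross_sign X Y"
 using assms unfolding cross_sign_def by (simp_all add: prod.distrib)

lemma cross_sign_\<Gamma>: "X \<inter> Y = {} ==> cross_sign X Y \<in> \<Gamma>"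
 unfolding cross_sign_def by (intro unit_subgroup_prod[OF subgroup] s_\<Gamma>) auto

text \<open>Four arguments in one summand give a rescaled relation of that summand. For mixed
  arguments, counting the elements in \<open>S\<close> shows that all products vanish, or that one
  vanishes and the relation reduces to an identity between the other two.\<close>

lemma weakright_sum:
 assumes fE: "finite E" and S: "S \<subseteq> E" and MS: "matroid S \<B>1" and MT: "matroid (E - S) \<B>2"
  and D1: "weakright S \<B>1 D1" and D2: "weakright (E - S) \<B>2 D2"
  and B: "\<And>B. B \<subseteq> E ==> B \<in> \<B> \<longleftrightarrow> B \<inter> S \<in> \<B>1 & B - S \<in> \<B>2" and BE: "\<And>B. B \<in> \<B> ==> B \<subseteq> E"
 shows "weakright E \<B> (\<lambda>B. cross_sign (B \<inter> S) (B - S) * D1 (B \<inter> S) * D2 (B - S))" (is "weakright E \<B> ?D")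
proof -
 note G = unit_subgroupD[OF subgroup]
 \<comment> \<open>The rank of the first summand.\<close>
 define r where "r = card (SOME X. X \<in> \<B>1)"
 have r: "card X = r" if "X \<subseteq> S" "D1 X ~= 0" for X
 proof -
  have X: "X \<in> \<B>1" using weakrightD(1)[OF D1 that(1)] that(2) by blast
  then have "(SOME X. X \<in> \<B>1) \<in> \<B>1" by (rule someI)
  then show ?thesis unfolding r_def using matroid_basis_card[OF MS X] by blast
 qed
 show ?thesis unfolding weakright_def
 proof (intro conjI allI impI ballI)
  fix A assume A: "A \<subseteq> E"
  have "cross_sign (A \<inter> S) (A - S) ~= 0" using cross_sign_\<Gamma>[of "A \<inter> S" "A - S"] G(2) by blast
  moreover have "D1 (A \<inter> S) ~= 0 \<longleftrightarrow> A \<inter> S \<in> \<B>1" by (rule weakrightD(1)[OF D1]) blast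
  moreover have "D2 (A - S) ~= 0 \<longleftrightarrow> A - S \<in> \<B>2" by (rule weakrightD(1)[OF D2]) (use A in blast)
  ultimately show "?D A ~= 0 \<longleftrightarrow> A \<in> \<B>" using B[OF A] by simp
 next
  fix A assume A: "A \<in> \<B>"
  then have "A \<inter> S \<in> \<B>1" "A - S \<in> \<B>2" using B[OF BE[OF A]] by auto
  then show "?D A \<in> \<Gamma>" by (intro G(3) weakrightD(2)[OF D1] weakrightD(2)[OF D2] cross_sign_\<Gamma>) auto
 next
  fix J a b c d assume h: "J \<subseteq> E" "{a, b, c, d} \<subseteq> E - J" "distinct [a, b, c, d]"
  define P Q where "P = J \<inter> S" and "Q = J - S"
  have fin: "finite P" "finite Q" using h(1) fE finite_subset unfolding P_def Q_def by auto
  have PQ: "P \<subseteq> S" "Q \<subseteq> E - S" using h(1) unfolding P_def Q_def by auto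
  define \<alpha> where "\<alpha> x = (\<Prod>q\<in>Q. of_int (s x q) :: 'k)" for x
  define \<beta> where "\<beta> y = (\<Prod>p\<in>P. of_int (s p y) :: 'k)" for y
  let ?\<sigma> = "cross_sign P Q" and ?F = "br ?D J"
  define u where "u x = \<alpha> x * D1 (insert x P)" for x
  define v where "v y = \<beta> y * D2 (insert y Q)" for y
  have \<alpha>nz: "\<alpha> x ~= 0" if "x \<in> S" for x
  proof -
   have "\<alpha> x \<in> \<Gamma>" unfolding \<alpha>_def using that PQ by (intro unit_subgroup_prod[OF subgroup] s_\<Gamma>) auto
   then show ?thesis using G(2) by blast
  qed
  have \<beta>nz: "\<beta> y ~= 0" if "y ~: S" for y
  proof -
   have "\<beta> y \<in> \<Gamma>" unfolding \<beta>_def using that PQ by (intro unit_subgroup_prod[OF subgroup] s_\<Gamma>) auto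
   then show ?thesis using G(2) by blast
  qed
  have \<sigma>nz: "?\<sigma> ~= 0" using cross_sign_\<Gamma>[of P Q] PQ G(2) by blast
  have FSS: "?F x y = ?\<sigma> * D2 Q * (\<alpha> x * \<alpha> y * br D1 P x y)"
   if xy: "x \<in> S" "y \<in> S" "x ~= y" "x ~: J" "y ~: J" for x y
  proof -
   have i: "insert x (insert y J) \<inter> S = insert x (insert y P)" "insert x (insert y J) - S = Q"
    using xy unfolding P_def Q_def by auto
   have n: "x ~: insert y P" "y ~: P" using xy unfolding P_def by auto
   show ?thesis unfolding br_def i cross_sign_insert(1)[OF finite.insertI[OF fin(1)] fin(2) n(1)] cross_sign_insert(1)[OF fin n(2)] \<alpha>_def
    by (simp add: ac_simps)
  qed
  have FTT: "?F x y = ?\<sigma> * D1 P * (\<beta> x * \<beta> y * br D2 Q x y)"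
   if xy: "x ~: S" "y ~: S" "x ~= y" "x ~: J" "y ~: J" for x y
  proof -
   have i: "insert x (insert y J) \<inter> S = P" "insert x (insert y J) - S = insert x (insert y Q)"
    using xy unfolding P_def Q_def by auto
   have n: "x ~: insert y Q" "y ~: Q" using xy unfolding Q_def by auto
   show ?thesis unfolding br_def i cross_sign_insert(2)[OF fin(1) finite.insertI[OF fin(2)] n(1)] cross_sign_insert(2)[OF fin n(2)] \<beta>_def
    by (simp add: ac_simps)
  qed
  have FST: "?F x y = ?\<sigma> * (u x * v y)" if xy: "x \<in> S" "y ~: S" "x ~: J" "y ~: J" for x y
  proof -
   have i: "insert x (insert y J) \<inter> S = insert x P" "insert x (insert y J) - S = insert y Q"
    using xy unfolding P_def Q_def by auto
   have n: "x ~: P" "y ~: Q" "x ~= y" using xy unfolding P_def Q_def by auto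
   have c: "cross_sign (insert x P) (insert y Q) = of_int (s x y) * \<alpha> x * (\<beta> y * ?\<sigma>)"
    unfolding cross_sign_insert(1)[OF fin(1) finite.insertI[OF fin(2)] n(1)] cross_sign_insert(2)[OF fin n(2)] \<alpha>_def \<beta>_def
    using fin n by simp
   have "?F x y = (of_int (s x y) * of_int (s x y)) * (?\<sigma> * (u x * v y))"
    unfolding br_def i c u_def v_def by (simp add: ac_simps)
   then show ?thesis by (simp add: s_sq[OF n(3)])
  qed
  have FTS: "?F x y = - (?\<sigma> * (u y * v x))" if "x ~: S" "y \<in> S" "x ~: J" "y ~: J" for x y
   using FST[of y x] alt2_flip[OF alt2_br, of ?D J x y] that by simp
  have nJ: "a ~: J" "b ~: J" "c ~: J" "d ~: J" using h(2) by auto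
  define m where "m x = (if x \<in> S then 1 else (0::nat))" for x
  \<comment> \<open>A nonzero bracket fills the part in \<open>S\<close> up to exactly
    \<open>r\<close> elements. So a product of two brackets vanishes unless both pairs have equally
    many elements in \<open>S\<close>.\<close>
  have deg: "card P + m x + m y = r" if "x ~= y" "x ~: J" "y ~: J" "?F x y ~= 0" for x y
  proof -
   consider (1) "x \<in> S" "y \<in> S" | (2) "x ~: S" "y ~: S" | (3) "x \<in> S" "y ~: S" | (4) "x ~: S" "y \<in> S" by blast
   then show ?thesis
   proof cases
    case 1
    then have "D1 (insert x (insert y P)) ~= 0" using FSS[OF 1 that(1-3)] that(4) unfolding br_def by auto
    then have "card (insert x (insert y P)) = r" using 1 PQ by (intro r) auto
    moreover have "x ~: insert y P" "y ~: P" using that unfolding P_def by auto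
    ultimately show ?thesis using 1 fin unfolding m_def by simp
   next
    case 2
    then have "D1 P ~= 0" using FTT[OF 2 that(1-3)] that(4) by auto
    then show ?thesis using 2 r[OF PQ(1)] unfolding m_def by simp
   next
    case 3
    then have "D1 (insert x P) ~= 0" using FST[OF 3 that(2,3)] that(4) unfolding u_def by auto
    then have "card (insert x P) = r" using 3 PQ by (intro r) auto
    moreover have "x ~: P" using that unfolding P_def by auto
    ultimately show ?thesis using 3 fin unfolding m_def by simp
   next
    case 4
    then have "D1 (insert y P) ~= 0" using FTS[OF 4 that(2,3)] that(4) unfolding u_def by auto
    then have "card (insert y P) = r" using 4 PQ by (intro r) auto
    moreover have "y ~: P" using that unfolding P_def by auto
    ultimately show ?thesis using 4 fin unfolding m_def by simp
   qed
  qed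
  have z: "?F x y * ?F z w = 0" if "m x + m y ~= m z + m w" "x ~= y" "z ~= w" "{x, y, z, w} \<inter> J = {}" for x y z w
  proof (rule ccontr)
   assume "?F x y * ?F z w ~= 0"
   then have "card P + m x + m y = r" "card P + m z + m w = r" using that by (auto intro!: deg)
   then show False using that(1) by simp
  qed
  show "W3 ?F a b c d"
  proof (cases "{a, b, c, d} \<subseteq> S \<or> {a, b, c, d} \<inter> S = {}")
   case True
   then show ?thesis
   proof
    assume sub: "{a, b, c, d} \<subseteq> S"
    show ?thesis
    proof (cases "D2 Q = 0")
     case True
     then have "?F x y = 0" if "x \<in> {a, b, c, d}" "y \<in> {a, b, c, d}" "x ~= y" for x y
      using FSS[of x y] that sub nJ by auto
     then show ?thesis using h(3) by (intro W3_degI) (auto simp: K3_def)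
    next
     case False
     show ?thesis
     proof (rule W3_scaled[where k = "?\<sigma> * D2 Q" and f = \<alpha>])
      show "W3 (br D1 P) a b c d" using sub h PQ nJ unfolding P_def by (intro weakrightD(3)[OF D1]) auto
      show "?F x y = ?\<sigma> * D2 Q * (\<alpha> x * \<alpha> y * br D1 P x y)" if "{x, y} \<subseteq> {a, b, c, d}" "x ~= y" for x y
       using that sub nJ by (intro FSS) auto
     qed (use False \<sigma>nz \<alpha>nz sub h(3) in auto)
    qed
   next
    assume sub: "{a, b, c, d} \<inter> S = {}"
    show ?thesis
    proof (cases "D1 P = 0")
     case True
     then have "?F x y = 0" if "x \<in> {a, b, c, d}" "y \<in> {a, b, c, d}" "x ~= y" for x y
      using FTT[of x y] that sub nJ by auto
     then show ?thesis using h(3) by (intro W3_degI) (auto simp: K3_def)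
    next
     case False
     show ?thesis
     proof (rule W3_scaled[where k = "?\<sigma> * D1 P" and f = \<beta>])
      show "W3 (br D2 Q) a b c d" using sub h PQ nJ unfolding Q_def by (intro weakrightD(3)[OF D2]) auto
      show "?F x y = ?\<sigma> * D1 P * (\<beta> x * \<beta> y * br D2 Q x y)" if "{x, y} \<subseteq> {a, b, c, d}" "x ~= y" for x y
       using that sub nJ by (intro FTT) auto
     qed (use False \<sigma>nz \<beta>nz sub h(3) in auto)
    qed
   qed
  next
   case False
   have d: "a ~= b" "c ~= d" "a ~= c" "b ~= d" "a ~= d" "b ~= c" using h(3) by auto
   have z1: "m a + m b ~= m c + m d ==> ?F a b * ?F c d = 0" using d nJ by (intro z) auto
   have z2: "m a + m c ~= m b + m d ==> ?F a c * ?F b d = 0" using d nJ by (intro z) auto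
   have z3: "m a + m d ~= m b + m c ==> ?F a d * ?F b c = 0" using d nJ by (intro z) auto
   have "K3 ?F a b c d & (?F a b * ?F c d = 0 \<or> ?F a c * ?F b d = 0 \<or> ?F a d * ?F b c = 0)"
   proof -
    consider (odd) "m a + m b ~= m c + m d" "m a + m c ~= m b + m d" "m a + m d ~= m b + m c"
     | (1) "a \<in> S" "b \<in> S" "c ~: S" "d ~: S" | (2) "a \<in> S" "b ~: S" "c \<in> S" "d ~: S" | (3) "a \<in> S" "b ~: S" "c ~: S" "d \<in> S"
     | (4) "a ~: S" "b ~: S" "c \<in> S" "d \<in> S" | (5) "a ~: S" "b \<in> S" "c ~: S" "d \<in> S" | (6) "a ~: S" "b \<in> S" "c \<in> S" "d ~: S"
     using False unfolding m_def by (cases "a \<in> S"; cases "b \<in> S"; cases "c \<in> S"; cases "d \<in> S") auto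
    then show ?thesis
    proof cases
     case odd show ?thesis unfolding K3_def z1[OF odd(1)] z2[OF odd(2)] z3[OF odd(3)] by simp
    next
     case 1
     then have z: "?F a b * ?F c d = 0" by (intro z1) (simp add: m_def)
     show ?thesis unfolding K3_def z using 1 nJ by (simp add: FST FTS)
    next
     case 2
     then have z: "?F a c * ?F b d = 0" by (intro z2) (simp add: m_def)
     show ?thesis unfolding K3_def z using 2 nJ by (simp add: FST FTS)
    next
     case 3
     then have z: "?F a d * ?F b c = 0" by (intro z3) (simp add: m_def)
     show ?thesis unfolding K3_def z using 3 nJ by (simp add: FST FTS)
    next
     case 4
     then have z: "?F a b * ?F c d = 0" by (intro z1) (simp add: m_def)
     show ?thesis unfolding K3_def z using 4 nJ by (simp add: FST FTS)
    next
     case 5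
     then have z: "?F a c * ?F b d = 0" by (intro z2) (simp add: m_def)
     show ?thesis unfolding K3_def z using 5 nJ by (simp add: FST FTS)
    next
     case 6
     then have z: "?F a d * ?F b c = 0" by (intro z3) (simp add: m_def)
     show ?thesis unfolding K3_def z using 6 nJ by (simp add: FST FTS)
    qed
   qed
   then show ?thesis by (intro W3_degI) blast+
  qed
 qed
qed

text \<open>A disconnected matroid is split along a separator; each summand is realised by fixing
  the trace of one basis \<open>B0\<close> on the other side, which also restricts \<open>D\<close>
  to the summand.\<close>

theorem weak_lift:
 assumes "matroid E \<B>" "noU 2 E \<B>" "noU 3 E \<B>" "prep E \<B> D"
 shows "\<exists>D'. weakright E \<B> D'"
 using assms
proof (induction "card E" arbitrary: E \<B> D rule: less_induct)
 case less
 note M = less(2) and U = less(3,4) and P = less(5)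
 show ?case
 proof (cases "connected_matroid E \<B>")
  case True
  then show ?thesis using liftable_connected[OF M _ U] P right_weakright unfolding liftable_def by blast
 next
  case False
  then obtain S where S: "S \<subseteq> E" "separator \<B> S" "S ~= {}" "S ~= E" unfolding connected_matroid_def by blast
  have fE: "finite E" using matroid_finite[OF M] .
  obtain B0 where B0: "B0 \<in> \<B>" using matroid_nonempty[OF M] by blast
  have B0E: "B0 \<subseteq> E" using matroid_basis_subset[OF M B0] .
  let ?\<B>1 = "{X. X \<subseteq> S & X \<union> (B0 - S) \<in> \<B>}" and ?\<B>2 = "{X. X \<subseteq> E - S & X \<union> (B0 \<inter> S) \<in> \<B>}"
  have T1: "B0 - S \<subseteq> E - S" and T2: "B0 \<inter> S \<subseteq> E - (E - S)" using B0E S(1) by auto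
  have M1: "matroid S ?\<B>1"
  proof (rule matroid_part[OF M S(1) T1])
   have "B0 \<inter> S \<union> (B0 - S) = B0" by blast
   then show "B0 \<inter> S \<union> (B0 - S) \<in> \<B>" using B0 by simp
  qed blast
  have M2: "matroid (E - S) ?\<B>2"
  proof (rule matroid_part[OF M _ T2])
   have "(B0 - S) \<union> (B0 \<inter> S) = B0" by blast
   then show "(B0 - S) \<union> (B0 \<inter> S) \<in> \<B>" using B0 by simp
  qed (use B0E in auto)
  have "card S < card E" using S fE by (intro psubset_card_mono) auto
  then obtain D1 where D1: "weakright S ?\<B>1 D1"
   using less(1)[OF _ M1 noU_part[OF U(1) S(1) T1] noU_part[OF U(2) S(1) T1] prep_part[OF P S(1) T1]] by blast
  have "card (E - S) < card E" using S fE by (intro psubset_card_mono) auto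
  then obtain D2 where D2: "weakright (E - S) ?\<B>2 D2"
   using less(1)[OF _ M2 noU_part[OF U(1) _ T2] noU_part[OF U(2) _ T2] prep_part[OF P _ T2]] by blast
  have sepC: "separator \<B> (E - S)" by (rule separator_compl[OF M S(2)])
  have "B \<in> \<B> \<longleftrightarrow> B \<inter> S \<in> ?\<B>1 & B - S \<in> ?\<B>2" if B: "B \<subseteq> E" for B
  proof
   assume h: "B \<in> \<B>"
   have "(B \<inter> S) \<union> (B0 - S) \<in> \<B>" by (rule separator_mix[OF M S(1,2) h B0])
   moreover have "(B0 \<inter> S) \<union> (B - S) \<in> \<B>" by (rule separator_mix[OF M S(1,2) B0 h])
   moreover have "(B0 \<inter> S) \<union> (B - S) = (B - S) \<union> (B0 \<inter> S)" by blast
   ultimately show "B \<inter> S \<in> ?\<B>1 & B - S \<in> ?\<B>2" using B by auto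
  next
   assume h: "B \<inter> S \<in> ?\<B>1 & B - S \<in> ?\<B>2"
   then have "(((B \<inter> S) \<union> (B0 - S)) \<inter> S) \<union> (((B - S) \<union> (B0 \<inter> S)) - S) \<in> \<B>"
    by (intro separator_mix[OF M S(1,2), of "(B \<inter> S) \<union> (B0 - S)" "(B - S) \<union> (B0 \<inter> S)"]) blast+
   moreover have "(((B \<inter> S) \<union> (B0 - S)) \<inter> S) \<union> (((B - S) \<union> (B0 \<inter> S)) - S) = B" by blast
   ultimately show "B \<in> \<B>" by simp
  qed
  then show ?thesis using weakright_sum[OF fE S(1) M1 M2 D1 D2] matroid_basis_subset[OF M] by blast
 qed
qed

end

section \<open>From tuples to sets and back\<close>

lemma exists_order_sign:
 "\<exists>s :: 'a => 'a => int. (\<forall>x y. s y x = - s x y) & (\<forall>x y. x ~= y \<longrightarrow> s x y = 1 \<or> s x y = - 1)"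
proof -
 obtain r :: "'a rel" where r: "Well_order r" "Field r = UNIV" using well_ordering by (elim exE conjE)
 have t: "total r" "antisym r"
  using r unfolding well_order_on_def linear_order_on_def partial_order_on_def by simp_all
 define s where "s x y = (if x = y then 0 else if (x, y) \<in> r then 1 else - 1 :: int)" for x y
 have "s y x = - s x y" for x y
 proof (cases "x = y")
  case False
  then have "(x, y) \<in> r \<or> (y, x) \<in> r" using t(1) by (simp add: total_on_def)
  moreover have "\<not> ((x, y) \<in> r & (y, x) \<in> r)" using antisymD[OF t(2), of x y] False by blast
  ultimately show ?thesis using False unfolding s_def by auto
 qed (simp add: s_def)
 moreover have "s x y = 1 \<or> s x y = - 1" if "x ~= y" for x y using that unfolding s_def by simp
 ultimately show ?thesis by blast
qed

lemma prod_list_mult_map: "(\<Prod>x\<leftarrow>xs. f x * g x) = (\<Prod>x\<leftarrow>xs. f x) * (\<Prod>x\<leftarrow>xs. g x :: 'b::comm_monoid_mult)"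
 by (induction xs) (simp_all add: ac_simps)

context signed_lifting
begin

text \<open>For distinct entries, the sign of sorting the list when \<open>s\<close> comes from a
  linear order; zero if an entry is repeated.\<close>

primrec sg :: "'a list => int" where
 "sg [] = 1"
| "sg (x # xs) = (\<Prod>y\<leftarrow>xs. s x y) * sg xs"

lemma sg_append: "sg (xs @ ys) = sg xs * (\<Prod>x\<leftarrow>xs. \<Prod>y\<leftarrow>ys. s x y) * sg ys"
 by (induction xs) (simp_all add: ac_simps)

lemma sg_snoc2: "sg (js @ [x, y]) = sg js * (\<Prod>j\<leftarrow>js. s j x) * (\<Prod>j\<leftarrow>js. s j y) * s x y"
 unfolding sg_append by (simp add: prod_list_mult_map ac_simps)

lemma prod_list_unit: "x ~: set ys ==> (\<Prod>y\<leftarrow>ys. s x y) = 1 \<or> (\<Prod>y\<leftarrow>ys. s x y) = - 1"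
proof (induction ys)
 case (Cons a ys)
 then have "s x a = 1 \<or> s x a = - 1" by (intro s_unit) auto
 then show ?case using Cons by auto
qed simp

lemma sg_distinct: "distinct xs ==> sg xs = 1 \<or> sg xs = - 1"
proof (induction xs)
 case (Cons a xs)
 then show ?case using prod_list_unit[of a xs] by auto
qed simp

lemma prod_list_self: "x \<in> set ys ==> (\<Prod>y\<leftarrow>ys. s x y) = 0" "x \<in> set ys ==> (\<Prod>y\<leftarrow>ys. s y x) = 0"
 by (induction ys) (auto simp: s_self)

lemma sg_nondistinct: "\<not> distinct xs ==> sg xs = 0"
proof (induction xs)
 case (Cons a xs)
 show ?case
 proof (cases "a \<in> set xs")
  case True
  then have "(\<Prod>y\<leftarrow>xs. s a y) = 0" by (rule prod_list_self)
  then show ?thesis by simp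
 qed (use Cons in simp)
qed simp

lemma prod_list_flip: "(\<Prod>m\<leftarrow>ms. s m b) = (- 1) ^ length ms * (\<Prod>m\<leftarrow>ms. s b m)"
proof (induction ms)
 case (Cons a ms)
 then show ?case by (simp add: s_flip[of b a])
qed simp

text \<open>Moving \<open>a\<close> and \<open>b\<close> across the block \<open>ms\<close> gives
  the same power of -1 twice; only the sign of the pair \<open>a, b\<close> itself is left.\<close>

lemma sg_swap: "sg (us @ b # ms @ a # vs) = - sg (us @ a # ms @ b # vs)"
proof -
 have "sg (b # ms @ a # vs) = - sg (a # ms @ b # vs)"
  unfolding sg.simps sg_append
  by (simp add: prod_list_mult_map prod_list_flip[of a] prod_list_flip[of b] s_flip[of b a] ac_simps)
 moreover have "(\<Prod>u\<leftarrow>us. \<Prod>y\<leftarrow>b # ms @ a # vs. s u y) = (\<Prod>u\<leftarrow>us. \<Prod>y\<leftarrow>a # ms @ b # vs. s u y)"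
  by (simp add: ac_simps)
 ultimately show ?thesis unfolding sg_append[of us] by (simp only: mult_minus_right)
qed

lemma sg_transpose:
 assumes ij: "i < j" "j < length xs"
 shows "sg (permute_list (Transposition.transpose i j) xs) = - sg xs"
proof -
 define us where "us = take i xs"
 define ms where "ms = take (j - Suc i) (drop (Suc i) xs)"
 define vs where "vs = drop (Suc j) xs"
 have l: "length us = i" "length ms = j - Suc i" using ij unfolding us_def ms_def by auto
 have e: "xs = us @ xs ! i # ms @ xs ! j # vs"
 proof -
  have "xs = us @ xs ! i # drop (Suc i) xs" unfolding us_def using ij by (simp add: id_take_nth_drop[symmetric])
  moreover have "drop (Suc i) xs = ms @ drop (Suc i) xs ! (j - Suc i) # drop (Suc (j - Suc i)) (drop (Suc i) xs)"
   unfolding ms_def using ij by (intro id_take_nth_drop) simp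
  moreover have "drop (Suc i) xs ! (j - Suc i) = xs ! j" "drop (Suc (j - Suc i)) (drop (Suc i) xs) = vs"
   unfolding vs_def using ij by simp_all
  ultimately show ?thesis by metis
 qed
 have "permute_list (Transposition.transpose i j) xs = xs[i := xs ! j, j := xs ! i]"
  by (rule nth_equalityI) (use ij in \<open>auto simp: permute_list_def Transposition.transpose_def nth_list_update\<close>)
 also have "\<dots> = us @ xs ! j # ms @ xs ! i # vs"
 proof -
  have "(us @ a # ms @ b # vs)[i := c, j := d] = us @ c # ms @ d # vs" for a b c d
  proof -
   have "j = length us + Suc (length ms)" "i = length us" using l ij by auto
   then show ?thesis by (simp add: list_update_append)
  qed
  then show ?thesis using e by metis
 qed
 finally have "sg (permute_list (Transposition.transpose i j) xs) = sg (us @ xs ! j # ms @ xs ! i # vs)" by (rule arg_cong)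
 also have "\<dots> = - sg (us @ xs ! i # ms @ xs ! j # vs)" by (rule sg_swap)
 also have "\<dots> = - sg xs" by (simp only: e[symmetric])
 finally show ?thesis .
qed

lemma sg_permute:
 assumes "\<sigma> permutes {..<n}" "length xs = n"
 shows "sg (permute_list \<sigma> xs) = sign \<sigma> * sg xs"
 using assms(1) finite_lessThan assms(2)
proof (induction arbitrary: xs rule: permutes_induct)
 case id then show ?case by (simp add: sign_id)
next
 case (swap a b p)
 have t: "sg (permute_list (Transposition.transpose a b) xs) = - sg xs"
 proof (cases "a < b")
  case True then show ?thesis using swap by (intro sg_transpose) auto
 next
  case False
  then show ?thesis using swap sg_transpose[of b a xs] by (simp add: transpose_commute)
 qed
 have "sg (permute_list (Transposition.transpose a b \<circ> p) xs) = sg (permute_list p (permute_list (Transposition.transpose a b) xs))"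
  using swap by (simp add: permute_list_compose)
 also have "\<dots> = sign p * (- sg xs)" using swap.IH[of "permute_list (Transposition.transpose a b) xs"] swap(6) t by simp
 also have "\<dots> = sign (Transposition.transpose a b \<circ> p) * sg xs"
  using swap permutation_permutes by (subst sign_compose) (auto simp: permutation_swap_id sign_swap_id)
 finally show ?case .
qed

end

section \<open>Uniform minors\<close>

text \<open>If all sets \<open>J \<union> C\<close> were bases, contracting \<open>J\<close> and
  deleting everything outside \<open>J \<union> A\<close> would give a uniform minor. The proof
  matches this with the definition of minors through maximal independent sets.\<close>

lemma without_large_uniform_minors_noU:
 assumes M: "matroid E \<B>" and W: "without_large_uniform_minors E \<B>" and k: "k = 2 \<or> k = 3"
 shows "noU k E \<B>"
 unfolding noU_def
proof (intro allI impI, rule ccontr)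
 fix J A assume h: "J \<union> A \<subseteq> E" "J \<inter> A = {}" "card A = 5" and n: "\<not> (\<exists>C\<subseteq>A. card C = k & J \<union> C ~: \<B>)"
 let ?D = "E - J - A"
 have fE: "finite E" using matroid_finite[OF M] .
 have fA: "finite A" and fJ: "finite J" using h(1) fE finite_subset by auto
 have bas: "J \<union> C \<in> \<B>" if "C \<subseteq> A" "card C = k" for C using n that by blast
 have ED: "E - ?D = J \<union> A" using h by blast
 have "k \<le> card A" using k h(3) by auto
 then obtain C0 where C0: "C0 \<subseteq> A" "card C0 = k" using obtain_subset_with_card_n by metis
 have cB: "card B = card J + k" if "B \<in> \<B>" for B
 proof -
  have "card (J \<union> C0) = card J + card C0" using fJ fA C0 h(2) by (intro card_Un_disjoint) (auto intro: finite_subset)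
  then show ?thesis using matroid_basis_card[OF M that bas[OF C0]] C0 by simp
 qed
 have "minor_bases E \<B> J ?D = {X. X \<subseteq> A & card X = k}"
 proof (rule equalityI; rule subsetI)
  fix C assume "C \<in> minor_bases E \<B> J ?D"
  then obtain X where X: "C = X - J" "basis_of \<B> (J \<union> A) X" "basis_of \<B> J (X \<inter> J)" unfolding minor_bases_def ED by blast
  have "indep \<B> J" unfolding indep_def using bas[OF C0] by blast
  then have JX: "J \<subseteq> X" using X(3) unfolding basis_of_def by blast
  obtain B where B: "B \<in> \<B>" "X \<subseteq> B" using X(2) unfolding basis_of_def indep_def by blast
  have fB: "finite B" using matroid_basis_finite[OF M B(1)] .
  have fX: "finite X" using B fB finite_subset by blast
  have "card X = card J + k"
  proof (rule ccontr)
   assume "card X ~= card J + k"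
   then have "card X < card (J \<union> C0)" using card_mono[OF fB B(2)] cB[OF B(1)] cB[OF bas[OF C0]] by simp
   from matroid_augment[OF M B(1,2) bas[OF C0] subset_refl this] obtain y B' where
    y: "y \<in> (J \<union> C0) - X" "B' \<in> \<B>" "insert y X \<subseteq> B'" by blast
   have "X \<subset> insert y X" "insert y X \<subseteq> J \<union> A" "indep \<B> (insert y X)"
    using y C0 X(2) unfolding basis_of_def indep_def by auto
   then show False using X(2) unfolding basis_of_def by blast
  qed
  then have "card C = k" unfolding X(1) using JX fJ by (simp add: card_Diff_subset)
  moreover have "C \<subseteq> A" using X unfolding basis_of_def by blast
  ultimately show "C \<in> {X. X \<subseteq> A & card X = k}" by simp
 next
  fix C assume "C \<in> {X. X \<subseteq> A & card X = k}"
  then have C: "C \<subseteq> A" "card C = k" by auto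
  have "basis_of \<B> (J \<union> A) (J \<union> C)" unfolding basis_of_def
  proof (intro conjI allI impI notI)
   show "J \<union> C \<subseteq> J \<union> A" using C by blast
   show "indep \<B> (J \<union> C)" unfolding indep_def using bas[OF C] by blast
   fix Y assume Y: "J \<union> C \<subset> Y & Y \<subseteq> J \<union> A" "indep \<B> Y"
   then obtain B where B: "B \<in> \<B>" "Y \<subseteq> B" unfolding indep_def by blast
   then have "J \<union> C \<subset> B" using Y(1) by blast
   then have "card (J \<union> C) < card B" using matroid_basis_finite[OF M B(1)] by (intro psubset_card_mono)
   then show False using cB[OF B(1)] cB[OF bas[OF C]] by simp
  qed
  moreover have "basis_of \<B> J ((J \<union> C) \<inter> J)" unfolding basis_of_def indep_def using bas[OF C] by auto
  moreover have "C = (J \<union> C) - J" using C h(2) by blast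
  ultimately show "C \<in> minor_bases E \<B> J ?D" unfolding minor_bases_def ED by blast
 qed
 moreover have "E - J - ?D = A" using h by blast
 ultimately have "is_uniform k 5 (E - J - ?D) (minor_bases E \<B> J ?D)" unfolding is_uniform_def using fA h(3) by simp
 moreover have "J \<subseteq> E" "?D \<subseteq> E" "J \<inter> ?D = {}" using h by auto
 ultimately show False using W k unfolding without_large_uniform_minors_def by blast
qed

section \<open>Transfer of representations\<close>

context signed_lifting
begin

text \<open>The embedding \<open>\<iota>\<close> brings the pasture into \<open>'p\<close>, and
  multiplication by \<open>sg\<close> makes the value on a list independent of the order of its
  entries, which leaves a function on sets.\<close>

lemma prep_of_rep:
 assumes M: "matroid E \<B>" and r: "\<forall>X\<in>\<B>. card X = r" and rep: "pasture_rep K z mul eps nul E \<B> r \<Delta>"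
  and closed: "\<And>u v. u \<in> K ==> v \<in> K ==> mul u v \<in> K" "eps \<in> K"
  and i: "\<And>u. u \<in> K ==> \<iota> u = 0 \<longleftrightarrow> u = z" "\<And>u v. u \<in> K ==> v \<in> K ==> \<iota> (mul u v) = \<iota> u * \<iota> v" "\<iota> eps = - 1"
  and nul: "\<And>u v w. u \<in> K ==> v \<in> K ==> w \<in> K ==> nul u v w ==> \<exists>x' y' z'. RL (\<iota> u) (\<iota> v) (\<iota> w) x' y' z'"
 shows "\<exists>D. prep E \<B> D"
proof -
 have \<Delta>K: "\<Delta> xs \<in> K" "\<Delta> xs ~= z \<longleftrightarrow> set xs \<in> \<B>" if "set xs \<subseteq> E" "length xs = r" for xs
  using rep that unfolding pasture_rep_def by blast+
 have \<Delta>p: "\<Delta> (permute_list \<sigma> xs) = (if evenperm \<sigma> then \<Delta> xs else mul eps (\<Delta> xs))"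
  if "set xs \<subseteq> E" "length xs = r" "\<sigma> permutes {..<r}" for xs \<sigma>
  using rep that unfolding pasture_rep_def permute_list_def by blast
 have \<Delta>n: "nul (mul (\<Delta> (J @ [a, b])) (\<Delta> (J @ [c, d]))) (mul eps (mul (\<Delta> (J @ [a, c])) (\<Delta> (J @ [b, d]))))
      (mul (\<Delta> (J @ [a, d])) (\<Delta> (J @ [b, c])))"
  if "set J \<subseteq> E" "length J + 2 = r" "{a, b, c, d} \<subseteq> E" for J a b c d
  using rep that unfolding pasture_rep_def by blast
 \<comment> \<open>\<open>\<Delta>\<close> is unconstrained on lists of other lengths, hence the
   guard on the cardinality.\<close>
 define D where "D B = (let xs = (SOME xs. distinct xs & set xs = B) in
  if card B = r then of_int (sg xs) * \<iota> (\<Delta> xs) else 0)" for B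
 have D: "D (set ys) = of_int (sg ys) * \<iota> (\<Delta> ys)" if ys: "distinct ys" "set ys \<subseteq> E" "length ys = r" for ys
 proof -
  define xs where "xs = (SOME xs. distinct xs & set xs = set ys)"
  have "distinct xs & set xs = set ys" unfolding xs_def by (rule someI[of _ ys]) (use ys in simp)
  then have xs: "distinct xs" "set xs = set ys" by auto
  then have lx: "length xs = r" using ys distinct_card by metis
  have "mset ys = mset xs" using xs ys by (simp add: set_eq_iff_mset_eq_distinct[symmetric])
  then obtain \<sigma> where \<sigma>: "\<sigma> permutes {..<length xs}" "permute_list \<sigma> xs = ys" using mset_eq_permutation by metis
  have "\<iota> (\<Delta> ys) = of_int (sign \<sigma>) * \<iota> (\<Delta> xs)"
   using \<Delta>p[of xs \<sigma>] \<Delta>K[of xs] \<sigma> lx xs ys i(2)[OF closed(2)] i(3) by (auto simp: sign_def)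
  moreover have "sg ys = sign \<sigma> * sg xs" using sg_permute[of \<sigma> r xs] \<sigma> lx by simp
  moreover have "(of_int (sign \<sigma>) :: 'p) * of_int (sign \<sigma>) = 1" by (simp add: sign_def)
  ultimately have "of_int (sg ys) * \<iota> (\<Delta> ys) = of_int (sg xs) * \<iota> (\<Delta> xs)" by (simp add: sign_def)
  moreover have "card (set ys) = r" using ys distinct_card by metis
  ultimately show ?thesis unfolding D_def Let_def xs_def[symmetric] by simp
 qed
 have D0: "D B = 0" if "card B ~= r" for B using that unfolding D_def Let_def by simp
 have "prep E \<B> D"
 proof (rule prepI)
  fix B assume B: "B \<subseteq> E"
  show "D B ~= 0 \<longleftrightarrow> B \<in> \<B>"
  proof (cases "card B = r")
   case False then show ?thesis using D0 r by auto
  next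
   case True
   have "finite B" using B matroid_finite[OF M] finite_subset by blast
   then obtain xs where xs: "set xs = B" "distinct xs" using finite_distinct_list by blast
   then have l: "length xs = r" using True distinct_card by metis
   have "sg xs ~= 0" using sg_distinct[OF xs(2)] by auto
   moreover have "(of_int (sg xs) :: 'p) ~= 0" using sg_distinct[OF xs(2)] by auto
   ultimately show ?thesis using D[OF xs(2)] xs l B \<Delta>K[of xs] i(1)[of "\<Delta> xs"] by auto
  qed
 next
  fix J a b c d assume h: "J \<subseteq> E" "{a, b, c, d} \<subseteq> E - J" "distinct [a, b, c, d]"
  have fJ: "finite J" using h(1) matroid_finite[OF M] finite_subset by blast
  show "N3 (br D J) a b c d"
  proof (cases "card J + 2 = r")
   case False
   have "br D J x y = 0" if "x \<in> {a, b, c, d}" "y \<in> {a, b, c, d}" for x y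
   proof (cases "x = y")
    case True then show ?thesis unfolding br_zero by simp
   next
    case n: False
    have "x ~: insert y J" "y ~: J" using that h n by auto
    then have "card (insert x (insert y J)) ~= r" using fJ False by simp
    then show ?thesis unfolding br_zero using D0 by simp
   qed
   then show ?thesis unfolding N3_def using RL_zero by auto
  next
   case True
   obtain js where js: "set js = J" "distinct js" using finite_distinct_list[OF fJ] by blast
   have lj: "length js + 2 = r" using True js distinct_card by metis
   \<comment> \<open>The signs between \<open>js\<close> and \<open>x\<close> depend on
     \<open>x\<close> alone, so the brackets on lists and on sets differ by a rescaling of
     points.\<close>
   define f where "f x = (of_int (\<Prod>j\<leftarrow>js. s j x) :: 'p)" for x
   define G where "G x y = of_int (sg js) * \<iota> (\<Delta> (js @ [x, y]))" for x y
   have sq: "(of_int (sg js) :: 'p) * of_int (sg js) = 1" using sg_distinct[OF js(2)] by auto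
   have fnz: "f x ~= 0" if "x \<in> {a, b, c, d}" for x
   proof -
    have "x ~: set js" using that h(2) js by auto
    then have "(\<Prod>j\<leftarrow>js. s x j) = 1 \<or> (\<Prod>j\<leftarrow>js. s x j) = - 1" by (rule prod_list_unit)
    then have "(\<Prod>j\<leftarrow>js. s j x) = 1 \<or> (\<Prod>j\<leftarrow>js. s j x) = - 1"
     unfolding prod_list_flip by (cases "even (length js)") auto
    then show ?thesis unfolding f_def by auto
   qed
   have in_K: "\<Delta> (js @ [x, y]) \<in> K" if "x \<in> {a, b, c, d}" "y \<in> {a, b, c, d}" for x y
    using that h js lj by (intro \<Delta>K) auto
   have Gm: "G x y * G p q = \<iota> (mul (\<Delta> (js @ [x, y])) (\<Delta> (js @ [p, q])))"
    if "{x, y, p, q} \<subseteq> {a, b, c, d}" for x y p q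
   proof -
    have "G x y * G p q = (of_int (sg js) * of_int (sg js)) * (\<iota> (\<Delta> (js @ [x, y])) * \<iota> (\<Delta> (js @ [p, q])))"
     unfolding G_def by (simp only: ac_simps)
    also have "\<dots> = \<iota> (mul (\<Delta> (js @ [x, y])) (\<Delta> (js @ [p, q])))"
     unfolding sq using i(2)[OF in_K in_K, of x y p q] that by simp
    finally show ?thesis .
   qed
   have mK: "mul (\<Delta> (js @ [x, y])) (\<Delta> (js @ [p, q])) \<in> K" if "{x, y, p, q} \<subseteq> {a, b, c, d}" for x y p q
    using that by (intro closed in_K) auto
   have n: "nul (mul (\<Delta> (js @ [a, b])) (\<Delta> (js @ [c, d]))) (mul eps (mul (\<Delta> (js @ [a, c])) (\<Delta> (js @ [b, d]))))
      (mul (\<Delta> (js @ [a, d])) (\<Delta> (js @ [b, c])))" using h js lj by (intro \<Delta>n) auto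
   have e: "- (G a c * G b d) = \<iota> (mul eps (mul (\<Delta> (js @ [a, c])) (\<Delta> (js @ [b, d]))))"
    using Gm[of a c b d] i(2)[OF closed(2) mK[of a c b d]] i(3) by simp
   have "N3 G a b c d" unfolding N3_def e Gm[of a b c d, simplified] Gm[of a d b c, simplified]
    by (rule nul[OF mK closed(1)[OF closed(2) mK] mK n]) auto
   then show ?thesis
   proof (rule N3_scaled[where f = f])
    fix x y assume xy: "{x, y} \<subseteq> {a, b, c, d}"
    show "br D J x y = f x * f y * G x y"
    proof (cases "x = y")
     case True
     have "set (js @ [x, y]) \<subseteq> E" "length (js @ [x, y]) = r" using xy h js lj by auto
     moreover have "set (js @ [x, y]) ~: \<B>"
     proof
      assume b: "set (js @ [x, y]) \<in> \<B>"
      have "card (set (js @ [x, y])) = card (insert x (set js))" using True by simp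
      also have "\<dots> \<le> Suc (length js)" by (metis List.finite_set Suc_le_mono card_insert_le_m1 card_length card_insert_if le_SucI)
      finally show False using bspec[OF r b] lj by simp
     qed
     ultimately have "\<iota> (\<Delta> (js @ [x, y])) = 0" using \<Delta>K[of "js @ [x, y]"] i(1) by blast
     then show ?thesis unfolding br_def G_def True by (simp add: s_self)
    next
     case False
     have d: "distinct (js @ [x, y])" "set (js @ [x, y]) \<subseteq> E" "length (js @ [x, y]) = r"
      using xy h js lj False by auto
     have "insert x (insert y J) = set (js @ [x, y])" using js by auto
     then have "br D J x y = of_int (s x y) * (of_int (sg (js @ [x, y])) * \<iota> (\<Delta> (js @ [x, y])))"
      unfolding br_def using D[OF d] by simp
     also have "\<dots> = (of_int (s x y) * of_int (s x y)) * (f x * f y * G x y)"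
      unfolding sg_snoc2 f_def G_def of_int_mult by (simp only: ac_simps)
     finally show ?thesis unfolding s_sq[OF False] by simp
    qed
   qed (rule fnz)
  qed
 qed
 then show ?thesis by blast
qed

text \<open>\<open>h\<close> is multiplicative on \<open>\<Gamma>\<close> and need not be additive.
  It preserves the zero sums of lifted triples by \<open>hL\<close> and cancellation of opposite
  terms by \<open>hn\<close>, and the three-term relations consist of such sums.\<close>

lemma rep_of_weakright:
 fixes R (structure)
 assumes M: "matroid E \<B>" and r: "\<forall>X\<in>\<B>. card X = r" and D: "weakright E \<B> D" and R: "field R"
  and h0: "h 0 = \<zero>" and h\<Gamma>: "\<And>x. x \<in> \<Gamma> ==> h x \<in> carrier R - {\<zero>}"
  and hm: "\<And>x y. x \<in> \<Gamma> ==> y \<in> \<Gamma> ==> h (x * y) = h x \<otimes> h y" and hn: "h (- 1) = \<ominus> \<one>"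
  and hL: "\<And>x y z x' y' z'. L x y z x' y' z' ==> {x', y', z'} \<subseteq> \<Gamma> ==> h x' \<oplus> h y' \<oplus> h z' = \<zero>"
 shows "representable_over_field R E \<B>"
proof -
 interpret R: field R by fact
 note G = unit_subgroupD[OF subgroup]
 let ?G = "insert 0 \<Gamma>"
 have hc: "h x \<in> carrier R" if "x \<in> ?G" for x using that h0 h\<Gamma> by auto
 have hm': "h (x * y) = h x \<otimes> h y" if "x \<in> ?G" "y \<in> ?G" for x y
  using that hm[of x y] h0 hc[OF that(1)] hc[OF that(2)] by auto
 have Gm: "x * y \<in> ?G" if "x \<in> ?G" "y \<in> ?G" for x y using that G(3) by auto
 have Gn: "- x \<in> ?G" if "x \<in> ?G" for x using Gm[of "- 1" x] neg_one that by simp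
 have hneg: "h (- x) = (\<ominus> \<one>) \<otimes> h x" if "x \<in> ?G" for x using hm'[of "- 1" x] neg_one that hn by simp
 have hsum: "h x' \<oplus> h y' \<oplus> h z' = \<zero>" if RL: "RL x y z x' y' z'" and g: "x' \<in> ?G" "y' \<in> ?G" "z' \<in> ?G" for x y z x' y' z'
 proof (cases "x' = 0 \<or> y' = 0 \<or> z' = 0")
  case False
  then have "L x y z x' y' z'" using RL unfolding RL_def by auto
  then show ?thesis using hL[of x y z x' y' z'] g False by auto
 next
  case True
  have s: "x' + y' + z' = 0" using RL unfolding RL_def by blast
  have neg: "h u \<oplus> h (- u) = \<zero>" "h (- u) \<oplus> h u = \<zero>" if "u \<in> ?G" for u
   unfolding hneg[OF that] using hc[OF that] by (simp_all add: R.l_minus R.r_neg R.l_neg)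
  from True consider "x' = 0" | "y' = 0" | "z' = 0" by blast
  then show ?thesis
  proof cases
   case 1 then have "z' = - y'" using s by (simp add: eq_neg_iff_add_eq_0 add.commute)
   then show ?thesis using 1 neg(1)[OF g(2)] h0 hc[OF g(2)] by simp
  next
   case 2 then have "z' = - x'" using s by (simp add: eq_neg_iff_add_eq_0 add.commute)
   then show ?thesis using 2 neg(1)[OF g(1)] h0 hc[OF g(1)] by simp
  next
   case 3 then have "y' = - x'" using s by (simp add: eq_neg_iff_add_eq_0 add.commute)
   then show ?thesis using 3 neg(1)[OF g(1)] h0 hc[OF g(1)] by simp
  qed
 qed
 have sgG: "of_int k \<in> ?G" if "k = 0 \<or> k = 1 \<or> k = - 1" for k :: int using that G(1) neg_one by auto
 have sg3: "sg xs = 0 \<or> sg xs = 1 \<or> sg xs = - 1" for xs using sg_distinct[of xs] sg_nondistinct[of xs] by blast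
 have DG: "D B \<in> ?G" if "B \<subseteq> E" for B using weakrightD(1)[OF D that] weakrightD(2)[OF D, of B] by blast
 define \<Delta> where "\<Delta> xs = h (of_int (sg xs) * D (set xs))" for xs
 have \<Delta>G: "of_int (sg xs) * D (set xs) \<in> ?G" if "set xs \<subseteq> E" for xs
  using Gm[OF sgG[OF sg3] DG[OF that]] .
 have "pasture_rep (carrier R) \<zero> (\<otimes>) (\<ominus> \<one>) (field_null R) E \<B> r \<Delta>"
  unfolding pasture_rep_def
 proof (intro conjI allI impI; (elim conjE)?)
  fix xs assume xs: "set xs \<subseteq> E" "length xs = r"
  show "\<Delta> xs \<in> carrier R" unfolding \<Delta>_def using hc[OF \<Delta>G[OF xs(1)]] .
  show "\<Delta> xs ~= \<zero> \<longleftrightarrow> set xs \<in> \<B>"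
  proof
   assume "\<Delta> xs ~= \<zero>"
   then have "D (set xs) ~= 0" unfolding \<Delta>_def using h0 by auto
   then show "set xs \<in> \<B>" using weakrightD(1)[OF D xs(1)] by blast
  next
   assume b: "set xs \<in> \<B>"
   then have "distinct xs" using r xs(2) card_distinct by metis
   then have "sg xs = 1 \<or> sg xs = - 1" by (rule sg_distinct)
   then have "of_int (sg xs) \<in> \<Gamma>" using G(1) neg_one by auto
   then have "of_int (sg xs) * D (set xs) \<in> \<Gamma>" using weakrightD(2)[OF D b] by (rule G(3))
   then show "\<Delta> xs ~= \<zero>" unfolding \<Delta>_def using h\<Gamma> by blast
  qed
 next
  fix xs \<sigma> assume xs: "set xs \<subseteq> E" "length xs = r" and \<sigma>: "\<sigma> permutes {..<r}"
  have e: "map (\<lambda>i. xs ! \<sigma> i) [0..<r] = permute_list \<sigma> xs" unfolding permute_list_def xs(2) by simp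
  have st: "set (permute_list \<sigma> xs) = set xs" using \<sigma> xs(2) by simp
  have "\<Delta> (permute_list \<sigma> xs) = h (of_int (sign \<sigma>) * (of_int (sg xs) * D (set xs)))"
   unfolding \<Delta>_def st sg_permute[OF \<sigma> xs(2)] by (simp add: mult.assoc)
  then show "\<Delta> (map (\<lambda>i. xs ! \<sigma> i) [0..<r]) = (if evenperm \<sigma> then \<Delta> xs else (\<ominus> \<one>) \<otimes> \<Delta> xs)"
   unfolding e using hneg[OF \<Delta>G[OF xs(1)]] by (simp add: sign_def \<Delta>_def)
 next
  fix js a b c d assume J: "set js \<subseteq> E" "length js + 2 = r" and q: "{a, b, c, d} \<subseteq> E"
  let ?J = "set js"
  define F where "F x y = of_int (sg (js @ [x, y])) * D (set (js @ [x, y]))" for x y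
  define f where "f x = (of_int (\<Prod>j\<leftarrow>js. s j x) :: 'k)" for x
  have FG: "F x y \<in> ?G" if "x \<in> {a, b, c, d}" "y \<in> {a, b, c, d}" for x y
   unfolding F_def by (rule \<Delta>G) (use that J q in auto)
  have Ff: "F x y = of_int (sg js) * (f x * f y * br D ?J x y)" for x y
  proof -
   have "set (js @ [x, y]) = insert x (insert y ?J)" by auto
   then show ?thesis unfolding F_def f_def br_def sg_snoc2 by (simp only: of_int_mult ac_simps)
  qed
  have alt: "alt2 F" unfolding alt2_def
  proof (intro conjI allI)
   show "F y x = - F x y" for x y unfolding Ff alt2_flip[OF alt2_br, of D ?J y x] by (simp add: ac_simps)
   show "F x x = 0" for x unfolding Ff br_def by (simp add: s_self)
  qed
  have fz: "f x = 0" if "x \<in> ?J" for x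
   unfolding f_def prod_list_self(2)[OF that] by simp
  have "W3 F a b c d"
  proof (cases "distinct js & {a, b, c, d} \<inter> ?J = {} & distinct [a, b, c, d]")
   case True
   then have sgj: "(of_int (sg js) :: 'k) ~= 0" using sg_distinct[of js] by auto
   have "W3 (br D ?J) a b c d" using True J q by (intro weakrightD(3)[OF D]) auto
   then show ?thesis
   proof (rule W3_scaled[OF _ sgj, where f = f])
    fix x assume "x \<in> {a, b, c, d}"
    then have "x ~: set js" using True by auto
    then have "(\<Prod>j\<leftarrow>js. s x j) = 1 \<or> (\<Prod>j\<leftarrow>js. s x j) = - 1" by (rule prod_list_unit)
    then have "(\<Prod>j\<leftarrow>js. s j x) = 1 \<or> (\<Prod>j\<leftarrow>js. s j x) = - 1"
     unfolding prod_list_flip by (cases "even (length js)") auto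
    then show "f x ~= 0" unfolding f_def by auto
   qed (use True Ff in auto)
  next
   case False
   show ?thesis
   proof (cases "distinct [a, b, c, d]")
    case nd: False
    have z: "F x x = 0" for x using alt unfolding alt2_def by blast
    have "a = b \<or> a = c \<or> a = d \<or> b = c \<or> b = d \<or> c = d" using nd by auto
    then have "F a b * F c d = 0 \<or> F a c * F b d = 0 \<or> F a d * F b c = 0" by (elim disjE) (simp_all add: z)
    then show ?thesis by (rule W3_degI[OF K3_nondistinct[OF alt nd]])
   next
    case True
    then have "sg js = 0 \<or> f a = 0 \<or> f b = 0 \<or> f c = 0 \<or> f d = 0"
     using False sg_nondistinct[of js] fz by auto
    then have "F a b * F c d = 0" "F a c * F b d = 0" "F a d * F b c = 0" unfolding Ff by auto
    then show ?thesis by (intro W3_degI) (auto simp: K3_def)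
   qed
  qed
  then obtain x y z where RL: "RL x y z (F a b * F c d) (- (F a c * F b d)) (F a d * F b c)" unfolding W3_def by blast
  have \<Delta>F: "\<Delta> (js @ [x, y]) = h (F x y)" for x y unfolding \<Delta>_def F_def ..
  have g: "F a b * F c d \<in> ?G" "F a c * F b d \<in> ?G" "F a d * F b c \<in> ?G" by (rule Gm; rule FG; simp)+
  have "h (F a b * F c d) \<oplus> h (- (F a c * F b d)) \<oplus> h (F a d * F b c) = \<zero>"
   by (rule hsum[OF RL g(1) Gn[OF g(2)] g(3)])
  moreover have "h (F a b * F c d) = h (F a b) \<otimes> h (F c d)" "h (F a c * F b d) = h (F a c) \<otimes> h (F b d)"
   "h (F a d * F b c) = h (F a d) \<otimes> h (F b c)" by (rule hm'; rule FG; simp)+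
  ultimately show "field_null R (\<Delta> (js @ [a, b]) \<otimes> \<Delta> (js @ [c, d]))
     ((\<ominus> \<one>) \<otimes> (\<Delta> (js @ [a, c]) \<otimes> \<Delta> (js @ [b, d])))
     (\<Delta> (js @ [a, d]) \<otimes> \<Delta> (js @ [b, c]))"
   unfolding field_null_def \<Delta>F hneg[OF g(2)] by simp
 qed
 then show ?thesis unfolding representable_over_field_def representable_over_def using r by blast
qed

end

theorem (in lifting) transfer:
 fixes E :: "'a set" and R (structure)
 assumes M: "matroid E \<B>" and W: "without_large_uniform_minors E \<B>" and rep: "representable_over K z mul eps nul E \<B>"
  and closed: "\<And>u v. u \<in> K ==> v \<in> K ==> mul u v \<in> K" "eps \<in> K"
  and i: "\<And>u. u \<in> K ==> \<iota> u = 0 \<longleftrightarrow> u = z" "\<And>u v. u \<in> K ==> v \<in> K ==> \<iota> (mul u v) = \<iota> u * \<iota> v" "\<iota> eps = - 1"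
  and nul: "\<And>u v w. u \<in> K ==> v \<in> K ==> w \<in> K ==> nul u v w ==> \<exists>x' y' z'. RL (\<iota> u) (\<iota> v) (\<iota> w) x' y' z'"
  and R: "field R" and h0: "h 0 = \<zero>" and h\<Gamma>: "\<And>x. x \<in> \<Gamma> ==> h x \<in> carrier R - {\<zero>}"
  and hm: "\<And>x y. x \<in> \<Gamma> ==> y \<in> \<Gamma> ==> h (x * y) = h x \<otimes> h y" and hn: "h (- 1) = \<ominus> \<one>"
  and hL: "\<And>x y z x' y' z'. L x y z x' y' z' ==> {x', y', z'} \<subseteq> \<Gamma> ==> h x' \<oplus> h y' \<oplus> h z' = \<zero>"
 shows "representable_over_field R E \<B>"
proof -
 obtain s :: "'a => 'a => int" where s: "\<forall>x y. s y x = - s x y" "\<forall>x y. x ~= y \<longrightarrow> s x y = 1 \<or> s x y = - 1"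
  using exists_order_sign by (elim exE conjE)
 interpret S: signed_lifting L \<Gamma> s
 proof unfold_locales
  show "s y x = - s x y" for x y using s(1) by (elim allE)
  show "s x y = 1 \<or> s x y = - 1" if "x ~= y" for x y using s(2) that by (elim allE impE)
 qed
 obtain r \<Delta> where r: "\<forall>X\<in>\<B>. card X = r" "pasture_rep K z mul eps nul E \<B> r \<Delta>"
  using rep unfolding representable_over_def by (elim exE conjE)
 have "\<exists>D. S.prep E \<B> D" by (rule S.prep_of_rep[OF M r closed i nul]; assumption)
 then obtain D where D: "S.prep E \<B> D" by blast
 have U: "noU 2 E \<B>" "noU 3 E \<B>" using without_large_uniform_minors_noU[OF M W] by auto
 obtain D' where D': "S.weakright E \<B> D'" using S.weak_lift[OF M U D] by (elim exE)
 show ?thesis by (rule S.rep_of_weakright[OF M r(1) D' R h0 h\<Gamma> hm hn hL]; assumption)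
qed

section \<open>The three pastures\<close>

subsection \<open>The group generated by 2 and a root of unity\<close>

text \<open>Natural exponents suffice for \<open>w\<close>, which will be a root of unity.\<close>

definition two_group :: "complex => complex set" where
 "two_group w = {x. \<exists>(n::int) (i::nat). x = 2 powi n * w ^ i}"

lemma two_groupI: "2 powi n * w ^ i \<in> two_group w"
 unfolding two_group_def by blast

lemma unit_subgroup_two_group:
 assumes m: "m > 0" "w ^ m = 1"
 shows "unit_subgroup (two_group w)"
 unfolding unit_subgroup_def
proof (intro conjI ballI)
 have w0: "w ~= 0" using m by (metis power_0_left zero_neq_one not_gr_zero)
 show "1 \<in> two_group w" using two_groupI[of 0 w 0] by simp
 show "0 ~: two_group w" unfolding two_group_def using w0 by auto
 fix x assume "x \<in> two_group w"
 then obtain n i where x: "x = 2 powi n * w ^ i" unfolding two_group_def by blast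
 show "x * y \<in> two_group w" if y_mem: "y \<in> two_group w" for y
 proof -
  obtain k j where y: "y = 2 powi k * w ^ j" using y_mem unfolding two_group_def by blast
  have "x * y = 2 powi (n + k) * w ^ (i + j)" unfolding x y by (simp add: power_int_add power_add)
  then show ?thesis using two_groupI by metis
 qed
 have "i + (m - 1) * i = m * i" using m(1) by (simp add: algebra_simps)
 then have "w ^ i * w ^ ((m - 1) * i) = (w ^ m) ^ i" by (simp flip: power_add power_mult)
 then have "inverse (w ^ i) = w ^ ((m - 1) * i)" using m(2) by (intro inverse_unique) simp
 then have "inverse x = 2 powi (- n) * w ^ ((m - 1) * i)" unfolding x by (simp add: power_int_minus)
 then show "inverse x \<in> two_group w" using two_groupI by metis
qed

text \<open>These conditions make sending 2 to \<open>\<one> \<oplus> \<one>\<close> and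
  \<open>w\<close> to \<open>g\<close> a homomorphism on \<open>two_group w\<close>: the absolute
  value separates the powers of 2 from those of \<open>w\<close>, and \<open>rel\<close> transfers
  every relation between powers of \<open>w\<close>.\<close>

locale two_hom = field R for R (structure) +
 fixes w :: complex and g
 assumes two_nz: "\<one> \<oplus> \<one> ~= \<zero>" and g: "g \<in> carrier R" "g ~= \<zero>" and norm_w: "norm w = 1"
  and rel: "w ^ d = 1 ==> g [^] (d::nat) = \<one>"
begin

definition \<tau> :: "int => 'a" where "\<tau> n = (\<one> \<oplus> \<one>) [^]\<^bsub>mult_of R\<^esub> n"

definition h :: "complex => 'a" where
 "h x = (if x = 0 then \<zero> else (case (SOME p. x = 2 powi (fst p) * w ^ snd p) of (n, i) => \<tau> n \<otimes> g [^] i))"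

lemma \<tau>: "\<tau> n \<in> carrier R - {\<zero>}" "\<tau> (m + n) = \<tau> m \<otimes> \<tau> n" "\<tau> 0 = \<one>" "\<tau> 1 = \<one> \<oplus> \<one>"
proof -
 interpret G: group "mult_of R" by (rule field_mult_group)
 have t: "\<one> \<oplus> \<one> \<in> carrier (mult_of R)" using two_nz by simp
 show "\<tau> n \<in> carrier R - {\<zero>}" unfolding \<tau>_def using G.int_pow_closed[OF t] by simp
 show "\<tau> (m + n) = \<tau> m \<otimes> \<tau> n" unfolding \<tau>_def using G.int_pow_mult[OF t] by simp
 show "\<tau> 0 = \<one>" unfolding \<tau>_def by simp
 show "\<tau> 1 = \<one> \<oplus> \<one>" unfolding \<tau>_def using G.int_pow_1[OF t] by simp
qed

lemma g_pow_nz: "g [^] (i::nat) \<in> carrier R - {\<zero>}"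
proof (induction i)
 case (Suc i) then show ?case using g integral_iff by auto
qed simp

lemma w_nz: "w ~= 0" using norm_w by auto

lemma w_pow_eq: assumes "w ^ i = w ^ j" shows "g [^] i = g [^] j"
proof -
 have le: "g [^] i = g [^] j" if "i \<le> j" "w ^ i = w ^ j" for i j :: nat
 proof -
  have "w ^ i * w ^ (j - i) = w ^ j" using that(1) by (simp flip: power_add)
  also have "\<dots> = w ^ i * 1" using that(2) by simp
  finally have "w ^ i * w ^ (j - i) = w ^ i * 1" .
  then have "w ^ (j - i) = 1" using w_nz by simp
  then have "g [^] (j - i) = \<one>" by (rule rel)
  moreover have "g [^] i \<otimes> g [^] (j - i) = g [^] j" using nat_pow_mult[OF g(1), of i "j - i"] that(1) by simp
  ultimately show ?thesis using g(1) by simp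
 qed
 show ?thesis
 proof (cases "i \<le> j")
  case True then show ?thesis using le assms by blast
 next
  case False then show ?thesis using le[of j i] assms by simp
 qed
qed

lemma h_val: "h (2 powi n * w ^ i) = \<tau> n \<otimes> g [^] i"
proof -
 let ?x = "2 powi n * w ^ i"
 obtain m j where p: "(SOME p. ?x = 2 powi (fst p) * w ^ snd p) = (m, j)" by (metis surj_pair)
 have "\<exists>p. ?x = 2 powi (fst p) * w ^ snd p" by (rule exI[of _ "(n, i)"]) simp
 from someI_ex[OF this] have e: "?x = 2 powi m * w ^ j" unfolding p by simp
 \<comment> \<open>As \<open>w\<close> has absolute value 1, this recovers the exponent of 2 from
   whichever representation was chosen.\<close>
 then have "norm ?x = norm (2 powi m * w ^ j)" by simp
 then have "(2::real) powi n = 2 powi m" using norm_w by (simp add: norm_mult norm_power norm_power_int)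
 then have nm: "n = m"
  using power_int_strict_increasing[of n m "2::real"] power_int_strict_increasing[of m n "2::real"] by (metis less_irrefl linorder_neqE one_less_numeral_iff semiring_norm(76))
 then have "w ^ i = w ^ j" using e by simp
 then have "g [^] i = g [^] j" by (rule w_pow_eq)
 moreover have "?x ~= 0" using w_nz by simp
 ultimately show ?thesis unfolding h_def p using nm w_nz by simp
qed

lemma h_0: "h 0 = \<zero>" unfolding h_def by simp

lemma h_closed: assumes "x \<in> two_group w" shows "h x \<in> carrier R - {\<zero>}"
proof -
 obtain n i where "x = 2 powi n * w ^ i" using assms unfolding two_group_def by blast
 then have "h x = \<tau> n \<otimes> g [^] i" using h_val by simp
 then show ?thesis using \<tau>(1)[of n] g_pow_nz[of i] integral_iff by auto
qed

lemma h_mult: assumes "x \<in> two_group w" "y \<in> two_group w" shows "h (x * y) = h x \<otimes> h y"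
proof -
 obtain n i m j where xy: "x = 2 powi n * w ^ i" "y = 2 powi m * w ^ j" using assms unfolding two_group_def by blast
 have "x * y = 2 powi (n + m) * w ^ (i + j)" unfolding xy by (simp add: power_int_add power_add)
 then have "h (x * y) = \<tau> n \<otimes> \<tau> m \<otimes> (g [^] i \<otimes> g [^] j)" using h_val \<tau>(2) g(1) by (simp add: nat_pow_mult)
 also have "\<dots> = \<tau> n \<otimes> g [^] i \<otimes> (\<tau> m \<otimes> g [^] j)"
  using \<tau>(1)[of n] \<tau>(1)[of m] g(1) by (simp add: m_ac)
 finally show ?thesis unfolding xy h_val .
qed

lemma h_w: "h (w ^ i) = g [^] i"
 using h_val[of 0 i] \<tau>(3) g(1) by simp

lemma h_2: "h 2 = \<one> \<oplus> \<one>" and two_mem: "2 \<in> two_group w"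
 using h_val[of 1 0] \<tau>(4) two_groupI[of 1 w 0] by simp_all

lemma w_mem: "w ^ i \<in> two_group w"
 using two_groupI[of 0 w i] by simp

lemma h_harmonic:
 assumes "x \<in> two_group w" "w ^ k = - 1" "g [^] k = \<ominus> \<one>"
 shows "h x \<oplus> h x \<oplus> h (- 2 * x) = \<zero>" "h x \<oplus> h (- 2 * x) \<oplus> h x = \<zero>" "h (- 2 * x) \<oplus> h x \<oplus> h x = \<zero>"
proof -
 have c: "h x \<in> carrier R" using h_closed[OF assms(1)] by simp
 have m: "- 1 \<in> two_group w" using w_mem[of k] assms(2) by simp
 have g: "- 1 * 2 \<in> two_group w"
 proof -
  have "2 powi 1 * w ^ k = - 1 * 2" using assms(2) by simp
  then show ?thesis using two_groupI[of 1 w k] by simp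
 qed
 have "h (- 2 * x) = h (- 1 * 2) \<otimes> h x" using h_mult[OF g assms(1)] by simp
 also have "h (- 1 * 2) = \<ominus> \<one> \<otimes> (\<one> \<oplus> \<one>)" using h_mult[OF m two_mem] h_2 h_w[of k] assms(2,3) by simp
 finally have e: "h (- 2 * x) = \<ominus> (h x \<oplus> h x)" using c by (simp add: l_minus l_distr minus_add)
 show "h x \<oplus> h x \<oplus> h (- 2 * x) = \<zero>" "h x \<oplus> h (- 2 * x) \<oplus> h x = \<zero>" "h (- 2 * x) \<oplus> h x \<oplus> h x = \<zero>"
  unfolding e using c by (simp_all add: r_neg minus_add a_assoc r_neg1 r_neg2 l_neg)
qed

end

subsection \<open>Harmonic triples and the sign hyperfield\<close>

text \<open>The three alternatives have the entry of the odd sign in the last, the middle and the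
  first place.\<close>

definition harm :: "complex => complex => complex => complex => complex => complex => bool" where
 "harm x y z x' y' z' \<longleftrightarrow> x ~= 0 & x' ~= 0 &
   (y = x & z = - x & y' = x' & z' = - 2 * x' \<or> y = - x & z = x & y' = - 2 * x' & z' = x' \<or>
   y = - x & z = - x & x' = - 2 * y' & z' = y')"

lemma harm_nz: "harm x y z x' y' z' ==> x ~= 0 & y ~= 0 & z ~= 0 & x' ~= 0 & y' ~= 0 & z' ~= 0"
 unfolding harm_def by auto

lemma harm_sum: "harm x y z x' y' z' ==> x' + y' + z' = 0"
 unfolding harm_def by auto

lemma harm_rot: "harm x y z x' y' z' ==> harm y z x y' z' x'"
 unfolding harm_def by auto

lemma harm_swap: "harm x y z x' y' z' ==> harm y x z y' x' z'"
 unfolding harm_def by auto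

lemma harm_scale: "harm x y z x' y' z' ==> c ~= 0 ==> c' ~= 0 ==> harm (c * x) (c * y) (c * z) (c' * x') (c' * y') (c' * z')"
 unfolding harm_def by auto

lemma harm_unique:
 assumes "harm x y z x' y' z'" "harm x y z x'' y'' z''"
 shows "\<exists>c. c ~= 0 & x'' = c * x' & y'' = c * y' & z'' = c * z'"
 using assms by (intro exI[of _ "x'' / x'"]) (auto simp: harm_def field_simps)

text \<open>The possible ratios are 1, -2 and -1/2, and -1 is a power of \<open>w\<close>.\<close>

lemma harm_ratio:
 assumes "harm x y z x' y' z'" "w ^ k = - 1"
 shows "x' / y' \<in> two_group w"
proof -
 have "x' / y' = 1 \<or> x' / y' = - (1/2) \<or> x' / y' = - 2" using assms(1) harm_nz[OF assms(1)] by (auto simp: harm_def field_simps)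
 moreover have "2 powi 0 * w ^ 0 = 1" "2 powi (- 1) * w ^ k = - (1/2)" "2 powi 1 * w ^ k = - 2"
  using assms(2) by (simp_all add: power_int_minus inverse_eq_divide)
 ultimately show ?thesis using two_groupI by metis
qed

lemma lifting_harm: "lifting harm (two_group (- 1))"
proof unfold_locales
 show "(2::complex) ~= 0" by simp
 show "unit_subgroup (two_group (- 1))" by (rule unit_subgroup_two_group[of 2]) auto
 show "- 1 \<in> two_group (- 1)" using two_groupI[of 0 "- 1" 1] by simp
 show "x' / y' \<in> two_group (- 1)" if "harm x y z x' y' z'" for x y z x' y' z'
  using harm_ratio[OF that, of "- 1" 1] by simp
qed (fact harm_nz harm_sum harm_rot harm_swap harm_scale harm_unique)+

fun sgn_embed :: "sgn => complex" where
 "sgn_embed SZero = 0"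
| "sgn_embed SPos = 1"
| "sgn_embed SNeg = - 1"

text \<open>If 1 + 1 vanishes, the multiples of 1 that vanish are exactly the even ones.\<close>

lemma ring_char_2:
 fixes R (structure)
 assumes "field R" "ring_char R ~= 2" shows "\<one> \<oplus> \<one> ~= \<zero>"
proof
 interpret field R by fact
 assume two: "\<one> \<oplus> \<one> = \<zero>"
 have suc: "add_pow R (Suc n) \<one> = add_pow R n \<one> \<oplus> \<one>" for n :: nat by (rule add.nat_pow_Suc)
 have par: "add_pow R (n::nat) \<one> = (if even n then \<zero> else \<one>)" for n
 proof (induction n)
  case (Suc n) then show ?case unfolding suc using two by simp
 qed simp
 have "{n::nat. add_pow R n \<one> = \<zero>} = {n. even n}" unfolding par by auto
 moreover have "Gcd {n::nat. even n} = 2"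
 proof (rule dvd_antisym)
  show "Gcd {n::nat. even n} dvd 2" by (rule Gcd_dvd) simp
  show "2 dvd Gcd {n::nat. even n}" by (rule Gcd_greatest) simp
 qed
 ultimately show False using assms(2) unfolding ring_char_def by simp
qed

text \<open>The instance \<open>w = -1\<close>: every field in which 2 is nonzero receives the group
  generated by 2 and -1.\<close>

theorem representable_over_S_imp_field:
 fixes R (structure)
 assumes M: "matroid E \<B>" and W: "without_large_uniform_minors E \<B>" and S: "representable_over_S E \<B>"
  and R: "field R" "ring_char R ~= 2"
 shows "representable_over_field R E \<B>"
proof -
 interpret L: lifting harm "two_group (- 1)" by (rule lifting_harm)
 interpret field R by fact
 have pow: "(\<ominus> \<one>) [^] (d::nat) = (if even d then \<one> else \<ominus> \<one>)" for d
  by (induction d) (simp_all add: l_minus)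
 interpret H: two_hom R "- 1" "\<ominus> \<one>"
 proof unfold_locales
  show "\<one> \<oplus> \<one> ~= \<zero>" using ring_char_2[OF R] .
  show "\<ominus> \<one> \<in> carrier R" by simp
  show "\<ominus> \<one> ~= \<zero>" by (metis add.inv_eq_1_iff one_closed one_not_zero)
  show "norm (- 1 :: complex) = 1" by simp
  show "(\<ominus> \<one>) [^] d = \<one>" if "(- 1 :: complex) ^ d = 1" for d
   using that pow[of d] by (cases "even d") auto
 qed
 have neg: "(- 1 :: complex) ^ 1 = - 1" "(\<ominus> \<one>) [^] (1::nat) = \<ominus> \<one>" using pow[of 1] by simp_all
 show ?thesis
 proof (rule L.transfer[OF M W S[unfolded representable_over_S_def], where \<iota> = sgn_embed and h = H.h])
  show "sgn_embed u = 0 \<longleftrightarrow> u = SZero" for u by (cases u) auto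
  show "sgn_embed (sgn_mul u v) = sgn_embed u * sgn_embed v" for u v by (cases u; cases v) auto
  show "sgn_embed SNeg = - 1" by simp
  show "\<exists>x' y' z'. L.RL (sgn_embed u) (sgn_embed v) (sgn_embed w) x' y' z'" if n: "S_null u v w" for u v w
  proof (cases "u = SZero \<or> v = SZero \<or> w = SZero")
   case True
   then show ?thesis using n by (intro L.RL_degI; cases u; cases v; cases w) (auto simp: S_null_def)
  next
   case False
   have "harm 1 1 (- 1) 1 1 (- 2)" "harm 1 (- 1) 1 1 (- 2) 1" "harm (- 1) 1 1 (- 2) 1 1"
    "harm (- 1) (- 1) 1 1 1 (- 2)" "harm (- 1) 1 (- 1) 1 (- 2) 1" "harm 1 (- 1) (- 1) (- 2) 1 1"
    unfolding harm_def by auto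
   note r = this[THEN L.RL_LI]
   show ?thesis using n False r by (cases u; cases v; cases w) (auto simp: S_null_def)
  qed
  show "field R" by fact
  show "H.h 0 = \<zero>" by (rule H.h_0)
  show "H.h x \<in> carrier R - {\<zero>}" if "x \<in> two_group (- 1)" for x using H.h_closed[OF that] .
  show "H.h (x * y) = H.h x \<otimes> H.h y" if "x \<in> two_group (- 1)" "y \<in> two_group (- 1)" for x y using H.h_mult[OF that] .
  show "H.h (- 1) = \<ominus> \<one>" using H.h_w[of 1] neg by simp
  show "H.h x' \<oplus> H.h y' \<oplus> H.h z' = \<zero>" if "harm x y z x' y' z'" "{x', y', z'} \<subseteq> two_group (- 1)" for x y z x' y' z'
   using that H.h_harmonic[OF _ neg, of x'] H.h_harmonic[OF _ neg, of y'] unfolding harm_def by auto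
 qed auto
qed

subsection \<open>The weak sign hyperfield\<close>

text \<open>The multiplication of signs is that of the field with three elements, so this type
  serves as source and as target field for the weak sign hyperfield.\<close>

instantiation sgn :: field
begin

fun plus_sgn :: "sgn => sgn => sgn" where
 "plus_sgn SZero y = y"
| "plus_sgn x SZero = x"
| "plus_sgn SPos SPos = SNeg"
| "plus_sgn SNeg SNeg = SPos"
| "plus_sgn SPos SNeg = SZero"
| "plus_sgn SNeg SPos = SZero"

fun uminus_sgn :: "sgn => sgn" where
 "uminus_sgn SZero = SZero"
| "uminus_sgn SPos = SNeg"
| "uminus_sgn SNeg = SPos"

definition zero_sgn :: sgn where "zero_sgn = SZero"
definition one_sgn :: sgn where "one_sgn = SPos"
definition times_sgn :: "sgn => sgn => sgn" where "times_sgn = sgn_mul"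
definition minus_sgn :: "sgn => sgn => sgn" where "minus_sgn x y = x + - y"
definition inverse_sgn :: "sgn => sgn" where "inverse_sgn x = x"
definition divide_sgn :: "sgn => sgn => sgn" where "divide_sgn x y = x * inverse y"

instance
proof
 fix a b c :: sgn
 show "a + b + c = a + (b + c)" by (cases a; cases b; cases c) auto
 show "a + b = b + a" by (cases a; cases b) auto
 show "0 + a = a" by (simp add: zero_sgn_def)
 show "- a + a = 0" by (cases a) (auto simp: zero_sgn_def)
 show "a - b = a + - b" by (simp add: minus_sgn_def)
 show "a * b * c = a * (b * c)" unfolding times_sgn_def by (cases a; cases b; cases c) auto
 show "a * b = b * a" unfolding times_sgn_def by (cases a; cases b) auto
 show "1 * a = a" unfolding times_sgn_def one_sgn_def by (cases a) auto
 show "(a + b) * c = a * c + b * c" unfolding times_sgn_def by (cases a; cases b; cases c) auto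
 show "(0::sgn) ~= 1" by (simp add: zero_sgn_def one_sgn_def)
 show "inverse a * a = 1" if "a ~= 0" using that by (cases a) (auto simp: zero_sgn_def one_sgn_def inverse_sgn_def times_sgn_def)
 show "a div b = a * inverse b" by (simp add: divide_sgn_def)
 show "inverse (0::sgn) = 0" by (simp add: inverse_sgn_def)
qed

end

fun sgn_residue :: "sgn => int" where
 "sgn_residue SZero = 0"
| "sgn_residue SPos = 1"
| "sgn_residue SNeg = 2"

theorem representable_over_W_imp_ternary:
 assumes M: "matroid E \<B>" and U: "without_large_uniform_minors E \<B>" and W: "representable_over_W E \<B>"
 shows "representable_over_field (residue_ring 3) E \<B>"
proof -
 \<comment> \<open>Any three nonzero elements are null here, so the source triple is constrained
   only to be nonzero.\<close>
 define L where "L x y z x' y' z' \<longleftrightarrow> x ~= 0 & y ~= 0 & z ~= 0 & x' ~= 0 & x' = y' & x' = z'" for x y z x' y' z' :: sgn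
 note sgn_simps = zero_sgn_def one_sgn_def times_sgn_def
 have one2: "(2::sgn) = SNeg" unfolding one_add_one[symmetric] one_sgn_def by simp
 interpret L: lifting L "{SPos, SNeg}"
 proof unfold_locales
  show "(2::sgn) ~= 0" unfolding one2 zero_sgn_def by simp
  show "unit_subgroup {SPos, SNeg}" unfolding unit_subgroup_def by (auto simp: sgn_simps inverse_sgn_def)
  show "- 1 \<in> {SPos, SNeg}" by (simp add: one_sgn_def)
  fix x y z x' y' z' assume h: "L x y z x' y' z'"
  show "x' + y' + z' = 0" using h unfolding L_def by (cases x') (auto simp: zero_sgn_def)
  show "x ~= 0 & y ~= 0 & z ~= 0 & x' ~= 0 & y' ~= 0 & z' ~= 0" "L y z x y' z' x'" "L y x z y' x' z'"
   using h unfolding L_def by auto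
  show "L (c * x) (c * y) (c * z) (c' * x') (c' * y') (c' * z')" if "c ~= 0" "c' ~= 0" for c c'
   using h that unfolding L_def by auto
  show "x' / y' \<in> {SPos, SNeg}"
  proof -
   have "x' / y' = 1" using h unfolding L_def by auto
   then show ?thesis unfolding one_sgn_def by simp
  qed
  fix x'' y'' z'' assume h': "L x y z x'' y'' z''"
  show "\<exists>c. c ~= 0 & x'' = c * x' & y'' = c * y' & z'' = c * z'"
   using h h' unfolding L_def by (intro exI[of _ "x'' / x'"]) auto
 qed
 have p3: "prime (3::nat)" by (simp add: prime_nat_numeral_eq)
 have fld: "field (residue_ring 3)" using residues_prime.is_field[OF residues_prime.intro[OF p3]] by simp
 have c: "carrier (residue_ring 3) = {0, 1, 2}" "\<zero>\<^bsub>residue_ring 3\<^esub> = 0" "\<one>\<^bsub>residue_ring 3\<^esub> = 1"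
  "x \<oplus>\<^bsub>residue_ring 3\<^esub> y = (x + y) mod 3" "x \<otimes>\<^bsub>residue_ring 3\<^esub> y = x * y mod 3" for x y
  unfolding residue_ring_def by auto
 have neg: "\<ominus>\<^bsub>residue_ring 3\<^esub> 1 = 2"
  by (rule abelian_group.minus_equality[OF ring.is_abelian_group[OF cring.axioms(1)[OF domain.axioms(1)[OF field.axioms(1)[OF fld]]]]])
   (simp_all add: c)
 show ?thesis
 proof (rule L.transfer[OF M U W[unfolded representable_over_W_def], where \<iota> = "\<lambda>x. x" and h = sgn_residue])
  show "u = 0 \<longleftrightarrow> u = SZero" for u by (simp add: zero_sgn_def)
  show "sgn_mul u v = u * v" for u v by (simp add: times_sgn_def)
  show "SNeg = - 1" by (simp add: one_sgn_def)
  show "\<exists>x' y' z'. L.RL u v w x' y' z'" if n: "W_null u v w" for u v w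
  proof (cases "u = SZero \<or> v = SZero \<or> w = SZero")
   case True
   show ?thesis
   proof (rule L.RL_degI)
    show "u = 0 \<or> v = 0 \<or> w = 0" using True by (simp add: zero_sgn_def)
    from n True consider "u = SZero & v = SZero & w = SZero"
     | x where "x ~= SZero" "{#u, v, w#} = {#x, sgn_mul SNeg x, SZero#}" unfolding W_null_def by blast
    then show "u + v + w = 0"
    proof cases
     case 1 then show ?thesis by (simp add: zero_sgn_def)
    next
     case 2
     have "u + v + w = sum_mset {#u, v, w#}" by (simp add: add.assoc)
     also have "\<dots> = x + sgn_mul SNeg x + SZero" unfolding 2(2) by (simp add: add.assoc)
     also have "\<dots> = 0" by (cases x) (simp_all add: zero_sgn_def)
     finally show ?thesis .
    qed
   qed
  next
   case False
   then have "L u v w 1 1 1" unfolding L_def by (auto simp: zero_sgn_def one_sgn_def)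
   then show ?thesis using L.RL_LI by blast
  qed
  show "field (residue_ring 3)" by (rule fld)
  show "sgn_residue 0 = \<zero>\<^bsub>residue_ring 3\<^esub>" by (simp add: zero_sgn_def c)
  show "sgn_residue x \<in> carrier (residue_ring 3) - {\<zero>\<^bsub>residue_ring 3\<^esub>}" if "x \<in> {SPos, SNeg}" for x
   using that c by auto
  show "sgn_residue (x * y) = sgn_residue x \<otimes>\<^bsub>residue_ring 3\<^esub> sgn_residue y" for x y
   unfolding times_sgn_def c by (cases x; cases y) auto
  show "sgn_residue (- 1) = \<ominus>\<^bsub>residue_ring 3\<^esub> \<one>\<^bsub>residue_ring 3\<^esub>"
   unfolding c neg one_sgn_def by simp
  show "sgn_residue x' \<oplus>\<^bsub>residue_ring 3\<^esub> sgn_residue y' \<oplus>\<^bsub>residue_ring 3\<^esub> sgn_residue z' = \<zero>\<^bsub>residue_ring 3\<^esub>"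
   if "L x y z x' y' z'" for x y z x' y' z'
   using that unfolding c L_def by (cases x') auto
 qed auto
qed

subsection \<open>The phase hyperfield\<close>

text \<open>A primitive sixth root of unity, since the group must contain -1 besides the cube roots
  of unity.\<close>

definition \<zeta> :: complex where "\<zeta> = Complex (1/2) (sqrt 3 / 2)"

lemma zeta_sq: "\<zeta> ^ 2 = \<zeta> - 1"
 unfolding \<zeta>_def by (simp add: complex_eq_iff power2_eq_square)

lemma zeta_cube: "\<zeta> ^ 3 = - 1"
proof -
 have "\<zeta> ^ 3 = \<zeta> * \<zeta> ^ 2" by (simp add: power2_eq_square power3_eq_cube)
 also have "\<dots> = \<zeta> ^ 2 - \<zeta>" unfolding zeta_sq by (simp add: algebra_simps power2_eq_square[symmetric] zeta_sq)
 finally show ?thesis by (simp add: zeta_sq)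
qed

lemma zeta_6: "\<zeta> ^ 6 = 1"
proof -
 have "\<zeta> ^ 6 = (\<zeta> ^ 3) ^ 2" by (simp flip: power_mult)
 then show ?thesis by (simp add: zeta_cube)
qed

lemma norm_zeta: "norm \<zeta> = 1"
 unfolding \<zeta>_def by (simp add: cmod_def power2_eq_square)

text \<open>With it, a field element whose sixth power is 1 satisfies the condition
  \<open>rel\<close> of \<open>two_hom\<close>.\<close>

lemma zeta_order: assumes "\<zeta> ^ d = 1" shows "6 dvd d"
proof -
 have "\<zeta> ^ d = \<zeta> ^ (6 * (d div 6) + d mod 6)" by simp
 also have "\<dots> = \<zeta> ^ (d mod 6)" unfolding power_add power_mult zeta_6 by simp
 finally have r: "\<zeta> ^ (d mod 6) = 1" using assms by simp
 have I: "Im \<zeta> ~= 0" "Im (\<zeta> ^ 2) ~= 0" unfolding zeta_sq unfolding \<zeta>_def by simp_all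
 have "\<zeta> ^ 4 = \<zeta> ^ 3 * \<zeta>" "\<zeta> ^ 5 = \<zeta> ^ 3 * \<zeta> ^ 2" by (simp_all flip: power_add power_Suc2)
 then have p: "\<zeta> ^ 4 = - \<zeta>" "\<zeta> ^ 5 = - (\<zeta> ^ 2)" by (simp_all add: zeta_cube)
 have n: "\<zeta> ^ 1 ~= 1" "\<zeta> ^ 2 ~= 1" "\<zeta> ^ 3 ~= 1" "\<zeta> ^ 4 ~= 1" "\<zeta> ^ 5 ~= 1"
 proof -
  show "\<zeta> ^ 1 ~= 1" using I by auto
  show "\<zeta> ^ 2 ~= 1" using I(2) by force
  show "\<zeta> ^ 3 ~= 1" unfolding zeta_cube by simp
  show "\<zeta> ^ 4 ~= 1" unfolding p using I(1) by (metis Im_i_times complex_i_mult_minus minus_equation_iff one_complex.sel(2) uminus_complex.sel(2) neg_equal_0_iff_equal)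
  show "\<zeta> ^ 5 ~= 1" unfolding p using I(2) by (metis one_complex.sel(2) uminus_complex.sel(2) neg_equal_0_iff_equal)
 qed
 have "d mod 6 < 6" by simp
 then have "d mod 6 = 0 \<or> d mod 6 = 1 \<or> d mod 6 = 2 \<or> d mod 6 = 3 \<or> d mod 6 = 4 \<or> d mod 6 = 5" by presburger
 then have "d mod 6 = 0" using r n by (elim disjE) simp_all
 then show ?thesis by presburger
qed

definition \<omega> :: complex where "\<omega> = \<zeta> ^ 2"

lemma omega_zeta: "\<omega> * \<omega> = \<zeta> ^ 4"
 unfolding \<omega>_def by (simp flip: power_add)

lemma omega: "\<omega> * (\<omega> * \<omega>) = 1" "1 + \<omega> + \<omega> * \<omega> = 0" "\<omega> ~= 0"
proof -
 have "\<omega> * (\<omega> * \<omega>) = \<zeta> ^ 6" unfolding \<omega>_def by (simp flip: power_add)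
 then show o: "\<omega> * (\<omega> * \<omega>) = 1" by (simp add: zeta_6)
 then show "\<omega> ~= 0" by auto
 have "\<omega> * \<omega> = \<zeta> ^ 3 * \<zeta>" unfolding omega_zeta by (simp flip: power_Suc2)
 then show "1 + \<omega> + \<omega> * \<omega> = 0" by (simp add: zeta_cube zeta_sq \<omega>_def)
qed

text \<open>Three phases that positively span the plane lift to \<open>1, \<omega>, \<omega>\<^sup>2\<close> in their cyclic order.\<close>

definition phase_lift :: "complex => complex => complex => complex => complex => complex => bool" where
 "phase_lift x y z x' y' z' \<longleftrightarrow> harm x y z x' y' z' \<or>
   x' ~= 0 & Im (y / x) > 0 & Im (z / y) > 0 & Im (x / z) > 0 & y' = \<omega> * x' & z' = \<omega> * \<omega> * x' \<or>
   x' ~= 0 & Im (y / x) < 0 & Im (z / y) < 0 & Im (x / z) < 0 & y' = \<omega> * \<omega> * x' & z' = \<omega> * x'"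

lemma phase_lift_cases:
 assumes "phase_lift x y z x' y' z'"
 obtains (harm) "harm x y z x' y' z'"
  | (pos) "x' ~= 0" "Im (y / x) > 0" "Im (z / y) > 0" "Im (x / z) > 0" "y' = \<omega> * x'" "z' = \<omega> * \<omega> * x'"
  | (neg) "x' ~= 0" "Im (y / x) < 0" "Im (z / y) < 0" "Im (x / z) < 0" "y' = \<omega> * \<omega> * x'" "z' = \<omega> * x'"
 using assms unfolding phase_lift_def by argo

text \<open>Inversion reverses the sign of the imaginary part; so exchanging two phases reverses
  their orientation.\<close>

lemma Im_flip: "Im (b / a) > 0 \<longleftrightarrow> Im (a / b) < 0"
proof -
 have e: "Im (inverse w) > 0 \<longleftrightarrow> Im w < 0" for w
 proof (cases "w = 0")
  case False
  then have "(Re w)\<^sup>2 + (Im w)\<^sup>2 > 0" by (simp add: complex_neq_0)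
  then show ?thesis by (simp add: divide_less_0_iff)
 qed simp
 have "b / a = inverse (a / b)" by simp
 then show ?thesis using e[of "a / b"] by simp
qed

lemma Im_flip': "Im (b / a) < 0 \<longleftrightarrow> Im (a / b) > 0"
 using Im_flip[of a b] by blast

lemma lifting_phase: "lifting phase_lift (two_group \<zeta>)"
proof unfold_locales
 show "(2::complex) ~= 0" by simp
 show "unit_subgroup (two_group \<zeta>)" by (rule unit_subgroup_two_group[of 6]) (simp_all add: zeta_6)
 show "- 1 \<in> two_group \<zeta>" using two_groupI[of 0 \<zeta> 3] by (simp add: zeta_cube)
next
 fix x y z x' y' z' assume h: "phase_lift x y z x' y' z'"
 show "x ~= 0 & y ~= 0 & z ~= 0 & x' ~= 0 & y' ~= 0 & z' ~= 0"
  using h by (cases rule: phase_lift_cases) (auto dest: harm_nz simp: omega)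
 show "x' + y' + z' = 0" using h
 proof (cases rule: phase_lift_cases)
  case harm then show ?thesis by (rule harm_sum)
 next
  case pos
  have "x' + y' + z' = (1 + \<omega> + \<omega> * \<omega>) * x'" unfolding pos(5,6) by (simp add: algebra_simps)
  then show ?thesis unfolding omega(2) by simp
 next
  case neg
  have "x' + y' + z' = (1 + \<omega> + \<omega> * \<omega>) * x'" unfolding neg(5,6) by (simp add: algebra_simps)
  then show ?thesis unfolding omega(2) by simp
 qed
 show "phase_lift y z x y' z' x'" using h
 proof (cases rule: phase_lift_cases)
  case harm then show ?thesis unfolding phase_lift_def using harm_rot by blast
 next
  case pos
  have x: "x' = (\<omega> * (\<omega> * \<omega>)) * x'" unfolding omega(1) by simp
  have "y' ~= 0" "z' = \<omega> * y'" "x' = \<omega> * \<omega> * y'"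
   using pos(1) omega(3) x unfolding pos(5,6) by (simp_all add: ac_simps)
  then show ?thesis unfolding phase_lift_def using pos(2-4) by blast
 next
  case neg
  have "x' = (\<omega> * (\<omega> * \<omega>)) * x'" unfolding omega(1) by simp
  then have "y' ~= 0" "x' = \<omega> * y'" "z' = \<omega> * \<omega> * y'"
   using neg(1) omega(3) omega(1) unfolding neg(5,6) by (simp_all add: ac_simps)
  then show ?thesis unfolding phase_lift_def using neg(2-4) by blast
 qed
 show "phase_lift y x z y' x' z'" using h
 proof (cases rule: phase_lift_cases)
  case harm then show ?thesis unfolding phase_lift_def using harm_swap by blast
 next
  case pos
  have x: "x' = (\<omega> * (\<omega> * \<omega>)) * x'" unfolding omega(1) by simp
  have "y' ~= 0" "x' = \<omega> * \<omega> * y'" "z' = \<omega> * y'"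
   using pos(1) omega(3) x unfolding pos(5,6) by (simp_all add: ac_simps)
  then show ?thesis unfolding phase_lift_def using pos(2-4) Im_flip by blast
 next
  case neg
  have "x' = (\<omega> * (\<omega> * \<omega>)) * x'" unfolding omega(1) by simp
  then have "y' ~= 0" "x' = \<omega> * y'" "z' = \<omega> * \<omega> * y'"
   using neg(1) omega(3) omega(1) unfolding neg(5,6) by (simp_all add: ac_simps)
  then show ?thesis unfolding phase_lift_def using neg(2-4) Im_flip' by blast
 qed
 show "phase_lift (c * x) (c * y) (c * z) (c' * x') (c' * y') (c' * z')" if "c ~= 0" "c' ~= 0" for c c'
  using h that harm_scale[of x y z x' y' z' c c'] unfolding phase_lift_def by auto
 show "x' / y' \<in> two_group \<zeta>" using h
 proof (cases rule: phase_lift_cases)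
  case harm then show ?thesis using harm_ratio zeta_cube by blast
 next
  case pos
  have "x' = (\<omega> * (\<omega> * \<omega>)) * x'" unfolding omega(1) by simp
  then have "x' = \<omega> * \<omega> * y'" unfolding pos(5) by (simp add: ac_simps)
  moreover have "y' ~= 0" using pos omega by simp
  ultimately have "x' / y' = 2 powi 0 * \<zeta> ^ 4" by (simp add: omega_zeta)
  then show ?thesis using two_groupI by metis
 next
  case neg
  have "x' = (\<omega> * (\<omega> * \<omega>)) * x'" unfolding omega(1) by simp
  then have "x' = \<omega> * y'" unfolding neg(5) by (simp add: ac_simps)
  moreover have "y' ~= 0" using neg omega by simp
  ultimately have "x' / y' = 2 powi 0 * \<zeta> ^ 2" by (simp add: \<omega>_def)
  then show ?thesis using two_groupI by metis
 qed
 fix x'' y'' z'' assume h': "phase_lift x y z x'' y'' z''"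
 have r: "Im (y / x) = 0" if "harm x y z a b c" for a b c using that unfolding harm_def by auto
 show "\<exists>c. c ~= 0 & x'' = c * x' & y'' = c * y' & z'' = c * z'" using h
 proof (cases rule: phase_lift_cases)
  case harm
  then have "Im (y / x) = 0" by (rule r)
  then have "harm x y z x'' y'' z''" using h' unfolding phase_lift_def by auto
  then show ?thesis by (rule harm_unique[OF harm])
 next
  case pos
  have "\<not> harm x y z x'' y'' z''" using r pos(2) by fastforce
  then have "x'' ~= 0" "y'' = \<omega> * x''" "z'' = \<omega> * \<omega> * x''" using h' pos(2) unfolding phase_lift_def by auto
  then show ?thesis using pos by (intro exI[of _ "x'' / x'"]) simp
 next
  case neg
  have "\<not> harm x y z x'' y'' z''" using r neg(2) by fastforce
  then have "x'' ~= 0" "y'' = \<omega> * \<omega> * x''" "z'' = \<omega> * x''" using h' neg(2) unfolding phase_lift_def by auto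
  then show ?thesis using neg by (intro exI[of _ "x'' / x'"]) simp
 qed
qed

text \<open>A cone that is a subspace contains \<open>- a\<close>, \<open>- b\<close> and
  \<open>- c\<close>. Adding the three resulting relations gives coefficients that are all at least
  1.\<close>

lemma P_null_positive_relation:
 assumes "P_null a b c"
 shows "\<exists>A B C :: real. A > 0 & B > 0 & C > 0 & A *\<^sub>R a + B *\<^sub>R b + C *\<^sub>R c = 0"
proof -
 define T where "T = {u. \<exists>\<alpha> \<beta> \<gamma> :: real. \<alpha> \<ge> 0 & \<beta> \<ge> 0 & \<gamma> \<ge> 0 & u = \<alpha> *\<^sub>R a + \<beta> *\<^sub>R b + \<gamma> *\<^sub>R c}"
 have TI: "\<alpha> *\<^sub>R a + \<beta> *\<^sub>R b + \<gamma> *\<^sub>R c \<in> T" if "\<alpha> \<ge> 0" "\<beta> \<ge> 0" "\<gamma> \<ge> 0" for \<alpha> \<beta> \<gamma>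
  using that unfolding T_def by blast
 have "convex_cone T" unfolding convex_cone_iff
 proof (intro conjI ballI allI impI)
  show "0 \<in> T" using TI[of 0 0 0] by simp
  show "u + v \<in> T" if uv: "u \<in> T" "v \<in> T" for u v
  proof -
   obtain \<alpha> \<beta> \<gamma> where u: "\<alpha> \<ge> 0" "\<beta> \<ge> 0" "\<gamma> \<ge> 0" "u = \<alpha> *\<^sub>R a + \<beta> *\<^sub>R b + \<gamma> *\<^sub>R c" using uv(1) unfolding T_def by blast
   obtain \<alpha>' \<beta>' \<gamma>' where v: "\<alpha>' \<ge> 0" "\<beta>' \<ge> 0" "\<gamma>' \<ge> 0" "v = \<alpha>' *\<^sub>R a + \<beta>' *\<^sub>R b + \<gamma>' *\<^sub>R c" using uv(2) unfolding T_def by blast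
   have "u + v = (\<alpha> + \<alpha>') *\<^sub>R a + (\<beta> + \<beta>') *\<^sub>R b + (\<gamma> + \<gamma>') *\<^sub>R c" unfolding u(4) v(4) by (simp add: scaleR_add_left)
   then show ?thesis using TI[of "\<alpha> + \<alpha>'" "\<beta> + \<beta>'" "\<gamma> + \<gamma>'"] u v by simp
  qed
  show "k *\<^sub>R u \<in> T" if u_mem: "u \<in> T" and k: "0 \<le> k" for u k
  proof -
   obtain \<alpha> \<beta> \<gamma> where u: "\<alpha> \<ge> 0" "\<beta> \<ge> 0" "\<gamma> \<ge> 0" "u = \<alpha> *\<^sub>R a + \<beta> *\<^sub>R b + \<gamma> *\<^sub>R c" using u_mem unfolding T_def by blast
   have "k *\<^sub>R u = (k * \<alpha>) *\<^sub>R a + (k * \<beta>) *\<^sub>R b + (k * \<gamma>) *\<^sub>R c" unfolding u(4) by (simp add: scaleR_add_right)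
   then show ?thesis using TI[of "k * \<alpha>" "k * \<beta>" "k * \<gamma>"] u k by simp
  qed
 qed
 moreover have "{a, b, c} \<subseteq> T" using TI[of 1 0 0] TI[of 0 1 0] TI[of 0 0 1] by simp
 ultimately have sub: "convex_cone hull {a, b, c} \<subseteq> T" by (simp add: hull_minimal)
 have S: "subspace (convex_cone hull {a, b, c})" using assms unfolding P_null_def .
 have neg: "- u \<in> T" if "u \<in> {a, b, c}" for u
  using subspace_neg[OF S hull_inc[OF that]] sub by blast
 obtain A1 B1 C1 where 1: "A1 \<ge> 0" "B1 \<ge> 0" "C1 \<ge> 0" "- a = A1 *\<^sub>R a + B1 *\<^sub>R b + C1 *\<^sub>R c" using neg[of a] unfolding T_def by blast
 obtain A2 B2 C2 where 2: "A2 \<ge> 0" "B2 \<ge> 0" "C2 \<ge> 0" "- b = A2 *\<^sub>R a + B2 *\<^sub>R b + C2 *\<^sub>R c" using neg[of b] unfolding T_def by blast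
 obtain A3 B3 C3 where 3: "A3 \<ge> 0" "B3 \<ge> 0" "C3 \<ge> 0" "- c = A3 *\<^sub>R a + B3 *\<^sub>R b + C3 *\<^sub>R c" using neg[of c] unfolding T_def by blast
 have "(1 + A1 + A2 + A3) *\<^sub>R a + (1 + B1 + B2 + B3) *\<^sub>R b + (1 + C1 + C2 + C3) *\<^sub>R c
  = (a + (A1 *\<^sub>R a + B1 *\<^sub>R b + C1 *\<^sub>R c)) + (b + (A2 *\<^sub>R a + B2 *\<^sub>R b + C2 *\<^sub>R c)) + (c + (A3 *\<^sub>R a + B3 *\<^sub>R b + C3 *\<^sub>R c))"
  by (simp add: scaleR_add_left)
 also have "\<dots> = 0" unfolding 1(4)[symmetric] 2(4)[symmetric] 3(4)[symmetric] by simp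
 finally show ?thesis using 1 2 3
  by (intro exI[of _ "1 + A1 + A2 + A3"] exI[of _ "1 + B1 + B2 + B3"] exI[of _ "1 + C1 + C2 + C3"]) auto
qed

text \<open>Comparing absolute values, phases being of norm 0 or 1, forces equal coefficients unless
  both phases vanish.\<close>

lemma opposite_phases:
 assumes "A > 0" "B > 0" "A *\<^sub>R a + B *\<^sub>R b = (0::complex)" "a \<in> {0} \<union> sphere 0 1" "b \<in> {0} \<union> sphere 0 1"
 shows "a + b = 0"
proof -
 have e: "A *\<^sub>R a = - (B *\<^sub>R b)" using assms(3) by (simp add: eq_neg_iff_add_eq_0)
 then have "A * norm a = B * norm b" using assms(1,2) by (metis abs_of_pos norm_minus_cancel norm_scaleR)
 then consider "a = 0" "b = 0" | "A = B" using assms by auto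
 then show ?thesis
 proof cases
  case 2
  then have "A *\<^sub>R (a + b) = 0" using assms(3) by (simp add: scaleR_add_right)
  then show ?thesis using assms(1) by simp
 qed simp
qed

text \<open>A positive relation divided by \<open>a\<close> or by \<open>b\<close> has imaginary
  part zero, which makes the three consecutive quotients turn in the same direction, unless the
  phases lie on one real line and form a harmonic triple.\<close>

lemma phase_null_lift:
 assumes K: "a \<in> {0} \<union> sphere 0 1" "b \<in> {0} \<union> sphere 0 1" "c \<in> {0} \<union> sphere 0 1" and N: "P_null a b c"
 shows "\<exists>x' y' z'. lifting.RL phase_lift a b c x' y' z'"
proof -
 interpret lifting phase_lift "two_group \<zeta>" by (rule lifting_phase)
 obtain A B C :: real where p: "A > 0" "B > 0" "C > 0" and e: "A *\<^sub>R a + B *\<^sub>R b + C *\<^sub>R c = 0"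
  using P_null_positive_relation[OF N] by blast
 show ?thesis
 proof (cases "a = 0 \<or> b = 0 \<or> c = 0")
  case True
  then have "a + b + c = 0"
  proof (elim disjE)
   assume "a = 0" then show ?thesis using opposite_phases[OF p(2,3) _ K(2,3)] e by simp
  next
   assume "b = 0" then show ?thesis using opposite_phases[OF p(1,3) _ K(1,3)] e by simp
  next
   assume "c = 0" then show ?thesis using opposite_phases[OF p(1,2) _ K(1,2)] e by simp
  qed
  then show ?thesis using True by (rule RL_degI)
 next
  case False
  then have nz: "a ~= 0" "b ~= 0" "c ~= 0" and n: "norm a = 1" "norm b = 1" "norm c = 1" using K by auto
  have div: "A *\<^sub>R (a / u) + B *\<^sub>R (b / u) + C *\<^sub>R (c / u) = 0" for u
  proof -
   have "A *\<^sub>R (a / u) + B *\<^sub>R (b / u) + C *\<^sub>R (c / u) = (A *\<^sub>R a + B *\<^sub>R b + C *\<^sub>R c) / u"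
    by (simp add: add_divide_distrib scaleR_conv_of_real)
   then show ?thesis unfolding e by simp
  qed
  have I1: "B * Im (b / a) + C * Im (c / a) = 0" using arg_cong[OF div[of a], of Im] nz by simp
  have I2: "A * Im (a / b) + C * Im (c / b) = 0" using arg_cong[OF div[of b], of Im] nz by simp
  consider (z) "Im (b / a) = 0" | (p) "Im (b / a) > 0" | (m) "Im (b / a) < 0" by linarith
  then show ?thesis
  proof cases
   case z
   have real: "u = a \<or> u = - a" if "Im (u / a) = 0" "norm u = 1" for u
   proof -
    have "norm (u / a) = 1" using that n by (simp add: norm_divide)
    then have "\<bar>Re (u / a)\<bar> = 1" using that(1) by (simp add: cmod_def)
    then have "u / a = 1 \<or> u / a = - 1" using that(1) by (auto simp: complex_eq_iff abs_if split: if_splits)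
    then show ?thesis using nz by (auto simp: field_simps)
   qed
   have "Im (c / a) = 0" using z I1 p by simp
   then have ca: "c = a \<or> c = - a" "b = a \<or> b = - a" using real z n by auto
   have "\<not> (b = a & c = a)"
   proof
    assume "b = a & c = a"
    then have "(A + B + C) *\<^sub>R a = 0" using e by (simp add: scaleR_add_left)
    then show False using p nz by simp
   qed
   moreover have "harm a a (- a) 1 1 (- 2)" "harm a (- a) a 1 (- 2) 1" "harm a (- a) (- a) (- 2) 1 1"
    unfolding harm_def using nz by simp_all
   ultimately have "\<exists>x' y' z'. phase_lift a b c x' y' z'" using ca unfolding phase_lift_def by blast
   then show ?thesis using RL_LI by blast
  next
   case (p)
   have "C * Im (c / a) < 0" using I1 mult_pos_pos[OF \<open>B > 0\<close> p] by linarith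
   then have "Im (c / a) < 0" using \<open>C > 0\<close> by (simp add: mult_less_0_iff)
   moreover have "Im (a / b) < 0" using p Im_flip by blast
   then have "A * Im (a / b) < 0" using \<open>A > 0\<close> by (simp add: mult_less_0_iff)
   then have "C * Im (c / b) > 0" using I2 by linarith
   then have "Im (c / b) > 0" using \<open>C > 0\<close> by (simp add: zero_less_mult_iff)
   ultimately have "phase_lift a b c 1 \<omega> (\<omega> * \<omega>)" unfolding phase_lift_def using p Im_flip' by simp
   then show ?thesis using RL_LI by blast
  next
   case m
   have "C * Im (c / a) > 0" using I1 mult_pos_neg[OF \<open>B > 0\<close> m] by linarith
   then have "Im (c / a) > 0" using \<open>C > 0\<close> by (simp add: zero_less_mult_iff)
   moreover have "Im (a / b) > 0" using m Im_flip' by blast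
   then have "A * Im (a / b) > 0" using \<open>A > 0\<close> by simp
   then have "C * Im (c / b) < 0" using I2 by linarith
   then have "Im (c / b) < 0" using \<open>C > 0\<close> by (simp add: mult_less_0_iff)
   ultimately have "phase_lift a b c 1 (\<omega> * \<omega>) \<omega>" unfolding phase_lift_def using m Im_flip by simp
   then show ?thesis using RL_LI by blast
  qed
 qed
qed

text \<open>The equation for \<open>g\<close> gives
  \<open>g \<otimes> g \<otimes> g = \<ominus> \<one>\<close>, so \<open>g\<close> can be the image
  of \<open>\<zeta>\<close>; the equation itself is the image of
  \<open>1 + \<omega> + \<omega> * \<omega> = 0\<close>, because
  \<open>\<omega> * \<omega> = - \<zeta>\<close>.\<close>

theorem representable_over_P_imp_field:
 fixes R (structure)
 assumes M: "matroid E \<B>" and W: "without_large_uniform_minors E \<B>" and P: "representable_over_P E \<B>"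
  and R: "field R" "ring_char R ~= 2" and g: "g \<in> carrier R" "g \<otimes> g \<oplus> \<one> = g"
 shows "representable_over_field R E \<B>"
proof -
 interpret L: lifting phase_lift "two_group \<zeta>" by (rule lifting_phase)
 interpret field R by fact
 have g2: "g [^] (2::nat) = g \<otimes> g" "g [^] (3::nat) = g \<otimes> g \<otimes> g" "g [^] (4::nat) = g \<otimes> g \<otimes> g \<otimes> g"
  using g(1) by (simp_all add: numeral_eq_Suc)
 have "g \<otimes> g \<otimes> g \<oplus> g = (g \<otimes> g \<oplus> \<one>) \<otimes> g" using g(1) by (simp add: l_distr)
 then have "g \<otimes> g \<otimes> g \<oplus> (g \<otimes> g \<oplus> \<one>) = g \<otimes> g" unfolding g(2) .
 then have "g \<otimes> g \<oplus> (g \<otimes> g \<otimes> g \<oplus> \<one>) = g \<otimes> g \<oplus> \<zero>" using g(1) by (simp add: a_lcomm)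
 then have "g \<otimes> g \<otimes> g \<oplus> \<one> = \<zero>" using g(1) by (simp del: r_zero)
 then have cube: "g \<otimes> g \<otimes> g = \<ominus> \<one>" using g(1) by (metis minus_equality m_closed one_closed)
 have g6: "g [^] (6::nat) = \<one>"
 proof -
  have "g [^] (6::nat) = (g [^] (3::nat)) \<otimes> (g [^] (3::nat))" using nat_pow_mult[OF g(1), of 3 3] by simp
  then show ?thesis unfolding g2 cube by (simp add: l_minus)
 qed
 have nz: "g ~= \<zero>" using g(2) by auto
 interpret H: two_hom R \<zeta> g
 proof unfold_locales
  show "\<one> \<oplus> \<one> ~= \<zero>" using ring_char_2[OF R] .
  show "g [^] d = \<one>" if d: "\<zeta> ^ d = 1" for d
  proof -
   obtain q where "d = 6 * q" using zeta_order[OF d] by blast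
   then show ?thesis using nat_pow_pow[OF g(1), of 6 q] g6 by simp
  qed
 qed (use g nz norm_zeta in auto)
 have neg: "\<zeta> ^ 3 = - 1" "g [^] (3::nat) = \<ominus> \<one>" using zeta_cube g2 cube by auto
 have P': "representable_over ({0} \<union> sphere 0 1) 0 (*) (- 1) P_null E \<B>" using P unfolding representable_over_P_def .
 show ?thesis
 proof (rule L.transfer[OF M W P', where \<iota> = "\<lambda>x. x" and h = H.h])
  show "u * v \<in> {0} \<union> sphere 0 1" if "u \<in> {0} \<union> sphere 0 1" "v \<in> {0} \<union> sphere 0 1" for u v :: complex
   using that by (auto simp: norm_mult)
  show "\<exists>x' y' z'. L.RL u v w x' y' z'" if "u \<in> {0} \<union> sphere 0 1" "v \<in> {0} \<union> sphere 0 1" "w \<in> {0} \<union> sphere 0 1" "P_null u v w" for u v w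
   using phase_null_lift[OF that] .
  show "field R" by fact
  show "H.h 0 = \<zero>" by (rule H.h_0)
  show "H.h x \<in> carrier R - {\<zero>}" if "x \<in> two_group \<zeta>" for x using H.h_closed[OF that] .
  show "H.h (x * y) = H.h x \<otimes> H.h y" if "x \<in> two_group \<zeta>" "y \<in> two_group \<zeta>" for x y using H.h_mult[OF that] .
  show "H.h (- 1) = \<ominus> \<one>" using H.h_w[of 3] neg by simp
  show "H.h x' \<oplus> H.h y' \<oplus> H.h z' = \<zero>" if l: "phase_lift x y z x' y' z'" and t: "{x', y', z'} \<subseteq> two_group \<zeta>" for x y z x' y' z'
  proof -
   have c: "H.h x' \<in> carrier R" using H.h_closed[of x'] t by simp
   have w2: "H.h (\<omega> * x') = g \<otimes> g \<otimes> H.h x'" using H.h_mult[OF H.w_mem[of 2], of x'] t H.h_w[of 2] g2 by (simp add: \<omega>_def)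
   have w4: "H.h (\<omega> * \<omega> * x') = \<ominus> \<one> \<otimes> g \<otimes> H.h x'" using H.h_mult[OF H.w_mem[of 4], of x'] t H.h_w[of 4] g2 cube by (simp add: omega_zeta)
   have "H.h x' \<oplus> g \<otimes> g \<otimes> H.h x' \<oplus> \<ominus> \<one> \<otimes> g \<otimes> H.h x' = ((g \<otimes> g \<oplus> \<one>) \<oplus> \<ominus> g) \<otimes> H.h x'"
    using c g(1) by (simp add: l_distr l_minus a_ac)
   also have "\<dots> = \<zero>" unfolding g(2) using g(1) c by (simp add: r_neg)
   finally have s: "H.h x' \<oplus> g \<otimes> g \<otimes> H.h x' \<oplus> \<ominus> \<one> \<otimes> g \<otimes> H.h x' = \<zero>" .
   have s': "H.h x' \<oplus> \<ominus> \<one> \<otimes> g \<otimes> H.h x' \<oplus> g \<otimes> g \<otimes> H.h x' = \<zero>"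
   proof -
    have "H.h x' \<oplus> \<ominus> \<one> \<otimes> g \<otimes> H.h x' \<oplus> g \<otimes> g \<otimes> H.h x' = H.h x' \<oplus> g \<otimes> g \<otimes> H.h x' \<oplus> \<ominus> \<one> \<otimes> g \<otimes> H.h x'"
     using c g(1) by (simp add: a_ac)
    then show ?thesis using s by simp
   qed
   show ?thesis using l
   proof (cases rule: phase_lift_cases)
    case harm
    then show ?thesis using t H.h_harmonic[OF _ neg, of x'] H.h_harmonic[OF _ neg, of y'] unfolding harm_def by auto
   next
    case pos then show ?thesis using w2 w4 s by simp
   next
    case neg then show ?thesis using w2 w4 s' by simp
   qed
  qed
 qed auto
qed

subsection \<open>Fields with a primitive sixth root of unity\<close>

lemma ring_charI:
 assumes "\<And>n::nat. add_pow R n \<one>\<^bsub>R\<^esub> = \<zero>\<^bsub>R\<^esub> \<longleftrightarrow> c dvd n"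
 shows "ring_char R = c"
proof (rule dvd_antisym)
 show "ring_char R dvd c" unfolding ring_char_def by (rule Gcd_dvd) (simp add: assms)
 show "c dvd ring_char R" unfolding ring_char_def by (rule Gcd_greatest) (simp add: assms)
qed

text \<open>The final statement asks for rings on the natural numbers, so fields on countable types
  are renumbered.\<close>

lemma field_transport_nat:
 fixes R :: "'c::countable ring"
 assumes "field R" and g: "g \<in> carrier R" "g \<otimes>\<^bsub>R\<^esub> g \<oplus>\<^bsub>R\<^esub> \<one>\<^bsub>R\<^esub> = g"
 shows "\<exists>(S :: nat ring) g'. field S & ring_char S = ring_char R & g' \<in> carrier S & g' \<otimes>\<^bsub>S\<^esub> g' \<oplus>\<^bsub>S\<^esub> \<one>\<^bsub>S\<^esub> = g'"
proof -
 interpret R: field R by fact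
 define S :: "nat ring" where "S = \<lparr>carrier = to_nat ` carrier R, monoid.mult = (\<lambda>x y. to_nat (from_nat x \<otimes>\<^bsub>R\<^esub> from_nat y)),
  one = to_nat \<one>\<^bsub>R\<^esub>, zero = to_nat \<zero>\<^bsub>R\<^esub>, add = (\<lambda>x y. to_nat (from_nat x \<oplus>\<^bsub>R\<^esub> from_nat y))\<rparr>"
 have S: "carrier S = to_nat ` carrier R" "to_nat x \<otimes>\<^bsub>S\<^esub> to_nat y = to_nat (x \<otimes>\<^bsub>R\<^esub> y)"
  "to_nat x \<oplus>\<^bsub>S\<^esub> to_nat y = to_nat (x \<oplus>\<^bsub>R\<^esub> y)" "\<one>\<^bsub>S\<^esub> = to_nat \<one>\<^bsub>R\<^esub>" "\<zero>\<^bsub>S\<^esub> = to_nat \<zero>\<^bsub>R\<^esub>" for x y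
  unfolding S_def by simp_all
 have "to_nat \<in> ring_iso R S" unfolding ring_iso_def
 proof (intro CollectI conjI ring_hom_memI)
  show "bij_betw to_nat (carrier R) (carrier S)" unfolding bij_betw_def S(1) by (simp add: inj_on_def)
 qed (simp_all add: S)
 from R.ring_iso_imp_img_field[OF this] have fS: "field S" unfolding S_def by simp
 then interpret S: field S .
 have "add_pow S n \<one>\<^bsub>S\<^esub> = to_nat (add_pow R n \<one>\<^bsub>R\<^esub>)" for n :: nat
 proof (induction n)
  case (Suc n)
  then show ?case unfolding S.add.nat_pow_Suc R.add.nat_pow_Suc using S by simp
 qed (simp add: S)
 then have "ring_char S = ring_char R" unfolding ring_char_def S(5) by simp
 moreover have "to_nat g \<in> carrier S" "to_nat g \<otimes>\<^bsub>S\<^esub> to_nat g \<oplus>\<^bsub>S\<^esub> \<one>\<^bsub>S\<^esub> = to_nat g" using g S by simp_all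
 ultimately show ?thesis using fS by blast
qed

text \<open>Pairs \<open>(a, b)\<close> stand for \<open>a + b \<zeta>\<close> with \<open>\<zeta>\<^sup>2 = \<zeta> - 1\<close>.\<close>

definition eis_rat :: "(rat \<times> rat) ring" where
 "eis_rat = \<lparr>carrier = UNIV,
   monoid.mult = (\<lambda>x y. (fst x * fst y - snd x * snd y, fst x * snd y + snd x * fst y + snd x * snd y)),
   one = (1, 0), zero = (0, 0), add = (\<lambda>x y. (fst x + fst y, snd x + snd y))\<rparr>"

definition eis_mod :: "int => (int \<times> int) ring" where
 "eis_mod p = \<lparr>carrier = {0..<p} \<times> {0..<p},
   monoid.mult = (\<lambda>x y. ((fst x * fst y - snd x * snd y) mod p, (fst x * snd y + snd x * fst y + snd x * snd y) mod p)),
   one = (1, 0), zero = (0, 0), add = (\<lambda>x y. ((fst x + fst y) mod p, (snd x + snd y) mod p))\<rparr>"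

lemma field_eis_rat: "field eis_rat"
proof -
 have "cring eis_rat"
 proof (intro cringI abelian_groupI comm_monoidI)
  show "\<exists>y\<in>carrier eis_rat. y \<oplus>\<^bsub>eis_rat\<^esub> x = \<zero>\<^bsub>eis_rat\<^esub>" for x
   by (rule bexI[of _ "(- fst x, - snd x)"]) (simp_all add: eis_rat_def)
 qed (auto simp: eis_rat_def algebra_simps)
 then show ?thesis
 proof (rule cring.cring_fieldI2)
  show "\<zero>\<^bsub>eis_rat\<^esub> ~= \<one>\<^bsub>eis_rat\<^esub>" by (simp add: eis_rat_def)
  fix x assume x: "x \<in> carrier eis_rat" "x ~= \<zero>\<^bsub>eis_rat\<^esub>"
  obtain a b where ab: "x = (a, b)" by (cases x)
  \<comment> \<open>The norm of \<open>a + b \<zeta>\<close>. The conjugate of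
    \<open>\<zeta>\<close> is \<open>1 - \<zeta>\<close>, so the inverse is the pair
    \<open>(a + b, - b)\<close> divided by \<open>N\<close>.\<close>
  define N where "N = a * a + a * b + b * b"
  have "4 * N = (2 * a + b)\<^sup>2 + 3 * b\<^sup>2" unfolding N_def by (simp add: power2_eq_square algebra_simps)
  moreover have "b ~= 0 \<or> 2 * a + b ~= 0" using x unfolding ab by (auto simp: eis_rat_def)
  then have "(2 * a + b)\<^sup>2 + 3 * b\<^sup>2 ~= 0" by (auto simp: add_nonneg_eq_0_iff)
  ultimately have N: "N ~= 0" by auto
  have "a * ((a + b) / N) - b * (- b / N) = N / N" "a * (- b / N) + b * ((a + b) / N) + b * (- b / N) = 0 / N"
   unfolding N_def by (simp_all add: add_divide_distrib[symmetric] diff_divide_distrib[symmetric] algebra_simps)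
  then have "x \<otimes>\<^bsub>eis_rat\<^esub> ((a + b) / N, - b / N) = \<one>\<^bsub>eis_rat\<^esub>" unfolding ab using N by (simp add: eis_rat_def)
  moreover have "((a + b) / N, - b / N) \<in> carrier eis_rat" by (simp add: eis_rat_def)
  ultimately show "\<exists>y\<in>carrier eis_rat. x \<otimes>\<^bsub>eis_rat\<^esub> y = \<one>\<^bsub>eis_rat\<^esub>" by (rule bexI)
 qed
qed

lemma ring_char_eis_rat: "ring_char eis_rat = 0"
proof (rule ring_charI)
 interpret field eis_rat by (rule field_eis_rat)
 have "add_pow eis_rat n \<one>\<^bsub>eis_rat\<^esub> = (of_nat n, 0)" for n :: nat
 proof (induction n)
  case 0 show ?case unfolding add.nat_pow_0 by (simp add: eis_rat_def)
 next
  case (Suc n) then show ?case unfolding add.nat_pow_Suc by (simp add: eis_rat_def)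
 qed
 then show "add_pow eis_rat n \<one>\<^bsub>eis_rat\<^esub> = \<zero>\<^bsub>eis_rat\<^esub> \<longleftrightarrow> 0 dvd n" for n :: nat by (simp add: eis_rat_def)
qed

lemma mod_linear:
 fixes p :: int
 shows "((u mod p) * a - (v mod p) * b) mod p = (u * a - v * b) mod p"
  "((u mod p) * a + (v mod p) * b + (w mod p) * c) mod p = (u * a + v * b + w * c) mod p"
  "(a * (u mod p) - b * (v mod p)) mod p = (a * u - b * v) mod p"
  "(a * (u mod p) + b * (v mod p) + c * (w mod p)) mod p = (a * u + b * v + c * w) mod p"
 unfolding cong_def[symmetric] by (intro cong_add cong_diff cong_mult cong_refl; simp add: cong_def)+

lemma eis_mod_simps:
 "x \<otimes>\<^bsub>eis_mod p\<^esub> y = ((fst x * fst y - snd x * snd y) mod p, (fst x * snd y + snd x * fst y + snd x * snd y) mod p)"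
 "x \<oplus>\<^bsub>eis_mod p\<^esub> y = ((fst x + fst y) mod p, (snd x + snd y) mod p)"
 by (simp_all add: eis_mod_def)

lemma cring_eis_mod: assumes "p > 1" shows "cring (eis_mod p)"
proof (intro cringI abelian_groupI comm_monoidI)
 fix x assume "x \<in> carrier (eis_mod p)"
 then show "\<exists>y\<in>carrier (eis_mod p). y \<oplus>\<^bsub>eis_mod p\<^esub> x = \<zero>\<^bsub>eis_mod p\<^esub>"
  using assms by (intro bexI[of _ "(- fst x mod p, - snd x mod p)"]) (simp_all add: eis_mod_def mod_simps mem_Times_iff)
next
 fix x y z
 show "x \<otimes>\<^bsub>eis_mod p\<^esub> y \<otimes>\<^bsub>eis_mod p\<^esub> z = x \<otimes>\<^bsub>eis_mod p\<^esub> (y \<otimes>\<^bsub>eis_mod p\<^esub> z)"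
  unfolding eis_mod_simps fst_conv snd_conv mod_linear mod_add_eq mod_add_left_eq mod_add_right_eq by (simp add: algebra_simps)
 show "(x \<oplus>\<^bsub>eis_mod p\<^esub> y) \<otimes>\<^bsub>eis_mod p\<^esub> z = x \<otimes>\<^bsub>eis_mod p\<^esub> z \<oplus>\<^bsub>eis_mod p\<^esub> y \<otimes>\<^bsub>eis_mod p\<^esub> z"
  unfolding eis_mod_simps fst_conv snd_conv mod_linear mod_add_eq mod_add_left_eq mod_add_right_eq by (simp add: algebra_simps)
 show "x \<oplus>\<^bsub>eis_mod p\<^esub> y \<oplus>\<^bsub>eis_mod p\<^esub> z = x \<oplus>\<^bsub>eis_mod p\<^esub> (y \<oplus>\<^bsub>eis_mod p\<^esub> z)"
  unfolding eis_mod_simps fst_conv snd_conv mod_linear mod_add_eq mod_add_left_eq mod_add_right_eq by (simp add: algebra_simps)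
qed (use assms in \<open>auto simp: eis_mod_def algebra_simps\<close>)

text \<open>If the norm of a nonzero pair were divisible by \<open>p\<close>, then \<open>b\<close>
  would be invertible modulo \<open>p\<close> and \<open>- a / b\<close> a root of
  \<open>t * t - t + 1\<close>.\<close>

lemma field_eis_mod:
 fixes p :: int
 assumes p: "prime p" and no_root: "\<And>t. \<not> p dvd t * t - t + 1"
 shows "field (eis_mod p)"
proof -
 have p1: "p > 1" using p prime_gt_1_int by blast
 show ?thesis
 proof (rule cring.cring_fieldI2[OF cring_eis_mod[OF p1]])
  show "\<zero>\<^bsub>eis_mod p\<^esub> ~= \<one>\<^bsub>eis_mod p\<^esub>" by (simp add: eis_mod_def)
  fix x assume x: "x \<in> carrier (eis_mod p)" "x ~= \<zero>\<^bsub>eis_mod p\<^esub>"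
  obtain a b where ab: "x = (a, b)" by (cases x)
  have rng: "0 \<le> a" "a < p" "0 \<le> b" "b < p" "a ~= 0 \<or> b ~= 0" using x unfolding ab by (auto simp: eis_mod_def)
  define N where "N = a * a + a * b + b * b"
  have "\<not> p dvd N"
  proof
   assume N: "p dvd N"
   show False
   proof (cases "p dvd b")
    case True
    then have "b = 0" using rng zdvd_not_zless[of b p] by (cases "b = 0") auto
    then have "p dvd a" using N p unfolding N_def by (simp add: prime_dvd_mult_iff)
    then have "a = 0" using rng zdvd_not_zless[of a p] by (cases "a = 0") auto
    then show False using rng(5) \<open>b = 0\<close> by simp
   next
    case False
    then have "coprime b p" using p by (metis coprime_commute prime_imp_coprime)
    then obtain b' where b': "[b * b' = 1] (mod p)" using cong_solve_coprime_int by blast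
    define t where "t = - a * b'"
    have d: "p dvd b * b' - 1" using b' by (simp add: cong_iff_dvd_diff)
    have "t * t - t + 1 = N * (b' * b') - (b * b' - 1) * (a * b' + b * b' + 1)"
     unfolding N_def t_def by (simp add: algebra_simps)
    then have "p dvd t * t - t + 1" using N d by simp
    then show False using no_root by blast
   qed
  qed
  then have "coprime N p" using p by (metis coprime_commute prime_imp_coprime)
  then obtain n where n: "[N * n = 1] (mod p)" using cong_solve_coprime_int by blast
  let ?y = "((a + b) * n mod p, (- b * n) mod p)"
  have "(a * ((a + b) * n mod p) - b * ((- b * n) mod p)) mod p = (a * ((a + b) * n) - b * (- b * n)) mod p"
   by (rule mod_linear)
  also have "a * ((a + b) * n) - b * (- b * n) = N * n" unfolding N_def by (simp add: algebra_simps)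
  finally have 1: "(a * ((a + b) * n mod p) - b * ((- b * n) mod p)) mod p = 1" using n p1 unfolding cong_def by simp
  have "(a * ((- b * n) mod p) + b * ((a + b) * n mod p) + b * ((- b * n) mod p)) mod p
   = (a * (- b * n) + b * ((a + b) * n) + b * (- b * n)) mod p" by (rule mod_linear)
  also have "a * (- b * n) + b * ((a + b) * n) + b * (- b * n) = 0" by (simp add: algebra_simps)
  finally have 2: "(a * ((- b * n) mod p) + b * ((a + b) * n mod p) + b * ((- b * n) mod p)) mod p = 0" by simp
  have "x \<otimes>\<^bsub>eis_mod p\<^esub> ?y = \<one>\<^bsub>eis_mod p\<^esub>" using 1 2 unfolding ab by (simp add: eis_mod_def)
  moreover have "?y \<in> carrier (eis_mod p)" using p1 by (simp add: eis_mod_def)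
  ultimately show "\<exists>y\<in>carrier (eis_mod p). x \<otimes>\<^bsub>eis_mod p\<^esub> y = \<one>\<^bsub>eis_mod p\<^esub>" by blast
 qed
qed

text \<open>In prime characteristic the prime field suffices if it already contains a root of
  \<open>t * t - t + 1\<close>; otherwise this polynomial is irreducible and its quadratic extension
  is a field.\<close>

lemma exists_field_sixth_root:
 assumes "c = 0 \<or> prime c"
 shows "\<exists>(R :: nat ring) g. field R & ring_char R = c & g \<in> carrier R & g \<otimes>\<^bsub>R\<^esub> g \<oplus>\<^bsub>R\<^esub> \<one>\<^bsub>R\<^esub> = g"
proof (cases "c = 0")
 case True
 have "(0, 1) \<in> carrier eis_rat" "(0, 1) \<otimes>\<^bsub>eis_rat\<^esub> (0, 1) \<oplus>\<^bsub>eis_rat\<^esub> \<one>\<^bsub>eis_rat\<^esub> = (0, 1)" by (simp_all add: eis_rat_def)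
 from field_transport_nat[OF field_eis_rat this] show ?thesis using True ring_char_eis_rat by simp
next
 case False
 then have c: "prime c" using assms by simp
 have p: "prime (int c)" "int c > 1" using c prime_gt_1_nat by auto
 have dvd: "int n mod int c = 0 \<longleftrightarrow> c dvd n" for n by (simp add: mod_eq_0_iff_dvd)
 show ?thesis
 proof (cases "\<exists>t. int c dvd t * t - t + 1")
  case True
  then obtain t where t: "int c dvd t * t - t + 1" by blast
  define R where "R = residue_ring (int c)"
  have R: "field R" unfolding R_def by (rule residues_prime.is_field[OF residues_prime.intro[OF c]])
  then interpret field R .
  define g where "g = t mod int c"
  have "add_pow R n \<one>\<^bsub>R\<^esub> = int n mod int c" for n :: nat
  proof (induction n)
   case 0 show ?case unfolding add.nat_pow_0 by (simp add: R_def residue_ring_def)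
  next
   case (Suc n)
   have "add_pow R (Suc n) \<one>\<^bsub>R\<^esub> = (int n mod int c + 1) mod int c" unfolding add.nat_pow_Suc Suc by (simp add: R_def residue_ring_def)
   then show ?case by (simp add: mod_simps add.commute)
  qed
  then have char: "ring_char R = c" by (intro ring_charI) (simp add: dvd R_def residue_ring_def)
  have "((t mod int c * (t mod int c)) mod int c + 1) mod int c = (t * t + 1) mod int c" by (simp add: mod_simps)
  also have "\<dots> = t mod int c" using t by (simp add: mod_eq_dvd_iff algebra_simps)
  finally have "g \<otimes>\<^bsub>R\<^esub> g \<oplus>\<^bsub>R\<^esub> \<one>\<^bsub>R\<^esub> = g" unfolding g_def by (simp add: R_def residue_ring_def)
  moreover have "g \<in> carrier R" unfolding g_def R_def residue_ring_def using p(2) by simp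
  ultimately show ?thesis using field_transport_nat[OF R] char by metis
 next
  case no: False
  have R: "field (eis_mod (int c))" using no by (intro field_eis_mod p(1)) blast
  then interpret field "eis_mod (int c)" .
  have "add_pow (eis_mod (int c)) n \<one>\<^bsub>eis_mod (int c)\<^esub> = (int n mod int c, 0)" for n :: nat
  proof (induction n)
   case 0 show ?case unfolding add.nat_pow_0 by (simp add: eis_mod_def)
  next
   case (Suc n)
   have "add_pow (eis_mod (int c)) (Suc n) \<one>\<^bsub>eis_mod (int c)\<^esub> = ((int n mod int c + 1) mod int c, 0)"
    unfolding add.nat_pow_Suc Suc by (simp add: eis_mod_def)
   then show ?case by (simp add: mod_simps add.commute)
  qed
  then have char: "ring_char (eis_mod (int c)) = c" by (intro ring_charI) (simp add: dvd eis_mod_def)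
  have "(0, 1) \<in> carrier (eis_mod (int c))" using p(2) by (simp add: eis_mod_def)
  moreover have "(0, 1) \<otimes>\<^bsub>eis_mod (int c)\<^esub> (0, 1) \<oplus>\<^bsub>eis_mod (int c)\<^esub> \<one>\<^bsub>eis_mod (int c)\<^esub> = (0, 1)"
   using p(2) by (simp add: eis_mod_def mod_simps)
  ultimately show ?thesis using field_transport_nat[OF R] char by metis
 qed
qed

theorem mainTheorem13:
  fixes E :: "'a set" and \<B> :: "'a set set"
  assumes "matroid E \<B>"
    and "without_large_uniform_minors E \<B>"
  shows "(representable_over_S E \<B> \<longrightarrow>
            (\<forall>R :: 'k ring. field R \<and> ring_char R \<noteq> 2 \<longrightarrow> representable_over_field R E \<B>))
       \<and> (representable_over_P E \<B> \<longrightarrow>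
            (\<forall>c::nat. c \<noteq> 2 \<and> (c = 0 \<or> prime c) \<longrightarrow>
               (\<exists>R :: nat ring. field R \<and> ring_char R = c \<and> representable_over_field R E \<B>)))
       \<and> (representable_over_W E \<B> \<longrightarrow> representable_over_field (residue_ring 3) E \<B>)"
proof (intro conjI impI allI)
  fix R :: "'k ring" assume "representable_over_S E \<B>" "field R \<and> ring_char R \<noteq> 2"
  then show "representable_over_field R E \<B>" using representable_over_S_imp_field[OF assms] by blast
next
  fix c :: nat assume P: "representable_over_P E \<B>" and c: "c \<noteq> 2 \<and> (c = 0 \<or> prime c)"
  obtain R :: "nat ring" and g where R: "field R" "ring_char R = c" "g \<in> carrier R" "g \<otimes>\<^bsub>R\<^esub> g \<oplus>\<^bsub>R\<^esub> \<one>\<^bsub>R\<^esub> = g"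
    using exists_field_sixth_root[of c] c by blast
  have "representable_over_field R E \<B>"
    by (rule representable_over_P_imp_field[OF assms P R(1) _ R(3,4)]) (use R(2) c in simp)
  then show "\<exists>R :: nat ring. field R \<and> ring_char R = c \<and> representable_over_field R E \<B>" using R(1,2) by blast
next
  assume "representable_over_W E \<B>"
  then show "representable_over_field (residue_ring 3) E \<B>" by (rule representable_over_W_imp_ternary[OF assms])
qed

end
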